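(* Let $\mathfrak{g}=\mathfrak{sl}_2(\mathbb{C})$ and let $\mathfrak{T}=\mathfrak{sl}_2\ltimes\overline{\mathfrak{sl}}_2$ be the Takiff Lie algebra of $\mathfrak{sl}_2$. Let $V$ be a simple $\mathfrak{g}$-Harish-Chandra module for $\mathfrak{T}$. Denote by $\chi\in\mathbb{C}$ the scalar by which $\bar C=\bar h^2+4\bar f\bar e$ acts on $V$, and suppose that $L(n)$, $n\in\mathbb{Z}_{\ge 0}$, is the minimal $\mathfrak{g}$-type of $V$. (i) If $\chi\neq 0$, then $V\cong V(n,\lambda_2)$ for a square root $\lambda_2$ of $\chi$. (ii) If $\chi=0$, then $V\cong L(n)$ with the trivial action of $\bar{\mathfrak{g}}=\overline{\mathfrak{sl}}_2$. In other words, the modules $V(n,\lambda_2)$, $n\in\mathbb{Z}$, $\lambda_2\in\mathbb{C}\setminus\{0\}$, together with the finite-dimensional simple $\mathfrak{g}$-modules (with trivial $\bar{\mathfrak{g}}$-action), constitute a complete list of simple $\mathfrak{g}$-Harish-Chandra modules for $\mathfrak{T}$. The only isomorphisms between different members of the list are $V(n,\lambda_2)\cong V(-n,-\lambda_2)$.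
   Context: Everything is over $\mathbb{C}$. $\mathfrak{g}=\mathfrak{sl}_2$ has standard basis $f,h,e$. The Takiff Lie algebra is $\mathfrak{T}=\mathfrak{g}\otimes\mathbb{C}[x]/(x^2)$ with bracket $[v\otimes x^i,w\otimes x^j]=[v,w]\otimes x^{i+j}$; $\mathfrak{g}$ is identified with $\mathfrak{g}\otimes 1$, and $\bar v:=v\otimes x$, $\bar{\mathfrak{g}}:=\mathfrak{g}\otimes x$ (a commutative ideal). $L(n)$ is the simple $\mathfrak{g}$-module of dimension $n+1$. A $\mathfrak{T}$-module is a $\mathfrak{g}$-Harish-Chandra module if its restriction to $\mathfrak{g}$ is a direct sum of simple finite-dimensional $\mathfrak{g}$-modules, each isomorphism class occurring with finite multiplicity. The simple $\mathfrak{g}$-submodules are its $\mathfrak{g}$-types; the minimal $\mathfrak{g}$-type is the $L(n)$ occurring with the smallest $n$. The element $\bar C=\bar h^2+4\bar f\bar e$ is central in $U(\mathfrak{T})$ (and acts by a scalar on every simple $\mathfrak{g}$-Harish-Chandra module). Verma modules: for $(\lambda_1,\lambda_2)\in\mathbb{C}^2$, $\Delta(\lambda_1,\lambda_2)=U(\mathfrak{T})\otimes_{U(\tilde{\mathfrak{b}})}\mathbb{C}_{\lambda}$, where $\tilde{\mathfrak{b}}=\mathrm{span}\{h,\bar h,e,\bar e\}$ and on the one-dimensional module $\mathbb{C}_\lambda$ the elements $e,\bar e$ act by $0$, $h$ by $\lambda_1$, $\bar h$ by $\lambda_2$. Completion functor: let $U=U(\mathfrak{T})$, let $U_{(f)}$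 be the Ore localization of $U$ at the powers of $f$, and $S_f:=U_{(f)}/U$, a $U$-$U$-bimodule. For a $\mathfrak{T}$-module $M$, $\mathbf{EA}(M)$ is the submodule of $S_f\otimes_U M$ consisting of all $m$ with $\dim\mathbb{C}[e]m<\infty$. For $n\in\mathbb{Z}$ and $\lambda_2\in\mathbb{C}\setminus\{0\}$, $V(n,\lambda_2):=\mathbf{EA}(\Delta(n-2,\lambda_2))$. *)

theory Defs
  imports
    "HOL-Analysis.Analysis"
    "HOL-Algebra.Free_Abelian_Groups"
    "HOL-Algebra.Module"
begin

section \<open>Complex algebras and complex Lie algebras\<close>

class complex_vector = ab_group_add +
  fixes cscale :: "complex \<Rightarrow> 'a \<Rightarrow> 'a"  (infixr \<open>*\<^sub>c\<close> 75)
  assumes cscale_add_right: "a *\<^sub>c (x + y) = a *\<^sub>c x + a *\<^sub>c y"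
    and cscale_add_left: "(a + b) *\<^sub>c x = a *\<^sub>c x + b *\<^sub>c x"
    and cscale_cscale: "a *\<^sub>c (b *\<^sub>c x) = (a * b) *\<^sub>c x"
    and cscale_one: "1 *\<^sub>c x = x"

global_interpretation cvec: vector_space "cscale :: complex \<Rightarrow> 'a::complex_vector \<Rightarrow> 'a"
  by unfold_locales (simp_all add: cscale_add_right cscale_add_left cscale_cscale cscale_one)

class complex_algebra_1 = complex_vector + ring_1 +
  assumes mult_cscale_left: "(a *\<^sub>c x) * y = a *\<^sub>c (x * y)"
    and mult_cscale_right: "x * (a *\<^sub>c y) = a *\<^sub>c (x * y)"

class complex_lie_algebra = complex_vector +
  fixes lie_bracket :: "'a \<Rightarrow> 'a \<Rightarrow> 'a"
  assumes lie_bracket_add_left: "lie_bracket (x + y) z = lie_bracket x z + lie_bracket y z"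
    and lie_bracket_add_right: "lie_bracket x (y + z) = lie_bracket x y + lie_bracket x z"
    and lie_bracket_cscale_left: "lie_bracket (a *\<^sub>c x) y = a *\<^sub>c lie_bracket x y"
    and lie_bracket_cscale_right: "lie_bracket x (a *\<^sub>c y) = a *\<^sub>c lie_bracket x y"
    and lie_bracket_self: "lie_bracket x x = 0"
    and lie_jacobi:
      "lie_bracket x (lie_bracket y z) + lie_bracket y (lie_bracket z x) + lie_bracket z (lie_bracket x y) = 0"

instantiation complex :: complex_algebra_1
begin
definition cscale_complex :: "complex \<Rightarrow> complex \<Rightarrow> complex" where "cscale_complex = (*)"
instance by standard (simp_all add: cscale_complex_def algebra_simps)
end


section \<open>The universal enveloping algebra\<close>

datatype 'a fword = FWord (letters: "'a list")

instantiation fword :: (type) monoid_add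
begin
definition zero_fword :: "'a fword" where "zero_fword = FWord []"
definition plus_fword :: "'a fword \<Rightarrow> 'a fword \<Rightarrow> 'a fword"
  where "plus_fword u v = FWord (letters u @ letters v)"
instance by standard (simp_all add: zero_fword_def plus_fword_def)
end

lemma letters_zero [simp]: "letters 0 = []"
  and letters_plus [simp]: "letters (u + v) = letters u @ letters v"
  by (simp_all add: zero_fword_def plus_fword_def)

text \<open>The words form the free monoid (written additively), so by the convolution product of
  \<^theory>\<open>HOL-Library.Poly_Mapping\<close> the following is the free associative unital algebra on
  the set of all elements of \<open>'a\<close>.\<close>

type_synonym 'a free_alg = "'a fword \<Rightarrow>\<^sub>0 complex"

definition free_gen :: "'a \<Rightarrow> 'a free_alg"
  where "free_gen x = Poly_Mapping.single (FWord [x]) 1"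

definition free_const :: "complex \<Rightarrow> 'a free_alg"
  where "free_const c = Poly_Mapping.single 0 c"

text \<open>The linearity relators identify the quotient with the tensor algebra of the
  Lie algebra modulo its usual commutator relations.\<close>

inductive_set uea_ideal :: "'a::complex_lie_algebra free_alg set" where
  rel_add: "free_gen (x + y) - free_gen x - free_gen y \<in> uea_ideal"
| rel_cscale: "free_gen (c *\<^sub>c x) - free_const c * free_gen x \<in> uea_ideal"
| rel_bracket: "free_gen x * free_gen y - free_gen y * free_gen x - free_gen (lie_bracket x y) \<in> uea_ideal"
| zero: "0 \<in> uea_ideal"
| add: "p \<in> uea_ideal \<Longrightarrow> q \<in> uea_ideal \<Longrightarrow> p + q \<in> uea_ideal"
| mult: "p \<in> uea_ideal \<Longrightarrow> a * p * b \<in> uea_ideal"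

definition uea_rel :: "'a::complex_lie_algebra free_alg \<Rightarrow> 'a free_alg \<Rightarrow> bool"
  where "uea_rel p q \<longleftrightarrow> p - q \<in> uea_ideal"

lemma uea_ideal_minus: "p \<in> uea_ideal \<Longrightarrow> - p \<in> uea_ideal"
  using uea_ideal.mult[of p "-1" 1] by simp

lemma uea_ideal_diff: "p \<in> uea_ideal \<Longrightarrow> q \<in> uea_ideal \<Longrightarrow> p - q \<in> uea_ideal"
  using uea_ideal.add[OF _ uea_ideal_minus] by fastforce

lemma equivp_uea_rel: "equivp (uea_rel :: 'a::complex_lie_algebra free_alg \<Rightarrow> _)"
proof (rule equivpI)
  show "reflp (uea_rel :: 'a free_alg \<Rightarrow> _)" by (simp add: reflp_def uea_rel_def uea_ideal.zero)
  show "symp (uea_rel :: 'a free_alg \<Rightarrow> _)"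
    using uea_ideal_minus by (fastforce simp: symp_def uea_rel_def)
  show "transp (uea_rel :: 'a free_alg \<Rightarrow> _)"
  proof (rule transpI)
    fix p q r :: "'a free_alg"
    assume "uea_rel p q" "uea_rel q r"
    then show "uea_rel p r"
      using uea_ideal.add[of "p - q" "q - r"] by (simp add: uea_rel_def)
  qed
qed

text \<open>The value of a noncommutative polynomial under a substitution of the generators.\<close>

definition free_eval :: "('l \<Rightarrow> 'a::complex_algebra_1) \<Rightarrow> 'l free_alg \<Rightarrow> 'a" where
  "free_eval \<phi> p = (\<Sum>w\<in>Poly_Mapping.keys p. Poly_Mapping.lookup p w *\<^sub>c prod_list (map \<phi> (letters w)))"

lemma free_eval_single: "free_eval \<phi> (Poly_Mapping.single w c) = c *\<^sub>c prod_list (map \<phi> (letters w))"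
  by (cases "c = 0") (simp_all add: free_eval_def)

lemma free_eval_zero [simp]: "free_eval \<phi> 0 = 0"
  by (simp add: free_eval_def)

lemma free_eval_add: "free_eval \<phi> (p + q) = free_eval \<phi> p + free_eval \<phi> q"
  unfolding free_eval_def
  by (rule setsum_keys_plus_distrib) (simp_all add: cscale_add_left)

lemma free_eval_minus: "free_eval \<phi> (- p) = - free_eval \<phi> p"
  using free_eval_add[of \<phi> p "- p"] by (simp add: eq_neg_iff_add_eq_0 add.commute)

lemma free_eval_diff: "free_eval \<phi> (p - q) = free_eval \<phi> p - free_eval \<phi> q"
  using free_eval_add[of \<phi> p "- q"] by (simp add: free_eval_minus)

lemma free_alg_induct [case_names zero single]:
  assumes "P 0" and step: "\<And>p w c. P p \<Longrightarrow> P (p + Poly_Mapping.single w c)"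
  shows "P (p :: 'l free_alg)"
proof (induction p rule: Poly_Mapping.update_induct)
  case const
  then show ?case using assms by simp
next
  case (update p w c)
  have "Poly_Mapping.update w c p = p + Poly_Mapping.single w c"
    using update(1)
    by (intro poly_mapping_eqI) (auto simp: lookup_update lookup_add lookup_single in_keys_iff when_def)
  then show ?case using step update by simp
qed

lemma free_eval_mult: "free_eval \<phi> (p * q) = free_eval \<phi> p * free_eval \<phi> q"
proof (induction p rule: free_alg_induct)
  case (single p w c)
  have "free_eval \<phi> (Poly_Mapping.single w c * q) = free_eval \<phi> (Poly_Mapping.single w c) * free_eval \<phi> q"
    by (induction q rule: free_alg_induct)
      (simp_all add: distrib_left free_eval_add mult_single free_eval_single
        mult_cscale_left mult_cscale_right)
  with single show ?case by (simp add: distrib_right free_eval_add)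
qed simp

lemma free_eval_one: "free_eval \<phi> 1 = 1"
  using free_eval_single[of \<phi> 0 1] by simp

lemma free_eval_gen: "free_eval \<phi> (free_gen x) = \<phi> x"
  by (simp add: free_gen_def free_eval_single)

lemma free_eval_const: "free_eval \<phi> (free_const c) = c *\<^sub>c 1"
  by (simp add: free_const_def free_eval_single)

text \<open>Lie algebra homomorphisms into an associative algebra with the commutator bracket.\<close>

definition lie_hom_to_algebra :: "('l::complex_lie_algebra \<Rightarrow> 'a::complex_algebra_1) \<Rightarrow> bool" where
  "lie_hom_to_algebra \<phi> \<longleftrightarrow>
     (\<forall>x y. \<phi> (x + y) = \<phi> x + \<phi> y) \<and> (\<forall>c x. \<phi> (c *\<^sub>c x) = c *\<^sub>c \<phi> x) \<and>
     (\<forall>x y. \<phi> (lie_bracket x y) = \<phi> x * \<phi> y - \<phi> y * \<phi> x)"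

lemma free_eval_uea_ideal:
  assumes "lie_hom_to_algebra \<phi>" "p \<in> uea_ideal"
  shows "free_eval \<phi> p = 0"
  using assms(2,1)
  by induction
    (simp_all add: lie_hom_to_algebra_def free_eval_diff free_eval_add free_eval_mult
      free_eval_gen free_eval_const mult_cscale_left)

quotient_type (overloaded) 'l uea = "'l::complex_lie_algebra free_alg" / uea_rel
  by (rule equivp_uea_rel)

lemma free_const_commute: "p * free_const c = free_const c * (p :: 'l free_alg)"
  by (induction p rule: free_alg_induct)
    (simp_all add: distrib_left distrib_right free_const_def mult_single mult.commute)

lemma abs_rep_uea: "abs_uea (rep_uea u) = u"
  by (rule Quotient3_abs_rep[OF Quotient3_uea])

instantiation uea :: (complex_lie_algebra) complex_algebra_1
begin

lift_definition zero_uea :: "'a uea" is 0 .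
lift_definition one_uea :: "'a uea" is 1 .
lift_definition plus_uea :: "'a uea \<Rightarrow> 'a uea \<Rightarrow> 'a uea" is "(+)"
proof -
  fix p q p' q' :: "'a free_alg"
  assume "uea_rel p p'" "uea_rel q q'"
  then show "uea_rel (p + q) (p' + q')"
    using uea_ideal.add[of "p - p'" "q - q'"] by (simp add: uea_rel_def algebra_simps)
qed
lift_definition uminus_uea :: "'a uea \<Rightarrow> 'a uea" is uminus
  using uea_ideal_minus by (fastforce simp: uea_rel_def)
lift_definition minus_uea :: "'a uea \<Rightarrow> 'a uea \<Rightarrow> 'a uea" is "(-)"
proof -
  fix p q p' q' :: "'a free_alg"
  assume "uea_rel p p'" "uea_rel q q'"
  then show "uea_rel (p - q) (p' - q')"
    using uea_ideal_diff[of "p - p'" "q - q'"] by (simp add: uea_rel_def algebra_simps)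
qed
lift_definition times_uea :: "'a uea \<Rightarrow> 'a uea \<Rightarrow> 'a uea" is "(*)"
proof -
  fix p q p' q' :: "'a free_alg"
  assume "uea_rel p p'" "uea_rel q q'"
  then have "1 * (p - p') * q + p' * (q - q') * 1 \<in> uea_ideal"
    unfolding uea_rel_def by (intro uea_ideal.add uea_ideal.mult)
  then show "uea_rel (p * q) (p' * q')"
    by (simp add: uea_rel_def algebra_simps)
qed
lift_definition cscale_uea :: "complex \<Rightarrow> 'a uea \<Rightarrow> 'a uea" is "\<lambda>c p. free_const c * p"
proof -
  fix c and p q :: "'a free_alg"
  assume "uea_rel p q"
  then show "uea_rel (free_const c * p) (free_const c * q)"
    using uea_ideal.mult[of "p - q" "free_const c" 1] by (simp add: uea_rel_def algebra_simps)
qed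

instance
proof
  have ref: "p = q \<Longrightarrow> uea_rel p q" for p q :: "'a free_alg"
    by (simp add: uea_rel_def uea_ideal.zero)
  fix a b :: complex and x y z :: "'a uea"
  show "x + y + z = x + (y + z)" by transfer (rule ref, simp add: algebra_simps)
  show "x + y = y + x" by transfer (rule ref, simp add: algebra_simps)
  show "0 + x = x" by transfer (rule ref, simp)
  show "- x + x = 0" by transfer (rule ref, simp)
  show "x - y = x + - y" by transfer (rule ref, simp)
  show "x * y * z = x * (y * z)" by transfer (rule ref, simp add: algebra_simps)
  show "1 * x = x" by transfer (rule ref, simp)
  show "x * 1 = x" by transfer (rule ref, simp)
  show "(x + y) * z = x * z + y * z" by transfer (rule ref, simp add: algebra_simps)
  show "x * (y + z) = x * y + x * z" by transfer (rule ref, simp add: algebra_simps)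
  show "a *\<^sub>c (x + y) = a *\<^sub>c x + a *\<^sub>c y" by transfer (rule ref, simp add: algebra_simps)
  show "(a + b) *\<^sub>c x = a *\<^sub>c x + b *\<^sub>c x"
    by transfer (rule ref, simp add: free_const_def single_add algebra_simps)
  show "a *\<^sub>c b *\<^sub>c x = (a * b) *\<^sub>c x"
    by transfer (rule ref, simp add: free_const_def mult_single flip: mult.assoc)
  show "1 *\<^sub>c x = x" by transfer (rule ref, simp add: free_const_def)
  show "(a *\<^sub>c x) * y = a *\<^sub>c (x * y)" by transfer (rule ref, simp add: mult.assoc)
  show "x * (a *\<^sub>c y) = a *\<^sub>c (x * y)"
    by transfer (rule ref, metis free_const_commute mult.assoc)
  have "lie_hom_to_algebra (\<lambda>_::'a. 0 :: complex)"
    by (simp add: lie_hom_to_algebra_def cscale_complex_def)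
  then have "(1 :: 'a free_alg) \<notin> uea_ideal"
    using free_eval_uea_ideal free_eval_one by (metis zero_neq_one)
  then have "\<not> uea_rel (0 :: 'a free_alg) 1"
    using uea_ideal_minus[of "- 1 :: 'a free_alg"] by (auto simp: uea_rel_def)
  then show "(0 :: 'a uea) \<noteq> 1" by transfer
qed

end

lift_definition uea_gen :: "'l::complex_lie_algebra \<Rightarrow> 'l uea" is free_gen .

text \<open>The extension of a Lie algebra homomorphism \<open>\<phi>\<close> to an algebra homomorphism; for
  other maps \<open>\<phi>\<close> the value depends on the choice of representatives.\<close>

definition uea_lift :: "('l::complex_lie_algebra \<Rightarrow> 'a::complex_algebra_1) \<Rightarrow> 'l uea \<Rightarrow> 'a"
  where "uea_lift \<phi> u = free_eval \<phi> (rep_uea u)"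

lemma uea_lift_abs:
  assumes "lie_hom_to_algebra \<phi>"
  shows "uea_lift \<phi> (abs_uea p) = free_eval \<phi> p"
proof -
  have "uea_rel (rep_uea (abs_uea p)) p"
    using Quotient3_uea Quotient3_rep_abs[OF Quotient3_uea] equivp_reflp[OF equivp_uea_rel] by blast
  then have "free_eval \<phi> (rep_uea (abs_uea p) - p) = 0"
    using assms by (simp add: uea_rel_def free_eval_uea_ideal)
  then show ?thesis by (simp add: uea_lift_def free_eval_diff)
qed

lemma uea_lift:
  assumes "lie_hom_to_algebra \<phi>"
  shows "uea_lift \<phi> (u + v) = uea_lift \<phi> u + uea_lift \<phi> v"
    and "uea_lift \<phi> (u * v) = uea_lift \<phi> u * uea_lift \<phi> v"
    and "uea_lift \<phi> 1 = 1"
    and "uea_lift \<phi> (c *\<^sub>c u) = c *\<^sub>c uea_lift \<phi> u"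
    and "uea_lift \<phi> (uea_gen x) = \<phi> x"
proof -
  obtain p q where u: "u = abs_uea p" and v: "v = abs_uea q"
    using abs_rep_uea by metis
  note [simp] = uea_lift_abs[OF assms]
  show "uea_lift \<phi> (u + v) = uea_lift \<phi> u + uea_lift \<phi> v"
    by (simp add: u v plus_uea.abs_eq free_eval_add)
  show "uea_lift \<phi> (u * v) = uea_lift \<phi> u * uea_lift \<phi> v"
    by (simp add: u v times_uea.abs_eq free_eval_mult)
  show "uea_lift \<phi> 1 = 1"
    by (simp add: one_uea.abs_eq free_eval_one)
  show "uea_lift \<phi> (c *\<^sub>c u) = c *\<^sub>c uea_lift \<phi> u"
    by (simp add: u cscale_uea.abs_eq free_eval_mult free_eval_const mult_cscale_left)
  show "uea_lift \<phi> (uea_gen x) = \<phi> x"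
    by (simp add: uea_gen.abs_eq free_eval_gen)
qed

lemma lie_hom_uea_gen: "lie_hom_to_algebra uea_gen"
  unfolding lie_hom_to_algebra_def
proof (intro conjI allI)
  fix x y :: 'a and c
  show "uea_gen (x + y) = uea_gen x + uea_gen y"
    by transfer (use uea_ideal.rel_add in \<open>simp add: uea_rel_def diff_diff_eq\<close>)
  show "uea_gen (c *\<^sub>c x) = c *\<^sub>c uea_gen x"
    by transfer (simp add: uea_rel_def uea_ideal.rel_cscale)
  show "uea_gen (lie_bracket x y) = uea_gen x * uea_gen y - uea_gen y * uea_gen x"
    by transfer (use uea_ideal_minus[OF uea_ideal.rel_bracket] in \<open>simp add: uea_rel_def algebra_simps\<close>)
qed

lemma uea_induct [case_names gen one cscale add mult]:
  assumes "\<And>x. P (uea_gen x)" "P 1" "\<And>c u. P u \<Longrightarrow> P (c *\<^sub>c u)"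
    and "\<And>u v. P u \<Longrightarrow> P v \<Longrightarrow> P (u + v)" "\<And>u v. P u \<Longrightarrow> P v \<Longrightarrow> P (u * v)"
  shows "P (u :: 'l::complex_lie_algebra uea)"
proof -
  have mono: "P (abs_uea (Poly_Mapping.single (FWord xs) 1))" for xs :: "'l list"
  proof (induction xs)
    case Nil
    then show ?case using assms(2) by (simp add: one_uea.abs_eq flip: zero_fword_def)
  next
    case (Cons x xs)
    have "abs_uea (Poly_Mapping.single (FWord (x # xs)) 1) = uea_gen x * abs_uea (Poly_Mapping.single (FWord xs) 1)"
      by (simp add: uea_gen.abs_eq times_uea.abs_eq free_gen_def mult_single plus_fword_def)
    then show ?case using Cons assms by simp
  qed
  have single: "P (abs_uea (Poly_Mapping.single w c))" for w :: "'l fword" and c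
  proof -
    have "abs_uea (Poly_Mapping.single w c) = c *\<^sub>c abs_uea (Poly_Mapping.single w 1)"
      by (simp add: cscale_uea.abs_eq free_const_def mult_single)
    then show ?thesis using mono[of "letters w"] assms(3) by simp
  qed
  have "P (abs_uea p)" for p :: "'l free_alg"
  proof (induction p rule: free_alg_induct)
    case zero
    then show ?case using single[of 0 0] by simp
  next
    case (single p w c)
    then show ?case
      using \<open>\<And>w c. P (abs_uea (Poly_Mapping.single w c))\<close> assms(4)
      by (simp flip: plus_uea.abs_eq)
  qed
  then show ?thesis using abs_rep_uea[of u] by metis
qed


section \<open>The Lie algebra \<open>sl\<^sub>2\<close> and its Takiff algebra\<close>

typedef sl2 = "{A :: complex^2^2. trace A = 0}"
  morphisms sl2_mat Abs_sl2
  by (rule exI[of _ 0]) (simp add: trace_def)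

setup_lifting type_definition_sl2

instantiation sl2 :: complex_lie_algebra
begin

lift_definition zero_sl2 :: sl2 is 0 by (simp add: trace_def)
lift_definition plus_sl2 :: "sl2 \<Rightarrow> sl2 \<Rightarrow> sl2" is "(+)" by (simp add: trace_add)
lift_definition minus_sl2 :: "sl2 \<Rightarrow> sl2 \<Rightarrow> sl2" is "(-)" by (simp add: trace_sub)
lift_definition uminus_sl2 :: "sl2 \<Rightarrow> sl2" is uminus by (simp add: trace_def sum_negf)
lift_definition cscale_sl2 :: "complex \<Rightarrow> sl2 \<Rightarrow> sl2" is "\<lambda>c A. \<chi> i j. c * A $ i $ j"
  by (simp only: trace_def vec_lambda_beta sum_distrib_left[symmetric] mult_zero_right)
lift_definition lie_bracket_sl2 :: "sl2 \<Rightarrow> sl2 \<Rightarrow> sl2" is "\<lambda>A B. A ** B - B ** A"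
proof -
  fix A B :: "complex^2^2"
  show "trace (A ** B - B ** A) = 0"
    using trace_mul_sym[of A B] by (simp only: trace_sub diff_self)
qed

lemma sl2_mat_22: "sl2_mat A $ 2 $ 2 = - sl2_mat A $ 1 $ 1"
  using sl2_mat[of A] by (simp add: trace_def sum_2 add_eq_0_iff)

lemma sl2_eq_iff:
  "A = B \<longleftrightarrow> sl2_mat A $ 1 $ 1 = sl2_mat B $ 1 $ 1 \<and> sl2_mat A $ 1 $ 2 = sl2_mat B $ 1 $ 2 \<and>
     sl2_mat A $ 2 $ 1 = sl2_mat B $ 2 $ 1"
  by (auto simp: vec_eq_iff forall_2 sl2_mat_22 simp flip: sl2_mat_inject)

lemma sl2_mat_ops [simp]:
  "sl2_mat 0 = 0" "sl2_mat (A + B) = sl2_mat A + sl2_mat B" "sl2_mat (A - B) = sl2_mat A - sl2_mat B"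
  "sl2_mat (- A) = - sl2_mat A" "sl2_mat (c *\<^sub>c A) $ i $ j = c * sl2_mat A $ i $ j"
  by (simp_all add: zero_sl2.rep_eq plus_sl2.rep_eq minus_sl2.rep_eq uminus_sl2.rep_eq cscale_sl2.rep_eq)

lemma sl2_mat_bracket:
  "sl2_mat (lie_bracket A B) = sl2_mat A ** sl2_mat B - sl2_mat B ** sl2_mat A"
  by (rule lie_bracket_sl2.rep_eq)

lemma sl2_bracket_entries [simp]:
  "sl2_mat (lie_bracket A B) $ 1 $ 1 =
     sl2_mat A $ 1 $ 2 * sl2_mat B $ 2 $ 1 - sl2_mat B $ 1 $ 2 * sl2_mat A $ 2 $ 1"
  "sl2_mat (lie_bracket A B) $ 1 $ 2 =
     2 * (sl2_mat A $ 1 $ 1 * sl2_mat B $ 1 $ 2 - sl2_mat B $ 1 $ 1 * sl2_mat A $ 1 $ 2)"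
  "sl2_mat (lie_bracket A B) $ 2 $ 1 =
     2 * (sl2_mat B $ 1 $ 1 * sl2_mat A $ 2 $ 1 - sl2_mat A $ 1 $ 1 * sl2_mat B $ 2 $ 1)"
  by (simp_all add: sl2_mat_bracket matrix_matrix_mult_def sum_2 sl2_mat_22 algebra_simps)

instance
  by standard (simp_all add: sl2_eq_iff algebra_simps)

end

lift_definition sl2_e :: sl2 is "vector [vector [0, 1], vector [0, 0]]"
  by (simp add: trace_def sum_2)
lift_definition sl2_f :: sl2 is "vector [vector [0, 0], vector [1, 0]]"
  by (simp add: trace_def sum_2)
lift_definition sl2_h :: sl2 is "vector [vector [1, 0], vector [0, -1]]"
  by (simp add: trace_def sum_2)

lemma sl2_mat_basis [simp]:
  "sl2_mat sl2_e $ 1 $ 1 = 0" "sl2_mat sl2_e $ 1 $ 2 = 1" "sl2_mat sl2_e $ 2 $ 1 = 0"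
  "sl2_mat sl2_f $ 1 $ 1 = 0" "sl2_mat sl2_f $ 1 $ 2 = 0" "sl2_mat sl2_f $ 2 $ 1 = 1"
  "sl2_mat sl2_h $ 1 $ 1 = 1" "sl2_mat sl2_h $ 1 $ 2 = 0" "sl2_mat sl2_h $ 2 $ 1 = 0"
  by (simp_all add: sl2_e.rep_eq sl2_f.rep_eq sl2_h.rep_eq)

lemma sl2_decompose:
  "A = sl2_mat A $ 1 $ 1 *\<^sub>c sl2_h + sl2_mat A $ 1 $ 2 *\<^sub>c sl2_e + sl2_mat A $ 2 $ 1 *\<^sub>c sl2_f"
  by (simp add: sl2_eq_iff)

lemma sl2_relations:
  "lie_bracket sl2_e sl2_f = sl2_h"
  "lie_bracket sl2_h sl2_e = 2 *\<^sub>c sl2_e"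
  "lie_bracket sl2_h sl2_f = (-2) *\<^sub>c sl2_f"
  by (simp_all add: sl2_eq_iff)

text \<open>\<open>Takiff v w\<close> stands for \<open>v \<otimes> 1 + w \<otimes> x\<close>, where \<open>x\<^sup>2 = 0\<close>.\<close>

datatype takiff = Takiff (part_1: sl2) (part_x: sl2)

instantiation takiff :: complex_lie_algebra
begin

definition zero_takiff :: takiff where "0 = Takiff 0 0"
definition plus_takiff :: "takiff \<Rightarrow> takiff \<Rightarrow> takiff"
  where "a + b = Takiff (part_1 a + part_1 b) (part_x a + part_x b)"
definition minus_takiff :: "takiff \<Rightarrow> takiff \<Rightarrow> takiff"
  where "a - b = Takiff (part_1 a - part_1 b) (part_x a - part_x b)"
definition uminus_takiff :: "takiff \<Rightarrow> takiff"
  where "- a = Takiff (- part_1 a) (- part_x a)"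
definition cscale_takiff :: "complex \<Rightarrow> takiff \<Rightarrow> takiff"
  where "c *\<^sub>c a = Takiff (c *\<^sub>c part_1 a) (c *\<^sub>c part_x a)"
definition lie_bracket_takiff :: "takiff \<Rightarrow> takiff \<Rightarrow> takiff"
  where "lie_bracket a b = Takiff (lie_bracket (part_1 a) (part_1 b))
           (lie_bracket (part_1 a) (part_x b) + lie_bracket (part_x a) (part_1 b))"

instance
proof
  fix x y z :: takiff
  have anti: "lie_bracket u v + lie_bracket v u = 0" for u v :: sl2
  proof -
    have "0 = lie_bracket (u + v) (u + v)" by (simp only: lie_bracket_self)
    also have "\<dots> = lie_bracket u v + lie_bracket v u"
      by (simp only: lie_bracket_add_left lie_bracket_add_right) (simp add: lie_bracket_self)
    finally show ?thesis by simp
  qed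
  show "lie_bracket x x = 0"
    by (simp add: lie_bracket_takiff_def zero_takiff_def lie_bracket_self anti)
  let ?J = "\<lambda>u v w :: sl2. lie_bracket u (lie_bracket v w) + lie_bracket v (lie_bracket w u) + lie_bracket w (lie_bracket u v)"
  have "?J (part_1 x) (part_1 y) (part_x z) + ?J (part_1 x) (part_x y) (part_1 z)
      + ?J (part_x x) (part_1 y) (part_1 z) = 0"
    by (simp only: lie_jacobi add_0_left)
  moreover note lie_jacobi[of "part_1 x" "part_1 y" "part_1 z"]
  ultimately show "lie_bracket x (lie_bracket y z) + lie_bracket y (lie_bracket z x) + lie_bracket z (lie_bracket x y) = 0"
    by (simp add: lie_bracket_takiff_def zero_takiff_def plus_takiff_def lie_bracket_add_left
        lie_bracket_add_right ac_simps)
qed (simp_all add: takiff.expand zero_takiff_def plus_takiff_def minus_takiff_def uminus_takiff_def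
    cscale_takiff_def lie_bracket_takiff_def cscale_add_right cscale_add_left
    lie_bracket_add_left lie_bracket_add_right lie_bracket_cscale_left lie_bracket_cscale_right
    algebra_simps)

end

definition in_g :: "sl2 \<Rightarrow> takiff" where "in_g v = Takiff v 0"
definition bar :: "sl2 \<Rightarrow> takiff" where "bar v = Takiff 0 v"

definition takiff_borel :: "takiff set"
  where "takiff_borel = cvec.span {in_g sl2_h, bar sl2_h, in_g sl2_e, bar sl2_e}"

lemma takiff_borel_iff:
  "a \<in> takiff_borel \<longleftrightarrow> sl2_mat (part_1 a) $ 2 $ 1 = 0 \<and> sl2_mat (part_x a) $ 2 $ 1 = 0"
proof -
  let ?S = "{in_g sl2_h, bar sl2_h, in_g sl2_e, bar sl2_e}"
  let ?B = "{a. sl2_mat (part_1 a) $ 2 $ 1 = 0 \<and> sl2_mat (part_x a) $ 2 $ 1 = 0}"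
  have "cvec.subspace ?B"
    by (simp add: cvec.subspace_def zero_takiff_def plus_takiff_def cscale_takiff_def)
  then have "cvec.span ?S \<subseteq> ?B"
    by (intro cvec.span_minimal) (auto simp: in_g_def bar_def)
  moreover have "a \<in> cvec.span ?S" if "a \<in> ?B"
  proof -
    have "a = sl2_mat (part_1 a) $ 1 $ 1 *\<^sub>c in_g sl2_h + sl2_mat (part_x a) $ 1 $ 1 *\<^sub>c bar sl2_h +
              sl2_mat (part_1 a) $ 1 $ 2 *\<^sub>c in_g sl2_e + sl2_mat (part_x a) $ 1 $ 2 *\<^sub>c bar sl2_e"
      using that
      by (simp add: takiff.expand in_g_def bar_def plus_takiff_def cscale_takiff_def sl2_eq_iff)
    also have "\<dots> \<in> cvec.span ?S"
      by (intro cvec.span_add cvec.span_scale cvec.span_base) auto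
    finally show ?thesis .
  qed
  ultimately show ?thesis by (auto simp: takiff_borel_def)
qed

typedef borel_type = takiff_borel
  morphisms borel_incl Abs_borel_type
  by (auto simp: takiff_borel_def intro: cvec.span_zero)

setup_lifting type_definition_borel_type

instantiation borel_type :: complex_lie_algebra
begin

lift_definition zero_borel_type :: "borel_type" is "0"
  unfolding takiff_borel_def by (rule cvec.span_zero)
lift_definition plus_borel_type :: "borel_type \<Rightarrow> borel_type \<Rightarrow> borel_type" is "(+)"
  unfolding takiff_borel_def by (rule cvec.span_add)
lift_definition minus_borel_type :: "borel_type \<Rightarrow> borel_type \<Rightarrow> borel_type" is "(-)"
  unfolding takiff_borel_def by (rule cvec.span_diff)
lift_definition uminus_borel_type :: "borel_type \<Rightarrow> borel_type" is "uminus"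
  unfolding takiff_borel_def by (rule cvec.span_neg)
lift_definition cscale_borel_type :: "complex \<Rightarrow> borel_type \<Rightarrow> borel_type" is "(*\<^sub>c)"
  unfolding takiff_borel_def by (rule cvec.span_scale)
lift_definition lie_bracket_borel_type :: "borel_type \<Rightarrow> borel_type \<Rightarrow> borel_type" is lie_bracket
  by (simp add: takiff_borel_iff lie_bracket_takiff_def)

lemmas borel_incl_ops = zero_borel_type.rep_eq plus_borel_type.rep_eq minus_borel_type.rep_eq
  uminus_borel_type.rep_eq cscale_borel_type.rep_eq lie_bracket_borel_type.rep_eq

instance
proof
  fix x y z :: borel_type
  show "x + y = y + x" "x + y + z = x + (y + z)"
    by (simp_all only: borel_incl_inject[symmetric] borel_incl_ops ac_simps)
qed (simp_all add: borel_incl_inject[symmetric] borel_incl_ops lie_bracket_add_left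
      lie_bracket_add_right lie_bracket_cscale_left lie_bracket_cscale_right lie_bracket_self
      lie_jacobi cscale_add_right cscale_add_left)

end


section \<open>Ore localization of \<open>U\<close> at the powers of \<open>f\<close>\<close>

type_synonym takiff_U = "takiff uea"

definition U_f :: takiff_U where "U_f = uea_gen (in_g sl2_f)"

definition ad_f :: "takiff_U \<Rightarrow> takiff_U" where "ad_f u = U_f * u - u * U_f"

lemma ad_f_add: "ad_f (u + v) = ad_f u + ad_f v"
  and ad_f_mult: "ad_f (u * v) = ad_f u * v + u * ad_f v"
  and ad_f_cscale: "ad_f (c *\<^sub>c u) = c *\<^sub>c ad_f u"
  by (simp_all add: ad_f_def algebra_simps mult_cscale_left mult_cscale_right cvec.scale_right_diff_distrib)

lemma ad_f_pow_add: "(ad_f ^^ n) (u + v) = (ad_f ^^ n) u + (ad_f ^^ n) v"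
  by (induction n) (simp_all add: ad_f_add)

lemma ad_f_pow_cscale: "(ad_f ^^ n) (c *\<^sub>c u) = c *\<^sub>c (ad_f ^^ n) u"
  by (induction n) (simp_all add: ad_f_cscale)

lemma ad_f_pow_zero [simp]: "(ad_f ^^ n) 0 = 0"
  by (induction n) (simp_all add: ad_f_def)

lemma ad_f_pow_le: "(ad_f ^^ n) u = 0 \<Longrightarrow> n \<le> m \<Longrightarrow> (ad_f ^^ m) u = 0"
  by (metis ad_f_pow_zero comp_apply funpow_add le_add_diff_inverse2)

lemma ad_f_pow_mult:
  "(ad_f ^^ a) u = 0 \<Longrightarrow> (ad_f ^^ b) v = 0 \<Longrightarrow> (ad_f ^^ (a + b)) (u * v) = 0"
proof (induction "a + b" arbitrary: a b u v)
  case (Suc n)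
  have "(ad_f ^^ n) (ad_f u * v) = 0"
  proof (cases a)
    case (Suc a')
    then show ?thesis using Suc.hyps(1)[of a' b "ad_f u" v] Suc.hyps(2) Suc.prems
      by (simp add: funpow_swap1)
  qed (use Suc.prems in \<open>simp add: ad_f_def\<close>)
  moreover have "(ad_f ^^ n) (u * ad_f v) = 0"
  proof (cases b)
    case (Suc b')
    then show ?thesis using Suc.hyps(1)[of a b' u "ad_f v"] Suc.hyps(2) Suc.prems
      by (simp add: funpow_swap1)
  qed (use Suc.prems in \<open>simp add: ad_f_def\<close>)
  ultimately have "(ad_f ^^ Suc n) (u * v) = 0"
    by (simp only: funpow_Suc_right comp_apply ad_f_mult ad_f_pow_add) simp
  then show ?case using Suc.hyps(2) by simp
qed simp

lemma ad_f_nilpotent: "\<exists>n. (ad_f ^^ n) u = 0"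
proof (induction u rule: uea_induct)
  case (gen x)
  have ad: "ad_f (uea_gen y) = uea_gen (lie_bracket (in_g sl2_f) y)" for y
    using lie_hom_uea_gen[where 'a = takiff] by (simp add: lie_hom_to_algebra_def ad_f_def U_f_def)
  have "lie_bracket sl2_f (lie_bracket sl2_f (lie_bracket sl2_f A)) = 0" for A
    by (simp add: sl2_eq_iff)
  moreover have "lie_bracket 0 A = 0" for A :: sl2
    using lie_bracket_add_left[of 0 0 A] by simp
  ultimately have "lie_bracket (in_g sl2_f) (lie_bracket (in_g sl2_f) (lie_bracket (in_g sl2_f) x)) = 0"
    by (simp add: lie_bracket_takiff_def in_g_def zero_takiff_def)
  moreover have "uea_gen (0 :: takiff) = 0"
    using lie_hom_uea_gen[where 'a = takiff] unfolding lie_hom_to_algebra_def by (metis add_cancel_right_right)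
  ultimately have "(ad_f ^^ 3) (uea_gen x) = 0"
    by (simp add: ad numeral_3_eq_3)
  then show ?case ..
next
  case one
  have "(ad_f ^^ 1) 1 = 0" by (simp add: ad_f_def)
  then show ?case ..
next
  case (cscale c u)
  then show ?case by (metis ad_f_pow_cscale cvec.scale_zero_right)
next
  case (add u v)
  then obtain a b where "(ad_f ^^ a) u = 0" "(ad_f ^^ b) v = 0" by blast
  then have "(ad_f ^^ (a + b)) (u + v) = 0"
    by (simp add: ad_f_pow_add ad_f_pow_le[of a u "a + b"] ad_f_pow_le[of b v "a + b"])
  then show ?case ..
next
  case (mult u v)
  then show ?case using ad_f_pow_mult by blast
qed

lemma U_f_ore: "\<exists>m w. U_f ^ m * u = w * U_f ^ l"
proof -
  have "\<forall>u l. (ad_f ^^ n) u = 0 \<longrightarrow> (\<exists>m w. U_f ^ m * u = w * U_f ^ l)" for n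
  proof (induction n)
    case 0
    then show ?case by (metis funpow_0 mult_zero_left mult_zero_right)
  next
    case (Suc n)
    note IH_n = Suc.IH
    show ?case
    proof (intro allI impI)
      fix u l assume nil: "(ad_f ^^ Suc n) u = 0"
      show "\<exists>m w. U_f ^ m * u = w * U_f ^ l"
      proof (induction l)
        case 0
        have "U_f ^ 0 * u = u * U_f ^ 0" by simp
        then show ?case by blast
      next
        case (Suc l)
        then obtain m w where m: "U_f ^ m * u = w * U_f ^ l" by blast
        have "(ad_f ^^ n) (ad_f u) = 0" using nil by (simp only: funpow_Suc_right comp_apply)
        then obtain m' w' where m': "U_f ^ m' * ad_f u = w' * U_f ^ Suc l"
          using IH_n[rule_format, of "ad_f u" "Suc l"] by blast
        have "U_f ^ Suc (m + m') * u = U_f ^ m' * (U_f ^ m * u) * U_f + U_f ^ m * (U_f ^ m' * ad_f u)"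
        proof -
          have "U_f ^ Suc (m + m') * u = U_f ^ (m + m') * (u * U_f + ad_f u)"
            by (simp only: power_Suc2 mult.assoc) (simp add: ad_f_def)
          also have "\<dots> = U_f ^ (m' + m) * u * U_f + U_f ^ (m + m') * ad_f u"
            by (simp add: distrib_left mult.assoc add.commute)
          finally show ?thesis by (simp only: power_add mult.assoc)
        qed
        also have "\<dots> = (U_f ^ m' * w + U_f ^ m * w') * U_f ^ Suc l"
          by (simp only: m m' distrib_right mult.assoc power_Suc2)
        finally show ?case by blast
      qed
    qed
  qed
  then show ?thesis using ad_f_nilpotent by blast
qed

lemma U_f_reversible1: assumes "u * U_f = 0" shows "\<exists>m. U_f ^ m * u = 0"
proof -
  have "(ad_f ^^ n) u = U_f ^ n * u" for n
  proof (induction n)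
    case (Suc n)
    then show ?case using assms by (simp add: ad_f_def mult.assoc)
  qed simp
  then show ?thesis using ad_f_nilpotent by metis
qed

lemma U_f_reversible: "u * U_f ^ l = 0 \<Longrightarrow> \<exists>m. U_f ^ m * u = 0"
proof (induction l arbitrary: u)
  case 0
  then show ?case by (metis mult.right_neutral power_0 mult.left_neutral)
next
  case (Suc l)
  then have "(u * U_f) * U_f ^ l = 0" by (simp add: mult.assoc)
  then obtain m where "(U_f ^ m * u) * U_f = 0" using Suc.IH by (metis mult.assoc)
  then obtain m' where "U_f ^ m' * (U_f ^ m * u) = 0" using U_f_reversible1 by blast
  then have "U_f ^ (m' + m) * u = 0" by (simp add: power_add mult.assoc)
  then show ?case ..
qed

text \<open>The pair \<open>(k, u)\<close> represents the left fraction \<open>f\<^sup>-\<^sup>k u\<close>.\<close>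

definition frac_rel :: "nat \<times> takiff_U \<Rightarrow> nat \<times> takiff_U \<Rightarrow> bool" where
  "frac_rel x y \<longleftrightarrow> (\<exists>m. U_f ^ (m + fst y) * snd x = U_f ^ (m + fst x) * snd y)"

lemma frac_relI: "U_f ^ (m + l) * u = U_f ^ (m + k) * v \<Longrightarrow> frac_rel (k, u) (l, v)"
  by (auto simp: frac_rel_def)

lemma U_f_pow_left: "U_f ^ a * u = U_f ^ b * v \<Longrightarrow> U_f ^ (c + a) * u = U_f ^ (c + b) * v"
  by (simp add: power_add mult.assoc)

lemma equivp_frac_rel: "equivp frac_rel"
proof (rule equivpI)
  show "reflp frac_rel" by (simp add: reflp_def frac_rel_def)
  show "symp frac_rel" by (simp add: symp_def frac_rel_def) metis
  show "transp frac_rel"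
  proof (rule transpI)
    fix x y z assume "frac_rel x y" "frac_rel y z"
    then obtain m m' where
      1: "U_f ^ (m + fst y) * snd x = U_f ^ (m + fst x) * snd y" and
      2: "U_f ^ (m' + fst z) * snd y = U_f ^ (m' + fst y) * snd z"
      by (auto simp: frac_rel_def)
    have "U_f ^ (m' + fst z + (m + fst y)) * snd x = U_f ^ (m' + fst z + (m + fst x)) * snd y"
      using 1 by (rule U_f_pow_left)
    also have "m' + fst z + (m + fst x) = m + fst x + (m' + fst z)" by simp
    also have "U_f ^ (m + fst x + (m' + fst z)) * snd y = U_f ^ (m + fst x + (m' + fst y)) * snd z"
      using 2 by (rule U_f_pow_left)
    finally have "U_f ^ ((m + m' + fst y) + fst z) * snd x = U_f ^ ((m + m' + fst y) + fst x) * snd z"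
      by (simp add: ac_simps)
    then show "frac_rel x z" unfolding frac_rel_def ..
  qed
qed

lemma frac_rel_expand: "frac_rel (k, u) (c + k, U_f ^ c * u)"
proof -
  have "U_f ^ (0 + (c + k)) * u = U_f ^ (0 + k) * (U_f ^ c * u)"
    by (simp only: add_0_left add.commute[of c k] power_add mult.assoc)
  then show ?thesis by (rule frac_relI)
qed

text \<open>The product \<open>(f\<^sup>-\<^sup>k u) (f\<^sup>-\<^sup>l v)\<close> is \<open>f\<^sup>-\<^sup>k\<^sup>-\<^sup>m w v\<close>, where
  \<open>f\<^sup>m u = w f\<^sup>l\<close>, i.e. \<open>u f\<^sup>-\<^sup>l = f\<^sup>-\<^sup>m w\<close>.\<close>

definition ore_pair :: "takiff_U \<Rightarrow> nat \<Rightarrow> nat \<times> takiff_U" where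
  "ore_pair u l = (SOME p. U_f ^ fst p * u = snd p * U_f ^ l)"

definition frac_mult :: "nat \<times> takiff_U \<Rightarrow> nat \<times> takiff_U \<Rightarrow> nat \<times> takiff_U" where
  "frac_mult x y = (let p = ore_pair (snd x) (fst y) in (fst x + fst p, snd p * snd y))"

definition frac_add :: "nat \<times> takiff_U \<Rightarrow> nat \<times> takiff_U \<Rightarrow> nat \<times> takiff_U" where
  "frac_add x y = (fst x + fst y, U_f ^ fst y * snd x + U_f ^ fst x * snd y)"

lemma frac_mult_ore:
  assumes "U_f ^ m * u = w * U_f ^ l"
  shows "frac_rel (frac_mult (k, u) (l, v)) (k + m, w * v)"
proof -
  define m' w' where "m' = fst (ore_pair u l)" and "w' = snd (ore_pair u l)"
  have "\<exists>p. U_f ^ fst p * u = snd p * U_f ^ l" using U_f_ore[of u l] by auto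
  then have *: "U_f ^ m' * u = w' * U_f ^ l"
    unfolding m'_def w'_def ore_pair_def by (rule someI_ex)
  have "(U_f ^ m' * w) * U_f ^ l = U_f ^ (m' + m) * u"
    by (simp add: power_add mult.assoc assms)
  also have "\<dots> = (U_f ^ m * w') * U_f ^ l"
    by (simp only: add.commute[of m'] power_add mult.assoc *)
  finally have "(U_f ^ m' * w - U_f ^ m * w') * U_f ^ l = 0" by (simp add: algebra_simps)
  then obtain j where j: "U_f ^ j * (U_f ^ m' * w - U_f ^ m * w') = 0"
    using U_f_reversible by blast
  have "U_f ^ (j + m) * w' = U_f ^ (j + m') * w"
    using j by (simp add: right_diff_distrib power_add mult.assoc)
  then have "U_f ^ (k + (j + m)) * (w' * v) = U_f ^ (k + (j + m')) * (w * v)"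
    by (metis U_f_pow_left mult.assoc)
  then have "U_f ^ (j + (k + m)) * (w' * v) = U_f ^ (j + (k + m')) * (w * v)"
    by (simp only: add.left_commute[of k])
  then have "frac_rel (k + m', w' * v) (k + m, w * v)" by (rule frac_relI)
  then show ?thesis by (simp add: frac_mult_def Let_def m'_def w'_def)
qed

quotient_type takiff_Uf = "nat \<times> takiff_U" / frac_rel
  by (rule equivp_frac_rel)

definition Frac :: "nat \<Rightarrow> takiff_U \<Rightarrow> takiff_Uf" where "Frac k u = abs_takiff_Uf (k, u)"

instantiation takiff_Uf :: "{ring, monoid_mult}"
begin

lift_definition zero_takiff_Uf :: takiff_Uf is "(0, 0)" .
lift_definition one_takiff_Uf :: takiff_Uf is "(0, 1)" .
lift_definition uminus_takiff_Uf :: "takiff_Uf \<Rightarrow> takiff_Uf" is "\<lambda>x. (fst x, - snd x)"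
  by (auto simp: frac_rel_def)
lift_definition plus_takiff_Uf :: "takiff_Uf \<Rightarrow> takiff_Uf \<Rightarrow> takiff_Uf" is frac_add
proof -
  fix x x' y y' assume "frac_rel x x'" "frac_rel y y'"
  then obtain a b where
    a: "U_f ^ (a + fst x') * snd x = U_f ^ (a + fst x) * snd x'" and
    b: "U_f ^ (b + fst y') * snd y = U_f ^ (b + fst y) * snd y'"
    by (auto simp: frac_rel_def)
  have "U_f ^ ((a + b) + (fst x' + fst y')) * (U_f ^ fst y * snd x + U_f ^ fst x * snd y) =
      U_f ^ ((b + fst y' + fst y) + (a + fst x')) * snd x + U_f ^ ((a + fst x' + fst x) + (b + fst y')) * snd y"
    by (simp only: distrib_left mult.assoc[symmetric] power_add[symmetric] ac_simps)
  also have "\<dots> = U_f ^ ((b + fst y' + fst y) + (a + fst x)) * snd x' + U_f ^ ((a + fst x' + fst x) + (b + fst y)) * snd y'"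
    using U_f_pow_left[OF a] U_f_pow_left[OF b] by simp
  also have "\<dots> = U_f ^ ((a + b) + (fst x + fst y)) * (U_f ^ fst y' * snd x' + U_f ^ fst x' * snd y')"
    by (simp only: distrib_left mult.assoc[symmetric] power_add[symmetric] ac_simps)
  finally show "frac_rel (frac_add x y) (frac_add x' y')"
    unfolding frac_rel_def frac_add_def fst_conv snd_conv ..
qed
definition minus_takiff_Uf :: "takiff_Uf \<Rightarrow> takiff_Uf \<Rightarrow> takiff_Uf"
  where "x - y = x + - y" for x y :: takiff_Uf
lift_definition times_takiff_Uf :: "takiff_Uf \<Rightarrow> takiff_Uf \<Rightarrow> takiff_Uf" is frac_mult
proof -
  note tr = equivp_transp[OF equivp_frac_rel] and sy = equivp_symp[OF equivp_frac_rel]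
  have left: "frac_rel (frac_mult (k, u) (l, v)) (frac_mult (k', u') (l, v))"
    if rel: "frac_rel (k, u) (k', u')" for k u k' u' l v
  proof -
    obtain a where a: "U_f ^ (a + k') * u = U_f ^ (a + k) * u'"
      using rel by (auto simp: frac_rel_def)
    obtain m w where m: "U_f ^ m * (U_f ^ (a + k') * u) = w * U_f ^ l" using U_f_ore by blast
    then have "U_f ^ (m + (a + k')) * u = w * U_f ^ l" "U_f ^ (m + (a + k)) * u' = w * U_f ^ l"
      using a by (simp_all add: power_add[of _ m] mult.assoc)
    from this[THEN frac_mult_ore]
    have "frac_rel (frac_mult (k, u) (l, v)) (k + (m + (a + k')), w * v)"
      "frac_rel (frac_mult (k', u') (l, v)) (k' + (m + (a + k)), w * v)" .
    moreover have "k + (m + (a + k')) = k' + (m + (a + k))" by simp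
    ultimately show ?thesis using tr sy by metis
  qed
  have right: "frac_rel (frac_mult (k, u) (l, v)) (frac_mult (k, u) (l', v'))"
    if rel: "frac_rel (l, v) (l', v')" for k u l v l' v'
  proof -
    obtain a where a: "U_f ^ (a + l') * v = U_f ^ (a + l) * v'"
      using rel by (auto simp: frac_rel_def)
    obtain b y where "U_f ^ b * u = y * U_f ^ (a + l + l')" using U_f_ore by blast
    then have "U_f ^ b * u = (y * U_f ^ (a + l')) * U_f ^ l" "U_f ^ b * u = (y * U_f ^ (a + l)) * U_f ^ l'"
      by (simp_all only: mult.assoc power_add[symmetric] ac_simps)
    from this[THEN frac_mult_ore]
    have "frac_rel (frac_mult (k, u) (l, v)) (k + b, (y * U_f ^ (a + l')) * v)"
      "frac_rel (frac_mult (k, u) (l', v')) (k + b, (y * U_f ^ (a + l)) * v')" .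
    moreover have "(y * U_f ^ (a + l')) * v = (y * U_f ^ (a + l)) * v'"
      by (simp only: mult.assoc a)
    ultimately show ?thesis using tr sy by metis
  qed
  fix x x' y y' assume "frac_rel x x'" "frac_rel y y'"
  then show "frac_rel (frac_mult x y) (frac_mult x' y')"
    using left[of "fst x" "snd x" "fst x'" "snd x'"] right[of "fst y" "snd y" "fst y'" "snd y'"] tr
    by (metis prod.collapse)
qed

lemma Frac_cases: obtains k u where "x = Frac k u"
proof -
  have "x = Frac (fst (rep_takiff_Uf x)) (snd (rep_takiff_Uf x))"
    by (simp add: Frac_def Quotient3_abs_rep[OF Quotient3_takiff_Uf])
  then show ?thesis by (rule that)
qed

lemma Frac_eq_iff: "Frac k u = Frac l v \<longleftrightarrow> (\<exists>m. U_f ^ (m + l) * u = U_f ^ (m + k) * v)"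
  by (simp add: Frac_def takiff_Uf.abs_eq_iff frac_rel_def)

lemma Frac_expand: "Frac k u = Frac (c + k) (U_f ^ c * u)"
  by (simp add: Frac_def takiff_Uf.abs_eq_iff frac_rel_expand)

lemma Frac_mult: "U_f ^ m * u = w * U_f ^ l \<Longrightarrow> Frac k u * Frac l v = Frac (k + m) (w * v)"
  by (simp add: Frac_def times_takiff_Uf.abs_eq takiff_Uf.abs_eq_iff frac_mult_ore)

lemma Frac_add': "Frac k u + Frac l v = Frac (k + l) (U_f ^ l * u + U_f ^ k * v)"
  by (simp add: Frac_def plus_takiff_Uf.abs_eq frac_add_def)

lemma Frac_add: "Frac k u + Frac k v = Frac k (u + v)"
  using Frac_expand[of k "u + v" k] by (simp add: Frac_add' distrib_left)

lemma Frac_uminus: "- Frac k u = Frac k (- u)"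
  by (simp add: Frac_def uminus_takiff_Uf.abs_eq)

lemma zero_Frac: "0 = Frac 0 0"
  by (simp add: Frac_def zero_takiff_Uf.abs_eq)

lemma one_Frac: "1 = Frac 0 1"
  by (simp add: Frac_def one_takiff_Uf.abs_eq)

lemma Frac_zero: "Frac k 0 = 0"
  by (simp add: zero_Frac Frac_eq_iff)

instance
proof
  fix x y z :: takiff_Uf
  obtain k u where x: "x = Frac k u" by (rule Frac_cases)
  obtain l v where y: "y = Frac l v" by (rule Frac_cases)
  obtain j t where z: "z = Frac j t" by (rule Frac_cases)
  show "x + y + z = x + (y + z)"
    by (simp add: x y z Frac_add' distrib_left mult.assoc[symmetric] power_add[symmetric] ac_simps)
  show "x + y = y + x"
    by (simp add: x y Frac_add' add.commute)
  show "0 + x = x"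
    using Frac_add[of k 0 u] by (simp add: x Frac_zero)
  show "- x + x = 0"
    by (simp add: x Frac_uminus Frac_add Frac_zero)
  show "x - y = x + - y" by (rule minus_takiff_Uf_def)
  show "1 * x = x"
    using Frac_mult[of k 1 1 k 0 u]
    by (simp add: x one_Frac Frac_mult[of k _ 1] flip: Frac_expand)
  show "x * 1 = x"
    using Frac_mult[of 0 u u 0 k 1] by (simp add: x one_Frac)
  show "x * y * z = x * (y * z)"
  proof -
    obtain n q where n: "U_f ^ n * v = q * U_f ^ j" using U_f_ore by blast
    obtain b p where b: "U_f ^ b * u = p * U_f ^ (l + n)" using U_f_ore by blast
    have "x * (y * z) = Frac (k + b) (p * (q * t))"
      unfolding x y z Frac_mult[OF n] by (rule Frac_mult[OF b])
    moreover have "x * y = Frac (k + b) ((p * U_f ^ n) * v)"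
      unfolding x y by (rule Frac_mult) (simp only: b mult.assoc power_add[symmetric] add.commute)
    moreover have "Frac (k + b) ((p * U_f ^ n) * v) * z = Frac (k + b + 0) ((p * q) * t)"
      unfolding z by (rule Frac_mult) (simp add: mult.assoc n)
    ultimately show ?thesis by (simp add: mult.assoc)
  qed
  show "(x + y) * z = x * z + y * z"
  proof -
    obtain m w where m: "U_f ^ m * (U_f ^ l * u) = w * U_f ^ j" using U_f_ore by blast
    obtain m' w' where m': "U_f ^ m' * (U_f ^ k * v) = w' * U_f ^ j" using U_f_ore by blast
    let ?W = "U_f ^ m' * w" and ?W' = "U_f ^ m * w'"
    have W: "U_f ^ (m + m') * (U_f ^ l * u) = ?W * U_f ^ j"
      by (simp only: add.commute[of m m'] power_add mult.assoc m)
    have W': "U_f ^ (m + m') * (U_f ^ k * v) = ?W' * U_f ^ j"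
      by (simp only: power_add mult.assoc m')
    have "(x + y) * z = Frac (k + l + (m + m')) ((?W + ?W') * t)"
      unfolding x y z Frac_add' by (rule Frac_mult) (simp only: distrib_left distrib_right W W')
    moreover have "x * z = Frac (k + (m + m' + l)) (?W * t)"
      unfolding x z by (rule Frac_mult) (use W in \<open>simp only: mult.assoc power_add\<close>)
    moreover have "y * z = Frac (l + (m + m' + k)) (?W' * t)"
      unfolding y z by (rule Frac_mult) (use W' in \<open>simp only: mult.assoc power_add\<close>)
    moreover have "k + (m + m' + l) = k + l + (m + m')" "l + (m + m' + k) = k + l + (m + m')" by simp_all
    ultimately show ?thesis by (simp only: Frac_add distrib_right)
  qed
  show "x * (y + z) = x * y + x * z"
  proof -
    obtain b p where b: "U_f ^ b * u = p * U_f ^ (l + j)" using U_f_ore by blast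
    have "x * (y + z) = Frac (k + b) (p * (U_f ^ j * v + U_f ^ l * t))"
      unfolding x y z Frac_add' by (rule Frac_mult[OF b])
    moreover have "x * y = Frac (k + b) ((p * U_f ^ j) * v)"
      unfolding x y by (rule Frac_mult) (simp only: b mult.assoc power_add[symmetric] add.commute)
    moreover have "x * z = Frac (k + b) ((p * U_f ^ l) * t)"
      unfolding x z by (rule Frac_mult) (simp only: b mult.assoc power_add[symmetric])
    ultimately show ?thesis by (simp only: Frac_add distrib_left mult.assoc)
  qed
qed

end

definition of_U :: "takiff_U \<Rightarrow> takiff_Uf" where "of_U u = Frac 0 u"

lemma of_U_add: "of_U (u + v) = of_U u + of_U v"
  and of_U_mult: "of_U (u * v) = of_U u * of_U v"
  and of_U_one: "of_U 1 = 1"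
  and of_U_zero: "of_U 0 = 0"
  and of_U_minus: "of_U (- u) = - of_U u"
  using Frac_mult[of 0 u u 0 0 v]
  by (simp_all add: of_U_def Frac_add one_Frac zero_Frac Frac_uminus)

text \<open>The defining properties of the ring of left fractions.\<close>

lemma ore_localization:
  shows "of_U (U_f ^ k) * Frac k 1 = 1" and "Frac k 1 * of_U (U_f ^ k) = 1"
    and "Frac k u = Frac k 1 * of_U u"
    and "of_U u = 0 \<longleftrightarrow> (\<exists>m. U_f ^ m * u = 0)"
proof -
  show "of_U (U_f ^ k) * Frac k 1 = 1"
    using Frac_mult[of 0 "U_f ^ k" 1 k 0 1] by (simp add: of_U_def one_Frac)
  show *: "Frac k u = Frac k 1 * of_U u" for k u
    using Frac_mult[of 0 1 1 0 k u] by (simp add: of_U_def)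
  show "Frac k 1 * of_U (U_f ^ k) = 1"
    using Frac_expand[of 0 1 k] by (simp add: one_Frac flip: *)
  show "of_U u = 0 \<longleftrightarrow> (\<exists>m. U_f ^ m * u = 0)"
    by (simp add: of_U_def zero_Frac Frac_eq_iff)
qed


section \<open>The bimodule \<open>S\<^sub>f = U\<^sub>(\<^sub>f\<^sub>) / U\<close>\<close>

definition Sf_rel :: "takiff_Uf \<Rightarrow> takiff_Uf \<Rightarrow> bool"
  where "Sf_rel x y \<longleftrightarrow> x - y \<in> range of_U"

lemma range_of_U_add: "x \<in> range of_U \<Longrightarrow> y \<in> range of_U \<Longrightarrow> x + y \<in> range of_U"
  by (auto simp flip: of_U_add)

lemma range_of_U_uminus: "x \<in> range of_U \<Longrightarrow> - x \<in> range of_U"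
  by (auto simp flip: of_U_minus)

lemma equivp_Sf_rel: "equivp Sf_rel"
proof (rule equivpI)
  show "reflp Sf_rel" by (simp add: reflp_def Sf_rel_def flip: of_U_zero)
  show "symp Sf_rel"
  proof (rule sympI)
    fix x y assume "Sf_rel x y"
    then show "Sf_rel y x" using range_of_U_uminus[of "x - y"] by (simp add: Sf_rel_def)
  qed
  show "transp Sf_rel"
  proof (rule transpI)
    fix x y z assume "Sf_rel x y" "Sf_rel y z"
    then show "Sf_rel x z" using range_of_U_add[of "x - y" "y - z"] by (simp add: Sf_rel_def)
  qed
qed

quotient_type takiff_Sf = takiff_Uf / Sf_rel
  by (rule equivp_Sf_rel)

instantiation takiff_Sf :: ab_group_add
begin

lift_definition zero_takiff_Sf :: takiff_Sf is 0 .
lift_definition uminus_takiff_Sf :: "takiff_Sf \<Rightarrow> takiff_Sf" is uminus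
proof -
  fix x y assume "Sf_rel x y"
  then show "Sf_rel (- x) (- y)" using range_of_U_uminus[of "x - y"] by (simp add: Sf_rel_def)
qed
lift_definition plus_takiff_Sf :: "takiff_Sf \<Rightarrow> takiff_Sf \<Rightarrow> takiff_Sf" is "(+)"
proof -
  fix x x' y y' assume "Sf_rel x x'" "Sf_rel y y'"
  then show "Sf_rel (x + y) (x' + y')"
    using range_of_U_add[of "x - x'" "y - y'"] by (simp add: Sf_rel_def algebra_simps)
qed
definition minus_takiff_Sf :: "takiff_Sf \<Rightarrow> takiff_Sf \<Rightarrow> takiff_Sf"
  where "x - y = x + - y" for x y :: takiff_Sf

instance
proof
  have ref: "x = y \<Longrightarrow> Sf_rel x y" for x y
    by (simp add: equivp_reflp[OF equivp_Sf_rel])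
  fix x y z :: takiff_Sf
  show "x + y + z = x + (y + z)" by transfer (rule ref, simp add: add.assoc)
  show "x + y = y + x" by transfer (rule ref, simp add: add.commute)
  show "0 + x = x" by transfer (rule ref, simp)
  show "- x + x = 0" by transfer (rule ref, simp)
  show "x - y = x + - y" by (rule minus_takiff_Sf_def)
qed

end

definition Sf_left :: "takiff_U \<Rightarrow> takiff_Sf \<Rightarrow> takiff_Sf"
  where "Sf_left u x = abs_takiff_Sf (of_U u * rep_takiff_Sf x)"

definition Sf_right :: "takiff_Sf \<Rightarrow> takiff_U \<Rightarrow> takiff_Sf"
  where "Sf_right x u = abs_takiff_Sf (rep_takiff_Sf x * of_U u)"

lemma Sf_actions_abs:
  shows "Sf_left u (abs_takiff_Sf x) = abs_takiff_Sf (of_U u * x)"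
    and "Sf_right (abs_takiff_Sf x) u = abs_takiff_Sf (x * of_U u)"
proof -
  have "Sf_rel (rep_takiff_Sf (abs_takiff_Sf x)) x"
    by (metis Quotient3_abs_rep[OF Quotient3_takiff_Sf] takiff_Sf.abs_eq_iff)
  then obtain v where v: "rep_takiff_Sf (abs_takiff_Sf x) - x = of_U v"
    by (auto simp: Sf_rel_def)
  show "Sf_left u (abs_takiff_Sf x) = abs_takiff_Sf (of_U u * x)"
    by (simp add: Sf_left_def takiff_Sf.abs_eq_iff Sf_rel_def v flip: right_diff_distrib of_U_mult)
  show "Sf_right (abs_takiff_Sf x) u = abs_takiff_Sf (x * of_U u)"
    by (simp add: Sf_right_def takiff_Sf.abs_eq_iff Sf_rel_def v flip: left_diff_distrib of_U_mult)
qed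

section \<open>Modules over Lie algebras\<close>

definition complex_ring :: "complex ring" where
  "complex_ring = \<lparr>carrier = UNIV, monoid.mult = (*), one = 1, ring.zero = 0, add = (+)\<rparr>"

text \<open>As in \<^theory>\<open>HOL-Algebra.Module\<close>, the multiplicative fields inherited from the ring
  record play no role for modules; below they are set to \<open>undefined\<close>.\<close>

record ('l, 'v) lie_module = "(complex, 'v) module" +
  lact :: "'l \<Rightarrow> 'v \<Rightarrow> 'v"

locale lie_module = Module.module complex_ring V
  for V :: "('l::complex_lie_algebra, 'v) lie_module" (structure) +
  assumes lact_closed: "v \<in> carrier V \<Longrightarrow> lact V x v \<in> carrier V"
    and lact_add_right: "v \<in> carrier V \<Longrightarrow> w \<in> carrier V \<Longrightarrow> lact V x (v \<oplus> w) = lact V x v \<oplus> lact V x w"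
    and lact_smult: "v \<in> carrier V \<Longrightarrow> lact V x (c \<odot> v) = c \<odot> lact V x v"
    and lact_add_left: "v \<in> carrier V \<Longrightarrow> lact V (x + y) v = lact V x v \<oplus> lact V y v"
    and lact_cscale: "v \<in> carrier V \<Longrightarrow> lact V (c *\<^sub>c x) v = c \<odot> lact V x v"
    and lact_bracket:
      "v \<in> carrier V \<Longrightarrow> lact V (lie_bracket x y) v = lact V x (lact V y v) \<ominus> lact V y (lact V x v)"

definition lie_submodule :: "'v set \<Rightarrow> ('l::complex_lie_algebra, 'v) lie_module \<Rightarrow> bool" where
  "lie_submodule W V \<longleftrightarrow> submodule W complex_ring V \<and> (\<forall>x. \<forall>w\<in>W. lact V x w \<in> W)"

definition simple_lie_module :: "('l::complex_lie_algebra, 'v) lie_module \<Rightarrow> bool" where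
  "simple_lie_module V \<longleftrightarrow> lie_module V \<and> carrier V \<noteq> {\<zero>\<^bsub>V\<^esub>} \<and>
     (\<forall>W. lie_submodule W V \<longrightarrow> W = {\<zero>\<^bsub>V\<^esub>} \<or> W = carrier V)"

definition lie_iso :: "('l::complex_lie_algebra, 'v) lie_module \<Rightarrow> ('l, 'w) lie_module \<Rightarrow> bool" where
  "lie_iso V W \<longleftrightarrow> (\<exists>\<phi>. bij_betw \<phi> (carrier V) (carrier W) \<and>
     (\<forall>v\<in>carrier V. \<forall>w\<in>carrier V. \<phi> (v \<oplus>\<^bsub>V\<^esub> w) = \<phi> v \<oplus>\<^bsub>W\<^esub> \<phi> w) \<and>
     (\<forall>c. \<forall>v\<in>carrier V. \<phi> (c \<odot>\<^bsub>V\<^esub> v) = c \<odot>\<^bsub>W\<^esub> \<phi> v) \<and>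
     (\<forall>x. \<forall>v\<in>carrier V. \<phi> (lact V x v) = lact W x (\<phi> v)))"

definition lin_span :: "(complex, 'v, 'm) module_scheme \<Rightarrow> 'v set \<Rightarrow> 'v set" where
  "lin_span V B = \<Inter>{W. submodule W complex_ring V \<and> B \<subseteq> W}"

definition finite_dim :: "(complex, 'v, 'm) module_scheme \<Rightarrow> bool" where
  "finite_dim V \<longleftrightarrow> (\<exists>B. finite B \<and> B \<subseteq> carrier V \<and> lin_span V B = carrier V)"

text \<open>\<open>V\<close> is the internal direct sum of the family \<open>I\<close> of subspaces: every vector is
  a finite sum of components in a unique way.\<close>

definition internal_direct_sum :: "(complex, 'v, 'm) module_scheme \<Rightarrow> 'v set set \<Rightarrow> bool" where
  "internal_direct_sum V I \<longleftrightarrow>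
     (\<forall>W\<in>I. submodule W complex_ring V) \<and>
     (\<forall>v\<in>carrier V. \<exists>!c. (\<forall>W\<in>I. c W \<in> W) \<and> (\<forall>W. W \<notin> I \<longrightarrow> c W = \<zero>\<^bsub>V\<^esub>) \<and>
        finite {W. c W \<noteq> \<zero>\<^bsub>V\<^esub>} \<and> v = finsum V c {W. c W \<noteq> \<zero>\<^bsub>V\<^esub>})"


section \<open>Harish-Chandra modules\<close>

definition restrict_g :: "(takiff, 'v) lie_module \<Rightarrow> (sl2, 'v) lie_module" where
  "restrict_g V = \<lparr>carrier = carrier V, monoid.mult = undefined, one = undefined,
     ring.zero = ring.zero V, add = add V, smult = smult V, lact = (\<lambda>x. lact V (in_g x))\<rparr>"

text \<open>The simple \<open>sl\<^sub>2\<close>-module of dimension \<open>n + 1\<close>: functions supported on \<open>{0..n}\<close>, where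
  the delta functions \<open>v\<^sub>k\<close> satisfy \<open>f v\<^sub>k = v\<^sub>k\<^sub>+\<^sub>1\<close> (\<open>0\<close> for \<open>k = n\<close>), \<open>h v\<^sub>k = (n - 2k) v\<^sub>k\<close> and
  \<open>e v\<^sub>k = k (n - k + 1) v\<^sub>k\<^sub>-\<^sub>1\<close>. A matrix is
  \<open>A\<^sub>1\<^sub>1 h + A\<^sub>1\<^sub>2 e + A\<^sub>2\<^sub>1 f\<close>.\<close>

definition L_g :: "nat \<Rightarrow> (sl2, nat \<Rightarrow> complex) lie_module" where
  "L_g n = \<lparr>carrier = {v. \<forall>k>n. v k = 0}, monoid.mult = undefined, one = undefined,
     ring.zero = (\<lambda>_. 0), add = (\<lambda>v w k. v k + w k), smult = (\<lambda>c v k. c * v k),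
     lact = (\<lambda>A v k. if k \<le> n then
         sl2_mat A $ 1 $ 1 * (of_nat n - 2 * of_nat k) * v k +
         sl2_mat A $ 1 $ 2 * of_nat (k + 1) * (of_nat n - of_nat k) * v (k + 1) +
         sl2_mat A $ 2 $ 1 * (if k = 0 then 0 else v (k - 1))
       else 0)\<rparr>"

lemma cring_complex_ring: "cring complex_ring"
proof -
  have "\<exists>y. x + y = 0" for x :: complex by (rule exI[of _ "- x"]) simp
  then show ?thesis
    by unfold_locales (auto simp: complex_ring_def Units_def algebra_simps)
qed

lemma module_L_g: "Module.module complex_ring (L_g n)"
proof (rule Module.moduleI[OF cring_complex_ring])
  show "abelian_group (L_g n)"
  proof (rule abelian_groupI)
    fix v assume v: "v \<in> carrier (L_g n)"
    show "\<exists>w\<in>carrier (L_g n). w \<oplus>\<^bsub>L_g n\<^esub> v = \<zero>\<^bsub>L_g n\<^esub>"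
      using v by (intro bexI[of _ "\<lambda>k. - v k"]) (simp_all add: L_g_def)
  qed (simp_all add: L_g_def fun_eq_iff)
qed (simp_all add: L_g_def complex_ring_def fun_eq_iff algebra_simps)

lemma lie_module_L_g: "lie_module (L_g n)"
proof (rule lie_module.intro[OF module_L_g], unfold_locales)
  interpret Module.module complex_ring "L_g n" by (rule module_L_g)
  have minus: "v \<ominus>\<^bsub>L_g n\<^esub> w = (\<lambda>k. v k - w k)"
    if v: "v \<in> carrier (L_g n)" and w: "w \<in> carrier (L_g n)" for v w
  proof -
    have "(\<lambda>k. - w k) \<in> carrier (L_g n)" using w by (simp add: L_g_def)
    moreover have "(\<lambda>k. - w k) \<oplus>\<^bsub>L_g n\<^esub> w = \<zero>\<^bsub>L_g n\<^esub>" by (simp add: L_g_def)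
    ultimately have "\<ominus>\<^bsub>L_g n\<^esub> w = (\<lambda>k. - w k)"
      using w minus_equality by blast
    then show ?thesis by (simp add: a_minus_def) (simp add: L_g_def)
  qed
  have closed: "lact (L_g n) x v \<in> carrier (L_g n)" for x v by (simp add: L_g_def)
  fix v x y assume v: "v \<in> carrier (L_g n)"
  have top: "v k = 0" if "\<not> k \<le> n" for k using v that by (simp add: L_g_def)
  show "lact (L_g n) (lie_bracket x y) v =
      lact (L_g n) x (lact (L_g n) y v) \<ominus>\<^bsub>L_g n\<^esub> lact (L_g n) y (lact (L_g n) x v)"
  proof (subst minus[OF closed closed], rule ext)
    fix k
    consider "\<not> k \<le> n" | "k = n" | "k < n" by linarith
    then show "lact (L_g n) (lie_bracket x y) v k =
        lact (L_g n) x (lact (L_g n) y v) k - lact (L_g n) y (lact (L_g n) x v) k"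
    proof cases
      case 2
      then show ?thesis by (cases k) (simp_all add: L_g_def algebra_simps)
    next
      case 3
      then show ?thesis by (cases k) (simp_all add: L_g_def algebra_simps)
    qed (simp add: L_g_def)
  qed
qed (simp_all add: L_g_def fun_eq_iff algebra_simps)

lemma simple_L_g: "simple_lie_module (L_g n)"
proof -
  interpret M: Module.module complex_ring "L_g n" by (rule module_L_g)
  define d where "d = (\<lambda>k i :: nat. if i = k then 1 else 0 :: complex)"
  have "W = {\<zero>\<^bsub>L_g n\<^esub>} \<or> W = carrier (L_g n)" if sub: "lie_submodule W (L_g n)" for W
  proof (rule disjCI)
    assume ne: "W \<noteq> carrier (L_g n)"
    have subW: "submodule W complex_ring (L_g n)" using sub by (simp add: lie_submodule_def)
    have carr: "W \<subseteq> carrier (L_g n)" and "W \<noteq> {}"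
      using M.submoduleE(1,2)[OF subW] .
    have smul: "(\<lambda>k. c * w k) \<in> W" if "w \<in> W" for c w
      using M.submoduleE(4)[OF subW, of c w] that by (simp add: L_g_def complex_ring_def)
    have plus: "(\<lambda>k. v k + w k) \<in> W" if "v \<in> W" "w \<in> W" for v w
      using M.submoduleE(5)[OF subW, of v w] that by (simp add: L_g_def)
    have act: "lact (L_g n) x w \<in> W" if "w \<in> W" for x w
      using sub that by (simp add: lie_submodule_def)
    have zero: "(\<lambda>_. 0) \<in> W" using \<open>W \<noteq> {}\<close> smul[of _ 0] by auto
    have d0: "w = (\<lambda>_. 0)" if "w \<in> W" "\<forall>k>j. w k = 0" "d 0 \<notin> W" for j w
      using that
    proof (induction j arbitrary: w)
      case 0
      show ?case
      proof (cases "w 0 = 0")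
        case True
        show ?thesis
        proof
          fix k show "w k = 0" using True 0(2) by (cases k) auto
        qed
      next
        case False
        have "(\<lambda>k. inverse (w 0) * w k) = d 0"
          using False 0(2) by (auto simp: d_def fun_eq_iff)
        then show ?thesis using smul[OF 0(1), of "inverse (w 0)"] 0(3) by simp
      qed
    next
      case (Suc j)
      have top: "w k = 0" if "k > n" for k using Suc.prems(1) carr that by (auto simp: L_g_def)
      have "lact (L_g n) sl2_e w = (\<lambda>_. 0)"
        using Suc.prems by (intro Suc.IH act) (auto simp: L_g_def)
      from fun_cong[OF this, of j] have "w (Suc j) = 0"
      proof (cases "j < n")
        case True
        then have nz: "of_nat n - of_nat j \<noteq> (0 :: complex)" by simp
        have "of_nat (Suc j) * (of_nat n - of_nat j) * w (Suc j) = 0"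
          using \<open>lact (L_g n) sl2_e w j = 0\<close> True by (simp add: L_g_def)
        then show ?thesis using nz by (simp del: of_nat_Suc)
      qed (use top in simp)
      with Suc.prems show ?case
        by (intro Suc.IH) (auto, metis Suc_lessI)
    qed
    have "d 0 \<notin> W"
    proof
      assume d: "d 0 \<in> W"
      have dk: "k \<le> n \<Longrightarrow> d k \<in> W" for k
      proof (induction k)
        case (Suc k)
        have "lact (L_g n) sl2_f (d k) = d (Suc k)"
          using Suc.prems by (auto simp: L_g_def d_def fun_eq_iff)
        then show ?case using act[of "d k" sl2_f] Suc by simp
      qed (use d in simp)
      have "v \<in> W" if v: "v \<in> carrier (L_g n)" for v
      proof -
        have "(\<lambda>k. if k < m then v k else 0) \<in> W" if "m \<le> Suc n" for m
          using that
        proof (induction m)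
          case (Suc m)
          have "(\<lambda>k. (if k < m then v k else 0) + v m * d m k) \<in> W"
            using Suc by (intro plus smul dk) auto
          also have "(\<lambda>k. (if k < m then v k else 0) + v m * d m k) = (\<lambda>k. if k < Suc m then v k else 0)"
            by (auto simp: fun_eq_iff d_def less_Suc_eq)
          finally show ?case .
        qed (simp add: zero)
        from this[of "Suc n"] have "(\<lambda>k. if k < Suc n then v k else 0) \<in> W" by simp
        also have "(\<lambda>k. if k < Suc n then v k else 0) = v"
          using v by (auto simp: fun_eq_iff L_g_def)
        finally show ?thesis .
      qed
      then show False using ne carr by blast
    qed
    then have "w = (\<lambda>_. 0)" if "w \<in> W" for w
      using d0[OF that, of n] carr that by (auto simp: L_g_def)
    then have "W = {\<lambda>_. 0}" using zero by blast
    then show "W = {\<zero>\<^bsub>L_g n\<^esub>}" by (simp add: L_g_def)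
  qed
  moreover have "carrier (L_g n) \<noteq> {\<zero>\<^bsub>L_g n\<^esub>}"
  proof
    assume "carrier (L_g n) = {\<zero>\<^bsub>L_g n\<^esub>}"
    moreover have "d 0 \<in> carrier (L_g n)" by (simp add: L_g_def d_def)
    ultimately have "d 0 = (\<lambda>_. 0)" by (simp add: L_g_def)
    from fun_cong[OF this, of 0] show False by (simp add: d_def)
  qed
  ultimately show ?thesis using lie_module_L_g by (simp add: simple_lie_module_def)
qed

definition L_mod :: "nat \<Rightarrow> (takiff, nat \<Rightarrow> complex) lie_module" where
  "L_mod n = \<lparr>carrier = carrier (L_g n), monoid.mult = undefined, one = undefined,
     ring.zero = ring.zero (L_g n), add = add (L_g n), smult = smult (L_g n),
     lact = (\<lambda>x. lact (L_g n) (part_1 x))\<rparr>"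

definition g_submodule :: "(takiff, 'v) lie_module \<Rightarrow> 'v set \<Rightarrow> (sl2, 'v) lie_module" where
  "g_submodule V W = (restrict_g V)\<lparr>carrier := W\<rparr>"

definition harish_chandra :: "(takiff, 'v) lie_module \<Rightarrow> bool" where
  "harish_chandra V \<longleftrightarrow> lie_module V \<and>
     (\<exists>I. internal_direct_sum (restrict_g V) I \<and>
        (\<forall>W\<in>I. lie_submodule W (restrict_g V) \<and> simple_lie_module (g_submodule V W) \<and>
               finite_dim (g_submodule V W)) \<and>
        (\<forall>W\<in>I. finite {W'\<in>I. lie_iso (g_submodule V W') (g_submodule V W)}))"

definition simple_harish_chandra :: "(takiff, 'v) lie_module \<Rightarrow> bool" where
  "simple_harish_chandra V \<longleftrightarrow> simple_lie_module V \<and> harish_chandra V"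

definition has_g_type :: "(takiff, 'v) lie_module \<Rightarrow> nat \<Rightarrow> bool" where
  "has_g_type V n \<longleftrightarrow> (\<exists>W. lie_submodule W (restrict_g V) \<and> lie_iso (g_submodule V W) (L_g n))"

definition minimal_g_type :: "(takiff, 'v) lie_module \<Rightarrow> nat \<Rightarrow> bool" where
  "minimal_g_type V n \<longleftrightarrow> has_g_type V n \<and> (\<forall>m. has_g_type V m \<longrightarrow> n \<le> m)"

text \<open>The element \<open>h\<^sub>b h\<^sub>b + 4 f\<^sub>b e\<^sub>b\<close> of the enveloping algebra acts as the scalar \<open>z\<close>, where the
  subscript \<open>b\<close> stands for the bar.\<close>

definition C_bar_acts_as :: "(takiff, 'v) lie_module \<Rightarrow> complex \<Rightarrow> bool" where
  "C_bar_acts_as V z \<longleftrightarrow> (\<forall>v\<in>carrier V.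
     lact V (bar sl2_h) (lact V (bar sl2_h) v) \<oplus>\<^bsub>V\<^esub>
     4 \<odot>\<^bsub>V\<^esub> lact V (bar sl2_f) (lact V (bar sl2_e) v) = z \<odot>\<^bsub>V\<^esub> v)"


section \<open>Tensor products, Verma modules and the completion functor\<close>

text \<open>Left modules over an algebra given by a type \<open>'r\<close> are encoded as records of type
  \<open>('r, 'b) module\<close>. For an abelian group \<open>'a\<close> with a left action \<open>la\<close> of \<open>'l\<close> and a
  right action \<open>ra\<close> of \<open>'r\<close>, the tensor product \<open>'a \<otimes>\<^sub>r B\<close> is the quotient of the free
  abelian group on pairs by the usual relations, with \<open>'l\<close> acting on the first factor.\<close>

definition tensor_relators ::
  "('a::ab_group_add \<Rightarrow> 'r \<Rightarrow> 'a) \<Rightarrow> ('r, 'b) module \<Rightarrow> ('a \<times> 'b \<Rightarrow>\<^sub>0 int) set" where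
  "tensor_relators ra B =
     {frag_of (a + a', b) - frag_of (a, b) - frag_of (a', b) | a a' b. b \<in> carrier B} \<union>
     {frag_of (a, b \<oplus>\<^bsub>B\<^esub> b') - frag_of (a, b) - frag_of (a, b') | a b b'.
        b \<in> carrier B \<and> b' \<in> carrier B} \<union>
     {frag_of (ra a r, b) - frag_of (a, r \<odot>\<^bsub>B\<^esub> b) | a r b. b \<in> carrier B}"

definition tensor_module ::
  "('l \<Rightarrow> 'a \<Rightarrow> 'a) \<Rightarrow> ('a::ab_group_add \<Rightarrow> 'r \<Rightarrow> 'a) \<Rightarrow> ('r, 'b) module \<Rightarrow>
     ('l, ('a \<times> 'b \<Rightarrow>\<^sub>0 int) set) module" where
  "tensor_module la ra B =
     (let G = free_Abelian_group (UNIV \<times> carrier B); H = generate G (tensor_relators ra B) in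
       \<lparr>carrier = carrier (G Mod H), monoid.mult = undefined, one = undefined,
        ring.zero = \<one>\<^bsub>G Mod H\<^esub>, add = monoid.mult (G Mod H),
        smult = (\<lambda>l X. \<Union>x\<in>X. H #>\<^bsub>G\<^esub> frag_extend (\<lambda>(a, b). frag_of (la l a, b)) x)\<rparr>)"

text \<open>The character of \<open>takiff_borel\<close> with the values \<open>\<lambda>\<^sub>1\<close> at \<open>h\<close>, \<open>\<lambda>\<^sub>2\<close> at \<open>h \<otimes> x\<close> and
  \<open>0\<close> at \<open>e\<close> and \<open>e \<otimes> x\<close> (the upper left entry of \<open>h\<close> is \<open>1\<close>, that of \<open>e\<close> is \<open>0\<close>).\<close>

definition borel_char :: "complex \<Rightarrow> complex \<Rightarrow> borel_type \<Rightarrow> complex" where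
  "borel_char l1 l2 x = l1 * sl2_mat (part_1 (borel_incl x)) $ 1 $ 1 +
     l2 * sl2_mat (part_x (borel_incl x)) $ 1 $ 1"

lemma lie_hom_borel_char: "lie_hom_to_algebra (borel_char l1 l2)"
proof -
  have [simp]: "sl2_mat (part_1 (borel_incl x)) $ 2 $ 1 = 0" "sl2_mat (part_x (borel_incl x)) $ 2 $ 1 = 0"
    for x using borel_incl[of x] by (simp_all add: takiff_borel_iff)
  show ?thesis
    by (simp add: lie_hom_to_algebra_def borel_char_def borel_incl_ops plus_takiff_def cscale_takiff_def
        lie_bracket_takiff_def cscale_complex_def algebra_simps)
qed

lemma borel_char_basis:
  "borel_incl x = in_g sl2_h \<Longrightarrow> borel_char l1 l2 x = l1"
  "borel_incl x = bar sl2_h \<Longrightarrow> borel_char l1 l2 x = l2"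
  "borel_incl x = in_g sl2_e \<Longrightarrow> borel_char l1 l2 x = 0"
  "borel_incl x = bar sl2_e \<Longrightarrow> borel_char l1 l2 x = 0"
  by (simp_all add: borel_char_def in_g_def bar_def)

lemma lie_hom_borel_incl: "lie_hom_to_algebra (\<lambda>x. uea_gen (borel_incl x))"
  using lie_hom_uea_gen[where 'a = takiff] by (simp add: lie_hom_to_algebra_def borel_incl_ops)

definition C_lambda :: "complex \<Rightarrow> complex \<Rightarrow> (borel_type uea, complex) module" where
  "C_lambda l1 l2 = \<lparr>carrier = UNIV, monoid.mult = undefined, one = undefined, ring.zero = 0,
     add = (+), smult = (\<lambda>b c. uea_lift (borel_char l1 l2) b * c)\<rparr>"

definition verma :: "complex \<Rightarrow> complex \<Rightarrow> (takiff_U, (takiff_U \<times> complex \<Rightarrow>\<^sub>0 int) set) module" where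
  "verma l1 l2 =
     tensor_module (*) (\<lambda>u b. u * uea_lift (\<lambda>x. uea_gen (borel_incl x)) b) (C_lambda l1 l2)"

definition as_lie_module :: "('l::complex_lie_algebra uea, 'v) module \<Rightarrow> ('l, 'v) lie_module" where
  "as_lie_module M = \<lparr>carrier = carrier M, monoid.mult = undefined, one = undefined,
     ring.zero = ring.zero M, add = add M, smult = (\<lambda>c v. (c *\<^sub>c 1) \<odot>\<^bsub>M\<^esub> v),
     lact = (\<lambda>x v. uea_gen x \<odot>\<^bsub>M\<^esub> v)\<rparr>"

definition EA :: "(takiff_U, 'v) module \<Rightarrow> (takiff, (takiff_Sf \<times> 'v \<Rightarrow>\<^sub>0 int) set) lie_module" where
  "EA M = (let X = as_lie_module (tensor_module Sf_left Sf_right M);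
               orbit = (\<lambda>m. lin_span X (range (\<lambda>k. (lact X (in_g sl2_e) ^^ k) m)))
     in X\<lparr>carrier := {m \<in> carrier X. finite_dim (X\<lparr>carrier := orbit m\<rparr>)}\<rparr>)"

definition V_mod :: "int \<Rightarrow> complex \<Rightarrow>
    (takiff, (takiff_Sf \<times> (takiff_U \<times> complex \<Rightarrow>\<^sub>0 int) set \<Rightarrow>\<^sub>0 int) set) lie_module" where
  "V_mod n l2 = EA (verma (of_int n - 2) l2)"

end

(*
Each module is realised inside a complex vector space type, where the bar elements give, besides the
central elements Cbar = hb hb + 4 fb eb and Cmix = h hb + 2 fb e + 2 f eb + 2 hb, the operator Dn m
that sends highest weight vectors of weight m to highest weight vectors of weight m - 2. A highest
weight vector v of minimal weight n on which Cbar and Cmix act as scalars z and c is killed by Dn, so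
the span of the vectors f^i eb^k v is a submodule, and c^2 = n^2 z. For z nonzero this module is
simple because eb and Dn are inverse to each other up to nonzero scalars; two simple modules with
the same (n, z, c) are isomorphic, since the submodule of their product generated by the pair of
generators is the graph of an isomorphism. Finally the completed Verma module is computed: S_f tensor
the Verma module is a module of Laurent polynomials in t with coefficients in C[s] on which the
elements act by differential operators, Cbar acts as l2^2 and Cmix as n l2, and local finiteness
of e cuts out the submodule generated by t^max(0,-n) (l2 - s)^max(0,n).
*)
theory Submission
  imports Defs "HOL-Library.Function_Algebras" "HOL-Computational_Algebra.Fundamental_Theorem_Algebra"
begin


section \<open>Linear algebra over the complex numbers\<close>

text \<open>The invariants that tell the modules apart are the weight n and the scalars z of
  \<open>Cbar\<close> and c of \<open>Cmix\<close>. The scalar c records which square root of z was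
  chosen as long as n is not 0 and forgets it for n = 0; for V(n, l2) the invariants are |n|, l2^2
  and n l2, which leaves only the coincidence with V(-n, -l2). The case z = 0 falls under the same
  uniqueness argument: then c = 0, and L(n) with zero action of the ideal has the same invariants
  (n, 0, 0). What that argument assumes is simplicity of both modules, for any z. The obstacle on
  the other side is that \<open>EA\<close> of a Verma module consists of cosets in a free abelian
  group, about which nothing is known at first. Commuting generators yields a spanning set of the
  tensor product, but could never show that it is nonzero. Independence comes from explicit
  differential operators whose bracket relations are checked on coefficients: the tensor product
  maps to them, and the spanning set goes to distinct monomials with nonzero coefficients.\<close>

instantiation "fun" :: (type, complex_vector) complex_vector
begin
definition cscale_fun :: "complex \<Rightarrow> ('a \<Rightarrow> 'b) \<Rightarrow> 'a \<Rightarrow> 'b" where "c *\<^sub>c f = (\<lambda>x. c *\<^sub>c f x)"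
instance
  by standard (simp_all add: cscale_fun_def fun_eq_iff cscale_add_right cscale_add_left)
end

lemma cscale_fun_apply [simp]: "(c *\<^sub>c f) x = c *\<^sub>c f x"
  by (simp add: cscale_fun_def)

instantiation prod :: (complex_vector, complex_vector) complex_vector
begin
definition cscale_prod :: "complex \<Rightarrow> 'a \<times> 'b \<Rightarrow> 'a \<times> 'b" where "c *\<^sub>c x = (c *\<^sub>c fst x, c *\<^sub>c snd x)"
instance
  by standard (simp_all add: cscale_prod_def prod_eq_iff cscale_add_right cscale_add_left)
end

lemma fst_cscale [simp]: "fst (c *\<^sub>c x) = c *\<^sub>c fst x"
  and snd_cscale [simp]: "snd (c *\<^sub>c x) = c *\<^sub>c snd x"
  by (simp_all add: cscale_prod_def)

instantiation poly :: (complex_algebra_1) complex_vector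
begin
definition cscale_poly :: "complex \<Rightarrow> 'a poly \<Rightarrow> 'a poly" where "c *\<^sub>c p = map_poly ((*\<^sub>c) c) p"
instance
  by standard (simp_all add: cscale_poly_def poly_eq_iff coeff_map_poly cscale_add_right cscale_add_left)
end

lemma cscale_complex [simp]: "c *\<^sub>c (x :: complex) = c * x"
  by (simp add: cscale_complex_def)

lemma cscale_poly_eq_smult [simp]: "c *\<^sub>c (p :: complex poly) = Polynomial.smult c p"
  by (simp add: cscale_poly_def poly_eq_iff coeff_map_poly)

locale clinear =
  fixes A :: "'a::complex_vector \<Rightarrow> 'b::complex_vector"
  assumes add: "A (x + y) = A x + A y" and cscale: "A (c *\<^sub>c x) = c *\<^sub>c A x"
begin

lemma zero: "A 0 = 0"
  using add[of 0 0] by simp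

lemma minus: "A (- x) = - A x"
  using add[of x "- x"] by (simp add: zero eq_neg_iff_add_eq_0 add.commute)

lemma diff: "A (x - y) = A x - A y"
  using add[of x "- y"] by (simp add: minus)

lemma sum: "A (sum g S) = (\<Sum>i\<in>S. A (g i))"
  by (induction S rule: infinite_finite_induct) (simp_all add: zero add)

lemma image_subspace: "cvec.subspace V \<Longrightarrow> cvec.subspace (A ` V)"
  unfolding cvec.subspace_def
  by (auto simp: image_iff) (metis zero, metis add, metis cscale)

lemma vimage_subspace: "cvec.subspace V \<Longrightarrow> cvec.subspace {x. A x \<in> V}"
  by (simp add: cvec.subspace_def zero add cscale)

lemma kernel_subspace: "cvec.subspace {x. A x = 0}"
  using vimage_subspace[of "{0}"] by simp

lemma span_image_subset: "x \<in> cvec.span S \<Longrightarrow> A ` S \<subseteq> V \<Longrightarrow> cvec.subspace V \<Longrightarrow> A x \<in> V"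
  using cvec.span_minimal[OF _ vimage_subspace, of S V] by blast

end

lemma eigenspace_subspace: "clinear A \<Longrightarrow> cvec.subspace {x. A x = a *\<^sub>c x}"
  by (simp add: cvec.subspace_def clinear.zero clinear.add clinear.cscale cscale_add_right cscale_cscale mult.commute)

section \<open>Finite-dimensional subsets, annihilating polynomials and eigenvectors\<close>

definition fd :: "'a::complex_vector set \<Rightarrow> bool" where
  "fd Y \<longleftrightarrow> (\<exists>B. finite B \<and> Y \<subseteq> cvec.span B)"

lemma fd_subset: "fd Y \<Longrightarrow> Z \<subseteq> Y \<Longrightarrow> fd Z"
  unfolding fd_def by blast

lemma fd_span: "finite B \<Longrightarrow> fd (cvec.span B)"
  unfolding fd_def by blast

lemma fd_span_Un: assumes "fd Y" "fd Z" shows "fd (cvec.span (Y \<union> Z))"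
proof -
  obtain B C where "finite B" "Y \<subseteq> cvec.span B" "finite C" "Z \<subseteq> cvec.span C"
    using assms unfolding fd_def by blast
  then have "finite (B \<union> C)" "cvec.span (Y \<union> Z) \<subseteq> cvec.span (B \<union> C)"
    by (simp, intro cvec.span_minimal)
      (auto intro: subsetD[OF cvec.span_mono[of B "B \<union> C"]] subsetD[OF cvec.span_mono[of C "B \<union> C"]])
  then show ?thesis unfolding fd_def by blast
qed

text \<open>The finite set must be taken from \<open>G\<close> itself: \<open>finite_dim\<close>
  asks for a spanning set inside the carrier, and the completion needs a bound on finitely many
  members of an orbit.\<close>

lemma fd_imp_span_finite_subset:
  assumes "fd (cvec.span G)"
  obtains B where "finite B" "B \<subseteq> G" "cvec.span B = cvec.span G"
proof -
  obtain C where C: "finite C" "cvec.span G \<subseteq> cvec.span C" using assms unfolding fd_def by blast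
  obtain B where B: "B \<subseteq> G" "cvec.independent B" "G \<subseteq> cvec.span B"
    using cvec.maximal_independent_subset by blast
  have "finite B"
    using cvec.independent_span_bound[OF C(1) B(2)] B(1) C(2) cvec.span_superset by blast
  moreover have "cvec.span B = cvec.span G"
    using B(1,3) by (simp add: cvec.span_eq cvec.span_superset subset_trans[of B G])
  ultimately show ?thesis using that B(1) by blast
qed

text \<open>The vector p(A) y by Horner's scheme, with A kept as a bare function instead of an
  element of an operator algebra.\<close>

definition poly_act :: "('a::complex_vector \<Rightarrow> 'a) \<Rightarrow> complex poly \<Rightarrow> 'a \<Rightarrow> 'a" where
  "poly_act A p y = fold_coeffs (\<lambda>c z. c *\<^sub>c y + A z) p 0"

lemma poly_act_0 [simp]: "poly_act A 0 y = 0"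
  by (simp add: poly_act_def)

lemma poly_act_pCons: "clinear A \<Longrightarrow> poly_act A (pCons c p) y = c *\<^sub>c y + A (poly_act A p y)"
  by (cases "p = 0 \<and> c = 0") (auto simp: poly_act_def clinear.zero)

lemma poly_act_add: "clinear A \<Longrightarrow> poly_act A (p + q) y = poly_act A p y + poly_act A q y"
  by (induction p q rule: poly_induct2) (simp_all add: poly_act_pCons clinear.add cscale_add_left)

lemma poly_act_smult: "clinear A \<Longrightarrow> poly_act A (Polynomial.smult c p) y = c *\<^sub>c poly_act A p y"
  by (induction p) (simp_all add: poly_act_pCons clinear.cscale cscale_cscale cscale_add_right)

lemma poly_act_linear_factor:
  assumes "clinear A"
  shows "poly_act A ([:- a, 1:] * q) y = A (poly_act A q y) - a *\<^sub>c poly_act A q y"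
proof -
  have "[:- a, 1:] * q = Polynomial.smult (- a) q + pCons 0 q" by simp
  then show ?thesis
    by (simp only: poly_act_add[OF assms] poly_act_smult[OF assms] poly_act_pCons[OF assms]) simp
qed

lemma poly_act_closed:
  assumes "clinear A" "cvec.subspace Y" "\<And>y. y \<in> Y \<Longrightarrow> A y \<in> Y" "y \<in> Y"
  shows "poly_act A p y \<in> Y"
  by (induction p) (use assms in \<open>auto simp: poly_act_pCons cvec.subspace_0 intro: cvec.subspace_add cvec.subspace_scale\<close>)

lemma poly_act_monom: "clinear A \<Longrightarrow> poly_act A (monom c k) y = c *\<^sub>c (A ^^ k) y"
  by (induction k) (simp_all add: monom_Suc monom_0 poly_act_pCons clinear.zero clinear.cscale)

text \<open>Split a root a off p, say p = (X - a) q. If q(A) y is not 0 it is an eigenvector for a;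
  otherwise q annihilates y and has smaller degree.\<close>

lemma exists_eigenvector_of_annihilator:
  assumes "clinear A" "cvec.subspace Y" "\<And>y. y \<in> Y \<Longrightarrow> A y \<in> Y"
  shows "p \<noteq> 0 \<Longrightarrow> y \<in> Y \<Longrightarrow> y \<noteq> 0 \<Longrightarrow> poly_act A p y = 0 \<Longrightarrow> \<exists>z\<in>Y. z \<noteq> 0 \<and> (\<exists>a. A z = a *\<^sub>c z)"
proof (induction "degree p" arbitrary: p rule: less_induct)
  case less
  show ?case
  proof (cases "degree p = 0")
    case True
    then obtain c where "p = [:c:]" by (metis degree_eq_zeroE)
    then show ?thesis using less.prems assms(1) by (simp add: poly_act_pCons clinear.zero)
  next
    case False
    then obtain a where "poly p a = 0"
      using fundamental_theorem_of_algebra[of p] constant_degree[of p] by metis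
    then obtain q where q: "p = [:- a, 1:] * q" by (metis dvd_def poly_eq_0_iff_dvd)
    have "q \<noteq> 0" using q less.prems(1) by auto
    then have "degree p = Suc (degree q)" unfolding q by (subst degree_mult_eq) auto
    show ?thesis
    proof (cases "poly_act A q y = 0")
      case True
      then show ?thesis using less.hyps[of q] \<open>q \<noteq> 0\<close> \<open>degree p = _\<close> less.prems by simp
    next
      case False
      moreover have "A (poly_act A q y) = a *\<^sub>c poly_act A q y"
        using less.prems(4) poly_act_linear_factor[OF assms(1)] by (simp add: q)
      moreover have "poly_act A q y \<in> Y" using assms less.prems by (intro poly_act_closed)
      ultimately show ?thesis by blast
    qed
  qed
qed

lemma poly_act_sum: "clinear A \<Longrightarrow> poly_act A (sum p S) y = (\<Sum>i\<in>S. poly_act A (p i) y)"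
  by (induction S rule: infinite_finite_induct) (simp_all add: poly_act_add)

lemma exists_eigenvector:
  assumes A: "clinear A" "cvec.subspace Y" "\<And>y. y \<in> Y \<Longrightarrow> A y \<in> Y" and "fd Y" "Y \<noteq> {0}"
  obtains z a where "z \<in> Y" "z \<noteq> 0" "A z = a *\<^sub>c z"
proof -
  obtain B where B: "finite B" "Y \<subseteq> cvec.span B" using \<open>fd Y\<close> unfolding fd_def by blast
  obtain y where y: "y \<in> Y" "y \<noteq> 0" using \<open>Y \<noteq> {0}\<close> cvec.subspace_0[OF A(2)] by blast
  have pow: "(A ^^ k) y \<in> Y" for k by (induction k) (use y A in auto)
  have "\<exists>p. p \<noteq> 0 \<and> poly_act A p y = 0"
  \<comment> \<open>Linear dependence is a property of sets, which does not see a repeated power A^i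
    y = A^j y; a repetition yields the annihilator X^i - X^j directly.\<close>
  proof (cases "inj (\<lambda>k. (A ^^ k) y)")
    case False
    then obtain i j where ij: "i \<noteq> j" "(A ^^ i) y = (A ^^ j) y" by (auto simp: inj_def)
    have "poly_act A (monom 1 i + monom (-1) j) y = 0"
      using ij(2) by (simp add: poly_act_add[OF A(1)] poly_act_monom[OF A(1)] cscale_one cvec.scale_minus_left)
    moreover have "coeff (monom 1 i + monom (-1) j) i \<noteq> (0::complex)" using ij(1) by simp
    ultimately show ?thesis by (metis coeff_0)
  next
    case True
    have "infinite (range (\<lambda>k. (A ^^ k) y))" using True by (simp add: finite_image_iff)
    moreover have "range (\<lambda>k. (A ^^ k) y) \<subseteq> cvec.span B" using pow B by blast
    ultimately have "cvec.dependent (range (\<lambda>k. (A ^^ k) y))"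
      using cvec.independent_span_bound[OF B(1)] by blast
    then obtain S u where S: "finite S" "S \<subseteq> range (\<lambda>k. (A ^^ k) y)" "(\<Sum>v\<in>S. u v *\<^sub>c v) = 0"
      and "\<exists>v\<in>S. u v \<noteq> 0" unfolding cvec.dependent_explicit by blast
    then obtain v0 where v0: "v0 \<in> S" "u v0 \<noteq> 0" by blast
    define K where "K = {k. (A ^^ k) y \<in> S}"
    have K: "finite K" "(\<lambda>k. (A ^^ k) y) ` K = S"
      using S(1,2) True finite_vimageI[OF S(1) True] by (auto simp: K_def vimage_def)
    define p where "p = (\<Sum>k\<in>K. monom (u ((A ^^ k) y)) k)"
    have "poly_act A p y = (\<Sum>k\<in>K. u ((A ^^ k) y) *\<^sub>c (A ^^ k) y)"
      by (simp add: p_def poly_act_sum[OF A(1)] poly_act_monom[OF A(1)])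
    also have "\<dots> = (\<Sum>v\<in>S. u v *\<^sub>c v)"
      unfolding K(2)[symmetric] by (rule sum.reindex_cong[symmetric, OF inj_on_subset[OF True]]) auto
    finally have "poly_act A p y = 0" using S(3) by simp
    moreover obtain k0 where k0: "k0 \<in> K" "(A ^^ k0) y = v0" using v0 K(2) by auto
    have "coeff p k0 = (\<Sum>k\<in>K. if k = k0 then u ((A ^^ k) y) else 0)"
      by (simp add: p_def coeff_sum)
    then have "coeff p k0 = u v0" using K(1) k0 by simp
    then have "p \<noteq> 0" using v0 by auto
    ultimately show ?thesis by blast
  qed
  then show ?thesis using exists_eigenvector_of_annihilator[OF A] y that by blast
qed

text \<open>Used with the Casimir operator and with \<open>h\<close> to cut a spanning set down to
  the members with the right eigenvalues. The reason is an elimination: when g has an eigenvalue b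
  other than a, the operator A - b removes g from an expansion of x and multiplies x by a -
  b.\<close>

lemma span_eigenvectors_eigenspace:
  assumes A: "clinear A" and G: "\<And>g. g \<in> G \<Longrightarrow> \<exists>b. A g = b *\<^sub>c g"
    and "x \<in> cvec.span G" "A x = a *\<^sub>c x"
  shows "x \<in> cvec.span {g \<in> G. A g = a *\<^sub>c g}"
proof -
  have "x \<in> cvec.span {g \<in> G. A g = a *\<^sub>c g}"
    if "finite F" "F \<subseteq> G" "x \<in> cvec.span F" "A x = a *\<^sub>c x" for F x
    using that
  proof (induction F arbitrary: x rule: finite_induct)
    case (insert g F)
    obtain c where c: "x - c *\<^sub>c g \<in> cvec.span F" using insert.prems(2) cvec.span_breakdown_eq by blast
    obtain b where b: "A g = b *\<^sub>c g" using G insert.prems by auto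
    show ?case
    proof (cases "b = a")
      case True
      have "A (x - c *\<^sub>c g) = a *\<^sub>c (x - c *\<^sub>c g)"
        using insert.prems(3) b True
        by (simp add: clinear.diff[OF A] clinear.cscale[OF A] cvec.scale_right_diff_distrib cvec.scale_left_commute)
      then have "x - c *\<^sub>c g \<in> cvec.span {g \<in> G. A g = a *\<^sub>c g}" using insert.IH c insert.prems by auto
      moreover have "c *\<^sub>c g \<in> cvec.span {g \<in> G. A g = a *\<^sub>c g}"
        using b True insert.prems by (intro cvec.span_scale cvec.span_base) auto
      ultimately show ?thesis using cvec.span_add by fastforce
    next
      case False
      define y where "y = x - c *\<^sub>c g"
      have F: "A y' \<in> cvec.span F" if "y' \<in> cvec.span F" for y'
      proof (rule clinear.span_image_subset[OF A that])
        have "A g' \<in> cvec.span F" if "g' \<in> F" for g'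
          using G[of g'] insert.prems(1) that by (metis cvec.span_base cvec.span_scale insert_subset subsetD)
        then show "A ` F \<subseteq> cvec.span F" by blast
      qed simp
      have "(a - b) *\<^sub>c x = A y - b *\<^sub>c y"
        using insert.prems(3) b
        by (simp add: y_def clinear.diff[OF A] clinear.cscale[OF A] algebra_simps
            cvec.scale_left_diff_distrib cvec.scale_right_diff_distrib)
      also have "\<dots> \<in> cvec.span F" using F c by (simp add: y_def cvec.span_diff cvec.span_scale)
      finally have "inverse (a - b) *\<^sub>c (a - b) *\<^sub>c x \<in> cvec.span F" by (rule cvec.span_scale)
      then have "x \<in> cvec.span F" using False by (simp add: cscale_cscale cscale_one)
      then show ?thesis using insert by auto
    qed
  qed (simp add: cvec.span_zero)
  moreover obtain F where "finite F" "F \<subseteq> G" "x \<in> cvec.span F"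
    using assms(3) unfolding cvec.span_explicit by (auto intro!: cvec.span_sum cvec.span_scale cvec.span_base) 
  ultimately show ?thesis using assms(4) by blast
qed

lemma sum_eigenvectors_eq_0:
  assumes "clinear A" "finite S" "\<And>i. i \<in> S \<Longrightarrow> A (g i) = a i *\<^sub>c g i" "inj_on a S" "sum g S = 0" "i \<in> S"
  shows "g i = 0"
  using assms(2-6)
proof (induction S arbitrary: g i rule: finite_induct)
  case (insert j S)
  have "(\<Sum>k\<in>S. (a k - a j) *\<^sub>c g k) = (\<Sum>k\<in>insert j S. A (g k)) - a j *\<^sub>c (\<Sum>k\<in>insert j S. g k)"
    using insert.hyps insert.prems(1)
    by (simp add: cvec.scale_sum_right cvec.scale_left_diff_distrib sum_subtractf cscale_add_right)
  also have "(\<Sum>k\<in>insert j S. A (g k)) = 0"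
    using insert.prems(3) by (simp only: clinear.sum[OF assms(1), symmetric] clinear.zero[OF assms(1)])
  finally have 0: "(\<Sum>k\<in>S. (a k - a j) *\<^sub>c g k) = 0" using insert.prems(3) by simp
  have S: "g k = 0" if "k \<in> S" for k
  proof -
    have "(a k - a j) *\<^sub>c g k = 0"
      by (rule insert.IH[OF _ _ 0 that])
        (use insert.prems in \<open>auto simp: clinear.cscale[OF assms(1)] cscale_cscale mult.commute\<close>)
    moreover have "a k \<noteq> a j" using insert that by (auto simp: inj_on_def)
    ultimately show ?thesis by simp
  qed
  then have "g j = 0" using insert.prems(3) insert.hyps by simp
  then show ?case using S insert.prems by auto
qed simp

text \<open>Nonzero eigenvectors for distinct eigenvalues are independent, and a finite-dimensional
  set holds only finitely many of them. Applied to weight vectors this makes \<open>e\<close> and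
  \<open>f\<close> nilpotent on them.\<close>

lemma fd_eigenvector_sequence:
  fixes y :: "nat \<Rightarrow> 'a::complex_vector"
  assumes "clinear A" "fd Y" "\<And>i. y i \<in> Y" "\<And>i. A (y i) = a i *\<^sub>c y i" "inj a"
  shows "\<exists>i. y i = 0"
proof (rule ccontr)
  assume "\<not> ?thesis"
  then have nz: "y i \<noteq> 0" for i by blast
  have inj: "inj y"
    by (rule injI) (metis assms(4,5) cvec.scale_right_imp_eq injD nz)
  obtain B where B: "finite B" "Y \<subseteq> cvec.span B" using assms(2) unfolding fd_def by blast
  have "infinite (range y)" using inj by (simp add: finite_image_iff)
  moreover have "range y \<subseteq> cvec.span B" using assms(3) B by blast
  ultimately have "cvec.dependent (range y)" using cvec.independent_span_bound[OF B(1)] by blast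
  then obtain S u where S: "finite S" "S \<subseteq> range y" "(\<Sum>v\<in>S. u v *\<^sub>c v) = 0" and "\<exists>v\<in>S. u v \<noteq> 0"
    unfolding cvec.dependent_explicit by blast
  then obtain v0 where v0: "v0 \<in> S" "u v0 \<noteq> 0" by blast
  have y_inv: "y (inv_into UNIV y v) = v" if "v \<in> S" for v using S(2) that by (auto intro: f_inv_into_f)
  have "u v0 *\<^sub>c v0 = 0"
  proof (rule sum_eigenvectors_eq_0[OF assms(1) S(1) _ _ S(3) v0(1)])
    show "A (u v *\<^sub>c v) = a (inv_into UNIV y v) *\<^sub>c u v *\<^sub>c v" if "v \<in> S" for v
      using assms(4)[of "inv_into UNIV y v"] y_inv[OF that] by (simp add: clinear.cscale[OF assms(1)] mult.commute)
    show "inj_on (\<lambda>v. a (inv_into UNIV y v)) S" by (rule inj_onI) (metis assms(5) injD y_inv)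
  qed
  then show False using v0 nz y_inv[OF v0(1)] by (metis cvec.scale_eq_0_iff)
qed


section \<open>Representations of the Takiff algebra\<close>

definition invariant_subspace :: "('l \<Rightarrow> 'a::complex_vector \<Rightarrow> 'a) \<Rightarrow> 'a set \<Rightarrow> bool" where
  "invariant_subspace \<rho> W \<longleftrightarrow> cvec.subspace W \<and> (\<forall>x. \<forall>w\<in>W. \<rho> x w \<in> W)"

text \<open>The action is defined and linear on the whole type; a module with a smaller carrier
  appears as an invariant subspace.\<close>

locale lie_rep =
  fixes \<rho> :: "'l::complex_lie_algebra \<Rightarrow> 'a::complex_vector \<Rightarrow> 'a"
  assumes rep_linear: "clinear (\<rho> x)"
    and rep_add: "\<rho> (x + y) v = \<rho> x v + \<rho> y v"
    and rep_cscale: "\<rho> (c *\<^sub>c x) v = c *\<^sub>c \<rho> x v"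
    and rep_bracket: "\<rho> (lie_bracket x y) v = \<rho> x (\<rho> y v) - \<rho> y (\<rho> x v)"
begin

lemmas rep_simps = clinear.add[OF rep_linear] clinear.diff[OF rep_linear] clinear.cscale[OF rep_linear]
  clinear.zero[OF rep_linear] clinear.minus[OF rep_linear] clinear.sum[OF rep_linear]

lemma rep_zero: "\<rho> 0 v = 0"
  using rep_add[of 0 0 v] by simp

lemma rep_minus: "\<rho> (- x) v = - \<rho> x v"
  using rep_add[of x "- x" v] by (simp add: rep_zero eq_neg_iff_add_eq_0 add.commute)

lemma rep_pow_linear: "clinear (\<rho> x ^^ k)"
  by unfold_locales (induction k, simp_all add: rep_simps)+

end

lemma takiff_bracket_simps:
  "lie_bracket (in_g a) (in_g b) = in_g (lie_bracket a b)"
  "lie_bracket (in_g a) (bar b) = bar (lie_bracket a b)"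
  "lie_bracket (bar a) (in_g b) = bar (lie_bracket a b)"
  "lie_bracket (bar a) (bar b) = 0"
proof -
  have [simp]: "lie_bracket 0 x = 0" "lie_bracket x 0 = 0" for x :: sl2
    using lie_bracket_add_left[of 0 0 x] lie_bracket_add_right[of x 0 0] by simp_all
  show "lie_bracket (in_g a) (in_g b) = in_g (lie_bracket a b)"
    "lie_bracket (in_g a) (bar b) = bar (lie_bracket a b)"
    "lie_bracket (bar a) (in_g b) = bar (lie_bracket a b)"
    "lie_bracket (bar a) (bar b) = 0"
    by (simp_all add: in_g_def bar_def lie_bracket_takiff_def zero_takiff_def)
qed

lemma takiff_linear_simps:
  "in_g (a + b) = in_g a + in_g b" "in_g (c *\<^sub>c a) = c *\<^sub>c in_g a"
  "bar (a + b) = bar a + bar b" "bar (c *\<^sub>c a) = c *\<^sub>c bar a"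
  "in_g (- a) = - in_g a" "bar (- a) = - bar a"
  by (simp_all add: in_g_def bar_def plus_takiff_def cscale_takiff_def uminus_takiff_def)

lemma takiff_decompose: "x = in_g (part_1 x) + bar (part_x x)"
  by (simp add: in_g_def bar_def plus_takiff_def)

text \<open>Numeral scalars become repeated sums, so that after sorting words both sides of an
  identity are sums of the same words and cancellation in an abelian group finishes.\<close>

lemma cscale_numeral_simps:
  "numeral (num.Bit0 w) *\<^sub>c v = numeral w *\<^sub>c v + numeral w *\<^sub>c v"
  "numeral (num.Bit1 w) *\<^sub>c v = numeral w *\<^sub>c v + numeral w *\<^sub>c v + v"
  "(a * numeral (num.Bit0 w)) *\<^sub>c v = (a * numeral w) *\<^sub>c v + (a * numeral w) *\<^sub>c v"
  "(a * numeral (num.Bit1 w)) *\<^sub>c v = (a * numeral w) *\<^sub>c v + (a * numeral w) *\<^sub>c v + a *\<^sub>c v"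
  "(a * (b * numeral (num.Bit0 w))) *\<^sub>c v = (a * (b * numeral w)) *\<^sub>c v + (a * (b * numeral w)) *\<^sub>c v"
  "(a * (b * numeral (num.Bit1 w))) *\<^sub>c v =
     (a * (b * numeral w)) *\<^sub>c v + (a * (b * numeral w)) *\<^sub>c v + (a * b) *\<^sub>c v"
  for v :: "'a::complex_vector"
  by (simp_all only: numeral_Bit0 numeral_Bit1 distrib_left cscale_add_left mult_1_right cscale_one)

lemmas cscale_expand = cscale_add_right cscale_add_left cvec.scale_right_diff_distrib
  cvec.scale_left_diff_distrib cscale_numeral_simps algebra_simps

locale takiff_rep = lie_rep \<rho> for \<rho> :: "takiff \<Rightarrow> 'a::complex_vector \<Rightarrow> 'a"
begin

abbreviation "e \<equiv> \<rho> (in_g sl2_e)"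
abbreviation "f \<equiv> \<rho> (in_g sl2_f)"
abbreviation "h \<equiv> \<rho> (in_g sl2_h)"
abbreviation "eb \<equiv> \<rho> (bar sl2_e)"
abbreviation "fb \<equiv> \<rho> (bar sl2_f)"
abbreviation "hb \<equiv> \<rho> (bar sl2_h)"

lemma rep_commute: "\<rho> x (\<rho> y v) = \<rho> y (\<rho> x v) + \<rho> (lie_bracket x y) v"
  by (simp add: rep_bracket)

lemma sl2_brackets:
  "lie_bracket sl2_e sl2_f = sl2_h" "lie_bracket sl2_f sl2_e = (-1) *\<^sub>c sl2_h"
  "lie_bracket sl2_h sl2_e = 2 *\<^sub>c sl2_e" "lie_bracket sl2_e sl2_h = (-2) *\<^sub>c sl2_e"
  "lie_bracket sl2_h sl2_f = (-2) *\<^sub>c sl2_f" "lie_bracket sl2_f sl2_h = 2 *\<^sub>c sl2_f"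
  by (simp_all add: sl2_eq_iff)

text \<open>Oriented so that simplification sorts words into the order \<open>f, fb, hb, eb, h, e\<close>.\<close>

lemma pbw:
  "fb (f v) = f (fb v)"
  "hb (f v) = f (hb v) - 2 *\<^sub>c fb v" "hb (fb v) = fb (hb v)"
  "eb (f v) = f (eb v) + hb v" "eb (fb v) = fb (eb v)" "eb (hb v) = hb (eb v)"
  "h (f v) = f (h v) - 2 *\<^sub>c f v" "h (fb v) = fb (h v) - 2 *\<^sub>c fb v" "h (hb v) = hb (h v)"
  "h (eb v) = eb (h v) + 2 *\<^sub>c eb v"
  "e (f v) = f (e v) + h v" "e (fb v) = fb (e v) + hb v" "e (hb v) = hb (e v) - 2 *\<^sub>c eb v"
  "e (eb v) = eb (e v)" "e (h v) = h (e v) - 2 *\<^sub>c e v"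
proof -
  have [simp]: "lie_bracket x x = 0" for x :: sl2 by (rule lie_bracket_self)
  have [simp]: "bar 0 = 0" by (simp add: bar_def zero_takiff_def)
  note [simp] = takiff_bracket_simps sl2_brackets takiff_linear_simps rep_cscale rep_zero rep_minus
  show "fb (f v) = f (fb v)" using rep_commute[of "bar sl2_f" "in_g sl2_f" v] by simp
  show "hb (f v) = f (hb v) - 2 *\<^sub>c fb v" using rep_commute[of "bar sl2_h" "in_g sl2_f" v] by simp
  show "hb (fb v) = fb (hb v)" using rep_commute[of "bar sl2_h" "bar sl2_f" v] by simp
  show "eb (f v) = f (eb v) + hb v" using rep_commute[of "bar sl2_e" "in_g sl2_f" v] by simp
  show "eb (fb v) = fb (eb v)" using rep_commute[of "bar sl2_e" "bar sl2_f" v] by simp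
  show "eb (hb v) = hb (eb v)" using rep_commute[of "bar sl2_e" "bar sl2_h" v] by simp
  show "h (f v) = f (h v) - 2 *\<^sub>c f v" using rep_commute[of "in_g sl2_h" "in_g sl2_f" v] by simp
  show "h (fb v) = fb (h v) - 2 *\<^sub>c fb v" using rep_commute[of "in_g sl2_h" "bar sl2_f" v] by simp
  show "h (hb v) = hb (h v)" using rep_commute[of "in_g sl2_h" "bar sl2_h" v] by simp
  show "h (eb v) = eb (h v) + 2 *\<^sub>c eb v" using rep_commute[of "in_g sl2_h" "bar sl2_e" v] by simp
  show "e (f v) = f (e v) + h v" using rep_commute[of "in_g sl2_e" "in_g sl2_f" v] by simp
  show "e (fb v) = fb (e v) + hb v" using rep_commute[of "in_g sl2_e" "bar sl2_f" v] by simp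
  show "e (hb v) = hb (e v) - 2 *\<^sub>c eb v" using rep_commute[of "in_g sl2_e" "bar sl2_h" v] by simp
  show "e (eb v) = eb (e v)" using rep_commute[of "in_g sl2_e" "bar sl2_e" v] by simp
  show "e (h v) = h (e v) - 2 *\<^sub>c e v" using rep_commute[of "in_g sl2_e" "in_g sl2_h" v] by simp
qed

lemma rep_expand:
  "\<rho> (in_g a) v = sl2_mat a $ 1 $ 1 *\<^sub>c h v + sl2_mat a $ 1 $ 2 *\<^sub>c e v + sl2_mat a $ 2 $ 1 *\<^sub>c f v"
  "\<rho> (bar a) v = sl2_mat a $ 1 $ 1 *\<^sub>c hb v + sl2_mat a $ 1 $ 2 *\<^sub>c eb v + sl2_mat a $ 2 $ 1 *\<^sub>c fb v"
  "\<rho> x v = \<rho> (in_g (part_1 x)) v + \<rho> (bar (part_x x)) v"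
  by (subst sl2_decompose[of a], simp only: takiff_linear_simps rep_add rep_cscale)
    (subst sl2_decompose[of a], simp only: takiff_linear_simps rep_add rep_cscale,
     subst takiff_decompose[of x], simp only: rep_add)

lemma g_invariantI:
  assumes "cvec.subspace W" "\<And>w. w \<in> W \<Longrightarrow> e w \<in> W" "\<And>w. w \<in> W \<Longrightarrow> f w \<in> W" "\<And>w. w \<in> W \<Longrightarrow> h w \<in> W"
  shows "invariant_subspace (\<lambda>a. \<rho> (in_g a)) W"
proof -
  have "\<rho> (in_g a) w \<in> W" if "w \<in> W" for a w
    unfolding rep_expand(1)[of a] using assms that by (intro cvec.subspace_add cvec.subspace_scale) auto
  then show ?thesis using assms(1) by (simp add: invariant_subspace_def)
qed

lemma invariantI:
  assumes "cvec.subspace W" "\<And>w. w \<in> W \<Longrightarrow> e w \<in> W" "\<And>w. w \<in> W \<Longrightarrow> f w \<in> W" "\<And>w. w \<in> W \<Longrightarrow> h w \<in> W"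
    and "\<And>w. w \<in> W \<Longrightarrow> eb w \<in> W" "\<And>w. w \<in> W \<Longrightarrow> fb w \<in> W" "\<And>w. w \<in> W \<Longrightarrow> hb w \<in> W"
  shows "invariant_subspace \<rho> W"
proof -
  have "\<rho> x w \<in> W" if "w \<in> W" for x w
    unfolding rep_expand(3)[of x] rep_expand(1)[of "part_1 x"] rep_expand(2)[of "part_x x"]
    using assms that by (intro cvec.subspace_add cvec.subspace_scale) auto
  then show ?thesis using assms(1) by (simp add: invariant_subspace_def)
qed

definition Cbar :: "'a \<Rightarrow> 'a" where "Cbar v = hb (hb v) + 4 *\<^sub>c fb (eb v)"

text \<open>Half the polarization of the Casimir element h h + 2 e f + 2 f e in the direction of the
  ideal, with its words sorted; the summand \<open>2 *\<^sub>c hb v\<close> collects the commutators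
  of the sorting.\<close>

definition Cmix :: "'a \<Rightarrow> 'a"
  where "Cmix v = h (hb v) + 2 *\<^sub>c fb (e v) + 2 *\<^sub>c f (eb v) + 2 *\<^sub>c hb v"

text \<open>The Casimir operator of sl2; its value m (m + 2) on a string of highest weight m tells
  the types apart.\<close>

definition Omega :: "'a \<Rightarrow> 'a" where "Omega v = h (h v) + 2 *\<^sub>c h v + 4 *\<^sub>c f (e v)"

text \<open>Up to a factor, the projection of \<open>fb u\<close> to the highest weight vectors of weight \<open>m - 2\<close>.\<close>

definition Dn :: "complex \<Rightarrow> 'a \<Rightarrow> 'a"
  where "Dn m u = (m * (m + 1)) *\<^sub>c fb u - (m + 1) *\<^sub>c f (hb u) - f (f (eb u))"

definition hw :: "complex \<Rightarrow> 'a \<Rightarrow> bool" where "hw m u \<longleftrightarrow> e u = 0 \<and> h u = m *\<^sub>c u"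

lemma Cbar_commute:
  "Cbar (e v) = e (Cbar v)" "Cbar (f v) = f (Cbar v)" "Cbar (h v) = h (Cbar v)"
  "Cbar (eb v) = eb (Cbar v)" "Cbar (fb v) = fb (Cbar v)" "Cbar (hb v) = hb (Cbar v)"
  by (simp_all add: Cbar_def pbw rep_simps cscale_expand)

lemma Cmix_commute:
  "Cmix (e v) = e (Cmix v)" "Cmix (f v) = f (Cmix v)" "Cmix (h v) = h (Cmix v)"
  "Cmix (eb v) = eb (Cmix v)" "Cmix (fb v) = fb (Cmix v)" "Cmix (hb v) = hb (Cmix v)"
  by (simp_all add: Cmix_def pbw rep_simps cscale_expand)

lemma Omega_commute:
  "Omega (e v) = e (Omega v)" "Omega (f v) = f (Omega v)" "Omega (h v) = h (Omega v)"
  by (simp_all add: Omega_def pbw rep_simps cscale_expand)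

lemma linear_Cbar: "clinear Cbar" and linear_Cmix: "clinear Cmix" and linear_Omega: "clinear Omega"
  by unfold_locales (simp_all add: Cbar_def Cmix_def Omega_def rep_simps cscale_expand)

lemma Omega_hw: "hw m u \<Longrightarrow> Omega u = (m * (m + 2)) *\<^sub>c u"
  by (simp add: hw_def Omega_def rep_simps cscale_expand)

text \<open>On a highest weight vector the term with \<open>e\<close> drops out. Where
  \<open>Cmix\<close> is a scalar this solves for \<open>hb u\<close> in terms of u and
  \<open>f (eb u)\<close>, as long as m + 2 is not 0.\<close>

lemma Cmix_hw: "hw m u \<Longrightarrow> Cmix u = (m + 2) *\<^sub>c hb u + 2 *\<^sub>c f (eb u)"
  by (simp add: hw_def Cmix_def pbw rep_simps cscale_expand)

lemma hw_eb: "hw m u \<Longrightarrow> hw (m + 2) (eb u)"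
  by (simp add: hw_def pbw rep_simps cscale_expand)

lemma hw_Dn: "hw m u \<Longrightarrow> hw (m - 2) (Dn m u)"
  by (simp add: hw_def Dn_def pbw rep_simps cscale_expand)

lemma hw_Cmix: "hw m u \<Longrightarrow> hw m (Cmix u)"
  by (simp add: hw_def rep_simps flip: Cmix_commute) (simp add: linear_Cmix clinear.cscale clinear.zero)

lemma hw_Cbar: "hw m u \<Longrightarrow> hw m (Cbar u)"
  by (simp add: hw_def rep_simps flip: Cbar_commute) (simp add: linear_Cbar clinear.cscale clinear.zero)

text \<open>\<open>eb\<close> raises and \<open>Dn\<close> lowers the weight of highest weight
  vectors by 2, and both composites are governed by the central elements. If these act as z and c,
  the ladder can break only where m^2 z = c^2, m being the larger of the two weights
  involved.\<close>

lemma eb_Dn: "hw m u \<Longrightarrow> 4 *\<^sub>c eb (Dn m u) = (m * m) *\<^sub>c Cbar u - Cmix (Cmix u)"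
  by (simp add: hw_def Dn_def Cbar_def Cmix_def pbw rep_simps cscale_expand)

lemma Dn_eb: "hw m u \<Longrightarrow> 4 *\<^sub>c Dn (m + 2) (eb u) = ((m + 2) * (m + 2)) *\<^sub>c Cbar u - Cmix (Cmix u)"
  by (simp add: hw_def Dn_def Cbar_def Cmix_def pbw rep_simps cscale_expand)

end


section \<open>Highest weight vectors of sl2 and their f-strings\<close>

context takiff_rep
begin

lemma f_pow_hw:
  assumes "hw m u"
  shows "h ((f ^^ i) u) = (m - 2 * of_nat i) *\<^sub>c (f ^^ i) u"
    and "e ((f ^^ Suc i) u) = (of_nat (Suc i) * (m - of_nat i)) *\<^sub>c (f ^^ i) u"
proof -
  show h: "h ((f ^^ i) u) = (m - 2 * of_nat i) *\<^sub>c (f ^^ i) u" for i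
  proof (induction i)
    case (Suc i)
    then show ?case by (simp add: pbw(7) rep_simps) (simp add: algebra_simps flip: cscale_add_left)
  qed (use assms in \<open>simp add: hw_def\<close>)
  show "e ((f ^^ Suc i) u) = (of_nat (Suc i) * (m - of_nat i)) *\<^sub>c (f ^^ i) u"
  proof (induction i)
    case 0
    then show ?case using assms by (simp add: hw_def pbw rep_simps)
  next
    case (Suc i)
    have "e ((f ^^ Suc (Suc i)) u) = f (e ((f ^^ Suc i) u)) + h ((f ^^ Suc i) u)" by (simp add: pbw)
    also have "\<dots> = (of_nat (Suc (Suc i)) * (m - of_nat (Suc i))) *\<^sub>c (f ^^ Suc i) u"
      unfolding Suc h rep_simps by (simp add: algebra_simps flip: cscale_add_left)
    finally show ?case .
  qed
qed

lemma e_f_pow_hw_mem: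
  assumes "hw m u" shows "e ((f ^^ i) u) \<in> cvec.span (range (\<lambda>i. (f ^^ i) u))"
proof (cases i)
  case 0
  then show ?thesis using assms by (simp add: hw_def cvec.span_zero)
next
  case (Suc j)
  then show ?thesis by (simp only: f_pow_hw(2)[OF assms]) (auto intro: cvec.span_scale cvec.span_base)
qed

lemma e_pow_weight: "h y = a *\<^sub>c y \<Longrightarrow> h ((e ^^ i) y) = (a + 2 * of_nat i) *\<^sub>c (e ^^ i) y"
proof (induction i)
  case (Suc i)
  have "h (e v) = e (h v) + 2 *\<^sub>c e v" for v by (simp add: pbw)
  then show ?case using Suc by (simp add: rep_simps) (simp add: algebra_simps flip: cscale_add_left)
qed simp

text \<open>For the last nonzero vector f^k u of the string, 0 = e f^(k+1) u = (k + 1) (m - k) f^k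
  u, which forces m = k.\<close>

lemma hw_f_nilpotent:
  assumes "hw m u" "u \<noteq> 0" "(f ^^ N) u = 0"
  obtains k :: nat where "m = of_nat k" "(f ^^ Suc k) u = 0" "\<And>i. i \<le> k \<Longrightarrow> (f ^^ i) u \<noteq> 0"
proof -
  define N' where "N' = (LEAST i. (f ^^ i) u = 0)"
  have N': "(f ^^ N') u = 0" unfolding N'_def using assms(3) by (rule LeastI)
  then obtain k where k: "N' = Suc k" using assms(2) by (cases N') auto
  have nz: "(f ^^ i) u \<noteq> 0" if "i \<le> k" for i
    using not_less_Least[of i "\<lambda>i. (f ^^ i) u = 0"] k that unfolding N'_def by linarith
  have "(of_nat (Suc k) * (m - of_nat k)) *\<^sub>c (f ^^ k) u = 0"
    using f_pow_hw(2)[OF assms(1), of k] N' k by (simp add: rep_simps)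
  then have "m = of_nat k" using nz[of k] by (simp del: of_nat_Suc)
  then show ?thesis using that N' k nz by auto
qed

text \<open>For a highest weight vector u this is the sl2-submodule generated by u.\<close>

definition fstring :: "'a \<Rightarrow> 'a set" where "fstring u = cvec.span (range (\<lambda>i. (f ^^ i) u))"

lemma f_pow_in_fstring: "(f ^^ i) u \<in> fstring u"
  by (simp add: fstring_def cvec.span_base)

lemma fstring_subset: "cvec.subspace W \<Longrightarrow> u \<in> W \<Longrightarrow> (\<And>w. w \<in> W \<Longrightarrow> f w \<in> W) \<Longrightarrow> fstring u \<subseteq> W"
proof -
  assume W: "cvec.subspace W" "u \<in> W" "\<And>w. w \<in> W \<Longrightarrow> f w \<in> W"
  have "(f ^^ i) u \<in> W" for i by (induction i) (use W in auto)
  then show ?thesis unfolding fstring_def using W(1) by (intro cvec.span_minimal) auto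
qed

lemma fstring_invariant:
  assumes "hw m u" shows "invariant_subspace (\<lambda>a. \<rho> (in_g a)) (fstring u)"
proof (rule g_invariantI)
  show "cvec.subspace (fstring u)" by (simp add: fstring_def)
  fix w assume w: "w \<in> fstring u"
  note step = clinear.span_image_subset[OF rep_linear w[unfolded fstring_def], of _ "fstring u"]
  show "e w \<in> fstring u"
    by (rule step) (use e_f_pow_hw_mem[OF assms] in \<open>auto simp: fstring_def\<close>)
  show "h w \<in> fstring u"
    by (rule step) (auto simp: f_pow_hw(1)[OF assms] fstring_def intro!: cvec.span_scale[OF cvec.span_base])
  show "f w \<in> fstring u"
    by (rule step) (use f_pow_in_fstring[of "Suc _" u] in \<open>auto simp: fstring_def\<close>)
qed

lemma f_pow_zero: "(f ^^ i) 0 = 0"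
  by (rule clinear.zero[OF rep_pow_linear])

lemma f_pow_le: "(f ^^ N) u = 0 \<Longrightarrow> N \<le> M \<Longrightarrow> (f ^^ M) u = 0"
  by (metis f_pow_zero funpow_add comp_apply le_add_diff_inverse2)

lemma fstring_eq: assumes "(f ^^ N) u = 0" shows "fstring u = cvec.span ((\<lambda>i. (f ^^ i) u) ` {..<N})"
proof
  have "(f ^^ i) u \<in> cvec.span ((\<lambda>i. (f ^^ i) u) ` {..<N})" for i
    by (cases "i < N") (use f_pow_le[OF assms, of i] in \<open>auto intro: cvec.span_base simp: cvec.span_zero\<close>)
  then show "fstring u \<subseteq> cvec.span ((\<lambda>i. (f ^^ i) u) ` {..<N})"
    unfolding fstring_def by (intro cvec.span_minimal) auto
  show "cvec.span ((\<lambda>i. (f ^^ i) u) ` {..<N}) \<subseteq> fstring u"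
    unfolding fstring_def by (intro cvec.span_mono) auto
qed

lemma fd_fstring: "(f ^^ N) u = 0 \<Longrightarrow> fd (fstring u)"
  by (simp add: fstring_eq fd_span)

lemma fd_f_nilpotent:
  assumes "fd Y" "invariant_subspace (\<lambda>a. \<rho> (in_g a)) Y" "u \<in> Y" "hw m u"
  shows "\<exists>N. (f ^^ N) u = 0"
proof -
  have "(f ^^ i) u \<in> Y" for i by (induction i) (use assms in \<open>auto simp: invariant_subspace_def\<close>)
  moreover have "inj (\<lambda>i::nat. m - 2 * of_nat i)" by (simp add: inj_def)
  ultimately show ?thesis
    using fd_eigenvector_sequence[where y = "\<lambda>i. (f ^^ i) u", OF rep_linear assms(1) _ f_pow_hw(1)[OF assms(4)]] by blast
qed

lemma fd_hw_nat:
  assumes "fd Y" "invariant_subspace (\<lambda>a. \<rho> (in_g a)) Y" "u \<in> Y" "u \<noteq> 0" "hw m u"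
  obtains k where "m = of_nat k" "(f ^^ Suc k) u = 0"
  using fd_f_nilpotent[OF assms(1-3,5)] hw_f_nilpotent[OF assms(5,4)] by metis

text \<open>An eigenvector of \<open>h\<close> exists in finite dimension; applying \<open>e\<close>
  changes the weight every time, so some power of \<open>e\<close> kills it, and the last nonzero
  vector is of highest weight.\<close>

lemma exists_hw:
  assumes "fd Y" "invariant_subspace (\<lambda>a. \<rho> (in_g a)) Y" "Y \<noteq> {0}"
  obtains k u where "u \<in> Y" "u \<noteq> 0" "hw (of_nat k) u" "(f ^^ Suc k) u = 0"
proof -
  have sub: "cvec.subspace Y" and inv: "\<And>a y. y \<in> Y \<Longrightarrow> \<rho> (in_g a) y \<in> Y"
    using assms(2) by (auto simp: invariant_subspace_def)
  obtain y a where y: "y \<in> Y" "y \<noteq> 0" "h y = a *\<^sub>c y"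
    using exists_eigenvector[OF rep_linear sub inv assms(1,3)] by blast
  have "(e ^^ i) y \<in> Y" for i by (induction i) (use y inv in auto)
  moreover have "inj (\<lambda>i::nat. a + 2 * of_nat i)" by (simp add: inj_def)
  ultimately have ex: "\<exists>i. (e ^^ i) y = 0"
    using fd_eigenvector_sequence[where y = "\<lambda>i. (e ^^ i) y", OF rep_linear assms(1) _ e_pow_weight[OF y(3)]] by blast
  define N where "N = (LEAST i. (e ^^ i) y = 0)"
  have N: "(e ^^ N) y = 0" unfolding N_def using ex by (rule LeastI_ex)
  then obtain j where j: "N = Suc j" using y(2) by (cases N) auto
  have nz: "(e ^^ j) y \<noteq> 0"
    using not_less_Least[of j "\<lambda>i. (e ^^ i) y = 0"] j unfolding N_def by linarith
  have hwj: "hw (a + 2 * of_nat j) ((e ^^ j) y)"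
    using N e_pow_weight[OF y(3)] by (simp add: hw_def j)
  show ?thesis using fd_hw_nat[OF assms(1,2) \<open>(e ^^ j) y \<in> Y\<close> nz hwj] that[OF \<open>(e ^^ j) y \<in> Y\<close> nz] hwj by metis
qed

text \<open>The element \<open>f\<close> acts ad-nilpotently on the Lie algebra. The basis is
  treated in the order \<open>f\<close>, \<open>fb\<close>, \<open>h\<close>, \<open>hb\<close>,
  \<open>eb\<close>, \<open>e\<close>, so that the commutator of \<open>f\<close> with each involves
  only elements already treated.\<close>

lemma f_nilpotent_invariant: "invariant_subspace \<rho> {v. \<exists>N. (f ^^ N) v = 0}"
proof (rule invariantI)
  let ?W = "{v. \<exists>N. (f ^^ N) v = 0}"
  note lin = clinear.add[OF rep_pow_linear] clinear.diff[OF rep_pow_linear] clinear.cscale[OF rep_pow_linear]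
  show sub: "cvec.subspace ?W"
  proof (rule cvec.subspaceI)
    fix u v assume "u \<in> ?W" "v \<in> ?W"
    then obtain N M where "(f ^^ N) u = 0" "(f ^^ M) v = 0" by blast
    then have "(f ^^ (N + M)) (u + v) = 0" by (simp add: lin f_pow_le[of N u] f_pow_le[of M v])
    then show "u + v \<in> ?W" by blast
  qed (auto simp: lin f_pow_zero intro: exI[of _ 0])
  have f_inv: "v \<in> ?W" if fv: "f v \<in> ?W" for v
  proof -
    obtain N where "(f ^^ N) (f v) = 0" using fv by blast
    then have "(f ^^ Suc N) v = 0" by (simp add: funpow_swap1)
    then show ?thesis by blast
  qed
  have zero: "0 \<in> ?W" by (auto intro: exI[of _ 0])
  have f: "f v \<in> ?W" if "v \<in> ?W" for v
  proof -
    obtain N where "(f ^^ N) v = 0" using \<open>v \<in> ?W\<close> by blast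
    then have "(f ^^ N) (f v) = 0" by (simp flip: funpow_swap1 add: rep_simps)
    then show ?thesis by blast
  qed
  \<comment> \<open>Induction on the order of nilpotency, which is smaller for \<open>f v\<close>
    than for v. Together with \<open>f_inv\<close> it reduces a claim about x v to f (x v), which is
    x (f v) plus a commutator term.\<close>
  have induct: "P v" if v: "v \<in> ?W" and P: "P 0" "\<And>v. v \<in> ?W \<Longrightarrow> P (f v) \<Longrightarrow> P v" for P v
  proof -
    obtain N where "(f ^^ N) v = 0" using v by blast
    then show "P v"
    proof (induction N arbitrary: v)
      case (Suc N)
      have "(f ^^ N) (f v) = 0" using Suc.prems by (simp add: funpow_swap1)
      then have "P (f v)" by (rule Suc.IH)
      moreover have "v \<in> ?W" using Suc.prems by (intro CollectI exI)
      ultimately show ?case by (rule P(2)[rotated])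
    qed (use P(1) in simp)
  qed
  note sub_rules = cvec.subspace_add[OF sub] cvec.subspace_diff[OF sub] cvec.subspace_scale[OF sub]
  have fb: "fb v \<in> ?W" if "v \<in> ?W" for v
    using that
  proof (rule induct[where P = "\<lambda>v. fb v \<in> ?W"])
    fix v assume "fb (f v) \<in> ?W"
    then show "fb v \<in> ?W" by - (rule f_inv, simp only: pbw(1))
  qed (simp only: rep_simps zero)
  have h: "h v \<in> ?W" if "v \<in> ?W" for v
    using that
  proof (rule induct[where P = "\<lambda>v. h v \<in> ?W"])
    fix v assume v: "v \<in> ?W" "h (f v) \<in> ?W"
    have "f (h v) = h (f v) + 2 *\<^sub>c f v" by (simp add: pbw)
    then show "h v \<in> ?W" using v f by - (rule f_inv, simp only: sub_rules)
  qed (simp only: rep_simps zero)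
  have hb: "hb v \<in> ?W" if "v \<in> ?W" for v
    using that
  proof (rule induct[where P = "\<lambda>v. hb v \<in> ?W"])
    fix v assume v: "v \<in> ?W" "hb (f v) \<in> ?W"
    have "f (hb v) = hb (f v) + 2 *\<^sub>c fb v" by (simp add: pbw)
    then show "hb v \<in> ?W" using v fb by - (rule f_inv, simp only: sub_rules)
  qed (simp only: rep_simps zero)
  have eb: "eb v \<in> ?W" if "v \<in> ?W" for v
    using that
  proof (rule induct[where P = "\<lambda>v. eb v \<in> ?W"])
    fix v assume v: "v \<in> ?W" "eb (f v) \<in> ?W"
    have "f (eb v) = eb (f v) - hb v" by (simp add: pbw)
    then show "eb v \<in> ?W" using v hb by - (rule f_inv, simp only: sub_rules)
  qed (simp only: rep_simps zero)
  have e: "e v \<in> ?W" if "v \<in> ?W" for v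
    using that
  proof (rule induct[where P = "\<lambda>v. e v \<in> ?W"])
    fix v assume v: "v \<in> ?W" "e (f v) \<in> ?W"
    have "f (e v) = e (f v) - h v" by (simp add: pbw)
    then show "e v \<in> ?W" using v h by - (rule f_inv, simp only: sub_rules)
  qed (simp only: rep_simps zero)
  fix w assume "w \<in> ?W"
  then show "e w \<in> ?W" "f w \<in> ?W" "h w \<in> ?W" "eb w \<in> ?W" "fb w \<in> ?W" "hb w \<in> ?W"
    by (rule e, rule f, rule h, rule eb, rule fb, rule hb)
qed

end


section \<open>The module spanned by the strings of the vectors eb^k v\<close>

context takiff_rep
begin

text \<open>\<open>v\<close> generates a module with minimal type \<open>n\<close> on which the central elements act by \<open>\<zeta>\<close> and \<open>c\<close>.\<close>

definition generator :: "nat \<Rightarrow> complex \<Rightarrow> complex \<Rightarrow> 'a \<Rightarrow> bool" where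
  "generator n \<zeta> c v \<longleftrightarrow> hw (of_nat n) v \<and> (f ^^ Suc n) v = 0 \<and>
     Cbar v = \<zeta> *\<^sub>c v \<and> Cmix v = c *\<^sub>c v \<and> Dn (of_nat n) v = 0"

text \<open>Only \<open>f\<close> and \<open>eb\<close> are applied; for a generator the remaining
  basis elements turn out to preserve this span as well.\<close>

definition gspan :: "'a \<Rightarrow> 'a set" where
  "gspan v = cvec.span {(f ^^ i) ((eb ^^ k) v) | i k. True}"

lemma fb_of_Dn:
  "m \<noteq> 0 \<Longrightarrow> m + 1 \<noteq> 0 \<Longrightarrow>
     fb u = (1 / (m * (m + 1))) *\<^sub>c (Dn m u + (m + 1) *\<^sub>c f (hb u) + f (f (eb u)))"
  by (simp add: Dn_def)

context
  fixes n \<zeta> c v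
  assumes gen: "generator n \<zeta> c v"
begin

lemma generator_scalars: "v \<noteq> 0 \<Longrightarrow> c * c = of_nat n * of_nat n * \<zeta>"
proof -
  assume "v \<noteq> 0"
  have "(of_nat n * of_nat n) *\<^sub>c \<zeta> *\<^sub>c v - c *\<^sub>c c *\<^sub>c v = 0"
    using gen eb_Dn[of "of_nat n" v] by (simp add: generator_def rep_simps clinear.cscale[OF linear_Cmix])
  then have "(of_nat n * of_nat n * \<zeta> - c * c) *\<^sub>c v = 0"
    by (simp add: cvec.scale_left_diff_distrib)
  then show ?thesis using \<open>v \<noteq> 0\<close> by simp
qed

lemma hw_eb_pow: "hw (of_nat (n + 2 * k)) ((eb ^^ k) v)"
proof (induction k)
  case (Suc k)
  then show ?case using hw_eb[OF Suc] by (simp add: algebra_simps)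
qed (use gen in \<open>simp add: generator_def\<close>)

lemma Cbar_eb_pow: "Cbar ((eb ^^ k) v) = \<zeta> *\<^sub>c (eb ^^ k) v"
  by (induction k) (use gen in \<open>simp_all add: generator_def Cbar_commute rep_simps\<close>)

lemma Cmix_eb_pow: "Cmix ((eb ^^ k) v) = c *\<^sub>c (eb ^^ k) v"
  by (induction k) (use gen in \<open>simp_all add: generator_def Cmix_commute rep_simps\<close>)

text \<open>Vectors killed by a power of \<open>f\<close> form a submodule, so eb^k v is one of
  them, and its weight n + 2 k then fixes the exponent. The vector may be 0, as happens for k > 0
  when the ideal acts trivially.\<close>

lemma eb_pow_f_nilpotent: "(f ^^ Suc (n + 2 * k)) ((eb ^^ k) v) = 0"
proof (cases "(eb ^^ k) v = 0")
  case False
  have "(eb ^^ k) v \<in> {v. \<exists>N. (f ^^ N) v = 0}"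
  proof (induction k)
    case 0
    show ?case using gen unfolding generator_def funpow_0 by blast
  next
    case (Suc k)
    then show ?case using f_nilpotent_invariant by (simp add: invariant_subspace_def)
  qed
  then obtain N where "(f ^^ N) ((eb ^^ k) v) = 0" by blast
  from hw_f_nilpotent[OF hw_eb_pow False this] show ?thesis by (metis of_nat_eq_iff)
qed (simp only: f_pow_zero)

lemma Dn_eb_pow:
  "4 *\<^sub>c Dn (of_nat (n + 2 * Suc k)) ((eb ^^ Suc k) v) =
     (of_nat (n + 2 * Suc k) * of_nat (n + 2 * Suc k) * \<zeta> - c * c) *\<^sub>c (eb ^^ k) v"
proof -
  have "of_nat (n + 2 * Suc k) = (of_nat (n + 2 * k) + 2 :: complex)" by simp
  then show ?thesis
    using Dn_eb[OF hw_eb_pow, of k]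
    by (simp add: Cbar_eb_pow Cmix_eb_pow clinear.cscale[OF linear_Cmix] cvec.scale_left_diff_distrib ac_simps)
qed

lemma generated_base: "(f ^^ i) ((eb ^^ k) v) \<in> gspan v"
  unfolding gspan_def by (rule cvec.span_base) auto

lemma subspace_generated: "cvec.subspace (gspan v)"
  by (simp add: gspan_def)

lemma generated_linear_image:
  assumes "clinear A" "\<And>i k. A ((f ^^ i) ((eb ^^ k) v)) \<in> W" "cvec.subspace W" "w \<in> gspan v"
  shows "A w \<in> W"
  by (rule clinear.span_image_subset[OF assms(1) assms(4)[unfolded gspan_def]]) (use assms in auto)

lemma fstring_subset_generated: "fstring ((eb ^^ k) v) \<subseteq> gspan v"
  unfolding fstring_def gspan_def by (rule cvec.span_mono) auto

lemma generated_g_invariant: "invariant_subspace (\<lambda>a. \<rho> (in_g a)) (gspan v)"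
proof (rule g_invariantI[OF subspace_generated])
  have "\<rho> (in_g a) ((f ^^ i) ((eb ^^ k) v)) \<in> gspan v" for a i k
    using fstring_invariant[OF hw_eb_pow, of k] f_pow_in_fstring[of i "(eb ^^ k) v"] fstring_subset_generated[of k]
    by (auto simp: invariant_subspace_def)
  then show "w \<in> gspan v \<Longrightarrow> e w \<in> gspan v" "w \<in> gspan v \<Longrightarrow> f w \<in> gspan v"
    "w \<in> gspan v \<Longrightarrow> h w \<in> gspan v" for w
    using generated_linear_image[OF rep_linear _ subspace_generated] by blast+
qed

text \<open>The vectors that the ideal maps into the span form a \<open>g\<close>-stable subspace, so only highest
  weight vectors have to be checked.\<close>

lemma generated_invariant: "invariant_subspace \<rho> (gspan v)"
proof -
  let ?N = "gspan v"
  define N' where "N' = {w \<in> ?N. eb w \<in> ?N \<and> hb w \<in> ?N \<and> fb w \<in> ?N}"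
  note add = cvec.subspace_add[OF subspace_generated] and diff = cvec.subspace_diff[OF subspace_generated]
    and scale = cvec.subspace_scale[OF subspace_generated]
  have g: "e w \<in> ?N" "f w \<in> ?N" "h w \<in> ?N" if "w \<in> ?N" for w
    using generated_g_invariant that by (auto simp: invariant_subspace_def)
  have sub: "cvec.subspace N'"
    unfolding N'_def by (rule cvec.subspaceI)
      (auto simp: rep_simps add scale cvec.subspace_0[OF subspace_generated])
  have f: "f w \<in> N'" if "w \<in> N'" for w
    using that by (auto simp: N'_def pbw g add diff scale)
  have top: "(eb ^^ k) v \<in> N'" for k
  proof -
    define m u where "m = (of_nat (n + 2 * k) :: complex)" and "u = (eb ^^ k) v"
    have hw: "hw m u" using hw_eb_pow by (simp add: m_def u_def)
    have "m + 2 = of_nat (Suc (Suc (n + 2 * k)))" by (simp add: m_def)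
    then have m2: "m + 2 \<noteq> 0" by (metis of_nat_eq_0_iff nat.distinct(2))
    have u: "u \<in> ?N" using generated_base[of 0 k] by (simp add: u_def)
    have eb: "eb u \<in> ?N" using generated_base[of 0 "Suc k"] by (simp add: u_def)
    have "(m + 2) *\<^sub>c hb u = c *\<^sub>c u - 2 *\<^sub>c f (eb u)"
      using Cmix_hw[OF hw] Cmix_eb_pow[of k] by (simp add: u_def)
    then have "hb u = (1 / (m + 2)) *\<^sub>c (c *\<^sub>c u - 2 *\<^sub>c f (eb u))"
      using m2 by (metis cvec.scale_scale nonzero_divide_eq_eq cvec.scale_one)
    then have hb: "hb u \<in> ?N" using u eb g by (simp only: scale diff)
    \<comment> \<open>\<open>fb u\<close> is recovered from \<open>Dn m u\<close>, in which its
      coefficient m (m + 1) vanishes at m = 0. There u is v itself, \<open>f v = 0\<close>, and the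
      commutator of \<open>hb\<close> and \<open>f\<close> applied to v gives \<open>fb v\<close>
      instead.\<close>
    have fb: "fb u \<in> ?N"
    proof (cases "m = 0")
      case True
      then have "n = 0" "k = 0" by (simp_all add: m_def flip: of_nat_add)
      then have "f u = 0" using gen by (simp add: generator_def u_def)
      then have "2 *\<^sub>c fb u = f (hb u)" using pbw(2)[of u] by (simp add: rep_simps)
      then have "fb u = (1 / 2) *\<^sub>c f (hb u)"
        by (metis cvec.scale_scale nonzero_divide_eq_eq cvec.scale_one zero_neq_numeral)
      then show ?thesis using g hb by (simp only: scale)
    next
      case False
      have "m + 1 = of_nat (Suc (n + 2 * k))" by (simp add: m_def)
      then have m1: "m + 1 \<noteq> 0" by (metis of_nat_eq_0_iff nat.distinct(2))
      have "Dn m u \<in> ?N"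
      proof (cases k)
        case 0
        then show ?thesis using gen by (simp add: generator_def m_def u_def cvec.subspace_0[OF subspace_generated])
      next
        case (Suc j)
        have "4 *\<^sub>c Dn m u = (m * m * \<zeta> - c * c) *\<^sub>c (eb ^^ j) v"
          using Dn_eb_pow[of j] unfolding m_def u_def Suc .
        then have "Dn m u = (1 / 4) *\<^sub>c (m * m * \<zeta> - c * c) *\<^sub>c (eb ^^ j) v"
          by (metis cvec.scale_scale nonzero_divide_eq_eq cvec.scale_one zero_neq_numeral)
        then show ?thesis using generated_base[of 0 j] by (simp only: scale funpow_0)
      qed
      then show ?thesis using g hb eb by (subst fb_of_Dn[OF False m1]) (simp only: scale add)
    qed
    show ?thesis using u eb hb fb by (simp add: N'_def u_def)
  qed
  have "(f ^^ i) ((eb ^^ k) v) \<in> N'" for i k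
    by (induction i) (simp_all add: top f)
  then have "?N \<subseteq> N'" unfolding gspan_def using sub by (intro cvec.span_minimal) auto
  then show ?thesis using g by (intro invariantI subspace_generated) (auto simp: N'_def)
qed

lemma generator_in_generated: "v \<in> gspan v"
  using generated_base[of 0 0] by simp

lemma generated_f_nilpotent: "w \<in> gspan v \<Longrightarrow> \<exists>N. (f ^^ N) w = 0"
proof -
  assume "w \<in> gspan v"
  let ?W = "{v. \<exists>N. (f ^^ N) v = 0}"
  have "(f ^^ i) ((eb ^^ k) v) \<in> ?W" for i k
    using f_pow_le[OF eb_pow_f_nilpotent[of k], of "Suc (n + 2 * k) + i"]
    by (auto simp: funpow_add intro!: exI[of _ "Suc (n + 2 * k)"])
  then have "gspan v \<subseteq> ?W"
    unfolding gspan_def using f_nilpotent_invariant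
    by (intro cvec.span_minimal) (auto simp: invariant_subspace_def)
  then show ?thesis using \<open>w \<in> gspan v\<close> by blast
qed

lemma Omega_f_eb_pow:
  "Omega ((f ^^ i) ((eb ^^ k) v)) = (of_nat (n + 2 * k) * (of_nat (n + 2 * k) + 2)) *\<^sub>c (f ^^ i) ((eb ^^ k) v)"
  by (induction i) (simp_all only: funpow_0 funpow.simps(2) comp_apply Omega_commute Omega_hw[OF hw_eb_pow] rep_simps)

text \<open>Two operators select the members of the spanning set that can occur: the Casimir
  eigenvalue determines k, and then the weight forces i = 0. So each weight n + 2 k carries at most
  one line of highest weight vectors.\<close>

lemma hw_in_generated:
  assumes "w \<in> gspan v" "hw m w" "w \<noteq> 0"
  obtains k a where "m = of_nat (n + 2 * k)" "w = a *\<^sub>c (eb ^^ k) v" "a \<noteq> 0" "(eb ^^ k) v \<noteq> 0"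
proof -
  \<comment> \<open>The weight must be known to be a natural number, because x (x + 2) is injective
    there and not on the complex numbers.\<close>
  obtain N where "(f ^^ N) w = 0" using generated_f_nilpotent assms(1) by blast
  then obtain l where l: "m = of_nat l" using hw_f_nilpotent assms(2,3) by metis
  let ?G = "{(f ^^ i) ((eb ^^ k) v) | i k. True}"
  let ?G1 = "{g \<in> ?G. Omega g = (m * (m + 2)) *\<^sub>c g}"
  have w1: "w \<in> cvec.span ?G1"
    by (rule span_eigenvectors_eigenspace[OF linear_Omega _ assms(1)[unfolded gspan_def] Omega_hw[OF assms(2)]])
      (use Omega_f_eb_pow in blast)
  have "w \<in> cvec.span {g \<in> ?G1. h g = m *\<^sub>c g}"
  proof (rule span_eigenvectors_eigenspace[OF rep_linear _ w1])
    show "\<exists>b. h g = b *\<^sub>c g" if "g \<in> ?G1" for g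
      using that f_pow_hw(1)[OF hw_eb_pow] by auto
    show "h w = m *\<^sub>c w" using assms(2) by (simp add: hw_def)
  qed
  moreover have "g = 0 \<or> (\<exists>k. g = (eb ^^ k) v \<and> l = n + 2 * k)" if gG: "g \<in> ?G1" "h g = m *\<^sub>c g" for g
  proof (cases "g = 0")
    case False
    then have "g \<noteq> 0" .
    obtain i k where g: "g = (f ^^ i) ((eb ^^ k) v)" using gG by blast
    have "(m * (m + 2)) *\<^sub>c g = (of_nat (n + 2 * k) * (of_nat (n + 2 * k) + 2)) *\<^sub>c g"
      using gG(1) Omega_f_eb_pow[of i k, folded g] by (metis (mono_tags, lifting) mem_Collect_eq)
    then have "m * (m + 2) = of_nat (n + 2 * k) * (of_nat (n + 2 * k) + 2)"
      using \<open>g \<noteq> 0\<close> by (rule cvec.scale_right_imp_eq[rotated])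
    then have "(of_nat (l * (l + 2)) :: complex) = of_nat ((n + 2 * k) * ((n + 2 * k) + 2))"
      unfolding l by (simp only: of_nat_mult of_nat_add of_nat_numeral)
    then have eq: "l * (l + 2) = (n + 2 * k) * ((n + 2 * k) + 2)" by (simp only: of_nat_eq_iff)
    have lk: "l = n + 2 * k"
    proof (rule ccontr)
      assume "l \<noteq> n + 2 * k"
      then consider "l < n + 2 * k" | "n + 2 * k < l" by linarith
      then show False
      proof cases
        case 1
        then have "l * (l + 2) < (n + 2 * k) * ((n + 2 * k) + 2)" by (intro mult_strict_mono) auto
        then show ?thesis using eq by simp
      next
        case 2
        then have "(n + 2 * k) * ((n + 2 * k) + 2) < l * (l + 2)" by (intro mult_strict_mono) auto
        then show ?thesis using eq by simp
      qed
    qed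
    have "m *\<^sub>c g = (of_nat (n + 2 * k) - 2 * of_nat i) *\<^sub>c g"
      using f_pow_hw(1)[OF hw_eb_pow, of i k, folded g] gG(2) by metis
    then have "m = of_nat (n + 2 * k) - 2 * of_nat i"
      using \<open>g \<noteq> 0\<close> by (rule cvec.scale_right_imp_eq[rotated])
    then have "i = 0" using l lk by simp
    then show ?thesis using g lk by auto
  qed simp
  ultimately have "w \<in> cvec.span (insert 0 {(eb ^^ k) v | k. l = n + 2 * k})"
    by (elim subsetD[OF cvec.span_mono, rotated]) blast
  then have w: "w \<in> cvec.span {(eb ^^ k) v | k. l = n + 2 * k}" by (simp add: cvec.span_insert_0)
  then obtain k where k: "l = n + 2 * k" using assms(3) by (cases "\<exists>k. l = n + 2 * k") auto
  then have "{(eb ^^ k) v | k. l = n + 2 * k} = {(eb ^^ k) v}" by auto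
  then obtain a where "w = a *\<^sub>c (eb ^^ k) v" using w by (auto simp: cvec.span_singleton)
  then show ?thesis using that k l assms(3) by (metis cvec.scale_zero_left cvec.scale_zero_right)
qed

text \<open>Each spanning vector lies in a finite-dimensional string, and finitely many strings
  suffice for one vector.\<close>

lemma generated_locally_finite:
  assumes "w \<in> gspan v"
  obtains Y where "fd Y" "invariant_subspace (\<lambda>a. \<rho> (in_g a)) Y" "w \<in> Y" "Y \<subseteq> gspan v"
proof -
  let ?P = "\<lambda>w. \<exists>Y. fd Y \<and> invariant_subspace (\<lambda>a. \<rho> (in_g a)) Y \<and> w \<in> Y \<and> Y \<subseteq> gspan v"
  have "?P w"
    using assms unfolding gspan_def[of v]
  proof (induction rule: cvec.span_induct_alt)
    case base
    have "invariant_subspace (\<lambda>a. \<rho> (in_g a)) {0}" by (simp add: invariant_subspace_def rep_simps cvec.subspace_single_0)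
    moreover have "fd {0::'a}" unfolding fd_def by (intro exI[of _ "{}"]) (simp add: cvec.span_empty)
    ultimately show ?case using cvec.subspace_0[OF subspace_generated]
      by (intro exI[of _ "{0}"]) (auto simp: gspan_def)
  next
    case (step b x y)
    then obtain Y where Y: "fd Y" "invariant_subspace (\<lambda>a. \<rho> (in_g a)) Y" "y \<in> Y" "Y \<subseteq> gspan v"
      by (auto simp: gspan_def)
    obtain i k where x: "x = (f ^^ i) ((eb ^^ k) v)" using step by blast
    let ?Z = "cvec.span (fstring ((eb ^^ k) v) \<union> Y)"
    have "fd ?Z" using fd_fstring[OF eb_pow_f_nilpotent] Y(1) by (rule fd_span_Un)
    moreover have "invariant_subspace (\<lambda>a. \<rho> (in_g a)) ?Z"
      unfolding invariant_subspace_def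
    proof (intro conjI allI ballI)
      fix a w assume w: "w \<in> ?Z"
      show "\<rho> (in_g a) w \<in> ?Z"
        by (rule clinear.span_image_subset[OF rep_linear w])
          (use Y(2) fstring_invariant[OF hw_eb_pow] in \<open>auto simp: invariant_subspace_def intro!: cvec.span_base\<close>)
    qed simp
    moreover have "b *\<^sub>c x + y \<in> ?Z"
      unfolding x using Y(3) f_pow_in_fstring by (intro cvec.span_add cvec.span_scale cvec.span_base) auto
    moreover have "?Z \<subseteq> gspan v"
      using fstring_subset_generated Y(4) subspace_generated by (intro cvec.span_minimal) auto
    ultimately show ?case by (auto simp: gspan_def)
  qed
  then show ?thesis using that by blast
qed

text \<open>Since c^2 = n^2 \<open>\<zeta>\<close>, the descent by \<open>Dn\<close> from eb^(k+1) v
  to eb^k v has the factor ((n + 2 k + 2)^2 - n^2) \<open>\<zeta>\<close> / 4, nonzero because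
  \<open>\<zeta>\<close> is.\<close>

lemma eb_pow_Dn_closed:
  assumes "\<zeta> \<noteq> 0" "v \<noteq> 0" "invariant_subspace \<rho> W" "(eb ^^ k) v \<in> W"
  shows "v \<in> W"
  using assms(4)
proof (induction k)
  case (Suc k)
  have "Dn (of_nat (n + 2 * Suc k)) ((eb ^^ Suc k) v) \<in> W"
    using Suc.prems assms(3) unfolding Dn_def invariant_subspace_def
    by (intro cvec.subspace_diff cvec.subspace_scale) auto
  then have mem: "(of_nat (n + 2 * Suc k) * of_nat (n + 2 * Suc k) * \<zeta> - c * c) *\<^sub>c (eb ^^ k) v \<in> W"
    using assms(3) cvec.subspace_scale[of W _ 4] unfolding invariant_subspace_def Dn_eb_pow[symmetric] by blast
  have "(of_nat (n + 2 * Suc k) * of_nat (n + 2 * Suc k) :: complex) \<noteq> of_nat n * of_nat n"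
  proof -
    have "n * n < (n + 2 * Suc k) * (n + 2 * Suc k)" by (intro mult_strict_mono) auto
    then show ?thesis by (metis of_nat_mult of_nat_eq_iff less_irrefl)
  qed
  then have nz: "of_nat (n + 2 * Suc k) * of_nat (n + 2 * Suc k) * \<zeta> - c * c \<noteq> 0"
    using assms(1) generator_scalars[OF assms(2)] by simp
  have "(eb ^^ k) v \<in> W"
    using cvec.subspace_scale[OF _ mem, of "inverse (of_nat (n + 2 * Suc k) * of_nat (n + 2 * Suc k) * \<zeta> - c * c)"]
      assms(3) nz by (simp add: invariant_subspace_def)
  then show ?case by (rule Suc.IH)
qed simp

lemma generated_minimal: "invariant_subspace \<rho> W \<Longrightarrow> v \<in> W \<Longrightarrow> gspan v \<subseteq> W"
proof -
  assume W: "invariant_subspace \<rho> W" "v \<in> W"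
  have "(eb ^^ k) v \<in> W" for k by (induction k) (use W in \<open>auto simp: invariant_subspace_def\<close>)
  then have "(f ^^ i) ((eb ^^ k) v) \<in> W" for i k
    by (induction i) (use W in \<open>auto simp: invariant_subspace_def\<close>)
  then show ?thesis unfolding gspan_def using W
    by (intro cvec.span_minimal) (auto simp: invariant_subspace_def)
qed

text \<open>A nonzero submodule meets some finite-dimensional sl2-stable subspace nontrivially,
  hence contains a highest weight vector. That vector is a multiple of some eb^j v, and
  \<open>Dn\<close> brings it down to the generator.\<close>

lemma generated_irreducible:
  assumes "\<zeta> \<noteq> 0" "v \<noteq> 0" "invariant_subspace \<rho> W" "W \<subseteq> gspan v" "W \<noteq> {0}"
  shows "W = gspan v"
proof -
  have sub: "cvec.subspace W" using assms(3) by (simp add: invariant_subspace_def)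
  then obtain w where w: "w \<in> W" "w \<noteq> 0" using assms(5) cvec.subspace_0 by blast
  obtain Y where Y: "fd Y" "invariant_subspace (\<lambda>a. \<rho> (in_g a)) Y" "w \<in> Y"
    using generated_locally_finite w assms(4) by blast
  have "fd (Y \<inter> W)" by (rule fd_subset[OF Y(1)]) auto
  moreover have "invariant_subspace (\<lambda>a. \<rho> (in_g a)) (Y \<inter> W)"
    using Y(2) assms(3) by (auto simp: invariant_subspace_def intro: cvec.subspace_inter)
  ultimately obtain k u where u: "u \<in> Y \<inter> W" "u \<noteq> 0" "hw (of_nat k) u"
    using exists_hw[of "Y \<inter> W"] w Y(3) by blast
  then obtain j a where "u = a *\<^sub>c (eb ^^ j) v" "a \<noteq> 0"
    using hw_in_generated[of u "of_nat k"] assms(4) by blast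
  then have "(eb ^^ j) v \<in> W"
    using u(1) cvec.subspace_scale[OF sub, of u "inverse a"] by simp
  then show ?thesis
    using eb_pow_Dn_closed[OF assms(1,2,3)] generated_minimal assms(3,4) by blast
qed

end

end


section \<open>Charts of modules\<close>

text \<open>A chart identifies a module given by a record with a subspace of a complex vector space type.\<close>

locale chart =
  fixes V :: "('l::complex_lie_algebra, 'v) lie_module" and \<phi> :: "'v \<Rightarrow> 'a::complex_vector"
    and \<rho> :: "'l \<Rightarrow> 'a \<Rightarrow> 'a"
  assumes inj: "inj_on \<phi> (carrier V)"
    and zero: "\<zero>\<^bsub>V\<^esub> \<in> carrier V" "\<phi> \<zero>\<^bsub>V\<^esub> = 0"
    and add: "v \<in> carrier V \<Longrightarrow> w \<in> carrier V \<Longrightarrow> v \<oplus>\<^bsub>V\<^esub> w \<in> carrier V"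
      "v \<in> carrier V \<Longrightarrow> w \<in> carrier V \<Longrightarrow> \<phi> (v \<oplus>\<^bsub>V\<^esub> w) = \<phi> v + \<phi> w"
    and smult: "v \<in> carrier V \<Longrightarrow> c \<odot>\<^bsub>V\<^esub> v \<in> carrier V"
      "v \<in> carrier V \<Longrightarrow> \<phi> (c \<odot>\<^bsub>V\<^esub> v) = c *\<^sub>c \<phi> v"
    and lact: "v \<in> carrier V \<Longrightarrow> lact V x v \<in> carrier V"
      "v \<in> carrier V \<Longrightarrow> \<phi> (lact V x v) = \<rho> x (\<phi> v)"
begin

lemma eq_iff: "v \<in> carrier V \<Longrightarrow> w \<in> carrier V \<Longrightarrow> \<phi> v = \<phi> w \<longleftrightarrow> v = w"
  using inj by (auto simp: inj_on_def)

lemma eq_zero_iff: "v \<in> carrier V \<Longrightarrow> \<phi> v = 0 \<longleftrightarrow> v = \<zero>\<^bsub>V\<^esub>"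
  using eq_iff[OF _ zero(1)] zero(2) by simp

lemma subspace_image: "cvec.subspace (\<phi> ` carrier V)"
proof (rule cvec.subspaceI)
  show "0 \<in> \<phi> ` carrier V" using zero by (metis imageI)
  show "x \<in> \<phi> ` carrier V \<Longrightarrow> y \<in> \<phi> ` carrier V \<Longrightarrow> x + y \<in> \<phi> ` carrier V" for x y
    by (auto simp flip: add(2) intro!: imageI add(1))
  show "x \<in> \<phi> ` carrier V \<Longrightarrow> c *\<^sub>c x \<in> \<phi> ` carrier V" for x c
    by (auto simp flip: smult(2) intro!: imageI smult(1))
qed

text \<open>The module axioms are equations, so they hold in V as soon as they hold after the
  injective map.\<close>

lemma module: "Module.module complex_ring V"
proof (rule Module.moduleI[OF cring_complex_ring])
  show "abelian_group V"
  proof (rule abelian_groupI)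
    fix v assume v: "v \<in> carrier V"
    show "\<exists>w\<in>carrier V. w \<oplus>\<^bsub>V\<^esub> v = \<zero>\<^bsub>V\<^esub>"
      using v by (intro bexI[of _ "(-1) \<odot>\<^bsub>V\<^esub> v"]) (simp_all add: smult add flip: eq_zero_iff)
  qed (simp_all add: add zero add.assoc add.commute flip: eq_iff)
qed (simp_all add: complex_ring_def smult add cscale_add_right cscale_add_left flip: eq_iff)

lemma a_inv: assumes "v \<in> carrier V" shows "\<ominus>\<^bsub>V\<^esub> v = (-1) \<odot>\<^bsub>V\<^esub> v"
proof -
  interpret M: Module.module complex_ring V by (rule module)
  show ?thesis using assms by (intro M.minus_equality) (simp_all add: smult add zero flip: eq_iff)
qed

lemma a_inv_image: "v \<in> carrier V \<Longrightarrow> \<ominus>\<^bsub>V\<^esub> v \<in> carrier V" "v \<in> carrier V \<Longrightarrow> \<phi> (\<ominus>\<^bsub>V\<^esub> v) = - \<phi> v"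
  by (simp_all add: a_inv smult)

lemma lie_module: "lie_rep \<rho> \<Longrightarrow> lie_module V"
proof -
  assume "lie_rep \<rho>"
  then interpret lie_rep \<rho> .
  show ?thesis
    by (intro lie_module.intro module lie_module_axioms.intro)
      (simp_all add: lact add smult a_minus_def a_inv_image rep_simps rep_add rep_cscale rep_bracket flip: eq_iff)
qed

lemma submodule_iff: "submodule W complex_ring V \<longleftrightarrow> W \<subseteq> carrier V \<and> cvec.subspace (\<phi> ` W)"
proof
  interpret M: Module.module complex_ring V by (rule module)
  {
    assume W: "submodule W complex_ring V"
    note E = M.submoduleE[OF W]
    have car: "W \<subseteq> carrier V" by (rule E(1))
    have "cvec.subspace (\<phi> ` W)"
    proof (rule cvec.subspaceI)
      obtain w where w: "w \<in> W" using E(2) by blast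
      then have "0 \<odot>\<^bsub>V\<^esub> w \<in> W" using E(4) by (simp add: complex_ring_def)
      moreover have "\<phi> (0 \<odot>\<^bsub>V\<^esub> w) = 0" using w car by (simp add: smult subset_iff)
      ultimately show "0 \<in> \<phi> ` W" by (metis imageI)
      show "x + y \<in> \<phi> ` W" if "x \<in> \<phi> ` W" "y \<in> \<phi> ` W" for x y
      proof -
        obtain v w where "v \<in> W" "w \<in> W" "x = \<phi> v" "y = \<phi> w" using \<open>x \<in> \<phi> ` W\<close> \<open>y \<in> \<phi> ` W\<close> by blast
        then show ?thesis using car add(2)[of v w] E(5)[of v w] by (metis imageI subsetD)
      qed
      show "c *\<^sub>c x \<in> \<phi> ` W" if "x \<in> \<phi> ` W" for x c
      proof -
        obtain v where "v \<in> W" "x = \<phi> v" using \<open>x \<in> \<phi> ` W\<close> by blast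
        then show ?thesis using car smult(2)[of v c] E(4)[of c v] by (metis UNIV_I complex_ring_def imageI partial_object.select_convs(1) subsetD)
      qed
    qed
    then show "W \<subseteq> carrier V \<and> cvec.subspace (\<phi> ` W)" using car by blast
  }
  assume W: "W \<subseteq> carrier V \<and> cvec.subspace (\<phi> ` W)"
  then have mem: "w \<in> W" if "w \<in> carrier V" "\<phi> w \<in> \<phi> ` W" for w
    using that inj by (auto simp: inj_on_def)
  have car: "w \<in> carrier V" if "w \<in> W" for w using W that by blast
  note sub = cvec.subspace_add cvec.subspace_scale cvec.subspace_neg cvec.subspace_0
  show "submodule W complex_ring V"
  proof (rule M.submoduleI)
    show "W \<subseteq> carrier V" using W by blast
    show "\<zero>\<^bsub>V\<^esub> \<in> W" using W by (intro mem) (auto simp: zero sub)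
    show "w \<in> W \<Longrightarrow> \<ominus>\<^bsub>V\<^esub> w \<in> W" for w using W by (intro mem) (auto simp: car a_inv_image sub)
    show "w \<in> W \<Longrightarrow> w' \<in> W \<Longrightarrow> w \<oplus>\<^bsub>V\<^esub> w' \<in> W" for w w' using W by (intro mem) (auto simp: car add sub)
    show "w \<in> W \<Longrightarrow> c \<odot>\<^bsub>V\<^esub> w \<in> W" for w c using W by (intro mem) (auto simp: car smult sub)
  qed
qed

lemma lie_submodule_iff: "lie_submodule W V \<longleftrightarrow> W \<subseteq> carrier V \<and> invariant_subspace \<rho> (\<phi> ` W)"
proof (cases "W \<subseteq> carrier V \<and> cvec.subspace (\<phi> ` W)")
  case True
  then have "lact V x w \<in> W \<longleftrightarrow> \<rho> x (\<phi> w) \<in> \<phi> ` W" if "w \<in> W" for x w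
    using that inj_on_image_mem_iff[OF inj, of "lact V x w" W] by (auto simp: lact subset_iff)
  then show ?thesis using True by (auto simp: lie_submodule_def submodule_iff invariant_subspace_def)
qed (auto simp: lie_submodule_def submodule_iff invariant_subspace_def)

definition pull :: "'a set \<Rightarrow> 'v set" where "pull W = {v \<in> carrier V. \<phi> v \<in> W}"

lemma image_pull: "W \<subseteq> \<phi> ` carrier V \<Longrightarrow> \<phi> ` pull W = W"
  by (auto simp: pull_def)

lemma pull_image: "W \<subseteq> carrier V \<Longrightarrow> pull (\<phi> ` W) = W"
  using inj by (auto simp: pull_def inj_on_def subset_iff)

lemma simple_iff:
  assumes "lie_rep \<rho>"
  shows "simple_lie_module V \<longleftrightarrow> \<phi> ` carrier V \<noteq> {0} \<and>
     (\<forall>W. invariant_subspace \<rho> W \<and> W \<subseteq> \<phi> ` carrier V \<longrightarrow> W = {0} \<or> W = \<phi> ` carrier V)"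
proof -
  have z: "W = {\<zero>\<^bsub>V\<^esub>} \<longleftrightarrow> \<phi> ` W = {0}" if "W \<subseteq> carrier V" for W
  proof -
    have "\<phi> ` W = \<phi> ` {\<zero>\<^bsub>V\<^esub>} \<longleftrightarrow> W = {\<zero>\<^bsub>V\<^esub>}"
      by (rule inj_on_image_eq_iff[OF inj that]) (simp add: zero)
    then show ?thesis by (simp add: zero)
  qed
  have c: "W = carrier V \<longleftrightarrow> \<phi> ` W = \<phi> ` carrier V" if "W \<subseteq> carrier V" for W
    using inj_on_image_eq_iff[OF inj that, of "carrier V"] by auto
  have "(\<forall>W. W \<subseteq> carrier V \<and> invariant_subspace \<rho> (\<phi> ` W) \<longrightarrow> W = {\<zero>\<^bsub>V\<^esub>} \<or> W = carrier V) \<longleftrightarrow>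
      (\<forall>W. invariant_subspace \<rho> W \<and> W \<subseteq> \<phi> ` carrier V \<longrightarrow> W = {0} \<or> W = \<phi> ` carrier V)"
  proof (intro iffI allI impI)
    fix W assume *: "\<forall>W. W \<subseteq> carrier V \<and> invariant_subspace \<rho> (\<phi> ` W) \<longrightarrow> W = {\<zero>\<^bsub>V\<^esub>} \<or> W = carrier V"
      and "invariant_subspace \<rho> W \<and> W \<subseteq> \<phi> ` carrier V"
    then have W: "pull W \<subseteq> carrier V" "invariant_subspace \<rho> (\<phi> ` pull W)" "\<phi> ` pull W = W"
      by (auto simp: image_pull) (simp add: pull_def)
    then have "pull W = {\<zero>\<^bsub>V\<^esub>} \<or> pull W = carrier V" using * by blast
    then show "W = {0} \<or> W = \<phi> ` carrier V" using z[OF W(1)] c[OF W(1)] W(3) by simp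
  next
    fix W assume *: "\<forall>W. invariant_subspace \<rho> W \<and> W \<subseteq> \<phi> ` carrier V \<longrightarrow> W = {0} \<or> W = \<phi> ` carrier V"
      and "W \<subseteq> carrier V \<and> invariant_subspace \<rho> (\<phi> ` W)"
    then have W: "W \<subseteq> carrier V" "invariant_subspace \<rho> (\<phi> ` W)" "\<phi> ` W \<subseteq> \<phi> ` carrier V" by blast+
    then have "\<phi> ` W = {0} \<or> \<phi> ` W = \<phi> ` carrier V" using * by blast
    then show "W = {\<zero>\<^bsub>V\<^esub>} \<or> W = carrier V" using z[OF W(1)] c[OF W(1)] by simp
  qed
  then show ?thesis
    unfolding simple_lie_module_def lie_submodule_iff using lie_module[OF assms] z[OF order_refl] by simp
qed

lemma lin_span_eq: assumes "B \<subseteq> carrier V" shows "lin_span V B = pull (cvec.span (\<phi> ` B))"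
proof
  have sub: "cvec.span (\<phi> ` B) \<subseteq> \<phi> ` carrier V"
    using assms by (intro cvec.span_minimal subspace_image) auto
  then have "submodule (pull (cvec.span (\<phi> ` B))) complex_ring V"
    unfolding submodule_iff image_pull[OF sub] by (auto simp: pull_def)
  moreover have "B \<subseteq> pull (cvec.span (\<phi> ` B))"
    using assms by (auto simp: pull_def intro: cvec.span_base)
  ultimately show "lin_span V B \<subseteq> pull (cvec.span (\<phi> ` B))" unfolding lin_span_def by blast
  have "pull (cvec.span (\<phi> ` B)) \<subseteq> W" if "submodule W complex_ring V" "B \<subseteq> W" for W
  proof -
    have W: "W \<subseteq> carrier V" "cvec.subspace (\<phi> ` W)" using that by (auto simp: submodule_iff)
    then have "cvec.span (\<phi> ` B) \<subseteq> \<phi> ` W" using that by (intro cvec.span_minimal) auto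
    then show ?thesis using pull_image[OF W(1)] by (auto simp: pull_def)
  qed
  then show "pull (cvec.span (\<phi> ` B)) \<subseteq> lin_span V B" unfolding lin_span_def by blast
qed

lemma finite_dim_iff: "finite_dim V \<longleftrightarrow> fd (\<phi> ` carrier V)"
proof
  assume "finite_dim V"
  then obtain B where B: "finite B" "B \<subseteq> carrier V" "lin_span V B = carrier V"
    unfolding finite_dim_def by blast
  then have "\<phi> ` carrier V \<subseteq> cvec.span (\<phi> ` B)" using lin_span_eq[OF B(2)] by (auto simp: pull_def)
  then show "fd (\<phi> ` carrier V)" unfolding fd_def using B(1) by blast
next
  assume "fd (\<phi> ` carrier V)"
  then have "fd (cvec.span (\<phi> ` carrier V))" using subspace_image by (metis cvec.span_eq_iff)
  then obtain C where C: "finite C" "C \<subseteq> \<phi> ` carrier V" "cvec.span C = cvec.span (\<phi> ` carrier V)"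
    by (rule fd_imp_span_finite_subset)
  obtain B where B: "B \<subseteq> carrier V" "finite B" "C = \<phi> ` B"
    using C(1,2) by (metis finite_subset_image)
  have "lin_span V B = carrier V"
    unfolding lin_span_eq[OF B(1)] using C(3) B(3) by (auto simp: pull_def intro: cvec.span_base)
  then show "finite_dim V" unfolding finite_dim_def using B by blast
qed

lemma finsum_image:
  "finite A \<Longrightarrow> (\<And>i. i \<in> A \<Longrightarrow> g i \<in> carrier V) \<Longrightarrow>
     finsum V g A \<in> carrier V \<and> \<phi> (finsum V g A) = (\<Sum>i\<in>A. \<phi> (g i))"
proof (induction A rule: finite_induct)
  interpret M: Module.module complex_ring V by (rule module)
  {
    case empty
    then show ?case by (simp add: zero)
  next
    case (insert i A)
    then show ?case by (simp add: M.finsum_insert Pi_iff add)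
  }
qed

lemma restrict_carrier:
  assumes "W \<subseteq> carrier V" "invariant_subspace \<rho> (\<phi> ` W)"
  shows "chart (V\<lparr>carrier := W\<rparr>) \<phi> \<rho>"
proof -
  have "lie_submodule W V" using assms by (simp add: lie_submodule_iff)
  then have sub: "submodule W complex_ring V" and act: "\<And>x w. w \<in> W \<Longrightarrow> lact V x w \<in> W"
    by (auto simp: lie_submodule_def)
  interpret M: Module.module complex_ring V by (rule module)
  have 0: "0 \<in> \<phi> ` W" using assms(2) by (simp add: invariant_subspace_def cvec.subspace_0)
  then have "\<zero>\<^bsub>V\<^esub> \<in> W" using assms(1) zero by (metis eq_zero_iff image_iff subsetD)
  moreover have "v \<in> W \<Longrightarrow> c \<odot>\<^bsub>V\<^esub> v \<in> W" for v c
    using M.submoduleE(4)[OF sub] by (simp add: complex_ring_def)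
  ultimately show ?thesis
    using assms(1) act M.submoduleE(5)[OF sub]
    by unfold_locales (auto simp: zero add smult lact inj_on_subset[OF inj] subset_iff)
qed

end

section \<open>Isomorphisms expressed through charts\<close>

lemma lie_iso_of_charts:
  assumes "chart V \<phi> \<rho>" "chart W \<psi> \<sigma>"
    and \<theta>: "bij_betw \<theta> (\<phi> ` carrier V) (\<psi> ` carrier W)"
      "\<And>u w. u \<in> \<phi> ` carrier V \<Longrightarrow> w \<in> \<phi> ` carrier V \<Longrightarrow> \<theta> (u + w) = \<theta> u + \<theta> w"
      "\<And>c u. u \<in> \<phi> ` carrier V \<Longrightarrow> \<theta> (c *\<^sub>c u) = c *\<^sub>c \<theta> u"
      "\<And>x u. u \<in> \<phi> ` carrier V \<Longrightarrow> \<theta> (\<rho> x u) = \<sigma> x (\<theta> u)"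
  shows "lie_iso V W"
proof -
  interpret V: chart V \<phi> \<rho> by fact
  interpret W: chart W \<psi> \<sigma> by fact
  define \<eta> where "\<eta> v = inv_into (carrier W) \<psi> (\<theta> (\<phi> v))" for v
  have mem: "\<theta> (\<phi> v) \<in> \<psi> ` carrier W" if "v \<in> carrier V" for v
    using \<theta>(1) that by (auto simp: bij_betw_def)
  have \<eta>: "\<eta> v \<in> carrier W" "\<psi> (\<eta> v) = \<theta> (\<phi> v)" if "v \<in> carrier V" for v
    using mem[OF that] by (simp_all add: \<eta>_def inv_into_into f_inv_into_f)
  have "bij_betw (inv_into (carrier W) \<psi> \<circ> (\<theta> \<circ> \<phi>)) (carrier V) (carrier W)"
    using V.inj W.inj \<theta>(1)
    by (intro bij_betw_trans bij_betw_inv_into) (auto simp: bij_betw_def)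
  then have "bij_betw \<eta> (carrier V) (carrier W)" by (simp add: \<eta>_def[abs_def] comp_def)
  then show ?thesis
    unfolding lie_iso_def
    by (intro exI[of _ \<eta>] conjI ballI allI)
      (simp_all add: \<eta> \<theta>(2-4) V.add V.smult V.lact W.add W.smult W.lact flip: W.eq_iff)
qed

text \<open>The chart of \<open>W\<close> is pulled back along the isomorphism, so an isomorphism
  question becomes a comparison of two charts of one module. \<open>lie_iso\<close> does not mention
  the zero vector; that it goes to 0 follows from 0 + 0 = 0 in V.\<close>

lemma lie_iso_chart:
  assumes "chart W \<psi> \<sigma>" "lie_iso V W" "\<zero>\<^bsub>V\<^esub> \<in> carrier V"
    and "\<And>v w. v \<in> carrier V \<Longrightarrow> w \<in> carrier V \<Longrightarrow> v \<oplus>\<^bsub>V\<^esub> w \<in> carrier V" "\<And>v c. v \<in> carrier V \<Longrightarrow> c \<odot>\<^bsub>V\<^esub> v \<in> carrier V"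
    and "\<And>v x. v \<in> carrier V \<Longrightarrow> lact V x v \<in> carrier V" "\<zero>\<^bsub>V\<^esub> \<oplus>\<^bsub>V\<^esub> \<zero>\<^bsub>V\<^esub> = \<zero>\<^bsub>V\<^esub>"
  obtains \<phi> where "chart V \<phi> \<sigma>" "\<phi> ` carrier V = \<psi> ` carrier W"
proof -
  interpret W: chart W \<psi> \<sigma> by fact
  obtain \<eta> where \<eta>: "bij_betw \<eta> (carrier V) (carrier W)"
    "\<And>v w. v \<in> carrier V \<Longrightarrow> w \<in> carrier V \<Longrightarrow> \<eta> (v \<oplus>\<^bsub>V\<^esub> w) = \<eta> v \<oplus>\<^bsub>W\<^esub> \<eta> w"
    "\<And>c v. v \<in> carrier V \<Longrightarrow> \<eta> (c \<odot>\<^bsub>V\<^esub> v) = c \<odot>\<^bsub>W\<^esub> \<eta> v"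
    "\<And>x v. v \<in> carrier V \<Longrightarrow> \<eta> (lact V x v) = lact W x (\<eta> v)"
    using assms(2) unfolding lie_iso_def by blast
  have mem: "v \<in> carrier V \<Longrightarrow> \<eta> v \<in> carrier W" for v using \<eta>(1) by (auto simp: bij_betw_def)
  have "\<psi> (\<eta> \<zero>\<^bsub>V\<^esub>) = \<psi> (\<eta> \<zero>\<^bsub>V\<^esub>) + \<psi> (\<eta> \<zero>\<^bsub>V\<^esub>)"
    using \<eta>(2)[OF assms(3,3)] W.add(2)[OF mem mem, OF assms(3,3)] assms(7) by simp
  then have "\<psi> (\<eta> \<zero>\<^bsub>V\<^esub>) = 0" by simp
  moreover have "inj_on (\<psi> \<circ> \<eta>) (carrier V)"
    using \<eta>(1) W.inj by (intro comp_inj_on) (auto simp: bij_betw_def)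
  ultimately have "chart V (\<psi> \<circ> \<eta>) \<sigma>"
    using assms(3-6) mem by unfold_locales (auto simp: \<eta> W.add W.smult W.lact)
  moreover have "(\<psi> \<circ> \<eta>) ` carrier V = \<psi> ` carrier W"
    using \<eta>(1) by (simp only: bij_betw_def image_comp[symmetric])
  ultimately show ?thesis using that by blast
qed

lemma lie_module_chart_closure:
  assumes "lie_module V"
  shows "\<zero>\<^bsub>V\<^esub> \<in> carrier V" "v \<in> carrier V \<Longrightarrow> w \<in> carrier V \<Longrightarrow> v \<oplus>\<^bsub>V\<^esub> w \<in> carrier V"
    "v \<in> carrier V \<Longrightarrow> c \<odot>\<^bsub>V\<^esub> v \<in> carrier V" "v \<in> carrier V \<Longrightarrow> lact V x v \<in> carrier V"
    "\<zero>\<^bsub>V\<^esub> \<oplus>\<^bsub>V\<^esub> \<zero>\<^bsub>V\<^esub> = \<zero>\<^bsub>V\<^esub>"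
proof -
  interpret lie_module V by fact
  show "\<zero>\<^bsub>V\<^esub> \<in> carrier V" "v \<in> carrier V \<Longrightarrow> w \<in> carrier V \<Longrightarrow> v \<oplus>\<^bsub>V\<^esub> w \<in> carrier V"
    "v \<in> carrier V \<Longrightarrow> c \<odot>\<^bsub>V\<^esub> v \<in> carrier V" "v \<in> carrier V \<Longrightarrow> lact V x v \<in> carrier V"
    "\<zero>\<^bsub>V\<^esub> \<oplus>\<^bsub>V\<^esub> \<zero>\<^bsub>V\<^esub> = \<zero>\<^bsub>V\<^esub>"
    by (simp_all add: lact_closed) (simp add: smult_closed complex_ring_def)
qed

lemma lie_iso_trans: "lie_iso V W \<Longrightarrow> lie_iso W X \<Longrightarrow> lie_iso V X"
proof -
  assume "lie_iso V W" "lie_iso W X"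
  then obtain \<phi> \<psi> where \<phi>: "bij_betw \<phi> (carrier V) (carrier W)"
     "(\<forall>v\<in>carrier V. \<forall>w\<in>carrier V. \<phi> (v \<oplus>\<^bsub>V\<^esub> w) = \<phi> v \<oplus>\<^bsub>W\<^esub> \<phi> w)"
     "(\<forall>c. \<forall>v\<in>carrier V. \<phi> (c \<odot>\<^bsub>V\<^esub> v) = c \<odot>\<^bsub>W\<^esub> \<phi> v)"
     "(\<forall>x. \<forall>v\<in>carrier V. \<phi> (lact V x v) = lact W x (\<phi> v))"
   and \<psi>: "bij_betw \<psi> (carrier W) (carrier X)"
     "(\<forall>v\<in>carrier W. \<forall>w\<in>carrier W. \<psi> (v \<oplus>\<^bsub>W\<^esub> w) = \<psi> v \<oplus>\<^bsub>X\<^esub> \<psi> w)"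
     "(\<forall>c. \<forall>v\<in>carrier W. \<psi> (c \<odot>\<^bsub>W\<^esub> v) = c \<odot>\<^bsub>X\<^esub> \<psi> v)"
     "(\<forall>x. \<forall>v\<in>carrier W. \<psi> (lact W x v) = lact X x (\<psi> v))"
    unfolding lie_iso_def by blast
  have "\<phi> v \<in> carrier W" if "v \<in> carrier V" for v using \<phi>(1) that by (auto simp: bij_betw_def)
  then show ?thesis
    unfolding lie_iso_def using \<phi> \<psi> bij_betw_trans[OF \<phi>(1) \<psi>(1)] by (intro exI[of _ "\<psi> \<circ> \<phi>"]) simp
qed

lemma lie_iso_sym:
  assumes V: "lie_module V" and "lie_iso V W"
  shows "lie_iso W V"
proof -
  obtain \<phi> where \<phi>: "bij_betw \<phi> (carrier V) (carrier W)"
     "\<And>v w. v \<in> carrier V \<Longrightarrow> w \<in> carrier V \<Longrightarrow> \<phi> (v \<oplus>\<^bsub>V\<^esub> w) = \<phi> v \<oplus>\<^bsub>W\<^esub> \<phi> w"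
     "\<And>c v. v \<in> carrier V \<Longrightarrow> \<phi> (c \<odot>\<^bsub>V\<^esub> v) = c \<odot>\<^bsub>W\<^esub> \<phi> v"
     "\<And>x v. v \<in> carrier V \<Longrightarrow> \<phi> (lact V x v) = lact W x (\<phi> v)"
    using assms(2) unfolding lie_iso_def by blast
  define \<psi> where "\<psi> = inv_into (carrier V) \<phi>"
  have bij: "bij_betw \<psi> (carrier W) (carrier V)" unfolding \<psi>_def using \<phi>(1) by (rule bij_betw_inv_into)
  then have mem: "w \<in> carrier W \<Longrightarrow> \<psi> w \<in> carrier V" for w by (auto simp: bij_betw_def)
  have l: "w \<in> carrier W \<Longrightarrow> \<phi> (\<psi> w) = w" for w
    unfolding \<psi>_def using \<phi>(1) by (metis bij_betw_inv_into_right)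
  have r: "v \<in> carrier V \<Longrightarrow> \<psi> (\<phi> v) = v" for v
    unfolding \<psi>_def using \<phi>(1) by (metis bij_betw_inv_into_left)
  note cl = lie_module_chart_closure[OF V]
  have "\<psi> (v \<oplus>\<^bsub>W\<^esub> w) = \<psi> v \<oplus>\<^bsub>V\<^esub> \<psi> w" if "v \<in> carrier W" "w \<in> carrier W" for v w
    using r[OF cl(2)[OF mem mem, OF that]] that by (simp add: \<phi>(2) mem l)
  moreover have "\<psi> (c \<odot>\<^bsub>W\<^esub> v) = c \<odot>\<^bsub>V\<^esub> \<psi> v" if "v \<in> carrier W" for c v
    using r[OF cl(3)[OF mem, OF that]] that by (simp add: \<phi>(3) mem l)
  moreover have "\<psi> (lact W x v) = lact V x (\<psi> v)" if "v \<in> carrier W" for x v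
    using r[OF cl(4)[OF mem, OF that]] that by (simp add: \<phi>(4) mem l)
  ultimately show ?thesis unfolding lie_iso_def using bij by blast
qed


section \<open>Harish-Chandra modules\<close>

lemma chart_L_g: "chart (L_g k) id (lact (L_g k))"
proof -
  have "lact (L_g k) x v \<in> carrier (L_g k)" for x v by (simp add: L_g_def)
  then show ?thesis
    by unfold_locales (simp_all add: L_g_def fun_eq_iff)
qed

context takiff_rep
begin

lemma g_rep: "lie_rep (\<lambda>a. \<rho> (in_g a))"
  by unfold_locales
    (simp_all add: rep_simps rep_add rep_cscale takiff_linear_simps rep_bracket flip: takiff_bracket_simps)

text \<open>The formulas defining \<open>L_g\<close> are those of the action on the string u, f u,
  ..., f^k u, so expanding in this string is an intertwiner.\<close>

lemma L_g_map_lact: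
  assumes "hw (of_nat k) u" "(f ^^ Suc k) u = 0"
  defines "\<theta> a \<equiv> \<Sum>i\<le>k. a i *\<^sub>c (f ^^ i) u"
  shows "\<rho> (in_g A) (\<theta> a) = \<theta> (lact (L_g k) A a)"
proof -
  have h: "h (\<theta> a) = (\<Sum>i\<le>k. ((of_nat k - 2 * of_nat i) * a i) *\<^sub>c (f ^^ i) u)"
    by (simp add: \<theta>_def rep_simps f_pow_hw(1)[OF assms(1)] mult.commute)
  have e: "e (\<theta> a) = (\<Sum>i\<le>k. (of_nat (i + 1) * (of_nat k - of_nat i) * a (i + 1)) *\<^sub>c (f ^^ i) u)"
  proof (cases k)
    case 0
    then show ?thesis using assms(1) by (simp add: \<theta>_def rep_simps hw_def)
  next
    case (Suc j)
    have "e (\<theta> a) = a 0 *\<^sub>c e u + (\<Sum>i\<le>j. a (Suc i) *\<^sub>c e ((f ^^ Suc i) u))"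
      unfolding \<theta>_def Suc by (simp only: rep_simps sum.atMost_Suc_shift funpow_0)
    also have "\<dots> = (\<Sum>i\<le>j. (of_nat (i + 1) * (of_nat k - of_nat i) * a (i + 1)) *\<^sub>c (f ^^ i) u)"
      unfolding f_pow_hw(2)[OF assms(1)] using assms(1) by (simp add: hw_def mult.commute)
    also have "\<dots> = (\<Sum>i\<le>k. (of_nat (i + 1) * (of_nat k - of_nat i) * a (i + 1)) *\<^sub>c (f ^^ i) u)"
      by (simp add: Suc)
    finally show ?thesis .
  qed
  have f: "f (\<theta> a) = (\<Sum>i\<le>k. (if i = 0 then 0 else a (i - 1)) *\<^sub>c (f ^^ i) u)"
  proof -
    have "f (\<theta> a) = (\<Sum>i\<le>k. a i *\<^sub>c (f ^^ Suc i) u)" by (simp add: \<theta>_def rep_simps)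
    also have "\<dots> = (\<Sum>i<k. a i *\<^sub>c (f ^^ Suc i) u)"
      using assms(2) by (simp only: lessThan_Suc_atMost[symmetric] sum.lessThan_Suc) simp
    also have "\<dots> = (\<Sum>i<Suc k. (if i = 0 then 0 else a (i - 1)) *\<^sub>c (f ^^ i) u)"
      by (simp only: sum.lessThan_Suc_shift) simp
    finally show ?thesis by (simp only: lessThan_Suc_atMost)
  qed
  have "\<rho> (in_g A) (\<theta> a) = sl2_mat A $ 1 $ 1 *\<^sub>c h (\<theta> a) + sl2_mat A $ 1 $ 2 *\<^sub>c e (\<theta> a) + sl2_mat A $ 2 $ 1 *\<^sub>c f (\<theta> a)"
    by (rule rep_expand(1))
  also have "\<dots> = \<theta> (lact (L_g k) A a)"
    unfolding h e f unfolding \<theta>_def cvec.scale_sum_right sum.distrib[symmetric]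
    by (rule sum.cong) (simp_all add: L_g_def cscale_add_left mult.assoc)
  finally show ?thesis .
qed

text \<open>The vectors f^i u with i \<le> k are nonzero and have distinct weights, so they form a
  basis of the string.\<close>

lemma lie_iso_L_g:
  assumes "chart W \<phi> (\<lambda>a. \<rho> (in_g a))" "\<phi> ` carrier W = fstring u"
    and u: "hw (of_nat k) u" "(f ^^ Suc k) u = 0" "u \<noteq> 0"
  shows "lie_iso (L_g k) W"
proof (rule lie_iso_of_charts[OF chart_L_g assms(1)])
  define \<theta> where "\<theta> a = (\<Sum>i\<le>k. a i *\<^sub>c (f ^^ i) u)" for a :: "nat \<Rightarrow> complex"
  have add: "\<theta> (a + b) = \<theta> a + \<theta> b" for a b by (simp add: \<theta>_def cscale_add_left sum.distrib)
  have scale: "\<theta> (c *\<^sub>c a) = c *\<^sub>c \<theta> a" for c a by (simp add: \<theta>_def cvec.scale_sum_right)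
  have nz: "(f ^^ i) u \<noteq> 0" if "i \<le> k" for i
    using hw_f_nilpotent[OF u(1,3,2)] that by (metis of_nat_eq_iff)
  have inj0: "a i = 0" if "\<theta> a = 0" "i \<le> k" for a i
  proof -
    have "a i *\<^sub>c (f ^^ i) u = 0"
      using that(1) unfolding \<theta>_def
      by (rule sum_eigenvectors_eq_0[where a = "\<lambda>i. of_nat k - 2 * of_nat i", OF rep_linear[of "in_g sl2_h"] finite_atMost, rotated 2])
        (use that(2) in \<open>simp_all add: f_pow_hw(1)[OF u(1)] rep_simps inj_on_def mult.commute\<close>)
    then show ?thesis using nz[OF that(2)] by simp
  qed
  have "inj_on \<theta> (carrier (L_g k))"
  proof (rule inj_onI)
    fix a b assume ab: "a \<in> carrier (L_g k)" "b \<in> carrier (L_g k)" "\<theta> a = \<theta> b"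
    then have "\<theta> (a + (-1) *\<^sub>c b) = 0" by (simp only: add scale) simp
    then have "(a + (-1) *\<^sub>c b) i = 0" if "i \<le> k" for i using inj0 that by blast
    then have "a i = b i" if "i \<le> k" for i using that by simp
    then show "a = b" using ab by (auto simp: L_g_def fun_eq_iff) (metis not_le)
  qed
  moreover have "\<theta> ` carrier (L_g k) = fstring u"
  proof
    show "\<theta> ` carrier (L_g k) \<subseteq> fstring u"
      unfolding \<theta>_def fstring_def by (auto intro!: cvec.span_sum cvec.span_scale[OF cvec.span_base])
    have "(f ^^ i) u \<in> \<theta> ` carrier (L_g k)" if "i < Suc k" for i
      using that by (intro image_eqI[of _ _ "\<lambda>j. if j = i then 1 else 0"])
        (auto simp: \<theta>_def L_g_def if_distrib[of "\<lambda>c. c *\<^sub>c _"] cong: if_cong)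
    moreover have "cvec.subspace (\<theta> ` carrier (L_g k))"
      by (intro clinear.image_subspace) (use chart.subspace_image[OF chart_L_g] in \<open>auto intro!: clinear.intro simp: add scale\<close>)
    ultimately show "fstring u \<subseteq> \<theta> ` carrier (L_g k)"
      unfolding fstring_eq[OF u(2)] by (intro cvec.span_minimal) auto
  qed
  ultimately show "bij_betw \<theta> (id ` carrier (L_g k)) (\<phi> ` carrier W)"
    by (simp add: bij_betw_def assms(2))
  show "\<theta> (a + b) = \<theta> a + \<theta> b" "\<theta> (c *\<^sub>c a) = c *\<^sub>c \<theta> a" for a b c by (fact add scale)+
  show "\<theta> (lact (L_g k) x a) = \<rho> (in_g x) (\<theta> a)" for x a
    unfolding \<theta>_def by (rule L_g_map_lact[OF u(1,2), symmetric])
qed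

end

lemma restrict_g_simps [simp]:
  "carrier (restrict_g V) = carrier V" "ring.zero (restrict_g V) = ring.zero V" "ring.add (restrict_g V) = ring.add V"
  "Module.smult (restrict_g V) = Module.smult V" "lact (restrict_g V) x = lact V (in_g x)"
  by (simp_all add: restrict_g_def)

lemma chart_restrict_g: "chart V \<phi> \<rho> \<Longrightarrow> chart (restrict_g V) \<phi> (\<lambda>a. \<rho> (in_g a))"
  by (simp add: chart_def)

lemma chart_g_submodule:
  assumes "chart V \<phi> \<rho>" "W \<subseteq> carrier V" "invariant_subspace (\<lambda>a. \<rho> (in_g a)) (\<phi> ` W)"
  shows "chart (g_submodule V W) \<phi> (\<lambda>a. \<rho> (in_g a))" "carrier (g_submodule V W) = W"
  using chart.restrict_carrier[OF chart_restrict_g[OF assms(1)], of W] assms(2,3)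
  by (simp_all add: g_submodule_def)

section \<open>Internal direct sums seen through a chart\<close>

lemma ex1_unique: "\<exists>!x. P x \<Longrightarrow> P a \<Longrightarrow> P b \<Longrightarrow> a = b"
  by blast

context chart
begin

lemma exists_sum_of_span_Union:
  assumes "z \<in> cvec.span (\<Union>W\<in>I. \<phi> ` W)" "\<And>W. W \<in> I \<Longrightarrow> cvec.subspace (\<phi> ` W)"
  shows "\<exists>F y. finite F \<and> F \<subseteq> I \<and> (\<forall>W\<in>F. y W \<in> \<phi> ` W) \<and> z = (\<Sum>W\<in>F. y W)"
  using assms(1)
proof (induction rule: cvec.span_induct_alt)
  case base
  show ?case by (intro exI[of _ "{}"]) simp
next
  case (step b g z)
  then obtain F y W0 where F: "finite F" "F \<subseteq> I" "\<forall>W\<in>F. y W \<in> \<phi> ` W" "z = (\<Sum>W\<in>F. y W)"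
    and W0: "W0 \<in> I" "g \<in> \<phi> ` W0" by blast
  define y' where "y' W = (if W \<in> F then y W else 0) + (if W = W0 then b *\<^sub>c g else 0)" for W
  have "(\<Sum>W\<in>insert W0 F. if W \<in> F then y W else 0) = z"
    unfolding F(4) using F(1) by (intro sum.mono_neutral_cong_right) auto
  then have "(\<Sum>W\<in>insert W0 F. y' W) = z + b *\<^sub>c g"
    using F(1) by (simp only: y'_def sum.distrib) (simp add: sum.delta del: sum.insert)
  moreover have "\<forall>W\<in>insert W0 F. y' W \<in> \<phi> ` W"
    using F(2,3) W0 assms(2)
    by (auto simp: y'_def intro!: cvec.subspace_add cvec.subspace_scale cvec.subspace_0)
  ultimately show ?case using F(1,2) W0 by (intro exI[of _ "insert W0 F"] exI[of _ y']) (simp add: add.commute)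
qed

text \<open>Existence of the decomposition comes from spanning, uniqueness from the summands lying
  in eigenspaces of one operator for distinct eigenvalues. The Casimir operator is used in this role
  later.\<close>

lemma internal_direct_sum_eigenspaces:
  assumes I: "\<And>W. W \<in> I \<Longrightarrow> W \<subseteq> carrier V" "\<And>W. W \<in> I \<Longrightarrow> cvec.subspace (\<phi> ` W)"
    and A: "clinear A" "\<And>W x. W \<in> I \<Longrightarrow> x \<in> W \<Longrightarrow> A (\<phi> x) = a W *\<^sub>c \<phi> x" "inj_on a I"
    and span: "\<phi> ` carrier V \<subseteq> cvec.span (\<Union>W\<in>I. \<phi> ` W)"
  shows "internal_direct_sum V I"
  unfolding internal_direct_sum_def
proof (intro conjI ballI)
  show "submodule W complex_ring V" if "W \<in> I" for W using I that by (simp add: submodule_iff)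
  fix v assume v: "v \<in> carrier V"
  let ?supp = "\<lambda>c. {W. c W \<noteq> \<zero>\<^bsub>V\<^esub>}"
  let ?P = "\<lambda>c. (\<forall>W\<in>I. c W \<in> W) \<and> (\<forall>W. W \<notin> I \<longrightarrow> c W = \<zero>\<^bsub>V\<^esub>) \<and> finite (?supp c) \<and> v = finsum V c (?supp c)"
  have z: "\<zero>\<^bsub>V\<^esub> \<in> W" if "W \<in> I" for W
  proof -
    have "0 \<in> \<phi> ` W" using I(2)[OF that] by (rule cvec.subspace_0)
    then show ?thesis using I(1)[OF that] by (metis eq_zero_iff image_iff subsetD)
  qed
  have supp_sum: "v = finsum V c G \<Longrightarrow> finite G \<Longrightarrow> (\<And>W. W \<in> G \<Longrightarrow> c W \<in> carrier V) \<Longrightarrow> \<phi> v = (\<Sum>W\<in>G. \<phi> (c W))" for c G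
    using finsum_image[of G c] by simp
  have car: "c W \<in> carrier V" if "?P c" for c W
    using that I(1) zero(1) by (cases "W \<in> I") auto
  show "\<exists>!c. ?P c"
  proof (rule ex_ex1I)
    obtain F y where F: "finite F" "F \<subseteq> I" "\<forall>W\<in>F. y W \<in> \<phi> ` W" "\<phi> v = (\<Sum>W\<in>F. y W)"
      using exists_sum_of_span_Union[of "\<phi> v" I] v span I(2) by blast
    define c where "c W = (if W \<in> F then inv_into W \<phi> (y W) else \<zero>\<^bsub>V\<^esub>)" for W
    have c: "c W \<in> W" "\<phi> (c W) = y W" if "W \<in> F" for W
      using F(3) that by (simp_all add: c_def inv_into_into f_inv_into_f)
    have cI: "c W \<in> W" if "W \<in> I" for W using c(1) z[OF that] by (cases "W \<in> F") (auto simp: c_def)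
    have sub: "?supp c \<subseteq> F" by (auto simp: c_def)
    have fin: "finite (?supp c)" using sub F(1) by (rule finite_subset)
    have cc: "c W \<in> carrier V" for W
      using c(1)[of W] I(1)[of W] F(2) zero(1) by (cases "W \<in> F") (blast, simp add: c_def)
    have "\<phi> v = (\<Sum>W\<in>F. \<phi> (c W))" using F(4) c(2) by simp
    also have "\<dots> = (\<Sum>W\<in>?supp c. \<phi> (c W))"
      using F(1) sub by (intro sum.mono_neutral_right) (auto simp: zero)
    also have "\<dots> = \<phi> (finsum V c (?supp c))" using finsum_image[OF fin, of c] cc by simp
    finally have "v = finsum V c (?supp c)" using v finsum_image[OF fin, of c] cc by (metis eq_iff)
    moreover have "\<forall>W. W \<notin> I \<longrightarrow> c W = \<zero>\<^bsub>V\<^esub>" using F(2) by (auto simp: c_def)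
    ultimately show "\<exists>c. ?P c" using cI fin by blast
  next
    fix c c' assume c: "?P c" and c': "?P c'"
    define G where "G = ?supp c \<union> ?supp c'"
    have G: "finite G" "G \<subseteq> I" using c c' by (auto simp: G_def)
    have full: "\<phi> v = (\<Sum>W\<in>G. \<phi> (d W))" if "?P d" "?supp d \<subseteq> G" for d
    proof -
      have "\<phi> v = (\<Sum>W\<in>?supp d. \<phi> (d W))" using that(1) car[OF that(1)] by (intro supp_sum) auto
      also have "\<dots> = (\<Sum>W\<in>G. \<phi> (d W))" using G(1) that(2) by (intro sum.mono_neutral_left) (auto simp: zero)
      finally show ?thesis .
    qed
    have "(\<Sum>W\<in>G. \<phi> (c W) - \<phi> (c' W)) = 0"
      using full[OF c] full[OF c'] by (simp add: sum_subtractf G_def)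
    moreover have "A (\<phi> (c W) - \<phi> (c' W)) = a W *\<^sub>c (\<phi> (c W) - \<phi> (c' W))" if "W \<in> G" for W
      using A(2)[of W "c W"] A(2)[of W "c' W"] c c' G(2) that
      by (auto simp: clinear.diff[OF A(1)] cvec.scale_right_diff_distrib)
    ultimately have "\<phi> (c W) - \<phi> (c' W) = 0" if "W \<in> G" for W
      using sum_eigenvectors_eq_0[where g = "\<lambda>W. \<phi> (c W) - \<phi> (c' W)", OF A(1) G(1) _ inj_on_subset[OF A(3) G(2)]] that by blast
    then have "c W = c' W" if "W \<in> G" for W using that car[OF c] car[OF c'] by (simp add: eq_iff)
    moreover have "c W = c' W" if "W \<notin> G" for W using that by (simp add: G_def)
    ultimately show "c = c'" by blast
  qed
qed

lemma direct_sum_decompose: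
  assumes "internal_direct_sum V I" "v \<in> carrier V"
  obtains F y where "finite F" "F \<subseteq> I" "\<And>W. W \<in> F \<Longrightarrow> y W \<in> \<phi> ` W" "\<phi> v = (\<Sum>W\<in>F. y W)"
proof -
  obtain c where c: "\<forall>W\<in>I. c W \<in> W" "\<forall>W. W \<notin> I \<longrightarrow> c W = \<zero>\<^bsub>V\<^esub>"
    "finite {W. c W \<noteq> \<zero>\<^bsub>V\<^esub>}" "v = finsum V c {W. c W \<noteq> \<zero>\<^bsub>V\<^esub>}"
    using assms unfolding internal_direct_sum_def by (elim conjE, drule_tac bspec) (assumption, elim ex1E conjE)
  have sub: "{W. c W \<noteq> \<zero>\<^bsub>V\<^esub>} \<subseteq> I" using c(2) by blast
  have "W \<subseteq> carrier V" if "W \<in> I" for W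
    using assms(1) that unfolding internal_direct_sum_def submodule_iff by blast
  then have "c W \<in> carrier V" if "W \<in> I" for W using c(1) that by blast
  then have "\<phi> v = (\<Sum>W\<in>{W. c W \<noteq> \<zero>\<^bsub>V\<^esub>}. \<phi> (c W))"
    unfolding c(4) using finsum_image[OF c(3), of c] sub by blast
  then show ?thesis using that[OF c(3) sub, of "\<lambda>W. \<phi> (c W)"] c(1) sub by blast
qed

text \<open>Uniqueness of the decomposition, applied to the zero vector. It lets the components of a
  highest weight vector inherit the equations for \<open>e\<close> and \<open>h\<close>.\<close>

lemma direct_sum_zero:
  assumes ds: "internal_direct_sum V I" and F: "finite F" "F \<subseteq> I" "\<And>W. W \<in> F \<Longrightarrow> y W \<in> \<phi> ` W" "(\<Sum>W\<in>F. y W) = 0"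
    and "W \<in> F"
  shows "y W = 0"
proof -
  let ?supp = "\<lambda>c. {W. c W \<noteq> \<zero>\<^bsub>V\<^esub>}"
  let ?P = "\<lambda>c. (\<forall>W\<in>I. c W \<in> W) \<and> (\<forall>W. W \<notin> I \<longrightarrow> c W = \<zero>\<^bsub>V\<^esub>) \<and> finite (?supp c) \<and> \<zero>\<^bsub>V\<^esub> = finsum V c (?supp c)"
  have I: "W \<subseteq> carrier V" "cvec.subspace (\<phi> ` W)" if "W \<in> I" for W
    using ds that unfolding internal_direct_sum_def submodule_iff by blast+
  have z: "\<zero>\<^bsub>V\<^esub> \<in> W" if "W \<in> I" for W
    using cvec.subspace_0[OF I(2)[OF that]] I(1)[OF that] by (metis eq_zero_iff image_iff subsetD)
  define c where "c W = (if W \<in> F then inv_into W \<phi> (y W) else \<zero>\<^bsub>V\<^esub>)" for W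
  have c: "c W \<in> W" "\<phi> (c W) = y W" if "W \<in> F" for W
    using F(3)[OF that] that by (simp_all add: c_def inv_into_into f_inv_into_f)
  have sub: "?supp c \<subseteq> F" by (auto simp: c_def)
  have fin: "finite (?supp c)" using sub F(1) by (rule finite_subset)
  have cc: "c W \<in> carrier V" for W
    using c(1)[of W] I(1)[of W] F(2) zero(1) by (cases "W \<in> F") (blast, simp add: c_def)
  have "\<phi> (finsum V c (?supp c)) = (\<Sum>W\<in>?supp c. \<phi> (c W))" using finsum_image[OF fin, of c] cc by simp
  also have "\<dots> = (\<Sum>W\<in>F. \<phi> (c W))"
    using F(1) sub by (intro sum.mono_neutral_left) (auto simp: zero)
  also have "\<dots> = 0" using F(4) c(2) by simp
  finally have F0: "\<zero>\<^bsub>V\<^esub> = finsum V c (?supp c)"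
    using finsum_image[OF fin, of c] cc by (metis eq_zero_iff)
  have F1: "c W \<in> W" if "W \<in> I" for W using c(1) z[OF that] by (cases "W \<in> F") (auto simp: c_def)
  have F2: "\<forall>W. W \<notin> I \<longrightarrow> c W = \<zero>\<^bsub>V\<^esub>" using F(2) by (auto simp: c_def)
  have P: "?P c" using F1 by (intro conjI ballI F0 F2 fin)
  have P0: "?P (\<lambda>_. \<zero>\<^bsub>V\<^esub>)"
  proof -
    interpret M: Module.module complex_ring V by (rule module)
    show ?thesis using z by simp
  qed
  have U: "\<exists>!c. ?P c" using ds zero(1) unfolding internal_direct_sum_def by (elim conjE bspec)
  have "c = (\<lambda>_. \<zero>\<^bsub>V\<^esub>)" by (rule ex1_unique[where P = ?P, OF U P P0])
  then show ?thesis using c(2)[OF \<open>W \<in> F\<close>] zero(2) by simp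
qed

end


section \<open>Types and highest weight vectors of a module with a chart\<close>

lemma chart_lact_pow:
  assumes "chart V \<phi> \<rho>" "v \<in> carrier V"
  shows "(lact V x ^^ i) v \<in> carrier V" "\<phi> ((lact V x ^^ i) v) = (\<rho> x ^^ i) (\<phi> v)"
  using assms(2) by (induction i) (simp_all add: chart.lact[OF assms(1)])

text \<open>Each of these conditions can be stated inside V, so it does not depend on the
  chart.\<close>

lemma two_charts:
  assumes "chart V \<phi> \<rho>" "chart V \<psi> \<sigma>" "w \<in> carrier V"
  shows "\<phi> w = 0 \<longleftrightarrow> \<psi> w = 0" "\<rho> x (\<phi> w) = m *\<^sub>c \<phi> w \<longleftrightarrow> \<sigma> x (\<psi> w) = m *\<^sub>c \<psi> w"
    "(\<rho> x ^^ i) (\<phi> w) = 0 \<longleftrightarrow> (\<sigma> x ^^ i) (\<psi> w) = 0"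
proof -
  interpret A: chart V \<phi> \<rho> by fact
  interpret B: chart V \<psi> \<sigma> by fact
  have eq: "\<phi> w = 0 \<longleftrightarrow> \<psi> w = 0" if "w \<in> carrier V" for w
    using that by (simp add: A.eq_zero_iff B.eq_zero_iff)
  show "\<rho> x (\<phi> w) = m *\<^sub>c \<phi> w \<longleftrightarrow> \<sigma> x (\<psi> w) = m *\<^sub>c \<psi> w"
    using A.eq_iff[of "lact V x w" "m \<odot>\<^bsub>V\<^esub> w"] B.eq_iff[of "lact V x w" "m \<odot>\<^bsub>V\<^esub> w"] assms(3)
    by (simp add: A.lact A.smult B.lact B.smult)
  show "(\<rho> x ^^ i) (\<phi> w) = 0 \<longleftrightarrow> (\<sigma> x ^^ i) (\<psi> w) = 0"
    using eq[of "(lact V x ^^ i) w"] chart_lact_pow[OF assms(1,3)] chart_lact_pow[OF assms(2,3)] by simp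
  show "\<phi> w = 0 \<longleftrightarrow> \<psi> w = 0" by (rule eq[OF assms(3)])
qed

locale takiff_chart = takiff_rep \<rho> + chart V \<phi> \<rho>
  for V :: "(takiff, 'v) lie_module" and \<phi> :: "'v \<Rightarrow> 'a::complex_vector" and \<rho> :: "takiff \<Rightarrow> 'a \<Rightarrow> 'a"
begin

sublocale R: chart "restrict_g V" \<phi> "\<lambda>a. \<rho> (in_g a)"
  by (rule chart_restrict_g) unfold_locales

lemma chart_V: "chart V \<phi> \<rho>" by unfold_locales

lemma lie_rep_\<rho>: "lie_rep \<rho>" by unfold_locales

lemma lie_submodule_restrict_iff:
  "lie_submodule W (restrict_g V) \<longleftrightarrow> W \<subseteq> carrier V \<and> invariant_subspace (\<lambda>a. \<rho> (in_g a)) (\<phi> ` W)"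
  using R.lie_submodule_iff by simp

lemma g_chart:
  assumes "lie_submodule W (restrict_g V)"
  shows "chart (g_submodule V W) \<phi> (\<lambda>a. \<rho> (in_g a))" "carrier (g_submodule V W) = W"
  using assms chart_g_submodule[OF chart_V] by (auto simp: lie_submodule_restrict_iff)

lemma pull_g_chart:
  assumes "invariant_subspace (\<lambda>a. \<rho> (in_g a)) Y" "Y \<subseteq> \<phi> ` carrier V"
  shows "lie_submodule (pull Y) (restrict_g V)" "chart (g_submodule V (pull Y)) \<phi> (\<lambda>a. \<rho> (in_g a))"
    "\<phi> ` carrier (g_submodule V (pull Y)) = Y"
proof -
  show *: "lie_submodule (pull Y) (restrict_g V)"
    using assms by (simp add: lie_submodule_restrict_iff image_pull) (simp add: pull_def)
  show "chart (g_submodule V (pull Y)) \<phi> (\<lambda>a. \<rho> (in_g a))" "\<phi> ` carrier (g_submodule V (pull Y)) = Y"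
    using g_chart[OF *] assms(2) by (simp_all add: image_pull)
qed

lemma closed: "u \<in> \<phi> ` carrier V \<Longrightarrow> \<rho> x u \<in> \<phi> ` carrier V"
  by (auto simp flip: lact(2) intro!: imageI lact(1))

lemma invariant_image: "invariant_subspace \<rho> (\<phi> ` carrier V)"
  by (simp add: invariant_subspace_def subspace_image closed)

lemma fstring_subset_image: "u \<in> \<phi> ` carrier V \<Longrightarrow> fstring u \<subseteq> \<phi> ` carrier V"
  by (intro fstring_subset subspace_image closed)

text \<open>The string of such a vector is isomorphic to L(m); conversely the vector corresponding
  to the delta function at 0 is of this kind. Submodules and isomorphisms are thereby replaced by
  equations for one vector.\<close>

lemma has_g_type_iff:
  "has_g_type V m \<longleftrightarrow> (\<exists>u\<in>\<phi> ` carrier V. u \<noteq> 0 \<and> hw (of_nat m) u \<and> (f ^^ Suc m) u = 0)"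
proof
  assume "\<exists>u\<in>\<phi> ` carrier V. u \<noteq> 0 \<and> hw (of_nat m) u \<and> (f ^^ Suc m) u = 0"
  then obtain u where u: "u \<in> \<phi> ` carrier V" "u \<noteq> 0" "hw (of_nat m) u" "(f ^^ Suc m) u = 0" by blast
  note W = pull_g_chart[OF fstring_invariant[OF u(3)] fstring_subset_image[OF u(1)]]
  have "lie_iso (L_g m) (g_submodule V (pull (fstring u)))"
    by (rule lie_iso_L_g[OF W(2,3) u(3,4,2)])
  then have "lie_iso (g_submodule V (pull (fstring u))) (L_g m)"
    by (rule lie_iso_sym[OF lie_module_L_g])
  then show "has_g_type V m" using W(1) unfolding has_g_type_def by blast
next
  assume "has_g_type V m"
  then obtain W where W: "lie_submodule W (restrict_g V)" "lie_iso (g_submodule V W) (L_g m)"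
    unfolding has_g_type_def by blast
  let ?W = "g_submodule V W"
  note c = g_chart[OF W(1)]
  have lm: "lie_module ?W" by (rule chart.lie_module[OF c(1) g_rep])
  obtain \<psi> where \<psi>: "chart ?W \<psi> (lact (L_g m))" "\<psi> ` carrier ?W = id ` carrier (L_g m)"
    using lie_iso_chart[OF chart_L_g W(2) lie_module_chart_closure[OF lm]] by blast
  define d where "d k = (\<lambda>i. if i = k then 1 else 0 :: complex)" for k :: nat
  have "d 0 \<in> \<psi> ` carrier ?W" unfolding \<psi>(2) by (simp add: L_g_def d_def)
  then obtain w where w: "w \<in> carrier ?W" "\<psi> w = d 0" by (metis imageE)
  note t = two_charts[OF c(1) \<psi>(1) w(1)]
  have "d 0 \<noteq> 0" by (auto simp: d_def fun_eq_iff)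
  moreover have "lact (L_g m) sl2_e (d 0) = 0 *\<^sub>c d 0" by (auto simp: L_g_def d_def fun_eq_iff)
  moreover have "lact (L_g m) sl2_h (d 0) = of_nat m *\<^sub>c d 0" by (auto simp: L_g_def d_def fun_eq_iff)
  moreover have "(lact (L_g m) sl2_f ^^ Suc m) (d 0) = 0"
  proof -
    have "(lact (L_g m) sl2_f ^^ i) (d 0) = d i" if "i \<le> m" for i
      using that by (induction i) (auto simp: L_g_def d_def fun_eq_iff)
    then show ?thesis by (auto simp: L_g_def d_def fun_eq_iff)
  qed
  ultimately have "\<phi> w \<noteq> 0" "e (\<phi> w) = 0 *\<^sub>c \<phi> w" "h (\<phi> w) = of_nat m *\<^sub>c \<phi> w" "(f ^^ Suc m) (\<phi> w) = 0"
    unfolding t w(2) by blast+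
  moreover have "w \<in> carrier V" using w(1) W(1) c(2) by (auto simp: lie_submodule_restrict_iff)
  ultimately show "\<exists>u\<in>\<phi> ` carrier V. u \<noteq> 0 \<and> hw (of_nat m) u \<and> (f ^^ Suc m) u = 0"
    by (intro bexI[of _ "\<phi> w"]) (auto simp: hw_def)
qed

lemma minimal_g_type_generator:
  assumes "generator n z c v" "v \<noteq> 0" "\<phi> ` carrier V = gspan v"
  shows "minimal_g_type V n"
  unfolding minimal_g_type_def
proof (intro conjI allI impI)
  show "has_g_type V n"
    unfolding has_g_type_iff assms(3) using assms(1,2) generator_in_generated[OF assms(1)]
    by (auto simp: generator_def)
  fix m assume "has_g_type V m"
  then obtain u where "u \<in> gspan v" "u \<noteq> 0" "hw (of_nat m) u"
    unfolding has_g_type_iff assms(3) by blast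
  then obtain k where "(of_nat m :: complex) = of_nat (n + 2 * k)" using hw_in_generated[OF assms(1)] by metis
  then show "n \<le> m" by (simp only: of_nat_eq_iff)
qed

lemma C_bar_acts_as_iff: "C_bar_acts_as V z \<longleftrightarrow> (\<forall>u\<in>\<phi> ` carrier V. Cbar u = z *\<^sub>c u)"
  unfolding C_bar_acts_as_def Cbar_def
  by (simp add: add smult lact flip: eq_iff)

text \<open>The isotypic components of a module generated by a generator are the spaces \<open>fstring (eb\<^sup>k v)\<close>.\<close>

lemma harish_chandra_generator:
  assumes gen: "generator n z c v" and car: "\<phi> ` carrier V = gspan v"
  shows "harish_chandra V"
proof -
  define u where "u k = (eb ^^ k) v" for k
  define om where "om k = (of_nat (n + 2 * k) * (of_nat (n + 2 * k) + 2) :: complex)" for k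
  have om_inj: "k = k'" if "om k = om k'" for k k'
  proof (rule ccontr)
    have lt: "om a \<noteq> om b" if "a < b" for a b
    proof
      assume "om a = om b"
      then have "(of_nat ((n + 2 * a) * (n + 2 * a + 2)) :: complex) = of_nat ((n + 2 * b) * (n + 2 * b + 2))"
        unfolding om_def by (simp only: of_nat_mult of_nat_add of_nat_numeral)
      moreover have "(n + 2 * a) * (n + 2 * a + 2) < (n + 2 * b) * (n + 2 * b + 2)"
        using that by (intro mult_strict_mono) auto
      ultimately show False by (simp only: of_nat_eq_iff)
    qed
    assume "k \<noteq> k'"
    then show False using lt[of k k'] lt[of k' k] that by (metis linorder_neqE_nat)
  qed
  have hw: "hw (of_nat (n + 2 * k)) (u k)" and nil: "(f ^^ Suc (n + 2 * k)) (u k) = 0" for k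
    unfolding u_def by (rule hw_eb_pow[OF gen], rule eb_pow_f_nilpotent[OF gen])
  have inv: "invariant_subspace (\<lambda>a. \<rho> (in_g a)) (fstring (u k))" for k by (rule fstring_invariant[OF hw])
  have sub: "fstring (u k) \<subseteq> \<phi> ` carrier V" for k
    unfolding car u_def by (rule fstring_subset_generated[OF gen])
  note ch = pull_g_chart[OF inv sub]
  have Om: "Omega x = om k *\<^sub>c x" if "x \<in> fstring (u k)" for x k
  proof -
    have "fstring (u k) \<subseteq> {x. Omega x = om k *\<^sub>c x}"
      unfolding fstring_def using Omega_f_eb_pow[OF gen, of _ k]
      by (intro cvec.span_minimal eigenspace_subspace[OF linear_Omega]) (auto simp: u_def om_def)
    then show ?thesis using that by blast
  qed
  have base: "u k \<in> fstring (u k)" for k using f_pow_in_fstring[of 0] by simp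
  define P where "P k = pull (fstring (u k))" for k
  \<comment> \<open>Some eb^k v may vanish, and a zero summand is not simple, so only the nonzero
    ones enter.\<close>
  define I where "I = P ` {k. u k \<noteq> 0}"
  have P_inj: "k = k'" if "u k \<noteq> 0" "u k \<in> \<phi> ` P k'" for k k'
  proof -
    have "om k *\<^sub>c u k = om k' *\<^sub>c u k"
      using Om[OF base] Om[of "u k" k'] that(2) image_pull[OF sub] by (simp add: P_def)
    then have "om k = om k'" using that(1) by simp
    then show ?thesis by (rule om_inj)
  qed
  have img: "\<phi> ` P k = fstring (u k)" for k unfolding P_def by (rule image_pull[OF sub])
  \<comment> \<open>The eigenvalue has to be a function of the summand and not of k; the choice of k
    is harmless because a nonzero vector has only one Casimir eigenvalue.\<close>
  define a where "a W = om (SOME k. u k \<noteq> 0 \<and> W = P k)" for W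
  have a: "a (P k) = om k" if "u k \<noteq> 0" for k
  proof -
    have "\<exists>k'. u k' \<noteq> 0 \<and> P k = P k'" using that by blast
    then have *: "u (SOME k'. u k' \<noteq> 0 \<and> P k = P k') \<noteq> 0 \<and> P k = P (SOME k'. u k' \<noteq> 0 \<and> P k = P k')"
      by (rule someI_ex)
    then have "k = (SOME k'. u k' \<noteq> 0 \<and> P k = P k')"
      using that base[of k] by (intro P_inj) (simp_all flip: img)
    then show ?thesis by (simp add: a_def)
  qed
  have lm: "lie_module V" by (rule lie_module[OF lie_rep_\<rho>])
  have ds: "internal_direct_sum (restrict_g V) I"
  proof (rule R.internal_direct_sum_eigenspaces[OF _ _ linear_Omega])
    show "W \<subseteq> carrier (restrict_g V)" if "W \<in> I" for W
      using that by (auto simp: I_def P_def pull_def)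
    show "cvec.subspace (\<phi> ` W)" if "W \<in> I" for W
      using that inv by (auto simp: I_def img invariant_subspace_def)
    show "Omega (\<phi> x) = a W *\<^sub>c \<phi> x" if "W \<in> I" "x \<in> W" for W x
    proof -
      obtain k where "u k \<noteq> 0" "W = P k" using \<open>W \<in> I\<close> by (auto simp: I_def)
      then show ?thesis using Om[of "\<phi> x" k] a[of k] img[of k] \<open>x \<in> W\<close> by auto
    qed
    show "inj_on a I" using a om_inj by (auto simp: I_def inj_on_def)
    show "\<phi> ` carrier (restrict_g V) \<subseteq> cvec.span (\<Union>W\<in>I. \<phi> ` W)"
      unfolding restrict_g_simps car gspan_def
    proof (rule cvec.span_minimal)
      have "(f ^^ i) ((eb ^^ k) v) \<in> cvec.span (\<Union>W\<in>I. \<phi> ` W)" for i k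
      proof (cases "u k = 0")
        case True
        then show ?thesis using f_pow_zero[of i] by (simp add: u_def cvec.span_zero)
      next
        case False
        then have "(f ^^ i) (u k) \<in> (\<Union>W\<in>I. \<phi> ` W)"
          using f_pow_in_fstring[of i "u k"] by (auto simp: I_def simp flip: img)
        then show ?thesis unfolding u_def by (rule cvec.span_base)
      qed
      then show "{(f ^^ i) ((eb ^^ k) v) |i k. True} \<subseteq> cvec.span (\<Union>W\<in>I. \<phi> ` W)" by blast
    qed simp
  qed
  have "lie_submodule W (restrict_g V) \<and> simple_lie_module (g_submodule V W) \<and> finite_dim (g_submodule V W)"
    if WI: "W \<in> I" for W
  proof -
    obtain k where k: "u k \<noteq> 0" "W = P k" using WI by (auto simp: I_def)
    have "chart (L_g (n + 2 * k)) id (lact (L_g (n + 2 * k)))" by (rule chart_L_g)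
    have iso: "lie_iso (L_g (n + 2 * k)) (g_submodule V W)"
      unfolding k P_def by (rule lie_iso_L_g[OF ch(2,3) hw nil k(1)])
    note lc = lie_module_chart_closure[OF lie_module_L_g[of "n + 2 * k"]]
    obtain \<psi> where \<psi>: "chart (L_g (n + 2 * k)) \<psi> (\<lambda>a. \<rho> (in_g a))"
      "\<psi> ` carrier (L_g (n + 2 * k)) = \<phi> ` carrier (g_submodule V W)"
      using lie_iso_chart[OF ch(2)[of k, folded P_def k(2)] iso lc] by blast
    have "simple_lie_module (g_submodule V W)"
      using simple_L_g[of "n + 2 * k"]
      unfolding chart.simple_iff[OF \<psi>(1) g_rep] chart.simple_iff[OF ch(2)[of k, folded P_def k(2)] g_rep] \<psi>(2) .
    moreover have "finite_dim (g_submodule V W)"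
      by (subst chart.finite_dim_iff[OF ch(2)[of k, folded P_def k(2)]])
        (simp only: k(2) P_def ch(3) fd_fstring[OF nil])
    ultimately show ?thesis using ch(1)[of k] k by (simp add: P_def)
  qed
  moreover have "finite {W'\<in>I. lie_iso (g_submodule V W') (g_submodule V W)}" if WI: "W \<in> I" for W
  proof -
    obtain k where k: "u k \<noteq> 0" "W = P k" using WI by (auto simp: I_def)
    \<comment> \<open>Multiplicity one: an isomorphism carries the highest weight vector of
      \<open>W'\<close> into \<open>W\<close>, where by its weight it is a multiple of
      \<open>u k'\<close>. So \<open>u k'\<close> lies in the string of \<open>u k\<close>, and
      comparing Casimir eigenvalues gives k' = k.\<close>
    have "W' = W" if W': "W' \<in> I" "lie_iso (g_submodule V W') (g_submodule V W)" for W'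
    proof -
      obtain k' where k': "u k' \<noteq> 0" "W' = P k'" using \<open>W' \<in> I\<close> by (auto simp: I_def)
      let ?W' = "g_submodule V W'"
      note c' = ch(2,3)[of k', folded P_def, folded k'(2)] and c = ch(2,3)[of k, folded P_def, folded k(2)]
      have lm': "lie_module ?W'" by (rule chart.lie_module[OF c'(1) g_rep])
      obtain \<psi> where \<psi>: "chart ?W' \<psi> (\<lambda>a. \<rho> (in_g a))" "\<psi> ` carrier ?W' = \<phi> ` carrier (g_submodule V W)"
        using lie_iso_chart[OF c(1) W'(2) lie_module_chart_closure[OF lm']] by blast
      obtain w where w: "w \<in> carrier ?W'" "\<phi> w = u k'" using base[of k'] unfolding c'(2)[symmetric] by (metis imageE)
      note t = two_charts[OF c'(1) \<psi>(1) w(1), unfolded w(2)]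
      have "\<psi> w \<noteq> 0" "hw (of_nat (n + 2 * k')) (\<psi> w)"
        using k'(1) hw[of k'] t(1) t(2)[of sl2_e 0] t(2)[of sl2_h] by (simp_all add: hw_def)
      moreover have mem: "\<psi> w \<in> fstring (u k)" using w(1) \<psi>(2) c(2) by blast
      moreover have "\<psi> w \<in> gspan v" using mem sub[of k] car by blast
      ultimately obtain j b where j: "(of_nat (n + 2 * k') :: complex) = of_nat (n + 2 * j)" "\<psi> w = b *\<^sub>c u j" "b \<noteq> 0"
        using hw_in_generated[OF gen, folded u_def] by metis
      have "j = k'" using j(1) by (simp only: of_nat_eq_iff)
      then have "u k' = inverse b *\<^sub>c \<psi> w" using j by simp
      then have "u k' \<in> fstring (u k)"
        using mem inv[of k] by (simp add: invariant_subspace_def cvec.subspace_scale)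
      then have "k' = k" using k'(1) by (intro P_inj) (simp_all add: img)
      then show ?thesis using k k' by simp
    qed
    then have "{W'\<in>I. lie_iso (g_submodule V W') (g_submodule V W)} \<subseteq> {W}" by blast
    then show ?thesis by (rule finite_subset) simp
  qed
  ultimately show ?thesis unfolding harish_chandra_def using lm ds by blast
qed

lemma simple_harish_chandra_generator:
  assumes "generator n z c v" "\<phi> ` carrier V = gspan v" "v \<noteq> 0" "z \<noteq> 0"
  shows "simple_harish_chandra V"
proof -
  have "simple_lie_module V"
    unfolding simple_iff[OF lie_rep_\<rho>] assms(2)
    using generated_irreducible[OF assms(1,4,3)] generator_in_generated[OF assms(1)] assms(3) by auto
  then show ?thesis using harish_chandra_generator[OF assms(1,2)] by (simp add: simple_harish_chandra_def)
qed

end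


section \<open>From a simple Harish-Chandra module to a generator\<close>

lemma fd_UN_span:
  assumes "finite F" "\<And>W. W \<in> F \<Longrightarrow> fd (Y W)"
  shows "fd (cvec.span (\<Union>W\<in>F. Y W))"
  using assms
proof (induction F rule: finite_induct)
  case empty
  then show ?case using fd_span[of "{}"] by simp
next
  case (insert W F)
  have "cvec.span (\<Union>W\<in>insert W F. Y W) \<subseteq> cvec.span (Y W \<union> cvec.span (\<Union>W\<in>F. Y W))"
    by (intro cvec.span_mono) (auto intro: cvec.span_base)
  then show ?case using fd_span_Un[of "Y W" "cvec.span (\<Union>W\<in>F. Y W)"] insert by (auto intro: fd_subset)
qed

lemma lie_rep_invariant_span_Union:
  assumes "lie_rep \<rho>" "\<And>W. W \<in> F \<Longrightarrow> invariant_subspace \<rho> (Y W)"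
  shows "invariant_subspace \<rho> (cvec.span (\<Union>W\<in>F. Y W))"
  unfolding invariant_subspace_def
proof (intro conjI allI ballI)
  fix x w assume w: "w \<in> cvec.span (\<Union>W\<in>F. Y W)"
  show "\<rho> x w \<in> cvec.span (\<Union>W\<in>F. Y W)"
    by (rule clinear.span_image_subset[OF lie_rep.rep_linear[OF assms(1)] w])
      (use assms(2) in \<open>auto simp: invariant_subspace_def intro!: cvec.span_base\<close>)
qed simp

context takiff_chart
begin

lemma harish_chandra_decomposition:
  assumes "harish_chandra V"
  obtains I where "internal_direct_sum (restrict_g V) I"
    and "\<And>W. W \<in> I \<Longrightarrow> lie_submodule W (restrict_g V)"
    and "\<And>W. W \<in> I \<Longrightarrow> invariant_subspace (\<lambda>a. \<rho> (in_g a)) (\<phi> ` W)"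
    and "\<And>W. W \<in> I \<Longrightarrow> \<phi> ` W \<subseteq> \<phi> ` carrier V"
    and "\<And>W. W \<in> I \<Longrightarrow> fd (\<phi> ` W)"
    and "\<And>W. W \<in> I \<Longrightarrow> finite {W'\<in>I. lie_iso (g_submodule V W') (g_submodule V W)}"
    and "\<And>W Y. W \<in> I \<Longrightarrow> invariant_subspace (\<lambda>a. \<rho> (in_g a)) Y \<Longrightarrow> Y \<subseteq> \<phi> ` W \<Longrightarrow> Y \<noteq> {0} \<Longrightarrow> Y = \<phi> ` W"
proof -
  obtain I where I: "internal_direct_sum (restrict_g V) I"
    "\<forall>W\<in>I. lie_submodule W (restrict_g V) \<and> simple_lie_module (g_submodule V W) \<and> finite_dim (g_submodule V W)"
    "\<forall>W\<in>I. finite {W'\<in>I. lie_iso (g_submodule V W') (g_submodule V W)}"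
    using assms unfolding harish_chandra_def by blast
  have sub: "lie_submodule W (restrict_g V)" if "W \<in> I" for W using I(2) that by blast
  show thesis
  proof (rule that[OF I(1) sub])
    fix W assume W: "W \<in> I"
    note c = g_chart[OF sub[OF W]]
    show "invariant_subspace (\<lambda>a. \<rho> (in_g a)) (\<phi> ` W)" "\<phi> ` W \<subseteq> \<phi> ` carrier V"
      using sub[OF W] by (auto simp: lie_submodule_restrict_iff)
    show "fd (\<phi> ` W)" using I(2) W chart.finite_dim_iff[OF c(1)] c(2) by simp
    show "finite {W'\<in>I. lie_iso (g_submodule V W') (g_submodule V W)}" using I(3) W by blast
    fix Y assume Y: "invariant_subspace (\<lambda>a. \<rho> (in_g a)) Y" "Y \<subseteq> \<phi> ` W" "Y \<noteq> {0}"
    have "simple_lie_module (g_submodule V W)" using I(2) W by blast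
    then show "Y = \<phi> ` W"
      unfolding chart.simple_iff[OF c(1) g_rep] c(2) using Y by blast
  qed
qed

lemma harish_chandra_locally_finite:
  assumes "harish_chandra V" "u \<in> \<phi> ` carrier V"
  obtains Y where "fd Y" "invariant_subspace (\<lambda>a. \<rho> (in_g a)) Y" "u \<in> Y" "Y \<subseteq> \<phi> ` carrier V"
proof (rule harish_chandra_decomposition[OF assms(1)])
  fix I
  assume I: "internal_direct_sum (restrict_g V) I"
    "\<And>W. W \<in> I \<Longrightarrow> lie_submodule W (restrict_g V)"
    "\<And>W. W \<in> I \<Longrightarrow> invariant_subspace (\<lambda>a. \<rho> (in_g a)) (\<phi> ` W)"
    "\<And>W. W \<in> I \<Longrightarrow> \<phi> ` W \<subseteq> \<phi> ` carrier V"
    "\<And>W. W \<in> I \<Longrightarrow> fd (\<phi> ` W)"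
    "\<And>W. W \<in> I \<Longrightarrow> finite {W'\<in>I. lie_iso (g_submodule V W') (g_submodule V W)}"
    "\<And>W Y. W \<in> I \<Longrightarrow> invariant_subspace (\<lambda>a. \<rho> (in_g a)) Y \<Longrightarrow> Y \<subseteq> \<phi> ` W \<Longrightarrow> Y \<noteq> {0} \<Longrightarrow> Y = \<phi> ` W"
  obtain v where "v \<in> carrier (restrict_g V)" "u = \<phi> v" using assms(2) by auto
  then obtain F y where F: "finite F" "F \<subseteq> I" "\<And>W. W \<in> F \<Longrightarrow> y W \<in> \<phi> ` W" "u = (\<Sum>W\<in>F. y W)"
    using R.direct_sum_decompose[OF I(1)] by metis
  show ?thesis
  proof
    show "fd (cvec.span (\<Union>W\<in>F. \<phi> ` W))" using F(1,2) I(5) by (intro fd_UN_span) auto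
    show "invariant_subspace (\<lambda>a. \<rho> (in_g a)) (cvec.span (\<Union>W\<in>F. \<phi> ` W))"
      using F(2) I(3) by (intro lie_rep_invariant_span_Union g_rep) auto
    show "u \<in> cvec.span (\<Union>W\<in>F. \<phi> ` W)"
      unfolding F(4) using F(3) by (intro cvec.span_sum cvec.span_base UN_I)
    show "cvec.span (\<Union>W\<in>F. \<phi> ` W) \<subseteq> \<phi> ` carrier V"
      using F(2) I(4) by (intro cvec.span_minimal subspace_image) blast
  qed
qed

text \<open>The component of a highest weight vector in a summand is 0 or again a highest weight
  vector, and a summand containing a nonzero one is isomorphic to L(m). Finite multiplicity leaves
  finitely many such summands.\<close>

lemma harish_chandra_hw_fd:
  assumes "harish_chandra V"
  shows "fd {u \<in> \<phi> ` carrier V. hw (of_nat m) u}"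
proof (rule harish_chandra_decomposition[OF assms])
  fix I
  assume I: "internal_direct_sum (restrict_g V) I"
    "\<And>W. W \<in> I \<Longrightarrow> lie_submodule W (restrict_g V)"
    "\<And>W. W \<in> I \<Longrightarrow> invariant_subspace (\<lambda>a. \<rho> (in_g a)) (\<phi> ` W)"
    "\<And>W. W \<in> I \<Longrightarrow> \<phi> ` W \<subseteq> \<phi> ` carrier V"
    "\<And>W. W \<in> I \<Longrightarrow> fd (\<phi> ` W)"
    "\<And>W. W \<in> I \<Longrightarrow> finite {W'\<in>I. lie_iso (g_submodule V W') (g_submodule V W)}"
    "\<And>W Y. W \<in> I \<Longrightarrow> invariant_subspace (\<lambda>a. \<rho> (in_g a)) Y \<Longrightarrow> Y \<subseteq> \<phi> ` W \<Longrightarrow> Y \<noteq> {0} \<Longrightarrow> Y = \<phi> ` W"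
  define J where "J = {W \<in> I. \<exists>u\<in>\<phi> ` W. u \<noteq> 0 \<and> hw (of_nat m) u}"
  have iso: "lie_iso (L_g m) (g_submodule V W)" if WJ: "W \<in> J" for W
  proof -
    obtain u where u: "u \<in> \<phi> ` W" "u \<noteq> 0" "hw (of_nat m) u" and W: "W \<in> I" using WJ unfolding J_def by blast
    note inv = I(3)[OF W]
    obtain k where "(of_nat m :: complex) = of_nat k" "(f ^^ Suc k) u = 0"
      using fd_hw_nat[OF I(5)[OF W] inv u] by metis
    then have nil: "(f ^^ Suc m) u = 0" by (metis of_nat_eq_iff)
    have sub: "fstring u \<subseteq> \<phi> ` W"
      using inv u(1) unfolding invariant_subspace_def by (intro fstring_subset) auto
    have "u \<in> fstring u" using f_pow_in_fstring[of 0 u] by simp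
    then have "fstring u = \<phi> ` W"
      using I(7)[OF W fstring_invariant[OF u(3)] sub] u(2) by auto
    then show ?thesis
      using lie_iso_L_g[OF g_chart(1)[OF I(2)[OF W]] _ u(3) nil u(2)] g_chart(2)[OF I(2)[OF W]] by simp
  qed
  have "finite J"
  proof (cases "J = {}")
    case False
    then obtain W0 where W0: "W0 \<in> J" by blast
    have "lie_iso (g_submodule V W) (g_submodule V W0)" if "W \<in> J" for W
      using lie_iso_trans[OF lie_iso_sym[OF lie_module_L_g iso[OF that]] iso[OF W0]] .
    then have "J \<subseteq> {W'\<in>I. lie_iso (g_submodule V W') (g_submodule V W0)}" by (auto simp: J_def)
    moreover have "W0 \<in> I" using W0 by (simp add: J_def)
    ultimately show ?thesis using I(6) finite_subset by blast
  qed simp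
  then have "fd (cvec.span (\<Union>W\<in>J. \<phi> ` W))" using I(5) by (intro fd_UN_span) (auto simp: J_def)
  moreover have "u \<in> cvec.span (\<Union>W\<in>J. \<phi> ` W)" if u: "u \<in> \<phi> ` carrier V" "hw (of_nat m) u" for u
  proof -
    obtain v where "v \<in> carrier (restrict_g V)" "u = \<phi> v" using u(1) by auto
    then obtain F y where F: "finite F" "F \<subseteq> I" "\<And>W. W \<in> F \<Longrightarrow> y W \<in> \<phi> ` W" "u = (\<Sum>W\<in>F. y W)"
      using R.direct_sum_decompose[OF I(1)] by metis
    have mem: "\<rho> (in_g a) (y W) \<in> \<phi> ` W" if "W \<in> F" for W a
      using F(2) F(3)[OF that] I(3)[of W] that unfolding invariant_subspace_def by blast
    have sub: "cvec.subspace (\<phi> ` W)" if "W \<in> F" for W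
      using F(2) I(3)[of W] that by (auto simp: invariant_subspace_def)
    have e0: "e (y W) = 0" if "W \<in> F" for W
      by (rule R.direct_sum_zero[OF I(1) F(1,2) _ _ that])
        (use u(2) in \<open>simp_all add: mem hw_def F(4) rep_simps\<close>)
    have h0: "h (y W) - of_nat m *\<^sub>c y W = 0" if "W \<in> F" for W
    proof (rule R.direct_sum_zero[where y = "\<lambda>W. h (y W) - of_nat m *\<^sub>c y W", OF I(1) F(1,2) _ _ that])
      show "h (y W) - of_nat m *\<^sub>c y W \<in> \<phi> ` W" if "W \<in> F" for W
        using that mem sub F(3) by (intro cvec.subspace_diff cvec.subspace_scale) auto
      show "(\<Sum>W\<in>F. h (y W) - of_nat m *\<^sub>c y W) = 0"
        using u(2) unfolding hw_def F(4) by (simp add: rep_simps cvec.scale_sum_right sum_subtractf)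
    qed
    have "y W \<in> cvec.span (\<Union>W\<in>J. \<phi> ` W)" if "W \<in> F" for W
    proof (cases "y W = 0")
      case False
      then have "y W \<noteq> 0 \<and> hw (of_nat m) (y W)" using e0[OF that] h0[OF that] by (simp add: hw_def)
      then have "W \<in> J" using F(2) F(3)[OF that] that unfolding J_def by blast
      then show ?thesis using F(3)[OF that] by (intro cvec.span_base) blast
    qed (simp add: cvec.span_zero)
    then show ?thesis unfolding F(4) by (rule cvec.span_sum)
  qed
  ultimately show ?thesis by (auto intro: fd_subset)
qed

text \<open>In infinite dimension an operator may lack eigenvectors; here the finite-dimensional
  stable subspace Y supplies one, and its eigenspace is a nonzero submodule. The highest weight
  vectors of one fixed weight will serve as Y.\<close>

lemma schur:
  assumes "simple_lie_module V" "clinear A"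
    and comm: "\<And>u. A (e u) = e (A u)" "\<And>u. A (f u) = f (A u)" "\<And>u. A (h u) = h (A u)"
      "\<And>u. A (eb u) = eb (A u)" "\<And>u. A (fb u) = fb (A u)" "\<And>u. A (hb u) = hb (A u)"
    and Y: "cvec.subspace Y" "fd Y" "Y \<noteq> {0}" "Y \<subseteq> \<phi> ` carrier V" "\<And>y. y \<in> Y \<Longrightarrow> A y \<in> Y"
  obtains a where "\<And>u. u \<in> \<phi> ` carrier V \<Longrightarrow> A u = a *\<^sub>c u"
proof -
  obtain y a where y: "y \<in> Y" "y \<noteq> 0" "A y = a *\<^sub>c y" using exists_eigenvector[OF assms(2) Y(1,5,2,3)] by blast
  let ?E = "\<phi> ` carrier V \<inter> {u. A u = a *\<^sub>c u}"
  have "invariant_subspace \<rho> ?E"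
    by (rule invariantI)
      (auto simp: comm rep_simps closed intro!: cvec.subspace_inter subspace_image eigenspace_subspace assms(2))
  moreover have "?E \<noteq> {0}" using y Y(4) by blast
  ultimately have "?E = \<phi> ` carrier V"
    using assms(1) unfolding simple_iff[OF lie_rep_\<rho>] by blast
  then show ?thesis using that by blast
qed

lemma subspace_hw: "cvec.subspace {u \<in> \<phi> ` carrier V. hw m u}"
proof -
  have "{u \<in> \<phi> ` carrier V. hw m u} = \<phi> ` carrier V \<inter> ({u. e u = 0} \<inter> {u. h u = m *\<^sub>c u})"
    by (auto simp: hw_def)
  then show ?thesis
    using subspace_image clinear.kernel_subspace[OF rep_linear] eigenspace_subspace[OF rep_linear]
    by (simp add: cvec.subspace_inter)
qed

lemma simple_harish_chandra_has_generator:
  assumes "simple_harish_chandra V"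
  obtains n z c v where "generator n z c v" "v \<noteq> 0" "\<phi> ` carrier V = gspan v"
    "\<And>u. u \<in> \<phi> ` carrier V \<Longrightarrow> Cbar u = z *\<^sub>c u"
proof -
  have simple: "simple_lie_module V" and hc: "harish_chandra V"
    using assms by (simp_all add: simple_harish_chandra_def)
  let ?M = "\<phi> ` carrier V"
  have nz: "?M \<noteq> {0}" using simple by (simp add: simple_iff[OF lie_rep_\<rho>])
  then obtain x where x: "x \<in> ?M" "x \<noteq> 0" using cvec.subspace_0[OF subspace_image] by blast
  obtain Y where Y: "fd Y" "invariant_subspace (\<lambda>a. \<rho> (in_g a)) Y" "x \<in> Y" "Y \<subseteq> ?M"
    using harish_chandra_locally_finite[OF hc x(1)] .
  have "Y \<noteq> {0}" using x Y(3) by blast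
  then obtain k0 u0 where u0: "u0 \<in> Y" "u0 \<noteq> 0" "hw (of_nat k0) u0" using exists_hw[OF Y(1,2)] by metis
  let ?Q = "\<lambda>k. \<exists>u\<in>?M. u \<noteq> 0 \<and> hw (of_nat k) u"
  have "?Q k0" using u0 Y(4) by blast
  define n where "n = (LEAST k. ?Q k)"
  have "?Q n" unfolding n_def by (rule LeastI[of ?Q, OF \<open>?Q k0\<close>])
  then obtain v where v: "v \<in> ?M" "v \<noteq> 0" "hw (of_nat n) v" by blast
  let ?H = "{u \<in> ?M. hw (of_nat n) u}"
  have H: "cvec.subspace ?H" "fd ?H" "?H \<noteq> {0}" "?H \<subseteq> ?M"
    using subspace_hw harish_chandra_hw_fd[OF hc] v by auto
  note sub = cvec.subspace_add[OF subspace_image] cvec.subspace_scale[OF subspace_image]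
  have C: "Cbar u \<in> ?H" "Cmix u \<in> ?H" if "u \<in> ?H" for u
    using that hw_Cbar hw_Cmix by (auto simp: Cbar_def Cmix_def intro!: sub closed)
  obtain z where z: "\<And>u. u \<in> ?M \<Longrightarrow> Cbar u = z *\<^sub>c u"
    using schur[OF simple linear_Cbar Cbar_commute H C(1)] by blast
  obtain c where c: "\<And>u. u \<in> ?M \<Longrightarrow> Cmix u = c *\<^sub>c u"
    using schur[OF simple linear_Cmix Cmix_commute H C(2)] by blast
  have nat_hw: "\<exists>k. m = of_nat k \<and> (f ^^ Suc k) u = 0" if u: "u \<in> ?M" "u \<noteq> 0" "hw m u" for m u
  proof -
    obtain Y where Y: "fd Y" "invariant_subspace (\<lambda>a. \<rho> (in_g a)) Y" "u \<in> Y"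
      using harish_chandra_locally_finite[OF hc u(1)] by metis
    show ?thesis using fd_hw_nat[OF Y u(2,3)] by metis
  qed
  have nil: "(f ^^ Suc n) v = 0" using nat_hw[OF v] by (metis of_nat_eq_iff)
  \<comment> \<open>Otherwise this would be a highest weight vector of weight n - 2, and that weight
    would be a natural number below the least one.\<close>
  have D: "Dn (of_nat n) v = 0"
  proof (rule ccontr)
    assume nz: "Dn (of_nat n) v \<noteq> 0"
    have mem: "Dn (of_nat n) v \<in> ?M"
      unfolding Dn_def by (intro cvec.subspace_diff[OF subspace_image] sub closed v)
    obtain k where k: "of_nat n - 2 = (of_nat k :: complex)"
      using nat_hw[OF mem nz hw_Dn[OF v(3)]] by blast
    have hw: "hw (of_nat k) (Dn (of_nat n) v)" using hw_Dn[OF v(3)] k by simp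
    have "(of_nat n :: complex) = of_nat (k + 2)" using k by (simp add: algebra_simps)
    then have "n = k + 2" by (simp only: of_nat_eq_iff)
    moreover have "?Q k" using mem nz hw by blast
    then have "n \<le> k" unfolding n_def by (rule Least_le)
    ultimately show False by simp
  qed
  have gen: "generator n z c v" using v nil D z[OF v(1)] c[OF v(1)] by (simp add: generator_def)
  have "gspan v \<subseteq> ?M" by (rule generated_minimal[OF gen invariant_image v(1)])
  moreover have "gspan v \<noteq> {0}" using generator_in_generated[OF gen] v(2) by auto
  ultimately have "?M = gspan v"
    using simple generated_invariant[OF gen] unfolding simple_iff[OF lie_rep_\<rho>] by blast
  then show ?thesis using that[OF gen v(2) _ z] by blast
qed

end

text \<open>The graph of the isomorphism is the submodule of the product generated by the pair of
  generators; by irreducibility it meets both factors trivially.\<close>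

lemma takiff_rep_product:
  assumes "takiff_rep \<rho>" "takiff_rep \<sigma>"
  shows "takiff_rep (\<lambda>x u. (\<rho> x (fst u), \<sigma> x (snd u)))"
proof -
  interpret A: takiff_rep \<rho> by fact
  interpret B: takiff_rep \<sigma> by fact
  show ?thesis
    by unfold_locales
      (simp_all add: A.rep_simps B.rep_simps A.rep_add B.rep_add A.rep_cscale B.rep_cscale
        A.rep_bracket B.rep_bracket cscale_prod_def prod_eq_iff)
qed

lemma generator_isomorphism:
  assumes "takiff_rep \<rho>" "takiff_rep \<sigma>" "takiff_rep.generator \<rho> n z c v" "takiff_rep.generator \<sigma> n z c w"
    and "v \<noteq> 0" "w \<noteq> 0"
    and "\<And>W. invariant_subspace \<rho> W \<Longrightarrow> W \<subseteq> takiff_rep.gspan \<rho> v \<Longrightarrow> W \<noteq> {0} \<Longrightarrow> W = takiff_rep.gspan \<rho> v"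
    and "\<And>W. invariant_subspace \<sigma> W \<Longrightarrow> W \<subseteq> takiff_rep.gspan \<sigma> w \<Longrightarrow> W \<noteq> {0} \<Longrightarrow> W = takiff_rep.gspan \<sigma> w"
  obtains \<theta> where "bij_betw \<theta> (takiff_rep.gspan \<rho> v) (takiff_rep.gspan \<sigma> w)"
    "\<And>u u'. u \<in> takiff_rep.gspan \<rho> v \<Longrightarrow> u' \<in> takiff_rep.gspan \<rho> v \<Longrightarrow> \<theta> (u + u') = \<theta> u + \<theta> u'"
    "\<And>a u. u \<in> takiff_rep.gspan \<rho> v \<Longrightarrow> \<theta> (a *\<^sub>c u) = a *\<^sub>c \<theta> u"
    "\<And>x u. u \<in> takiff_rep.gspan \<rho> v \<Longrightarrow> \<theta> (\<rho> x u) = \<sigma> x (\<theta> u)"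
proof -
  interpret A: takiff_rep \<rho> by fact
  interpret B: takiff_rep \<sigma> by fact
  define \<pi> where "\<pi> x u = (\<rho> x (fst u), \<sigma> x (snd u))" for x u
  interpret P: takiff_rep \<pi> unfolding \<pi>_def[abs_def] by (rule takiff_rep_product) fact+
  have pow: "(\<pi> x ^^ i) (a, b) = ((\<rho> x ^^ i) a, (\<sigma> x ^^ i) b)" for x i a b
    by (induction i) (simp_all add: \<pi>_def)
  \<comment> \<open>All conditions on a generator are equations with the parameters n, z, c, so the
    pair of generators satisfies them componentwise.\<close>
  have gen: "P.generator n z c (v, w)"
    using assms(3,4)
    unfolding A.generator_def B.generator_def P.generator_def A.hw_def B.hw_def P.hw_def pow
      A.Cbar_def B.Cbar_def P.Cbar_def A.Cmix_def B.Cmix_def P.Cmix_def A.Dn_def B.Dn_def P.Dn_def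
    by (elim conjE) (simp add: \<pi>_def prod_eq_iff A.rep_simps(4) B.rep_simps(4))
  let ?N = "P.gspan (v, w)" and ?A = "A.gspan v" and ?B = "B.gspan w"
  note subN = P.generated_invariant[OF gen]
  have subN': "cvec.subspace ?N" using subN by (simp add: invariant_subspace_def)
  have "P.gspan (v, w) \<subseteq> ?A \<times> ?B"
  proof (rule P.generated_minimal[OF gen])
    have "\<rho> x u \<in> ?A" if "u \<in> ?A" for x u
      using A.generated_invariant[OF assms(3)] that by (simp add: invariant_subspace_def)
    moreover have "\<sigma> x u \<in> ?B" if "u \<in> ?B" for x u
      using B.generated_invariant[OF assms(4)] that by (simp add: invariant_subspace_def)
    moreover have "cvec.subspace (?A \<times> ?B)"
      using A.subspace_generated[OF assms(3)] B.subspace_generated[OF assms(4)]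
      by (auto simp: cvec.subspace_def zero_prod_def plus_prod_def cscale_prod_def)
    ultimately show "invariant_subspace \<pi> (?A \<times> ?B)" by (auto simp: invariant_subspace_def \<pi>_def)
  qed (use A.generator_in_generated[OF assms(3)] B.generator_in_generated[OF assms(4)] in auto)
  then have N: "a \<in> ?A" "b \<in> ?B" if "(a, b) \<in> ?N" for a b using that by auto
  have "clinear (fst :: 'a \<times> 'b \<Rightarrow> 'a)" "clinear (snd :: 'a \<times> 'b \<Rightarrow> 'b)" by unfold_locales simp_all
  note sub_image = this[THEN clinear.image_subspace, OF subN']
  have vw: "(v, w) \<in> ?N" by (rule P.generator_in_generated[OF gen])
  have fstN: "?A \<subseteq> fst ` ?N"
    by (rule A.generated_minimal[OF assms(3)])
      (use subN sub_image vw in \<open>force simp: invariant_subspace_def \<pi>_def\<close>)+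
  have sndN: "?B \<subseteq> snd ` ?N"
    by (rule B.generated_minimal[OF assms(4)])
      (use subN sub_image vw in \<open>force simp: invariant_subspace_def \<pi>_def\<close>)+
  \<comment> \<open>Highest weight vectors of weight n in \<open>?N\<close> are multiples of (v, w),
    and neither (v, 0) nor (0, w) is a nonzero multiple.\<close>
  have pair0: False if mem: "(a, b) \<in> ?N" and ab: "(a, b) = (0, w) \<or> (a, b) = (v, 0)" for a b
  proof -
    have "P.hw (of_nat n) (a, b)"
      using ab assms(3,4)
      by (auto simp: P.hw_def A.hw_def B.hw_def A.generator_def B.generator_def \<pi>_def prod_eq_iff A.rep_simps B.rep_simps)
    moreover have "(a, b) \<noteq> 0" using ab assms(5,6) by (auto simp: zero_prod_def)
    ultimately obtain k d where k: "(of_nat n :: complex) = of_nat (n + 2 * k)" "(a, b) = d *\<^sub>c (\<pi> (bar sl2_e) ^^ k) (v, w)" "d \<noteq> 0"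
      using P.hw_in_generated[OF gen mem] by metis
    have "k = 0" using k(1) by (simp only: of_nat_eq_iff)
    then have "(a, b) = (d *\<^sub>c v, d *\<^sub>c w)" using k(2) by (simp add: cscale_prod_def)
    then show False using ab k(3) assms(5,6) by auto
  qed
  \<comment> \<open>The second components of vectors (0, b) in \<open>?N\<close> form a submodule of
    the irreducible \<open>?B\<close>, and by \<open>pair0\<close> it does not contain w.\<close>
  have right: "b = 0" if "(0, b) \<in> ?N" for b
  proof (rule ccontr)
    assume "b \<noteq> 0"
    let ?K = "{b. (0, b) \<in> ?N}"
    have "cvec.subspace ?K"
      using subN' unfolding cvec.subspace_def by (auto simp: zero_prod_def plus_prod_def cscale_prod_def) force+
    moreover have "\<sigma> x b \<in> ?K" if "b \<in> ?K" for x b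
      using subN that A.rep_simps(4) by (force simp: invariant_subspace_def \<pi>_def)
    ultimately have "invariant_subspace \<sigma> ?K" by (simp add: invariant_subspace_def)
    moreover have "?K \<subseteq> ?B" using N by blast
    moreover have "?K \<noteq> {0}" using \<open>b \<noteq> 0\<close> that by blast
    ultimately have "?K = ?B" by (rule assms(8))
    then have "(0, w) \<in> ?N" using B.generator_in_generated[OF assms(4)] by blast
    then show False using pair0 by blast
  qed
  have left: "a = 0" if "(a, 0) \<in> ?N" for a
  proof (rule ccontr)
    assume "a \<noteq> 0"
    let ?K = "{a. (a, 0) \<in> ?N}"
    have "cvec.subspace ?K"
      using subN' unfolding cvec.subspace_def by (auto simp: zero_prod_def plus_prod_def cscale_prod_def) force+
    moreover have "\<rho> x a \<in> ?K" if "a \<in> ?K" for x a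
      using subN that B.rep_simps(4) by (force simp: invariant_subspace_def \<pi>_def)
    ultimately have "invariant_subspace \<rho> ?K" by (simp add: invariant_subspace_def)
    moreover have "?K \<subseteq> ?A" using N by blast
    moreover have "?K \<noteq> {0}" using \<open>a \<noteq> 0\<close> that by blast
    ultimately have "?K = ?A" by (rule assms(7))
    then have "(v, 0) \<in> ?N" using A.generator_in_generated[OF assms(3)] by blast
    then show False using pair0 by blast
  qed
  have uniq_r: "b = b'" if "(a, b) \<in> ?N" "(a, b') \<in> ?N" for a b b'
    using right[of "b - b'"] cvec.subspace_diff[OF subN' that] by simp
  have uniq_l: "a = a'" if "(a, b) \<in> ?N" "(a', b) \<in> ?N" for a a' b
    using left[of "a - a'"] cvec.subspace_diff[OF subN' that] by simp
  define \<theta> where "\<theta> a = (SOME b. (a, b) \<in> ?N)" for a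
  have \<theta>: "(a, \<theta> a) \<in> ?N" if "a \<in> ?A" for a
  proof -
    obtain p where "p \<in> ?N" "a = fst p" using fstN \<open>a \<in> ?A\<close> by blast
    then have "\<exists>b. (a, b) \<in> ?N" by (cases p) auto
    then show ?thesis unfolding \<theta>_def by (rule someI_ex)
  qed
  have \<theta>_eq: "\<theta> a = b" if "(a, b) \<in> ?N" for a b
    using uniq_r[OF \<theta> that] N(1)[OF that] by blast
  show ?thesis
  proof
    show "bij_betw \<theta> ?A ?B"
      unfolding bij_betw_def
    proof
      show "inj_on \<theta> ?A" by (rule inj_onI) (metis \<theta> uniq_l)
      show "\<theta> ` ?A = ?B"
      proof
        show "\<theta> ` ?A \<subseteq> ?B" using \<theta> N by blast
        show "?B \<subseteq> \<theta> ` ?A"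
        proof
          fix b assume "b \<in> ?B"
          then obtain p where "p \<in> ?N" "b = snd p" using sndN by blast
          then have p: "(fst p, b) \<in> ?N" by simp
          show "b \<in> \<theta> ` ?A" using \<theta>_eq[OF p, symmetric] N(1)[OF p] by (rule image_eqI[where f = \<theta>])
        qed
      qed
    qed
    show "\<theta> (u + u') = \<theta> u + \<theta> u'" if "u \<in> ?A" "u' \<in> ?A" for u u'
      using cvec.subspace_add[OF subN' \<theta>[OF that(1)] \<theta>[OF that(2)]] by - (rule \<theta>_eq, simp)
    show "\<theta> (a *\<^sub>c u) = a *\<^sub>c \<theta> u" if "u \<in> ?A" for a u
      using cvec.subspace_scale[OF subN' \<theta>[OF that]] by - (rule \<theta>_eq, simp add: cscale_prod_def)
    show "\<theta> (\<rho> x u) = \<sigma> x (\<theta> u)" if "u \<in> ?A" for x u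
    proof (rule \<theta>_eq)
      have "\<pi> x (u, \<theta> u) \<in> ?N" using subN \<theta>[OF that] by (simp add: invariant_subspace_def)
      then show "(\<rho> x u, \<sigma> x (\<theta> u)) \<in> ?N" by (simp add: \<pi>_def)
    qed
  qed
qed

lemma lie_iso_of_generators:
  assumes "takiff_chart V \<phi> \<rho>" "takiff_chart W \<psi> \<sigma>"
    and "takiff_rep.generator \<rho> n z c v" "takiff_rep.generator \<sigma> n z c w"
    and "\<phi> ` carrier V = takiff_rep.gspan \<rho> v" "\<psi> ` carrier W = takiff_rep.gspan \<sigma> w"
    and "v \<noteq> 0" "w \<noteq> 0" "simple_lie_module V" "simple_lie_module W"
  shows "lie_iso V W"
proof -
  interpret A: takiff_chart V \<phi> \<rho> by fact
  interpret B: takiff_chart W \<psi> \<sigma> by fact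
  show ?thesis
  proof (rule generator_isomorphism[OF A.takiff_rep_axioms B.takiff_rep_axioms assms(3,4,7,8)])
    show "W = A.gspan v" if "invariant_subspace \<rho> W" "W \<subseteq> A.gspan v" "W \<noteq> {0}" for W
      using assms(9) that unfolding A.simple_iff[OF A.lie_rep_\<rho>] assms(5) by blast
    show "W = B.gspan w" if "invariant_subspace \<sigma> W" "W \<subseteq> B.gspan w" "W \<noteq> {0}" for W
      using assms(10) that unfolding B.simple_iff[OF B.lie_rep_\<rho>] assms(6) by blast
    fix \<theta> assume "bij_betw \<theta> (A.gspan v) (B.gspan w)"
      "\<And>u u'. u \<in> A.gspan v \<Longrightarrow> u' \<in> A.gspan v \<Longrightarrow> \<theta> (u + u') = \<theta> u + \<theta> u'"
      "\<And>a u. u \<in> A.gspan v \<Longrightarrow> \<theta> (a *\<^sub>c u) = a *\<^sub>c \<theta> u"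
      "\<And>x u. u \<in> A.gspan v \<Longrightarrow> \<theta> (\<rho> x u) = \<sigma> x (\<theta> u)"
    then show ?thesis
      by (intro lie_iso_of_charts[OF A.chart_V B.chart_V, of \<theta>]) (simp_all add: assms(5,6))
  qed
qed


section \<open>Every module has a chart\<close>

text \<open>Take nested bases of K, W and the whole space; the map keeps the basis vectors of W
  outside K and kills all others. It realizes the quotient W / K inside the given type, with
  representatives that depend linearly on the vector.\<close>

lemma exists_projection:
  assumes "cvec.subspace K" "cvec.subspace W" "K \<subseteq> W"
  obtains \<pi> :: "'a::complex_vector \<Rightarrow> 'a" where "clinear \<pi>" "range \<pi> \<subseteq> W" "\<And>x. x \<in> K \<Longrightarrow> \<pi> x = 0"
    "\<And>x. x \<in> W \<Longrightarrow> x - \<pi> x \<in> K"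
proof -
  interpret vector_space_pair "cscale :: complex \<Rightarrow> 'a \<Rightarrow> 'a" "cscale :: complex \<Rightarrow> 'a \<Rightarrow> 'a" ..
  obtain B where B: "B \<subseteq> K" "cvec.independent B" "K \<subseteq> cvec.span B" using cvec.maximal_independent_subset by blast
  obtain B1 where B1: "B \<subseteq> B1" "B1 \<subseteq> W" "cvec.independent B1" "W \<subseteq> cvec.span B1"
    by (rule cvec.maximal_independent_subset_extend[OF subset_trans[OF B(1) assms(3)] B(2)])
  obtain B2 where B2: "B1 \<subseteq> B2" "cvec.independent B2" "UNIV \<subseteq> cvec.span B2"
    by (rule cvec.maximal_independent_subset_extend[OF subset_UNIV B1(3)])
  define \<pi> where "\<pi> = construct B2 (\<lambda>b. if b \<in> B1 - B then b else 0)"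
  have "Vector_Spaces.linear cscale cscale \<pi>" unfolding \<pi>_def by (rule linear_construct[OF B2(2)])
  then interpret L: Vector_Spaces.linear cscale cscale \<pi> .
  interpret clinear \<pi> by unfold_locales (simp_all add: L.add L.scale)
  have basis: "\<pi> b = (if b \<in> B1 - B then b else 0)" if "b \<in> B2" for b
    unfolding \<pi>_def by (rule construct_basis[OF B2(2) that])
  show ?thesis
  proof
    show "clinear \<pi>" by unfold_locales
    have "\<pi> x \<in> W" for x
      by (rule span_image_subset[of _ B2]) (use B2(3) B1(2) assms(2) in \<open>auto simp: basis cvec.subspace_0\<close>)
    then show "range \<pi> \<subseteq> W" by blast
    show "\<pi> x = 0" if "x \<in> K" for x
    proof -
      have "\<pi> x \<in> {0}"
        by (rule span_image_subset[of _ B]) (use that B B1(1) B2(1) in \<open>auto simp: basis cvec.subspace_single_0\<close>)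
      then show ?thesis by simp
    qed
    show "x - \<pi> x \<in> K" if "x \<in> W" for x
    proof -
      interpret D: clinear "\<lambda>x. x - \<pi> x" by unfold_locales (simp_all add: add cscale cvec.scale_right_diff_distrib)
      show ?thesis
        by (rule D.span_image_subset[of _ B1]) (use that B1 B(1) B2(1) assms(1) in \<open>auto simp: basis subset_iff cvec.subspace_0\<close>)
    qed
  qed
qed

text \<open>The module is a quotient of the space of finitely supported functions on its carrier, hence
  isomorphic to a complement of the kernel.\<close>

lemma lie_module_has_chart:
  fixes V :: "('l::complex_lie_algebra, 'v) lie_module"
  assumes "lie_module V"
  obtains \<phi> :: "'v \<Rightarrow> 'v \<Rightarrow> complex" and \<rho> where "lie_rep \<rho>" "chart V \<phi> \<rho>"
proof -
  interpret lie_module V by fact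
  define Fin where "Fin = {g :: 'v \<Rightarrow> complex. finite {v. g v \<noteq> 0} \<and> {v. g v \<noteq> 0} \<subseteq> carrier V}"
  define \<epsilon> where "\<epsilon> g = finsum V (\<lambda>v. g v \<odot>\<^bsub>V\<^esub> v) {v. g v \<noteq> 0}" for g
  define \<delta> where "\<delta> v = (\<lambda>w. if w = v then 1 else 0 :: complex)" for v :: 'v
  have sc: "c \<odot>\<^bsub>V\<^esub> v \<in> carrier V" if "v \<in> carrier V" for c v
    using that by (simp add: smult_closed complex_ring_def)
  have s0: "0 \<odot>\<^bsub>V\<^esub> v = \<zero>\<^bsub>V\<^esub>" and s1: "1 \<odot>\<^bsub>V\<^esub> v = v"
    and sm: "(c * d) \<odot>\<^bsub>V\<^esub> v = c \<odot>\<^bsub>V\<^esub> (d \<odot>\<^bsub>V\<^esub> v)" and sa: "(c + d) \<odot>\<^bsub>V\<^esub> v = c \<odot>\<^bsub>V\<^esub> v \<oplus>\<^bsub>V\<^esub> d \<odot>\<^bsub>V\<^esub> v"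
    if "v \<in> carrier V" for c d v
    using smult_l_null[OF that] smult_one[OF that] smult_assoc1[of c d v] smult_l_distr[of c d v] that
    by (simp_all add: complex_ring_def)
  have \<epsilon>_over: "\<epsilon> g = finsum V (\<lambda>v. g v \<odot>\<^bsub>V\<^esub> v) A" if "finite A" "{v. g v \<noteq> 0} \<subseteq> A" "A \<subseteq> carrier V" for g A
    unfolding \<epsilon>_def using that
    by (intro add.finprod_mono_neutral_cong_left) (auto simp: s0 sc subset_iff)
  have \<epsilon>_closed: "\<epsilon> g \<in> carrier V" if "g \<in> Fin" for g
    using that unfolding \<epsilon>_def Fin_def by (intro finsum_closed) (auto simp: sc)
  have \<epsilon>_add: "\<epsilon> (g + g') = \<epsilon> g \<oplus>\<^bsub>V\<^esub> \<epsilon> g'" if "g \<in> Fin" "g' \<in> Fin" for g g'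
  proof -
    let ?A = "{v. g v \<noteq> 0} \<union> {v. g' v \<noteq> 0}"
    have A: "finite ?A" "?A \<subseteq> carrier V" using that by (auto simp: Fin_def)
    have mem: "v \<in> carrier V" if "v \<in> ?A" for v using that A(2) by blast
    have "\<epsilon> (g + g') = finsum V (\<lambda>v. (g + g') v \<odot>\<^bsub>V\<^esub> v) ?A"
      using A by (intro \<epsilon>_over) auto
    also have "\<dots> = finsum V (\<lambda>v. (g v \<odot>\<^bsub>V\<^esub> v) \<oplus>\<^bsub>V\<^esub> (g' v \<odot>\<^bsub>V\<^esub> v)) ?A"
      by (rule finsum_cong'[OF refl], rule Pi_I) (simp_all only: plus_fun_apply sa sc mem M.a_closed)
    also have "\<dots> = finsum V (\<lambda>v. g v \<odot>\<^bsub>V\<^esub> v) ?A \<oplus>\<^bsub>V\<^esub> finsum V (\<lambda>v. g' v \<odot>\<^bsub>V\<^esub> v) ?A"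
      using A by (intro finsum_addf) (auto simp: sc)
    also have "finsum V (\<lambda>v. g v \<odot>\<^bsub>V\<^esub> v) ?A = \<epsilon> g" using A by (intro \<epsilon>_over[symmetric]) auto
    also have "finsum V (\<lambda>v. g' v \<odot>\<^bsub>V\<^esub> v) ?A = \<epsilon> g'" using A by (intro \<epsilon>_over[symmetric]) auto
    finally show ?thesis .
  qed
  have \<epsilon>_scale: "\<epsilon> (c *\<^sub>c g) = c \<odot>\<^bsub>V\<^esub> \<epsilon> g" if "g \<in> Fin" for c g
  proof -
    let ?A = "{v. g v \<noteq> 0}"
    have A: "finite ?A" "?A \<subseteq> carrier V" using that by (auto simp: Fin_def)
    have mem: "v \<in> carrier V" if "v \<in> ?A" for v using that A(2) by blast
    have "\<epsilon> (c *\<^sub>c g) = finsum V (\<lambda>v. (c *\<^sub>c g) v \<odot>\<^bsub>V\<^esub> v) ?A"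
      using A by (intro \<epsilon>_over) auto
    also have "\<dots> = finsum V (\<lambda>v. c \<odot>\<^bsub>V\<^esub> (g v \<odot>\<^bsub>V\<^esub> v)) ?A"
      by (rule finsum_cong'[OF refl], rule Pi_I) (simp_all only: cscale_fun_apply cscale_complex sm sc mem)
    also have "\<dots> = c \<odot>\<^bsub>V\<^esub> \<epsilon> g"
      unfolding \<epsilon>_def using A by (intro finsum_smult_ldistr[symmetric]) (auto simp: complex_ring_def sc)
    finally show ?thesis .
  qed
  have \<delta>_Fin: "\<delta> v \<in> Fin" if "v \<in> carrier V" for v using that by (simp add: Fin_def \<delta>_def)
  have \<epsilon>_\<delta>: "\<epsilon> (\<delta> v) = v" if "v \<in> carrier V" for v
    using that by (subst \<epsilon>_over[of "{v}"]) (auto simp: \<delta>_def s1 finsum_insert)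
  have sub_Fin: "cvec.subspace Fin"
  proof (rule cvec.subspaceI)
    fix g g' assume "g \<in> Fin" "g' \<in> Fin"
    moreover have "{v. (g + g') v \<noteq> 0} \<subseteq> {v. g v \<noteq> 0} \<union> {v. g' v \<noteq> 0}" by auto
    ultimately show "g + g' \<in> Fin"
      unfolding Fin_def mem_Collect_eq by (meson Un_least finite_UnI finite_subset subset_trans)
  next
    fix c g assume "g \<in> Fin"
    moreover have "{v. (c *\<^sub>c g) v \<noteq> 0} \<subseteq> {v. g v \<noteq> 0}" by auto
    ultimately show "c *\<^sub>c g \<in> Fin"
      unfolding Fin_def mem_Collect_eq by (meson finite_subset subset_trans)
  qed (simp add: Fin_def)
  define K where "K = {g \<in> Fin. \<epsilon> g = \<zero>\<^bsub>V\<^esub>}"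
  have sub_K: "cvec.subspace K"
  proof (rule cvec.subspaceI)
    have "\<epsilon> (0 *\<^sub>c 0) = 0 \<odot>\<^bsub>V\<^esub> \<epsilon> 0" by (rule \<epsilon>_scale[OF cvec.subspace_0[OF sub_Fin]])
    then show "0 \<in> K" using s0[OF \<epsilon>_closed] cvec.subspace_0[OF sub_Fin] by (simp add: K_def)
    show "g + g' \<in> K" if "g \<in> K" "g' \<in> K" for g g'
      using that by (simp add: K_def \<epsilon>_add cvec.subspace_add[OF sub_Fin])
    show "c *\<^sub>c g \<in> K" if "g \<in> K" for c g
      using that by (simp add: K_def \<epsilon>_scale cvec.subspace_scale[OF sub_Fin] smult_r_null complex_ring_def)
  qed
  obtain \<pi> where \<pi>: "clinear \<pi>" "range \<pi> \<subseteq> Fin" "\<And>x. x \<in> K \<Longrightarrow> \<pi> x = 0" "\<And>x. x \<in> Fin \<Longrightarrow> x - \<pi> x \<in> K"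
    by (rule exists_projection[OF sub_K sub_Fin]) (auto simp: K_def)
  interpret \<pi>: clinear \<pi> by fact
  have \<pi>_Fin: "\<pi> x \<in> Fin" for x using \<pi>(2) by blast
  define \<tau> where "\<tau> g = \<epsilon> (\<pi> g)" for g
  define \<phi> where "\<phi> v = \<pi> (\<delta> v)" for v
  \<comment> \<open>The action on an arbitrary function: pass to the module by
    \<open>\<tau>\<close>, act there, and return by \<open>\<phi>\<close>. This is defined on the
    whole type, and \<open>\<tau> (\<phi> v) = v\<close> yields the bracket relation.\<close>
  define \<rho> where "\<rho> x g = \<phi> (lact V x (\<tau> g))" for x g
  have \<tau>: "\<tau> g \<in> carrier V" for g by (simp add: \<tau>_def \<epsilon>_closed \<pi>_Fin)
  have \<tau>_add: "\<tau> (g + g') = \<tau> g \<oplus>\<^bsub>V\<^esub> \<tau> g'" for g g' by (simp add: \<tau>_def \<pi>.add \<epsilon>_add \<pi>_Fin)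
  have \<tau>_scale: "\<tau> (c *\<^sub>c g) = c \<odot>\<^bsub>V\<^esub> \<tau> g" for c g by (simp add: \<tau>_def \<pi>.cscale \<epsilon>_scale \<pi>_Fin)
  have \<epsilon>_\<pi>: "\<epsilon> (\<pi> g) = \<epsilon> g" if "g \<in> Fin" for g
  proof -
    have "\<epsilon> g = \<epsilon> ((g - \<pi> g) + \<pi> g)" by simp
    also have "\<dots> = \<epsilon> (g - \<pi> g) \<oplus>\<^bsub>V\<^esub> \<epsilon> (\<pi> g)"
      using cvec.subspace_diff[OF sub_Fin that \<pi>_Fin] by (rule \<epsilon>_add[OF _ \<pi>_Fin])
    also have "\<dots> = \<epsilon> (\<pi> g)" using \<pi>(4)[OF that] \<epsilon>_closed[OF \<pi>_Fin] by (simp add: K_def)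
    finally show ?thesis by simp
  qed
  have \<tau>_\<phi>: "\<tau> (\<phi> v) = v" if "v \<in> carrier V" for v
    by (simp add: \<tau>_def \<phi>_def \<epsilon>_\<pi> \<pi>_Fin \<delta>_Fin \<epsilon>_\<delta> that)
  have \<pi>_eq: "\<pi> g = \<pi> g'" if "g \<in> Fin" "g' \<in> Fin" "\<epsilon> g = \<epsilon> g'" for g g'
  proof -
    have "\<epsilon> (g + (-1) *\<^sub>c g') = \<epsilon> g' \<oplus>\<^bsub>V\<^esub> (-1) \<odot>\<^bsub>V\<^esub> \<epsilon> g'"
      using that by (simp only: \<epsilon>_add \<epsilon>_scale cvec.subspace_scale[OF sub_Fin])
    also have "\<dots> = (1 + -1) \<odot>\<^bsub>V\<^esub> \<epsilon> g'" by (simp only: sa s1 \<epsilon>_closed[OF that(2)])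
    also have "\<dots> = \<zero>\<^bsub>V\<^esub>" using s0[OF \<epsilon>_closed[OF that(2)]] by simp
    finally have "g + (-1) *\<^sub>c g' \<in> K"
      using that by (simp add: K_def cvec.subspace_diff[OF sub_Fin])
    then have "\<pi> (g + (-1) *\<^sub>c g') = 0" by (rule \<pi>(3))
    then show ?thesis by (simp only: \<pi>.add \<pi>.cscale) simp
  qed
  have \<phi>_add: "\<phi> (v \<oplus>\<^bsub>V\<^esub> w) = \<phi> v + \<phi> w" if "v \<in> carrier V" "w \<in> carrier V" for v w
    unfolding \<phi>_def \<pi>.add[symmetric] using that
    by (intro \<pi>_eq) (simp_all add: \<delta>_Fin cvec.subspace_add[OF sub_Fin] \<epsilon>_add \<epsilon>_\<delta>)
  have \<phi>_scale: "\<phi> (c \<odot>\<^bsub>V\<^esub> v) = c *\<^sub>c \<phi> v" if "v \<in> carrier V" for v c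
    unfolding \<phi>_def \<pi>.cscale[symmetric] using that
    by (intro \<pi>_eq) (simp_all add: \<delta>_Fin cvec.subspace_scale[OF sub_Fin] \<epsilon>_scale \<epsilon>_\<delta> sc)
  have \<phi>_zero: "\<phi> \<zero>\<^bsub>V\<^esub> = 0" using \<phi>_add[of "\<zero>\<^bsub>V\<^esub>" "\<zero>\<^bsub>V\<^esub>"] by simp
  have \<phi>_diff: "\<phi> (v \<ominus>\<^bsub>V\<^esub> w) = \<phi> v - \<phi> w" if "v \<in> carrier V" "w \<in> carrier V" for v w
  proof -
    have "\<phi> (\<ominus>\<^bsub>V\<^esub> w) + \<phi> w = 0" using that by (simp add: \<phi>_zero l_neg flip: \<phi>_add)
    then have "\<phi> (\<ominus>\<^bsub>V\<^esub> w) = - \<phi> w" by (simp add: eq_neg_iff_add_eq_0)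
    then show ?thesis using that by (simp add: a_minus_def \<phi>_add)
  qed
  note lc = lact_closed[OF \<tau>]
  have "lie_rep \<rho>"
  proof (rule lie_rep.intro)
    show "clinear (\<rho> x)" for x
      by unfold_locales (simp_all add: \<rho>_def \<tau>_add \<tau>_scale \<tau> lact_add_right lact_smult lact_closed \<phi>_add \<phi>_scale)
    show "\<rho> (x + y) g = \<rho> x g + \<rho> y g" for x y g by (simp add: \<rho>_def lact_add_left \<tau> lact_closed \<phi>_add)
    show "\<rho> (c *\<^sub>c x) g = c *\<^sub>c \<rho> x g" for c x g by (simp add: \<rho>_def lact_cscale \<tau> lact_closed \<phi>_scale)
    show "\<rho> (lie_bracket x y) g = \<rho> x (\<rho> y g) - \<rho> y (\<rho> x g)" for x y g
      by (simp add: \<rho>_def lact_bracket \<tau> lact_closed \<phi>_diff \<tau>_\<phi>)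
  qed
  moreover have "chart V \<phi> \<rho>"
  proof (rule chart.intro)
    show "inj_on \<phi> (carrier V)" by (rule inj_onI) (metis \<tau>_\<phi>)
    show "\<phi> (lact V x v) = \<rho> x (\<phi> v)" if "v \<in> carrier V" for x v using that by (simp add: \<rho>_def \<tau>_\<phi>)
  qed (simp_all add: \<phi>_zero \<phi>_add \<phi>_scale sc lact_closed)
  ultimately show ?thesis using that by blast
qed

section \<open>The modules with trivial action of the ideal\<close>

lemma L_mod_simps:
  "carrier (L_mod n) = {v. \<forall>k>n. v k = 0}" "\<zero>\<^bsub>L_mod n\<^esub> = 0" "v \<oplus>\<^bsub>L_mod n\<^esub> w = v + w" "c \<odot>\<^bsub>L_mod n\<^esub> v = c *\<^sub>c v"
  "lact (L_mod n) x = lact (L_g n) (part_1 x)"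
  by (simp_all add: L_mod_def L_g_def fun_eq_iff)

text \<open>Cutting off above n puts the argument into the carrier of \<open>L_g n\<close>, so that
  the bracket relation of \<open>lie_module_L_g\<close> gives one on the whole function
  type.\<close>

definition L_rep :: "nat \<Rightarrow> takiff \<Rightarrow> (nat \<Rightarrow> complex) \<Rightarrow> nat \<Rightarrow> complex" where
  "L_rep n x v = lact (L_g n) (part_1 x) (\<lambda>k. if k \<le> n then v k else 0)"

lemma L_rep_apply:
  "L_rep n x v k = (if k \<le> n then
     sl2_mat (part_1 x) $ 1 $ 1 * (of_nat n - 2 * of_nat k) * v k +
     sl2_mat (part_1 x) $ 1 $ 2 * of_nat (k + 1) * (of_nat n - of_nat k) * (if k < n then v (k + 1) else 0) +
     sl2_mat (part_1 x) $ 2 $ 1 * (if k = 0 then 0 else v (k - 1)) else 0)"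
  by (auto simp: L_rep_def L_g_def)

lemma takiff_rep_L_rep: "takiff_rep (L_rep n)"
proof (intro takiff_rep.intro lie_rep.intro)
  show "clinear (L_rep n x)" for x
    by unfold_locales (auto simp: L_rep_apply fun_eq_iff algebra_simps)
  show "L_rep n (x + y) v = L_rep n x v + L_rep n y v" "L_rep n (c *\<^sub>c x) v = c *\<^sub>c L_rep n x v" for x y v c
    by (auto simp: L_rep_apply fun_eq_iff plus_takiff_def cscale_takiff_def algebra_simps)
  show "L_rep n (lie_bracket x y) v = L_rep n x (L_rep n y v) - L_rep n y (L_rep n x v)" for x y v
  proof -
    interpret G: chart "L_g n" id "lact (L_g n)" by (rule chart_L_g)
    define t where "t = (\<lambda>k. if k \<le> n then v k else 0)"
    have t: "t \<in> carrier (L_g n)" by (simp add: t_def L_g_def)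
    have trunc: "(\<lambda>k. if k \<le> n then w k else 0) = w" if "w \<in> carrier (L_g n)" for w :: "nat \<Rightarrow> complex"
      using that by (auto simp: L_g_def fun_eq_iff)
    note act = G.lact(1)[OF t] G.lact(1)[OF G.lact(1)[OF t]]
    have add: "(\<oplus>\<^bsub>L_g n\<^esub>) = (+)" by (simp add: L_g_def fun_eq_iff)
    have "L_rep n (lie_bracket x y) v = lact (L_g n) (lie_bracket (part_1 x) (part_1 y)) t"
      by (simp add: L_rep_def t_def lie_bracket_takiff_def)
    also have "\<dots> = lact (L_g n) (part_1 x) (lact (L_g n) (part_1 y) t) - lact (L_g n) (part_1 y) (lact (L_g n) (part_1 x) t)"
      using G.a_inv_image(2)[OF act(2)] by (simp add: lie_module.lact_bracket[OF lie_module_L_g t] a_minus_def add)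
    also have "\<dots> = L_rep n x (L_rep n y v) - L_rep n y (L_rep n x v)"
      by (simp only: L_rep_def t_def[symmetric] trunc[OF act(1)])
    finally show ?thesis .
  qed
qed

lemma takiff_chart_L_mod: "takiff_chart (L_mod n) id (L_rep n)"
proof -
  have "lact (L_g n) (part_1 x) v = L_rep n x v" if "\<forall>k>n. v k = 0" for x v
    using that by (auto simp: L_rep_def intro!: arg_cong[of _ _ "lact (L_g n) (part_1 x)"])
  moreover have "L_rep n x v k = 0" if "k > n" for x v k using that by (simp add: L_rep_apply)
  ultimately have "chart (L_mod n) id (L_rep n)"
    by unfold_locales (simp_all add: L_mod_simps)
  then show ?thesis by (rule takiff_chart.intro[OF takiff_rep_L_rep])
qed

lemma sum_fun_apply: "(\<Sum>i\<in>A. g i) x = (\<Sum>i\<in>A. g i x)"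
  by (induction A rule: infinite_finite_induct) simp_all

text \<open>The ideal acts by 0, hence so do \<open>Cbar\<close>, \<open>Cmix\<close> and
  \<open>Dn\<close>. The parameters (n, 0, 0) are the ones that z = 0 forces on every simple module
  of minimal type n.\<close>

lemma L_mod_generator:
  defines "d \<equiv> (\<lambda>i. if i = 0 then 1 else 0 :: complex)"
  shows "takiff_rep.generator (L_rep n) n 0 0 d" "id ` carrier (L_mod n) = takiff_rep.gspan (L_rep n) d" "d \<noteq> 0"
proof -
  interpret takiff_chart "L_mod n" id "L_rep n" by (rule takiff_chart_L_mod)
  have f: "(f ^^ i) d = (\<lambda>k. if k = i \<and> i \<le> n then 1 else 0)" for i
    by (induction i) (auto simp: d_def L_rep_apply in_g_def fun_eq_iff)
  have bar: "L_rep n (bar a) u = 0" for a u by (auto simp: L_rep_apply bar_def fun_eq_iff)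
  show gen: "generator n 0 0 d"
    unfolding generator_def f by (auto simp: hw_def d_def Cbar_def Cmix_def Dn_def bar rep_simps L_rep_apply in_g_def fun_eq_iff)
  show "d \<noteq> 0" by (auto simp: d_def fun_eq_iff)
  show "id ` carrier (L_mod n) = gspan d"
  proof
    show "gspan d \<subseteq> id ` carrier (L_mod n)"
      by (rule generated_minimal[OF gen invariant_image]) (simp add: L_mod_simps d_def)
    show "id ` carrier (L_mod n) \<subseteq> gspan d"
    proof
      fix v assume "v \<in> id ` carrier (L_mod n)"
      then have "v = (\<Sum>i\<le>n. v i *\<^sub>c (f ^^ i) d)"
        unfolding f by (auto simp: L_mod_simps fun_eq_iff sum_fun_apply if_distrib cong: if_cong)
      also have "\<dots> \<in> gspan d"
        using generated_base[OF gen, of _ 0] subspace_generated[OF gen]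
        by (intro cvec.subspace_sum cvec.subspace_scale) auto
      finally show "v \<in> gspan d" .
    qed
  qed
qed

lemma simple_harish_chandra_L_mod: "simple_harish_chandra (L_mod n)"
proof -
  interpret takiff_chart "L_mod n" id "L_rep n" by (rule takiff_chart_L_mod)
  have "lie_submodule W (L_mod n) \<Longrightarrow> lie_submodule W (L_g n)" for W
  proof -
    assume W: "lie_submodule W (L_mod n)"
    have "W \<subseteq> carrier (L_g n)" "cvec.subspace (id ` W)"
      using W lie_submodule_iff[of W] by (auto simp: L_mod_def invariant_subspace_def)
    then have "submodule W complex_ring (L_g n)" using chart.submodule_iff[OF chart_L_g] by blast
    moreover have "lact (L_g n) a w \<in> W" if "w \<in> W" for a w
      using W that unfolding lie_submodule_def L_mod_simps by (metis takiff.sel(1))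
    ultimately show ?thesis by (simp add: lie_submodule_def)
  qed
  then have "simple_lie_module (L_mod n)"
    using simple_L_g[of n] lie_module[OF lie_rep_\<rho>] unfolding simple_lie_module_def
    by (auto simp: L_mod_def)
  then show ?thesis
    unfolding simple_harish_chandra_def
    using harish_chandra_generator[OF L_mod_generator(1,2)] by blast
qed


section \<open>Tensor products\<close>

definition frag_eval :: "('k \<Rightarrow> 'm::complex_vector) \<Rightarrow> ('k \<Rightarrow>\<^sub>0 int) \<Rightarrow> 'm" where
  "frag_eval \<Theta> x = (\<Sum>k\<in>Poly_Mapping.keys x. of_int (Poly_Mapping.lookup x k) *\<^sub>c \<Theta> k)"

lemma frag_eval_of [simp]: "frag_eval \<Theta> (frag_of k) = \<Theta> k"
  by (simp add: frag_eval_def)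

lemma frag_eval_zero [simp]: "frag_eval \<Theta> 0 = 0"
  by (simp add: frag_eval_def)

lemma frag_eval_add: "frag_eval \<Theta> (x + y) = frag_eval \<Theta> x + frag_eval \<Theta> y"
  unfolding frag_eval_def by (rule setsum_keys_plus_distrib) (simp_all add: cscale_add_left)

lemma frag_eval_minus: "frag_eval \<Theta> (- x) = - frag_eval \<Theta> x"
  using frag_eval_add[of \<Theta> x "- x"] by (simp add: eq_neg_iff_add_eq_0 add.commute)

lemma frag_eval_diff: "frag_eval \<Theta> (x - y) = frag_eval \<Theta> x - frag_eval \<Theta> y"
  using frag_eval_add[of \<Theta> x "- y"] by (simp add: frag_eval_minus)

lemma frag_eval_sum: "frag_eval \<Theta> (\<Sum>i\<in>A. x i) = (\<Sum>i\<in>A. frag_eval \<Theta> (x i))"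
  by (induction A rule: infinite_finite_induct) (simp_all add: frag_eval_add)

locale tensor =
  fixes la :: "'l \<Rightarrow> 'a::ab_group_add \<Rightarrow> 'a" and ra :: "'a \<Rightarrow> 'r \<Rightarrow> 'a" and B :: "('r, 'b) module"
  assumes la_add: "la l (a + a') = la l a + la l a'"
    and la_ra: "la l (ra a r) = ra (la l a) r"
    and B_add: "b \<in> carrier B \<Longrightarrow> b' \<in> carrier B \<Longrightarrow> b \<oplus>\<^bsub>B\<^esub> b' \<in> carrier B"
    and B_smult: "b \<in> carrier B \<Longrightarrow> r \<odot>\<^bsub>B\<^esub> b \<in> carrier B"
begin

definition G :: "('a \<times> 'b \<Rightarrow>\<^sub>0 int) monoid" where "G = free_Abelian_group (UNIV \<times> carrier B)"

definition H :: "('a \<times> 'b \<Rightarrow>\<^sub>0 int) set" where "H = generate G (tensor_relators ra B)"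

definition cls :: "('a \<times> 'b \<Rightarrow>\<^sub>0 int) \<Rightarrow> ('a \<times> 'b \<Rightarrow>\<^sub>0 int) set" where "cls x = H #>\<^bsub>G\<^esub> x"

abbreviation "T \<equiv> tensor_module la ra B"

definition lmap :: "'l \<Rightarrow> ('a \<times> 'b \<Rightarrow>\<^sub>0 int) \<Rightarrow> ('a \<times> 'b \<Rightarrow>\<^sub>0 int)"
  where "lmap l = frag_extend (\<lambda>(a, b). frag_of (la l a, b))"

lemma G_carrier: "x \<in> carrier G \<longleftrightarrow> Poly_Mapping.keys x \<subseteq> UNIV \<times> carrier B"
  by (simp add: G_def)

lemma comm_group_G: "comm_group G"
  unfolding G_def by (rule abelian_free_Abelian_group)

lemma group_G: "group G"
  unfolding G_def by simp

lemma G_ops: "x \<otimes>\<^bsub>G\<^esub> y = x + y" "\<one>\<^bsub>G\<^esub> = 0" "x \<in> carrier G \<Longrightarrow> inv\<^bsub>G\<^esub> x = - x"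
  by (simp_all add: G_def)

lemma G_closed:
  "0 \<in> carrier G" "x \<in> carrier G \<Longrightarrow> y \<in> carrier G \<Longrightarrow> x + y \<in> carrier G" "x \<in> carrier G \<Longrightarrow> - x \<in> carrier G"
  "b \<in> carrier B \<Longrightarrow> frag_of (a, b) \<in> carrier G" "x \<in> carrier G \<Longrightarrow> y \<in> carrier G \<Longrightarrow> x - y \<in> carrier G"
  using keys_add[of x y] keys_diff[of x y] by (auto simp: G_carrier)

lemma relators_subset: "tensor_relators ra B \<subseteq> carrier G"
  unfolding tensor_relators_def by (auto intro!: G_closed B_add B_smult)

lemma subgroup_H: "subgroup H G"
  unfolding H_def using group.generate_is_subgroup[OF group_G relators_subset] .

lemma H_closed: "0 \<in> H" "x \<in> H \<Longrightarrow> y \<in> H \<Longrightarrow> x + y \<in> H" "x \<in> H \<Longrightarrow> - x \<in> H" "x \<in> H \<Longrightarrow> x \<in> carrier G"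
  using subgroup.one_closed[OF subgroup_H] subgroup.m_closed[OF subgroup_H, of x y]
    subgroup.m_inv_closed[OF subgroup_H, of x] subgroup.mem_carrier[OF subgroup_H, of x]
  by (simp_all add: G_ops)

lemma H_diff: "x \<in> H \<Longrightarrow> y \<in> H \<Longrightarrow> x - y \<in> H"
  using H_closed(2)[of x "- y"] H_closed(3)[of y] by simp

lemma H_sum: "(\<And>i. i \<in> A \<Longrightarrow> x i \<in> H) \<Longrightarrow> (\<Sum>i\<in>A. x i) \<in> H"
  by (induction A rule: infinite_finite_induct) (simp_all add: H_closed)

lemma H_relators:
  "b \<in> carrier B \<Longrightarrow> frag_of (a + a', b) - frag_of (a, b) - frag_of (a', b) \<in> H"
  "b \<in> carrier B \<Longrightarrow> b' \<in> carrier B \<Longrightarrow> frag_of (a, b \<oplus>\<^bsub>B\<^esub> b') - frag_of (a, b) - frag_of (a, b') \<in> H"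
  "b \<in> carrier B \<Longrightarrow> frag_of (ra a r, b) - frag_of (a, r \<odot>\<^bsub>B\<^esub> b) \<in> H"
  unfolding H_def tensor_relators_def by (rule generate.incl, blast)+

lemma H_frag_zero: "b \<in> carrier B \<Longrightarrow> frag_of (0, b) \<in> H"
  using H_closed(3)[OF H_relators(1)[of b 0 0]] by simp

lemma H_induct [consumes 1, case_names zero add left right balanced diff]:
  assumes "x \<in> H" "P 0" "\<And>a a' b. b \<in> carrier B \<Longrightarrow> P (frag_of (a + a', b) - frag_of (a, b) - frag_of (a', b))"
    and "\<And>a b b'. b \<in> carrier B \<Longrightarrow> b' \<in> carrier B \<Longrightarrow> P (frag_of (a, b \<oplus>\<^bsub>B\<^esub> b') - frag_of (a, b) - frag_of (a, b'))"
    and "\<And>a r b. b \<in> carrier B \<Longrightarrow> P (frag_of (ra a r, b) - frag_of (a, r \<odot>\<^bsub>B\<^esub> b))"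
    and "\<And>x y. P x \<Longrightarrow> P y \<Longrightarrow> P (x + y)" "\<And>x. P x \<Longrightarrow> P (- x)"
  shows "P x"
proof -
  have rel: "P y" if "y \<in> tensor_relators ra B" for y
    using that assms(3-5) unfolding tensor_relators_def by blast
  show ?thesis
    using assms(1) unfolding H_def
  proof (induction rule: generate.induct)
    case (inv y)
    then have "y \<in> carrier G" using relators_subset by blast
    then show ?case using assms(7) rel[OF inv] by (simp add: G_ops)
  qed (use assms(2,6) rel in \<open>simp_all add: G_ops\<close>)
qed

lemma cls_eq_iff: "x \<in> carrier G \<Longrightarrow> y \<in> carrier G \<Longrightarrow> cls x = cls y \<longleftrightarrow> x - y \<in> H"
proof
  assume xy: "x \<in> carrier G" "y \<in> carrier G"
  have mem: "z \<in> cls w \<longleftrightarrow> z - w \<in> H" for z w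
  proof
    show "z \<in> cls w \<Longrightarrow> z - w \<in> H" by (auto simp: cls_def r_coset_def G_ops)
    show "z - w \<in> H \<Longrightarrow> z \<in> cls w"
      by (auto simp: cls_def r_coset_def G_ops intro!: bexI[of _ "z - w"])
  qed
  show "x - y \<in> H" if "cls x = cls y"
    using that mem[of x x] mem[of x y] H_closed(1) by simp
  assume d: "x - y \<in> H"
  have "z - x \<in> H \<longleftrightarrow> z - y \<in> H" for z
    using H_closed(2)[OF _ d, of "z - x"] H_diff[OF _ d, of "z - y"] by auto
  then show "cls x = cls y" by (auto simp: mem)
qed

lemma mem_cls: "x \<in> cls x"
  using H_closed(1) by (auto simp: cls_def r_coset_def G_ops intro!: bexI[of _ 0])

lemma cls_mem_eq: assumes "x \<in> carrier G" "y \<in> cls x" shows "y \<in> carrier G" "y - x \<in> H"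
  using assms(2) H_closed(4) G_closed(2)[OF _ assms(1)] by (auto simp: cls_def r_coset_def G_ops)

lemma normal_H: "normal H G"
  using comm_group.normal_iff_subgroup[OF comm_group_G] subgroup_H by simp

lemma T_simps:
  "carrier T = cls ` carrier G" "\<zero>\<^bsub>T\<^esub> = cls 0"
  "x \<in> carrier G \<Longrightarrow> y \<in> carrier G \<Longrightarrow> cls x \<oplus>\<^bsub>T\<^esub> cls y = cls (x + y)"
proof -
  show "carrier T = cls ` carrier G"
    by (auto simp: tensor_module_def Let_def FactGroup_def RCOSETS_def cls_def G_def[symmetric] H_def[symmetric])
  have "cls 0 = H" by (simp add: cls_def r_coset_def G_ops)
  then show "\<zero>\<^bsub>T\<^esub> = cls 0"
    by (simp add: tensor_module_def Let_def FactGroup_def G_def[symmetric] H_def[symmetric])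
  show "cls x \<oplus>\<^bsub>T\<^esub> cls y = cls (x + y)" if "x \<in> carrier G" "y \<in> carrier G"
    using normal.rcos_sum[OF normal_H that]
    by (simp add: tensor_module_def Let_def FactGroup_def G_def[symmetric] H_def[symmetric] cls_def G_ops)
qed

lemma lmap_simps:
  "lmap l 0 = 0" "lmap l (x + y) = lmap l x + lmap l y" "lmap l (- x) = - lmap l x"
  "lmap l (x - y) = lmap l x - lmap l y" "lmap l (frag_of (a, b)) = frag_of (la l a, b)"
  by (simp_all add: lmap_def frag_extend_add frag_extend_minus frag_extend_diff)

lemma lmap_closed: "x \<in> carrier G \<Longrightarrow> lmap l x \<in> carrier G"
proof -
  assume "x \<in> carrier G"
  then have "Poly_Mapping.keys x \<subseteq> UNIV \<times> carrier B" by (simp only: G_carrier)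
  then show ?thesis
    by (rule free_Abelian_group_induct[where P = "\<lambda>x. lmap l x \<in> carrier G"])
      (auto simp: lmap_simps intro!: G_closed simp del: carrier_free_Abelian_group_iff)
qed

lemma lmap_H: "x \<in> H \<Longrightarrow> lmap l x \<in> H"
  by (induction rule: H_induct) (simp_all add: lmap_simps la_add la_ra H_relators H_closed)

lemma T_smult: assumes "x \<in> carrier G" shows "l \<odot>\<^bsub>T\<^esub> cls x = cls (lmap l x)"
proof -
  have "l \<odot>\<^bsub>T\<^esub> cls x = (\<Union>y\<in>cls x. cls (lmap l y))"
    by (simp add: tensor_module_def Let_def G_def[symmetric] H_def[symmetric] cls_def lmap_def)
  also have "\<dots> = cls (lmap l x)"
  proof -
    have "cls (lmap l y) = cls (lmap l x)" if "y \<in> cls x" for y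
      using cls_mem_eq[OF assms that] assms lmap_H[of "y - x" l]
      by (simp add: cls_eq_iff lmap_closed lmap_simps)
    then show ?thesis using mem_cls[of x] by blast
  qed
  finally show ?thesis .
qed

lemma T_cases: assumes "X \<in> carrier T" obtains x where "x \<in> carrier G" "X = cls x"
  using assms by (auto simp: T_simps)

lemma T_closed: "X \<in> carrier T \<Longrightarrow> Y \<in> carrier T \<Longrightarrow> X \<oplus>\<^bsub>T\<^esub> Y \<in> carrier T" "X \<in> carrier T \<Longrightarrow> l \<odot>\<^bsub>T\<^esub> X \<in> carrier T"
  by (auto simp: T_simps T_smult G_closed lmap_closed)

context
  fixes \<Theta> :: "'a \<times> 'b \<Rightarrow> 'm::complex_vector"
  assumes \<Theta>_add_left: "b \<in> carrier B \<Longrightarrow> \<Theta> (a + a', b) = \<Theta> (a, b) + \<Theta> (a', b)"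
    and \<Theta>_add_right: "b \<in> carrier B \<Longrightarrow> b' \<in> carrier B \<Longrightarrow> \<Theta> (a, b \<oplus>\<^bsub>B\<^esub> b') = \<Theta> (a, b) + \<Theta> (a, b')"
    and \<Theta>_balanced: "b \<in> carrier B \<Longrightarrow> \<Theta> (ra a r, b) = \<Theta> (a, r \<odot>\<^bsub>B\<^esub> b)"
begin

lemma frag_eval_H: "x \<in> H \<Longrightarrow> frag_eval \<Theta> x = 0"
  by (induction rule: H_induct)
    (simp_all add: frag_eval_add frag_eval_diff frag_eval_minus \<Theta>_add_left \<Theta>_add_right \<Theta>_balanced)

text \<open>The map induced on the tensor product by a balanced biadditive \<open>\<Theta>\<close>.
  A coset is evaluated at a chosen member; \<open>frag_eval_H\<close> makes the choice
  immaterial.\<close>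

definition hat :: "('a \<times> 'b \<Rightarrow>\<^sub>0 int) set \<Rightarrow> 'm" where "hat X = frag_eval \<Theta> (SOME x. x \<in> X)"

lemma hat_cls: "x \<in> carrier G \<Longrightarrow> hat (cls x) = frag_eval \<Theta> x"
proof -
  assume x: "x \<in> carrier G"
  have "(SOME y. y \<in> cls x) \<in> cls x" using mem_cls by (rule someI)
  then have "frag_eval \<Theta> ((SOME y. y \<in> cls x) - x) = 0" by (intro frag_eval_H cls_mem_eq(2)[OF x])
  then show ?thesis by (simp add: hat_def frag_eval_diff)
qed

lemma frag_eval_lmap:
  assumes "clinear A" "\<And>a b. b \<in> carrier B \<Longrightarrow> \<Theta> (la l a, b) = A (\<Theta> (a, b))" "x \<in> carrier G"
  shows "frag_eval \<Theta> (lmap l x) = A (frag_eval \<Theta> x)"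
proof -
  have "Poly_Mapping.keys x \<subseteq> UNIV \<times> carrier B" using assms(3) by (simp only: G_carrier)
  then show ?thesis
    by (rule free_Abelian_group_induct[where P = "\<lambda>x. frag_eval \<Theta> (lmap l x) = A (frag_eval \<Theta> x)"])
      (auto simp: lmap_simps frag_eval_diff clinear.zero[OF assms(1)] clinear.diff[OF assms(1)] assms(2))
qed

lemma hat_add: "X \<in> carrier T \<Longrightarrow> Y \<in> carrier T \<Longrightarrow> hat (X \<oplus>\<^bsub>T\<^esub> Y) = hat X + hat Y"
  by (auto simp: T_simps hat_cls G_closed frag_eval_add)

lemma hat_smult:
  assumes "clinear A" "\<And>a b. b \<in> carrier B \<Longrightarrow> \<Theta> (la l a, b) = A (\<Theta> (a, b))" "X \<in> carrier T"
  shows "hat (l \<odot>\<^bsub>T\<^esub> X) = A (hat X)"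
  using assms(3) by (auto simp: T_simps T_smult hat_cls lmap_closed frag_eval_lmap[OF assms(1,2)])

lemma inj_on_hat:
  assumes "\<And>x. x \<in> carrier G \<Longrightarrow> frag_eval \<Theta> x = 0 \<Longrightarrow> x \<in> H"
  shows "inj_on hat (carrier T)"
proof (rule inj_onI)
  fix X Y assume "X \<in> carrier T" "Y \<in> carrier T" "hat X = hat Y"
  then obtain x y where xy: "x \<in> carrier G" "y \<in> carrier G" "X = cls x" "Y = cls y"
    by (auto simp: T_simps)
  then have "frag_eval \<Theta> (x - y) = 0" using \<open>hat X = hat Y\<close> by (simp add: hat_cls frag_eval_diff)
  then show "X = Y" using assms[of "x - y"] xy by (simp add: cls_eq_iff G_closed)
qed

end

end

section \<open>Action of the enveloping algebra on Laurent expansions\<close>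

text \<open>One polynomial for each power of a Laurent variable. All functions are allowed, which
  keeps the operators total; finite support is established later for the image of the tensor
  product.\<close>

type_synonym lpoly = "int \<Rightarrow> complex poly"

text \<open>\<open>uea_lift\<close> takes values in a type of class
  \<open>complex_algebra_1\<close>, so the linear operators are bundled into a type.\<close>

typedef lop = "{A :: lpoly \<Rightarrow> lpoly. clinear A}"
  morphisms lop_apply Lop
  by (rule exI[of _ "\<lambda>x. x"]) (simp add: clinear_def)

setup_lifting type_definition_lop

lemma clinear_lop_apply: "clinear (lop_apply A)"
  using lop_apply[of A] by simp

lemmas lop_apply_simps = clinear.add[OF clinear_lop_apply] clinear.cscale[OF clinear_lop_apply]
  clinear.zero[OF clinear_lop_apply] clinear.minus[OF clinear_lop_apply] clinear.diff[OF clinear_lop_apply]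

instantiation lop :: complex_algebra_1
begin

lift_definition zero_lop :: lop is "\<lambda>_. 0" by (simp add: clinear_def)
lift_definition one_lop :: lop is "\<lambda>g. g" by (simp add: clinear_def)
lift_definition plus_lop :: "lop \<Rightarrow> lop \<Rightarrow> lop" is "\<lambda>A B g. A g + B g"
  by (simp add: clinear_def cscale_add_right)
lift_definition minus_lop :: "lop \<Rightarrow> lop \<Rightarrow> lop" is "\<lambda>A B g. A g - B g"
  by (simp add: clinear_def cvec.scale_right_diff_distrib)
lift_definition uminus_lop :: "lop \<Rightarrow> lop" is "\<lambda>A g. - A g"
  by (simp add: clinear_def cvec.scale_minus_right)
lift_definition times_lop :: "lop \<Rightarrow> lop \<Rightarrow> lop" is "\<lambda>A B g. A (B g)"
  by (simp add: clinear_def)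
lift_definition cscale_lop :: "complex \<Rightarrow> lop \<Rightarrow> lop" is "\<lambda>c A g. c *\<^sub>c A g"
  by (simp add: clinear_def cscale_add_right mult.commute)

instance
proof
  fix a b :: complex and x y z :: lop
  note ext = lop_apply_inject[THEN iffD1]
  note rep = zero_lop.rep_eq one_lop.rep_eq plus_lop.rep_eq minus_lop.rep_eq uminus_lop.rep_eq
    times_lop.rep_eq cscale_lop.rep_eq lop_apply_simps
  show "x + y + z = x + (y + z)" "x + y = y + x" "0 + x = x" "- x + x = 0" "x - y = x + - y"
    "x * y * z = x * (y * z)" "1 * x = x" "x * 1 = x" "(x + y) * z = x * z + y * z" "x * (y + z) = x * y + x * z"
    by (rule ext, rule HOL.ext, simp add: rep ac_simps)+
  show "a *\<^sub>c (x + y) = a *\<^sub>c x + a *\<^sub>c y" "(a + b) *\<^sub>c x = a *\<^sub>c x + b *\<^sub>c x" "a *\<^sub>c b *\<^sub>c x = (a * b) *\<^sub>c x"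
    "1 *\<^sub>c x = x" "(a *\<^sub>c x) * y = a *\<^sub>c (x * y)" "x * (a *\<^sub>c y) = a *\<^sub>c (x * y)"
    by (rule ext, rule HOL.ext, simp add: rep cscale_add_right cscale_add_left)+
  have "lop_apply 0 (\<lambda>_. 1) 0 \<noteq> lop_apply 1 (\<lambda>_. 1) 0" by (simp add: rep)
  then show "(0 :: lop) \<noteq> 1" by metis
qed

end

lemmas lop_rep_simps = zero_lop.rep_eq one_lop.rep_eq plus_lop.rep_eq minus_lop.rep_eq
  uminus_lop.rep_eq times_lop.rep_eq cscale_lop.rep_eq

definition U_act :: "('l::complex_lie_algebra \<Rightarrow> lpoly \<Rightarrow> lpoly) \<Rightarrow> 'l uea \<Rightarrow> lpoly \<Rightarrow> lpoly" where
  "U_act \<rho> u = lop_apply (uea_lift (\<lambda>x. Lop (\<rho> x)) u)"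

lemma clinear_U_act: "clinear (U_act \<rho> u)"
  unfolding U_act_def by (rule clinear_lop_apply)

lemma U_act_simps:
  assumes "lie_rep \<rho>"
  shows "U_act \<rho> (u + v) g = U_act \<rho> u g + U_act \<rho> v g" "U_act \<rho> (u * v) g = U_act \<rho> u (U_act \<rho> v g)"
    "U_act \<rho> 1 g = g" "U_act \<rho> (c *\<^sub>c u) g = c *\<^sub>c U_act \<rho> u g" "U_act \<rho> (uea_gen x) = \<rho> x"
proof -
  interpret lie_rep \<rho> by fact
  have [simp]: "lop_apply (Lop (\<rho> x)) = \<rho> x" for x by (simp add: Lop_inverse rep_linear)
  have "lie_hom_to_algebra (\<lambda>x. Lop (\<rho> x))"
    unfolding lie_hom_to_algebra_def
    by (simp add: fun_eq_iff lop_rep_simps rep_add rep_cscale rep_bracket flip: lop_apply_inject)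
  from uea_lift[OF this]
  show "U_act \<rho> (u + v) g = U_act \<rho> u g + U_act \<rho> v g" "U_act \<rho> (u * v) g = U_act \<rho> u (U_act \<rho> v g)"
    "U_act \<rho> 1 g = g" "U_act \<rho> (c *\<^sub>c u) g = c *\<^sub>c U_act \<rho> u g" "U_act \<rho> (uea_gen x) = \<rho> x"
    by (simp_all add: U_act_def lop_rep_simps)
qed

lemma U_act_intertwine:
  assumes "lie_rep \<rho>" "lie_rep \<sigma>" "clinear A" "\<And>x g. A (\<rho> x g) = \<sigma> x (A g)"
  shows "A (U_act \<rho> u g) = U_act \<sigma> u (A g)"
proof -
  have "\<forall>g. A (U_act \<rho> u g) = U_act \<sigma> u (A g)"
    by (induction u rule: uea_induct)
      (simp_all only: U_act_simps[OF assms(1)] U_act_simps[OF assms(2)] assms(4)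
        clinear.add[OF assms(3)] clinear.cscale[OF assms(3)] simp_thms)
  then show ?thesis by blast
qed


section \<open>Two explicit representations\<close>

definition gens_rep where
  "gens_rep e f h eb fb hb x v =
     sl2_mat (part_1 x) $ 1 $ 1 *\<^sub>c h v + sl2_mat (part_1 x) $ 1 $ 2 *\<^sub>c e v + sl2_mat (part_1 x) $ 2 $ 1 *\<^sub>c f v +
     (sl2_mat (part_x x) $ 1 $ 1 *\<^sub>c hb v + sl2_mat (part_x x) $ 1 $ 2 *\<^sub>c eb v + sl2_mat (part_x x) $ 2 $ 1 *\<^sub>c fb v)"

lemma gens_rep_basis:
  "gens_rep e f h eb fb hb (in_g sl2_e) = e" "gens_rep e f h eb fb hb (in_g sl2_f) = f"
  "gens_rep e f h eb fb hb (in_g sl2_h) = h" "gens_rep e f h eb fb hb (bar sl2_e) = eb"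
  "gens_rep e f h eb fb hb (bar sl2_f) = fb" "gens_rep e f h eb fb hb (bar sl2_h) = hb"
  for e f h eb fb hb :: "'a::complex_vector \<Rightarrow> 'a"
  by (rule HOL.ext, simp add: gens_rep_def in_g_def bar_def)+

lemma takiff_rep_gens_rep:
  fixes e f h eb fb hb :: "'a::complex_vector \<Rightarrow> 'a"
  assumes lin: "clinear e" "clinear f" "clinear h" "clinear eb" "clinear fb" "clinear hb"
    and rel: "\<And>v. fb (f v) = f (fb v)"
      "\<And>v. hb (f v) = f (hb v) - 2 *\<^sub>c fb v" "\<And>v. hb (fb v) = fb (hb v)"
      "\<And>v. eb (f v) = f (eb v) + hb v" "\<And>v. eb (fb v) = fb (eb v)" "\<And>v. eb (hb v) = hb (eb v)"
      "\<And>v. h (f v) = f (h v) - 2 *\<^sub>c f v" "\<And>v. h (fb v) = fb (h v) - 2 *\<^sub>c fb v" "\<And>v. h (hb v) = hb (h v)"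
      "\<And>v. h (eb v) = eb (h v) + 2 *\<^sub>c eb v"
      "\<And>v. e (f v) = f (e v) + h v" "\<And>v. e (fb v) = fb (e v) + hb v" "\<And>v. e (hb v) = hb (e v) - 2 *\<^sub>c eb v"
      "\<And>v. e (eb v) = eb (e v)" "\<And>v. e (h v) = h (e v) - 2 *\<^sub>c e v"
  shows "takiff_rep (gens_rep e f h eb fb hb)"
proof (intro takiff_rep.intro lie_rep.intro)
  note lins = lin[THEN clinear.add] lin[THEN clinear.cscale]
  show "clinear (gens_rep e f h eb fb hb x)" for x
    by unfold_locales (simp_all add: gens_rep_def lins cscale_add_right cvec.scale_left_commute algebra_simps)
  show "gens_rep e f h eb fb hb (x + y) v = gens_rep e f h eb fb hb x v + gens_rep e f h eb fb hb y v" for x y v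
    by (simp add: gens_rep_def plus_takiff_def cscale_add_left algebra_simps)
  show "gens_rep e f h eb fb hb (c *\<^sub>c x) v = c *\<^sub>c gens_rep e f h eb fb hb x v" for c x v
    by (simp add: gens_rep_def cscale_takiff_def cscale_add_right)
  show "gens_rep e f h eb fb hb (lie_bracket x y) v =
      gens_rep e f h eb fb hb x (gens_rep e f h eb fb hb y v) - gens_rep e f h eb fb hb y (gens_rep e f h eb fb hb x v)" for x y v
  proof -
    have two: "(2 * a) *\<^sub>c w = a *\<^sub>c w + a *\<^sub>c w" for a and w :: 'a
      by (simp only: mult_2 cscale_add_left)
    show ?thesis by (simp add: gens_rep_def lie_bracket_takiff_def lins rel cscale_expand two)
  qed
qed

lemma lpoly_eqI: "(\<And>i j. coeff (g i) j = coeff (g' i) j) \<Longrightarrow> g = (g' :: lpoly)"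
  by (intro HOL.ext poly_eqI)

text \<open>A composite of two of the operators below reaches at most two coefficients back, so j =
  0 and j = 1 are the boundary cases of the coefficient identities.\<close>

lemma nat_cases3: obtains "j = 0" | "j = Suc 0" | k where "j = Suc (Suc k)"
  by (metis not0_implies_Suc)

text \<open>The Verma module localized at \<open>f\<close>, with \<open>f\<^sup>i fb\<^sup>j v\<close> written as \<open>x\<^sup>i\<^sup>+\<^sup>j r\<^sup>j\<close>: the value of a
  function at \<open>a\<close> is the coefficient of \<open>x\<^sup>a\<close>, a polynomial in \<open>r\<close>.\<close>

definition M_wt :: "int \<Rightarrow> complex poly \<Rightarrow> complex poly" where
  "M_wt a A = Polynomial.smult (of_int a) A - pCons 0 (pderiv A)"

lemma coeff_M_wt: "coeff (M_wt a A) j = (of_int a - of_nat j) * coeff A j"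
  by (cases j) (simp_all add: M_wt_def coeff_pderiv algebra_simps)

definition M_f :: "lpoly \<Rightarrow> lpoly" where "M_f g = (\<lambda>a. g (a - 1))"
definition M_fb :: "lpoly \<Rightarrow> lpoly" where "M_fb g = (\<lambda>a. pCons 0 (g (a - 1)))"
definition M_h :: "complex \<Rightarrow> lpoly \<Rightarrow> lpoly" where
  "M_h l1 g = (\<lambda>a. Polynomial.smult (l1 - 2 * of_int a) (g a))"
definition M_hb :: "complex \<Rightarrow> lpoly \<Rightarrow> lpoly" where
  "M_hb l2 g = (\<lambda>a. Polynomial.smult l2 (g a) - Polynomial.smult 2 (pCons 0 (M_wt a (g a))))"
text \<open>On monomials, e f^i fb^j v = i (l1 - i + 1 - 2 j) f^(i-1) fb^j v + j l2 f^i fb^(j-1) v.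
  Here \<open>M_wt a\<close> multiplies the coefficient of r^j by a - j, the exponent of
  \<open>f\<close>.\<close>

definition M_e :: "complex \<Rightarrow> complex \<Rightarrow> lpoly \<Rightarrow> lpoly" where
  "M_e l1 l2 g = (\<lambda>a. Polynomial.smult l1 (M_wt (a + 1) (g (a + 1))) -
     Polynomial.smult 2 (pCons 0 (M_wt a (pderiv (g (a + 1))))) -
     M_wt a (M_wt (a + 1) (g (a + 1))) + Polynomial.smult l2 (pderiv (g (a + 1))))"
text \<open>On monomials, eb f^i fb^j v = i l2 f^(i-1) fb^j v - i (i - 1) f^(i-2) fb^(j+1)
  v.\<close>

definition M_eb :: "complex \<Rightarrow> lpoly \<Rightarrow> lpoly" where
  "M_eb l2 g = (\<lambda>a. Polynomial.smult l2 (M_wt (a + 1) (g (a + 1))) - pCons 0 (M_wt a (M_wt (a + 1) (g (a + 1)))))"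

definition M_rep :: "complex \<Rightarrow> complex \<Rightarrow> takiff \<Rightarrow> lpoly \<Rightarrow> lpoly" where
  "M_rep l1 l2 = gens_rep (M_e l1 l2) M_f (M_h l1) (M_eb l2) M_fb (M_hb l2)"

lemma coeff_M:
  "coeff (M_f g a) j = coeff (g (a - 1)) j"
  "coeff (M_fb g a) j = (if j = 0 then 0 else coeff (g (a - 1)) (j - 1))"
  "coeff (M_h l1 g a) j = (l1 - 2 * of_int a) * coeff (g a) j"
  "coeff (M_hb l2 g a) j = l2 * coeff (g a) j -
     2 * (if j = 0 then 0 else (of_int a - of_nat (j - 1)) * coeff (g a) (j - 1))"
  "coeff (M_e l1 l2 g a) j = (of_int a + 1 - of_nat j) * (l1 - of_int a - of_nat j) * coeff (g (a + 1)) j +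
     l2 * of_nat (Suc j) * coeff (g (a + 1)) (Suc j)"
  "coeff (M_eb l2 g a) j = l2 * (of_int a + 1 - of_nat j) * coeff (g (a + 1)) j -
     (if j = 0 then 0 else (of_int a - of_nat (j - 1)) * (of_int a + 1 - of_nat (j - 1)) * coeff (g (a + 1)) (j - 1))"
  by (cases j; simp add: M_f_def M_fb_def M_h_def M_hb_def M_e_def M_eb_def coeff_M_wt coeff_pderiv algebra_simps)+

lemma coeff_lpoly_simps:
  "coeff ((g + g') i) j = coeff (g i) j + coeff (g' i) j" "coeff ((g - g') i) j = coeff (g i) j - coeff (g' i) j"
  "coeff ((c *\<^sub>c g) i) j = c * coeff (g i) j"
  for g g' :: lpoly
  by simp_all

lemma takiff_rep_M: "takiff_rep (M_rep l1 l2)"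
  unfolding M_rep_def
proof (rule takiff_rep_gens_rep)
  show "clinear (M_e l1 l2)" "clinear M_f" "clinear (M_h l1)" "clinear (M_eb l2)" "clinear M_fb" "clinear (M_hb l2)"
    by (unfold_locales; rule lpoly_eqI; simp only: coeff_M coeff_lpoly_simps; simp add: algebra_simps)+
qed (rule lpoly_eqI, rule_tac j = j in nat_cases3; simp only: coeff_M coeff_lpoly_simps; simp add: algebra_simps)+

text \<open>The quotient by the Verma module, with the class of \<open>f\<^sup>-\<^sup>1\<^sup>-\<^sup>k fb\<^sup>j v\<close> written as a multiple of
  \<open>t\<^sup>k\<^sup>-\<^sup>j s\<^sup>j\<close>. Here \<open>f\<close> acts as \<open>-d/dt\<close> in the coordinates \<open>t\<close> and \<open>fb = s/t\<close>.\<close>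

definition P_f :: "lpoly \<Rightarrow> lpoly" where
  "P_f g = (\<lambda>i. - (Polynomial.smult (of_int (i + 1)) (g (i + 1)) + pCons 0 (pderiv (g (i + 1)))))"
text \<open>The ideal acts by multiplication: \<open>fb\<close> by s / t, \<open>hb\<close> by l2 -
  2 s, \<open>eb\<close> by t (l2 - s). These are coordinates on the quadric hb^2 + 4 fb eb = l2^2,
  while sl2 acts by differential operators of order at most one.\<close>

definition P_fb :: "lpoly \<Rightarrow> lpoly" where "P_fb g = (\<lambda>i. pCons 0 (g (i + 1)))"
definition P_h :: "complex \<Rightarrow> lpoly \<Rightarrow> lpoly" where
  "P_h n g = (\<lambda>i. Polynomial.smult (n + 2 * of_int i) (g i))"
definition P_hb :: "complex \<Rightarrow> lpoly \<Rightarrow> lpoly" where "P_hb l2 g = (\<lambda>i. [:l2, -2:] * g i)"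
text \<open>This is t (n + t d/dt) + t (l2 - s) d/ds, where n is the weight of the class of f^(-1)
  v.\<close>

definition P_e :: "complex \<Rightarrow> complex \<Rightarrow> lpoly \<Rightarrow> lpoly" where
  "P_e n l2 g = (\<lambda>i. Polynomial.smult (n + of_int i - 1) (g (i - 1)) + [:l2, -1:] * pderiv (g (i - 1)))"
definition P_eb :: "complex \<Rightarrow> lpoly \<Rightarrow> lpoly" where "P_eb l2 g = (\<lambda>i. [:l2, -1:] * g (i - 1))"

definition P_rep :: "complex \<Rightarrow> complex \<Rightarrow> takiff \<Rightarrow> lpoly \<Rightarrow> lpoly" where
  "P_rep n l2 = gens_rep (P_e n l2) P_f (P_h n) (P_eb l2) P_fb (P_hb l2)"

lemma coeff_P:
  "coeff (P_f g i) j = - (of_int i + 1 + of_nat j) * coeff (g (i + 1)) j"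
  "coeff (P_fb g i) j = (if j = 0 then 0 else coeff (g (i + 1)) (j - 1))"
  "coeff (P_h n g i) j = (n + 2 * of_int i) * coeff (g i) j"
  "coeff (P_hb l2 g i) j = l2 * coeff (g i) j - 2 * (if j = 0 then 0 else coeff (g i) (j - 1))"
  "coeff (P_e n l2 g i) j = (n + of_int i - 1 - of_nat j) * coeff (g (i - 1)) j +
     l2 * of_nat (Suc j) * coeff (g (i - 1)) (Suc j)"
  "coeff (P_eb l2 g i) j = l2 * coeff (g (i - 1)) j - (if j = 0 then 0 else coeff (g (i - 1)) (j - 1))"
  by (cases j; simp add: P_f_def P_fb_def P_h_def P_hb_def P_e_def P_eb_def coeff_pderiv algebra_simps)+

lemma takiff_rep_P: "takiff_rep (P_rep n l2)"
  unfolding P_rep_def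
proof (rule takiff_rep_gens_rep)
  show "clinear (P_e n l2)" "clinear P_f" "clinear (P_h n)" "clinear (P_eb l2)" "clinear P_fb" "clinear (P_hb l2)"
    by (unfold_locales; rule lpoly_eqI; simp only: coeff_P coeff_lpoly_simps; simp add: algebra_simps)+
qed (rule lpoly_eqI, rule_tac j = j in nat_cases3; simp only: coeff_P coeff_lpoly_simps; simp add: algebra_simps)+

text \<open>The class of f^(-1-m) v corresponds to \<open>kappa m\<close> times t^m. With
  \<open>f\<close> acting as -d/dt this requires \<open>kappa (m - 1) = - m * kappa m\<close>,
  starting from 1 at m = 0; the value 0 at negative m kills the monomials with nonnegative powers of
  \<open>f\<close>, which make up the Verma module.\<close>

definition kappa :: "int \<Rightarrow> complex" where
  "kappa m = (if m \<ge> 0 then (-1) ^ nat m / fact (nat m) else 0)"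

lemma kappa_pred: "kappa (m - 1) = - of_int m * kappa m"
proof (cases "m \<ge> 1")
  case True
  then obtain k where k: "m = int (Suc k)" by (metis Suc_diff_1 int_nat_eq not_le nat_0_iff zero_less_nat_eq less_le_trans zero_less_one int_one_le_iff_zero_less pos_int_cases)
  then have "kappa (m - 1) = (-1) ^ k / fact k" "kappa m = (-1) ^ Suc k / fact (Suc k)" by (simp_all add: kappa_def del: power_Suc fact_Suc) (auto simp: nat_add_distrib)
  moreover have "of_int m = (of_nat (Suc k) :: complex)" by (simp add: k)
  moreover have "(fact (Suc k) :: complex) = of_nat (Suc k) * fact k" by (rule fact_Suc)
  ultimately show ?thesis by (simp del: of_nat_Suc)
next
  case False
  then show ?thesis by (cases "m = 0") (auto simp: kappa_def)
qed

text \<open>The monomial f^(-1-k) fb^j v sits at a = j - k - 1 and goes to kappa k times t^(k-j)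
  s^j, whence the index - i - 1 and the argument i + j of \<open>kappa\<close>.\<close>

definition MtoP :: "lpoly \<Rightarrow> lpoly" where
  "MtoP g = (\<lambda>i. \<Sum>j\<le>degree (g (- i - 1)). monom (kappa (i + int j) * coeff (g (- i - 1)) j) j)"

lemma coeff_MtoP: "coeff (MtoP g i) j = kappa (i + int j) * coeff (g (- i - 1)) j"
  by (auto simp: MtoP_def coeff_sum coeff_eq_0 if_distrib cong: if_cong)

lemma clinear_MtoP: "clinear MtoP"
  by unfold_locales (rule lpoly_eqI, simp only: coeff_MtoP coeff_lpoly_simps, simp add: algebra_simps)+

lemma kappa_pred': "kappa (i - 1 + int j) = - (of_int i + of_nat j) * kappa (i + int j)"
  using kappa_pred[of "i + int j"] by (simp add: algebra_simps)

text \<open>Coefficientwise the cases reduce to the recursion for \<open>kappa\<close>. The shift l1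
  + 2 appears because f^(-1) v has weight l1 + 2, which is n for the Verma module of highest weight
  n - 2.\<close>

lemma MtoP_intertwines: "MtoP (M_rep l1 l2 x g) = P_rep (l1 + 2) l2 x (MtoP g)"
proof -
  have e: "MtoP (M_e l1 l2 g) = P_e (l1 + 2) l2 (MtoP g)"
  proof (rule lpoly_eqI)
    fix i j
    have "kappa (i - 1 + int (Suc j)) = kappa (i + int j)" by (simp add: algebra_simps)
    then show "coeff (MtoP (M_e l1 l2 g) i) j = coeff (P_e (l1 + 2) l2 (MtoP g) i) j"
      by (simp only: coeff_M coeff_P coeff_MtoP kappa_pred') (simp add: algebra_simps)
  qed
  have f: "MtoP (M_f g) = P_f (MtoP g)"
  proof (rule lpoly_eqI)
    fix i j
    have "kappa (i + int j) = - (of_int (i + 1) + of_nat j) * kappa (i + 1 + int j)"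
      using kappa_pred'[of "i + 1" j] by simp
    then show "coeff (MtoP (M_f g) i) j = coeff (P_f (MtoP g) i) j"
      by (simp only: coeff_M coeff_P coeff_MtoP) (simp add: algebra_simps)
  qed
  have h: "MtoP (M_h l1 g) = P_h (l1 + 2) (MtoP g)"
    by (rule lpoly_eqI) (simp add: coeff_M coeff_P coeff_MtoP algebra_simps)
  have eb: "MtoP (M_eb l2 g) = P_eb l2 (MtoP g)"
  proof (rule lpoly_eqI)
    fix i j
    show "coeff (MtoP (M_eb l2 g) i) j = coeff (P_eb l2 (MtoP g) i) j"
    proof (cases j)
      case 0
      then show ?thesis using kappa_pred[of i] by (simp add: coeff_M coeff_P coeff_MtoP algebra_simps)
    next
      case (Suc k)
      have "kappa (i - 1 + int k) = - (of_int i + of_nat k) * kappa (i + int k)" by (rule kappa_pred')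
      moreover have "kappa (i + int k) = - (of_int (i + 1) + of_nat k) * kappa (i + int (Suc k))"
        using kappa_pred'[of "i + 1" k] by (simp add: algebra_simps)
      ultimately show ?thesis
        by (simp only: coeff_M coeff_P coeff_MtoP Suc nat.distinct if_False diff_Suc_1 kappa_pred')
          (simp add: algebra_simps)
    qed
  qed
  have fb: "MtoP (M_fb g) = P_fb (MtoP g)"
    by (rule lpoly_eqI, rename_tac i j, case_tac j) (simp_all add: coeff_M coeff_P coeff_MtoP algebra_simps)
  have hb: "MtoP (M_hb l2 g) = P_hb l2 (MtoP g)"
  proof (rule lpoly_eqI)
    fix i j
    show "coeff (MtoP (M_hb l2 g) i) j = coeff (P_hb l2 (MtoP g) i) j"
    proof (cases j)
      case (Suc k)
      have "kappa (i + int k) = - (of_int (i + 1) + of_nat k) * kappa (i + int (Suc k))"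
        using kappa_pred'[of "i + 1" k] by (simp add: algebra_simps)
      then show ?thesis
        by (simp only: coeff_M coeff_P coeff_MtoP Suc nat.distinct if_False diff_Suc_1) (simp add: algebra_simps)
    qed (simp add: coeff_M coeff_P coeff_MtoP)
  qed
  show ?thesis
    unfolding M_rep_def P_rep_def gens_rep_def
    by (simp only: clinear.add[OF clinear_MtoP] clinear.cscale[OF clinear_MtoP] e f h eb fb hb)
qed


section \<open>The tensor product of \<open>S\<^sub>f\<close> and a Verma module\<close>

definition shift :: "int \<Rightarrow> lpoly \<Rightarrow> lpoly" where "shift s g = (\<lambda>a. g (a + s))"

lemma shift_simps:
  "shift s (shift s' g) = shift (s + s') g" "shift 0 g = g" "shift s (g + g') = shift s g + shift s g'"
  "shift s (c *\<^sub>c g) = c *\<^sub>c shift s g" "shift s 0 = 0"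
  by (simp_all add: shift_def fun_eq_iff algebra_simps)

definition U_fb :: takiff_U where "U_fb = uea_gen (bar sl2_f)"

lemma lie_rep_M: "lie_rep (M_rep l1 l2)" and lie_rep_P: "lie_rep (P_rep n l2)"
  using takiff_rep_M takiff_rep_P by (simp_all add: takiff_rep_def)

lemmas U_act_M = U_act_simps[OF lie_rep_M]
lemmas U_act_P = U_act_simps[OF lie_rep_P]
lemmas U_act_linear = clinear.add[OF clinear_U_act] clinear.cscale[OF clinear_U_act] clinear.zero[OF clinear_U_act]

lemma U_act_U_f_pow: "U_act (M_rep l1 l2) (U_f ^ k) g = shift (- int k) g"
proof (induction k)
  case (Suc k)
  have "U_act (M_rep l1 l2) U_f g = shift (-1) g" for g
    by (simp only: U_f_def U_act_M(5)) (simp add: M_rep_def gens_rep_basis M_f_def shift_def)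
  then show ?case using Suc by (simp add: U_act_M shift_simps algebra_simps)
qed (simp add: U_act_M shift_simps)

definition frac_act :: "complex \<Rightarrow> complex \<Rightarrow> takiff_Uf \<Rightarrow> lpoly \<Rightarrow> lpoly" where
  "frac_act l1 l2 x g = shift (int (fst (rep_takiff_Uf x))) (U_act (M_rep l1 l2) (snd (rep_takiff_Uf x)) g)"

text \<open>\<open>U_f\<close> acts as an invertible shift, so a power of it that witnesses the
  equality of two fractions can be cancelled. Hence the representative chosen in
  \<open>frac_act\<close> is immaterial.\<close>

lemma frac_act_Frac: "frac_act l1 l2 (Frac k u) g = shift (int k) (U_act (M_rep l1 l2) u g)"
proof -
  define k' u' where "k' = fst (rep_takiff_Uf (Frac k u))" and "u' = snd (rep_takiff_Uf (Frac k u))"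
  have "Frac k' u' = Frac k u"
    by (simp add: k'_def u'_def) (simp add: Frac_def Quotient3_abs_rep[OF Quotient3_takiff_Uf])
  then obtain m where "U_f ^ (m + k) * u' = U_f ^ (m + k') * u" unfolding Frac_eq_iff by blast
  then have "U_act (M_rep l1 l2) (U_f ^ (m + k) * u') g = U_act (M_rep l1 l2) (U_f ^ (m + k') * u) g" by simp
  then have "shift (- int (m + k)) (U_act (M_rep l1 l2) u' g) = shift (- int (m + k')) (U_act (M_rep l1 l2) u g)"
    by (simp only: U_act_M(2) U_act_U_f_pow)
  then have "shift (int (m + k + k')) (shift (- int (m + k)) (U_act (M_rep l1 l2) u' g)) =
      shift (int (m + k + k')) (shift (- int (m + k')) (U_act (M_rep l1 l2) u g))" by simp
  then show ?thesis
    by (simp add: shift_simps frac_act_def k'_def[symmetric] u'_def[symmetric])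
qed

lemma frac_act_add: "frac_act l1 l2 (x + y) g = frac_act l1 l2 x g + frac_act l1 l2 y g"
proof -
  obtain k u where x: "x = Frac k u" by (rule Frac_cases)
  obtain l v where y: "y = Frac l v" by (rule Frac_cases)
  show ?thesis
    unfolding x y Frac_add' frac_act_Frac by (simp add: U_act_M U_act_U_f_pow shift_simps)
qed

lemma frac_act_mult: "frac_act l1 l2 (x * y) g = frac_act l1 l2 x (frac_act l1 l2 y g)"
proof -
  obtain k u where x: "x = Frac k u" by (rule Frac_cases)
  obtain l v where y: "y = Frac l v" by (rule Frac_cases)
  obtain m w where m: "U_f ^ m * u = w * U_f ^ l" using U_f_ore by blast
  define h where "h = shift (int l) (U_act (M_rep l1 l2) v g)"
  have "shift (- int m) (U_act (M_rep l1 l2) u h) = U_act (M_rep l1 l2) (U_f ^ m * u) h"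
    by (simp add: U_act_M U_act_U_f_pow)
  also have "\<dots> = U_act (M_rep l1 l2) w (U_act (M_rep l1 l2) v g)"
    unfolding m by (simp add: U_act_M U_act_U_f_pow h_def shift_simps)
  finally have "shift (int m) (shift (- int m) (U_act (M_rep l1 l2) u h)) = shift (int m) (U_act (M_rep l1 l2) (w * v) g)"
    by (simp add: U_act_M)
  then show ?thesis
    unfolding x y Frac_mult[OF m] frac_act_Frac h_def[symmetric] by (simp add: shift_simps)
qed

lemma frac_act_of_U: "frac_act l1 l2 (of_U u) g = U_act (M_rep l1 l2) u g"
  by (simp add: of_U_def frac_act_Frac shift_simps)

lemma clinear_frac_act: "clinear (frac_act l1 l2 x)"
  by unfold_locales (simp_all add: frac_act_def U_act_linear shift_simps)

lemma Sf_cases: obtains x where "s = abs_takiff_Sf x"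
  using Quotient3_abs_rep[OF Quotient3_takiff_Sf] by metis

lemma Sf_add: "abs_takiff_Sf x + abs_takiff_Sf y = abs_takiff_Sf (x + y)"
  by (rule plus_takiff_Sf.abs_eq)

lemma Sf_zero: "abs_takiff_Sf (of_U u) = 0"
  by (simp add: zero_takiff_Sf_def takiff_Sf.abs_eq_iff Sf_rel_def)

locale verma_model =
  fixes l1 l2 :: complex
begin

abbreviation "actM \<equiv> U_act (M_rep l1 l2)"
abbreviation "actP \<equiv> U_act (P_rep (l1 + 2) l2)"

definition M_top :: lpoly where "M_top = (\<lambda>a. if a = 0 then 1 else 0)"

abbreviation "borel_U \<equiv> uea_lift (\<lambda>x. uea_gen (borel_incl x))"

sublocale Vt: tensor "(*)" "\<lambda>u b. u * borel_U b" "C_lambda l1 l2"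
  by unfold_locales (simp_all add: distrib_left mult.assoc C_lambda_def)

lemma verma_eq: "verma l1 l2 = Vt.T"
  by (simp add: verma_def)

lemma C_lambda_simps: "carrier (C_lambda l1 l2) = UNIV" "c \<oplus>\<^bsub>C_lambda l1 l2\<^esub> d = c + d"
  "b \<odot>\<^bsub>C_lambda l1 l2\<^esub> c = uea_lift (borel_char l1 l2) b * c"
  by (simp_all add: C_lambda_def)

lemmas borel_U_simps = uea_lift[OF lie_hom_borel_incl]
lemmas borel_char_simps = uea_lift[OF lie_hom_borel_char]

lemma M_rep_borel: "M_rep l1 l2 (borel_incl x) M_top = borel_char l1 l2 x *\<^sub>c M_top"
proof -
  have "sl2_mat (part_1 (borel_incl x)) $ 2 $ 1 = 0" "sl2_mat (part_x (borel_incl x)) $ 2 $ 1 = 0"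
    using borel_incl[of x] by (simp_all add: takiff_borel_iff)
  moreover have "M_e l1 l2 M_top = 0" "M_eb l2 M_top = 0" "M_h l1 M_top = l1 *\<^sub>c M_top" "M_hb l2 M_top = l2 *\<^sub>c M_top"
    by (rule lpoly_eqI, rename_tac i j, case_tac j; auto simp: coeff_M M_top_def simp flip: eq_neg_iff_add_eq_0)+
  ultimately show ?thesis
    by (simp add: M_rep_def gens_rep_def borel_char_def cscale_add_left mult.commute)
qed

lemma actM_borel: "actM (borel_U b) M_top = uea_lift (borel_char l1 l2) b *\<^sub>c M_top"
proof (induction b rule: uea_induct)
  case (mult u v)
  then show ?case
    by (simp only: borel_U_simps borel_char_simps U_act_M U_act_linear cscale_cscale mult.commute)
qed (simp_all only: borel_U_simps borel_char_simps U_act_M M_rep_borel cscale_add_left cscale_one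
    cscale_cscale cscale_complex)

definition val1 :: "takiff_U \<times> complex \<Rightarrow> lpoly" where "val1 = (\<lambda>(u, c). c *\<^sub>c actM u M_top)"

lemma val1_simps:
  "val1 (u + u', c) = val1 (u, c) + val1 (u', c)"
  "val1 (u, c \<oplus>\<^bsub>C_lambda l1 l2\<^esub> c') = val1 (u, c) + val1 (u, c')"
  "val1 (u * borel_U b, c) = val1 (u, b \<odot>\<^bsub>C_lambda l1 l2\<^esub> c)"
  "val1 (w * u, c) = actM w (val1 (u, c))"
  by (simp_all only: val1_def prod.case U_act_M C_lambda_simps cscale_add_right cscale_add_left
      actM_borel U_act_linear cscale_cscale mult.commute)

definition val :: "(takiff_U \<times> complex \<Rightarrow>\<^sub>0 int) set \<Rightarrow> lpoly" where "val = Vt.hat val1"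

lemma val_cls: "x \<in> carrier Vt.G \<Longrightarrow> val (Vt.cls x) = frag_eval val1 x"
  unfolding val_def by (rule Vt.hat_cls) (rule val1_simps | assumption)+

lemma val_add: "X \<in> carrier (verma l1 l2) \<Longrightarrow> Y \<in> carrier (verma l1 l2) \<Longrightarrow> val (X \<oplus>\<^bsub>verma l1 l2\<^esub> Y) = val X + val Y"
  unfolding val_def verma_eq by (rule Vt.hat_add) (rule val1_simps | assumption)+

lemma val_smult: "X \<in> carrier (verma l1 l2) \<Longrightarrow> val (u \<odot>\<^bsub>verma l1 l2\<^esub> X) = actM u (val X)"
  unfolding val_def verma_eq by (rule Vt.hat_smult) (rule val1_simps clinear_U_act | assumption)+

lemma MtoP_actM: "MtoP (actM u g) = actP u (MtoP g)"
  by (rule U_act_intertwine[OF lie_rep_M lie_rep_P clinear_MtoP MtoP_intertwines])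

lemma MtoP_top: "MtoP M_top = 0"
  by (rule lpoly_eqI) (auto simp: coeff_MtoP M_top_def kappa_def)

lemma G1_frag: "frag_of (u, c) \<in> carrier Vt.G"
  by (rule Vt.G_closed) (simp add: C_lambda_simps)

text \<open>A vector of the Verma module is the class of \<open>w \<otimes> 1\<close>; \<open>J\<close> is the annihilator of \<open>1 \<otimes> 1\<close>.\<close>

lemma verma_cyclic: "x \<in> carrier Vt.G \<Longrightarrow> \<exists>w. x - frag_of (w, 1) \<in> Vt.H"
proof -
  have rel: "frag_of (u * (c *\<^sub>c 1), 1) - frag_of (u, c) \<in> Vt.H" for u c
    using Vt.H_relators(3)[of 1 u "c *\<^sub>c 1"] by (simp add: C_lambda_simps borel_U_simps borel_char_simps)
  have diff: "frag_of (w - w', 1) - (frag_of (w, 1) - frag_of (w', 1)) \<in> Vt.H" for w w'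
    using Vt.H_closed(3)[OF Vt.H_relators(1)[of 1 "w - w'" w']] by (simp add: C_lambda_simps algebra_simps)
  assume "x \<in> carrier Vt.G"
  then have "Poly_Mapping.keys x \<subseteq> UNIV \<times> carrier (C_lambda l1 l2)" by (simp only: Vt.G_carrier)
  then show ?thesis
  proof (rule free_Abelian_group_induct[where P = "\<lambda>x. \<exists>w. x - frag_of (w, 1) \<in> Vt.H"])
    show "\<exists>w. 0 - frag_of (w, 1) \<in> Vt.H"
      using Vt.H_closed(3)[OF Vt.H_frag_zero[of 1]] by (intro exI[of _ 0]) (simp add: C_lambda_simps)
    fix x y assume "\<exists>w. x - frag_of (w, 1) \<in> Vt.H" "\<exists>w. y - frag_of (w, 1) \<in> Vt.H"
    then obtain w w' where w: "x - frag_of (w, 1) \<in> Vt.H" "y - frag_of (w', 1) \<in> Vt.H" by blast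
    have "x - y - frag_of (w - w', 1) =
        (x - frag_of (w, 1)) - (y - frag_of (w', 1)) - (frag_of (w - w', 1) - (frag_of (w, 1) - frag_of (w', 1)))" by simp
    then show "\<exists>w. x - y - frag_of (w, 1) \<in> Vt.H" using Vt.H_diff[OF Vt.H_diff[OF w] diff] by metis
  next
    fix p assume "p \<in> (UNIV :: takiff_U set) \<times> carrier (C_lambda l1 l2)"
    obtain u c where "p = (u, c)" by (cases p)
    then show "\<exists>w. frag_of p - frag_of (w, 1) \<in> Vt.H"
      using Vt.H_closed(3)[OF rel[of u c]] by (intro exI[of _ "u * (c *\<^sub>c 1)"]) simp
  qed
qed

definition top_cls :: "takiff_U \<Rightarrow> (takiff_U \<times> complex \<Rightarrow>\<^sub>0 int) set" where "top_cls w = Vt.cls (frag_of (w, 1))"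

lemma verma_cases: assumes "d \<in> carrier (verma l1 l2)" obtains w where "d = top_cls w"
proof -
  obtain x where x: "x \<in> carrier Vt.G" "d = Vt.cls x" using assms Vt.T_cases unfolding verma_eq by metis
  then obtain w where "x - frag_of (w, 1) \<in> Vt.H" using verma_cyclic by blast
  then have "d = top_cls w" using x by (simp add: top_cls_def Vt.cls_eq_iff G1_frag)
  then show ?thesis by (rule that)
qed

lemma top_cls_simps:
  "top_cls w \<in> carrier (verma l1 l2)" "top_cls w \<oplus>\<^bsub>verma l1 l2\<^esub> top_cls w' = top_cls (w + w')"
  "u \<odot>\<^bsub>verma l1 l2\<^esub> top_cls w = top_cls (u * w)" "val (top_cls w) = actM w M_top"
proof -
  show "top_cls w \<in> carrier (verma l1 l2)" by (simp add: verma_eq Vt.T_simps top_cls_def G1_frag)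
  have "frag_of (w, 1) + frag_of (w', 1) - frag_of (w + w', 1) \<in> Vt.H"
    using Vt.H_closed(3)[OF Vt.H_relators(1)[of 1 w w']] by (simp add: C_lambda_simps algebra_simps)
  then have "Vt.cls (frag_of (w, 1) + frag_of (w', 1)) = Vt.cls (frag_of (w + w', 1))"
    by (simp add: Vt.cls_eq_iff G1_frag Vt.G_closed)
  then show "top_cls w \<oplus>\<^bsub>verma l1 l2\<^esub> top_cls w' = top_cls (w + w')"
    by (simp only: top_cls_def verma_eq Vt.T_simps(3)[OF G1_frag G1_frag])
  show "u \<odot>\<^bsub>verma l1 l2\<^esub> top_cls w = top_cls (u * w)"
    by (simp only: top_cls_def verma_eq Vt.T_smult[OF G1_frag] Vt.lmap_simps)
  show "val (top_cls w) = actM w M_top"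
    by (simp add: top_cls_def val_cls[OF G1_frag] val1_def cscale_one)
qed

definition J :: "takiff_U set" where "J = {z. frag_of (z, 1) \<in> Vt.H}"

lemma J_closed: "z \<in> J \<Longrightarrow> z' \<in> J \<Longrightarrow> z + z' \<in> J" "z \<in> J \<Longrightarrow> u * z \<in> J" "z \<in> J \<Longrightarrow> c *\<^sub>c z \<in> J" "0 \<in> J"
proof -
  show add: "z + z' \<in> J" if "z \<in> J" "z' \<in> J" for z z'
  proof -
    have "frag_of (z + z', 1) = (frag_of (z + z', 1) - frag_of (z, 1) - frag_of (z', 1)) + frag_of (z, 1) + frag_of (z', 1)"
      by simp
    also have "\<dots> \<in> Vt.H"
      using that Vt.H_relators(1)[of 1 z z'] by (intro Vt.H_closed(2)) (auto simp: J_def C_lambda_simps)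
    finally show ?thesis by (simp add: J_def)
  qed
  show mult: "u * z \<in> J" if "z \<in> J" for u z
    using Vt.lmap_H[of "frag_of (z, 1)" u] that by (simp add: J_def Vt.lmap_simps)
  show "c *\<^sub>c z \<in> J" if "z \<in> J"
    using mult[OF that, of "c *\<^sub>c 1"] by (simp add: mult_cscale_left)
  show "0 \<in> J" using Vt.H_frag_zero[of 1] by (simp add: J_def C_lambda_simps)
qed

lemma top_cls_J: "w - w' \<in> J \<Longrightarrow> top_cls w = top_cls w'"
proof -
  assume "w - w' \<in> J"
  then have "(frag_of (w - w' + w', 1) - frag_of (w - w', 1) - frag_of (w', 1)) + frag_of (w - w', 1) \<in> Vt.H"
    using Vt.H_relators(1)[of 1 "w - w'" w'] by (intro Vt.H_closed(2)) (simp_all add: J_def C_lambda_simps)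
  then have "frag_of (w, 1) - frag_of (w', 1) \<in> Vt.H" by simp
  then show ?thesis by (simp add: top_cls_def Vt.cls_eq_iff G1_frag)
qed

lemma borel_J: "uea_gen (borel_incl x) - borel_char l1 l2 x *\<^sub>c 1 \<in> J"
proof -
  let ?c = "borel_char l1 l2 x"
  have 1: "frag_of (uea_gen (borel_incl x), 1) - frag_of (1, ?c) \<in> Vt.H"
    using Vt.H_relators(3)[of 1 1 "uea_gen x"] by (simp add: C_lambda_simps borel_U_simps borel_char_simps)
  have 2: "frag_of (?c *\<^sub>c 1, 1) - frag_of (1, ?c) \<in> Vt.H"
    using Vt.H_relators(3)[of 1 1 "?c *\<^sub>c 1"] by (simp add: C_lambda_simps borel_U_simps borel_char_simps)
  have 3: "frag_of (uea_gen (borel_incl x) - ?c *\<^sub>c 1 + ?c *\<^sub>c 1, 1) -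
      frag_of (uea_gen (borel_incl x) - ?c *\<^sub>c 1, 1) - frag_of (?c *\<^sub>c 1, 1) \<in> Vt.H"
    by (rule Vt.H_relators(1)) (simp add: C_lambda_simps)
  have "frag_of (uea_gen (borel_incl x) - ?c *\<^sub>c 1, 1) =
      (frag_of (uea_gen (borel_incl x), 1) - frag_of (1, ?c)) - (frag_of (?c *\<^sub>c 1, 1) - frag_of (1, ?c)) -
      (frag_of (uea_gen (borel_incl x) - ?c *\<^sub>c 1 + ?c *\<^sub>c 1, 1) -
      frag_of (uea_gen (borel_incl x) - ?c *\<^sub>c 1, 1) - frag_of (?c *\<^sub>c 1, 1))" by simp
  also have "\<dots> \<in> Vt.H" by (rule Vt.H_diff[OF Vt.H_diff[OF 1 2] 3])
  finally show ?thesis by (simp add: J_def)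
qed

lemma borel_gens_J:
  "uea_gen (in_g sl2_h) - l1 *\<^sub>c 1 \<in> J" "uea_gen (bar sl2_h) - l2 *\<^sub>c 1 \<in> J"
  "uea_gen (in_g sl2_e) - 0 *\<^sub>c 1 \<in> J" "uea_gen (bar sl2_e) - 0 *\<^sub>c 1 \<in> J"
proof -
  have ex: "\<exists>x. borel_incl x = a" if "a \<in> takiff_borel" for a
    using that borel_incl_cases[of a] by metis
  have "in_g sl2_h \<in> takiff_borel" "bar sl2_h \<in> takiff_borel" "in_g sl2_e \<in> takiff_borel" "bar sl2_e \<in> takiff_borel"
    by (simp_all add: takiff_borel_iff in_g_def bar_def)
  from this[THEN ex] show
    "uea_gen (in_g sl2_h) - l1 *\<^sub>c 1 \<in> J" "uea_gen (bar sl2_h) - l2 *\<^sub>c 1 \<in> J"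
    "uea_gen (in_g sl2_e) - 0 *\<^sub>c 1 \<in> J" "uea_gen (bar sl2_e) - 0 *\<^sub>c 1 \<in> J"
    using borel_J borel_char_basis by metis+
qed

section \<open>Spanning of the Verma module by the monomials f^i fb^j\<close>

definition PB :: "takiff_U set" where "PB = {U_f ^ i * U_fb ^ j | i j. True}"

text \<open>Elements congruent to a combination of monomials modulo the annihilator of the
  generator. That these are all of U is the spanning half of a PBW statement for the Verma
  module.\<close>

definition PJ :: "takiff_U set" where "PJ = {w. \<exists>w'\<in>cvec.span PB. w - w' \<in> J}"

lemma span_PB_PJ: "w \<in> cvec.span PB \<Longrightarrow> w \<in> PJ"
  using J_closed(4) by (auto simp: PJ_def intro!: bexI[of _ w])

lemma subspace_PJ: "cvec.subspace PJ"
proof (rule cvec.subspaceI)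
  show "0 \<in> PJ" by (rule span_PB_PJ) (rule cvec.span_zero)
  fix w v assume "w \<in> PJ" "v \<in> PJ"
  then obtain w' v' where "w' \<in> cvec.span PB" "v' \<in> cvec.span PB" "w - w' \<in> J" "v - v' \<in> J" by (auto simp: PJ_def)
  moreover have "w + v - (w' + v') = (w - w') + (v - v')" by simp
  ultimately show "w + v \<in> PJ" unfolding PJ_def using cvec.span_add J_closed(1) by (metis (mono_tags, lifting) mem_Collect_eq)
next
  fix c w assume "w \<in> PJ"
  then obtain w' where "w' \<in> cvec.span PB" "w - w' \<in> J" by (auto simp: PJ_def)
  then show "c *\<^sub>c w \<in> PJ"
    unfolding PJ_def using cvec.span_scale[of w' PB c] J_closed(3)[of "w - w'" c]
    by (auto simp: cvec.scale_right_diff_distrib intro!: bexI[of _ "c *\<^sub>c w'"])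
qed

lemmas PJ_closed = cvec.subspace_add[OF subspace_PJ] cvec.subspace_scale[OF subspace_PJ] cvec.subspace_diff[OF subspace_PJ]

lemma J_PJ: "z \<in> J \<Longrightarrow> z \<in> PJ"
  by (auto simp: PJ_def intro!: bexI[of _ 0] cvec.span_zero)

lemma PJ_mult:
  assumes "\<And>i j. u * (U_f ^ i * U_fb ^ j) \<in> PJ" "w \<in> PJ"
  shows "u * w \<in> PJ"
proof -
  obtain w' where w': "w' \<in> cvec.span PB" "w - w' \<in> J" using assms(2) by (auto simp: PJ_def)
  have "clinear ((*) u)" by unfold_locales (simp_all add: distrib_left mult_cscale_right)
  then have "u * w' \<in> PJ"
    by (rule clinear.span_image_subset[OF _ w'(1) _ subspace_PJ]) (use assms(1) in \<open>auto simp: PB_def\<close>)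
  moreover have "u * (w - w') \<in> PJ" using J_closed(2)[OF w'(2)] by (rule J_PJ)
  ultimately have "u * w' + u * (w - w') \<in> PJ" by (rule PJ_closed)
  then show ?thesis by (simp add: right_diff_distrib)
qed

lemma U_commute: "uea_gen x * uea_gen y = uea_gen y * uea_gen x + uea_gen (lie_bracket x y)"
  for x y :: takiff
  using lie_hom_uea_gen[where 'a = takiff] by (simp add: lie_hom_to_algebra_def)

lemma uea_gen_linear: "uea_gen (x + y) = uea_gen x + uea_gen y" "uea_gen (c *\<^sub>c x) = c *\<^sub>c uea_gen x"
  for x y :: takiff
  using lie_hom_uea_gen[where 'a = takiff] by (simp_all add: lie_hom_to_algebra_def)

lemma uea_gen_zero: "uea_gen (0 :: takiff) = 0"
  using uea_gen_linear(1)[of 0 0] by simp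

lemma PB_PJ: "U_f ^ i * U_fb ^ j \<in> PJ"
  by (rule span_PB_PJ[OF cvec.span_base]) (auto simp: PB_def)

lemma U_f_PJ: "w \<in> PJ \<Longrightarrow> U_f * w \<in> PJ"
proof (rule PJ_mult)
  fix i j
  have "U_f * (U_f ^ i * U_fb ^ j) = U_f ^ Suc i * U_fb ^ j" by (simp add: mult.assoc)
  then show "U_f * (U_f ^ i * U_fb ^ j) \<in> PJ" by (simp only: PB_PJ)
qed

lemma U_fb_PJ: "w \<in> PJ \<Longrightarrow> U_fb * w \<in> PJ"
proof (rule PJ_mult)
  fix i j
  have "lie_bracket (bar sl2_f) (in_g sl2_f) = 0"
    by (simp add: takiff_bracket_simps lie_bracket_self) (simp add: bar_def zero_takiff_def)
  then have comm: "U_fb * U_f = U_f * U_fb"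
    using U_commute[of "bar sl2_f" "in_g sl2_f"] by (simp add: U_fb_def U_f_def uea_gen_zero)
  have "U_fb * U_f ^ i = U_f ^ i * U_fb" by (induction i) (simp, metis (no_types, lifting) comm mult.assoc power_Suc)
  then have "U_fb * (U_f ^ i * U_fb ^ j) = U_f ^ i * U_fb ^ Suc j" by (simp add: mult.assoc[symmetric])
  then show "U_fb * (U_f ^ i * U_fb ^ j) \<in> PJ" by (simp only: PB_PJ)
qed

text \<open>The four elements are treated together, because moving \<open>e\<close> past
  \<open>f\<close> or \<open>fb\<close>, and \<open>eb\<close> past \<open>f\<close>, produces
  \<open>h\<close> and \<open>hb\<close>. Powers of \<open>fb\<close> are the base of the induction
  on the power of \<open>f\<close>; at i = j = 0 the elements act by scalars modulo
  \<open>J\<close>.\<close>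

lemma borel_PB_PJ:
  "uea_gen (in_g sl2_h) * (U_f ^ i * U_fb ^ j) \<in> PJ \<and> uea_gen (bar sl2_h) * (U_f ^ i * U_fb ^ j) \<in> PJ \<and>
   uea_gen (in_g sl2_e) * (U_f ^ i * U_fb ^ j) \<in> PJ \<and> uea_gen (bar sl2_e) * (U_f ^ i * U_fb ^ j) \<in> PJ"
proof -
  let ?h = "uea_gen (in_g sl2_h)" and ?hb = "uea_gen (bar sl2_h)" and ?e = "uea_gen (in_g sl2_e)" and ?eb = "uea_gen (bar sl2_e)"
  have br: "lie_bracket sl2_e sl2_f = sl2_h" "lie_bracket sl2_h sl2_f = (-2) *\<^sub>c sl2_f" by (simp_all add: sl2_eq_iff)
  have c: "?h * U_f = U_f * ?h + (-2) *\<^sub>c U_f" "?hb * U_f = U_f * ?hb + (-2) *\<^sub>c U_fb"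
    "?e * U_f = U_f * ?e + ?h" "?eb * U_f = U_f * ?eb + ?hb"
    "?h * U_fb = U_fb * ?h + (-2) *\<^sub>c U_fb" "?hb * U_fb = U_fb * ?hb + 0" "?e * U_fb = U_fb * ?e + ?hb" "?eb * U_fb = U_fb * ?eb + 0"
    unfolding U_f_def U_fb_def
    by (subst U_commute, simp only: takiff_bracket_simps br takiff_linear_simps uea_gen_linear uea_gen_zero)+
  have step: "x * (y * w) = y * (x * w) + z * w" if "x * y = y * x + z" for x y z w :: takiff_U
    using that by (simp add: mult.assoc[symmetric]) (simp add: distrib_right)
  have one: "1 \<in> PJ" using PB_PJ[of 0 0] by simp
  have base: "x \<in> PJ" if "x - a *\<^sub>c 1 \<in> J" for x a
    using PJ_closed(1)[OF J_PJ[OF that] PJ_closed(2)[OF one, of a]] by simp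
  have gen0: "U_fb ^ j \<in> PJ" for j using PB_PJ[of 0 j] by simp
  show ?thesis
  proof (induction i)
    case 0
    show ?case
    proof (induction j)
      case 0
      then show ?case using borel_gens_J[THEN base] by simp
    next
      case (Suc j)
      then show ?case
        by (simp only: power_0 mult_1_left power_Suc c(5-8)[THEN step] mult_cscale_left mult_zero_left add_0_right)
          (simp only: PJ_closed U_fb_PJ gen0 simp_thms)
    qed
  next
    case (Suc i)
    then show ?case
      by (simp only: power_Suc mult.assoc c(1-4)[THEN step] mult_cscale_left)
        (simp only: PJ_closed U_f_PJ U_fb_PJ PB_PJ simp_thms)
  qed
qed

end


lemma uea_gen_expand:
  "uea_gen x = sl2_mat (part_1 x) $ 1 $ 1 *\<^sub>c uea_gen (in_g sl2_h) + sl2_mat (part_1 x) $ 1 $ 2 *\<^sub>c uea_gen (in_g sl2_e) +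
     sl2_mat (part_1 x) $ 2 $ 1 *\<^sub>c uea_gen (in_g sl2_f) +
     (sl2_mat (part_x x) $ 1 $ 1 *\<^sub>c uea_gen (bar sl2_h) + sl2_mat (part_x x) $ 1 $ 2 *\<^sub>c uea_gen (bar sl2_e) +
     sl2_mat (part_x x) $ 2 $ 1 *\<^sub>c uea_gen (bar sl2_f))"
  by (subst takiff_decompose[of x], subst sl2_decompose[of "part_1 x"], subst sl2_decompose[of "part_x x"])
    (simp only: takiff_linear_simps verma_model.uea_gen_linear)

context verma_model
begin

text \<open>\<open>PJ\<close> contains 1 and is stable under left multiplication by the Lie algebra,
  hence by all of U.\<close>

lemma PJ_UNIV: "u \<in> PJ"
proof -
  have gens: "uea_gen x * w \<in> PJ" if "w \<in> PJ" for x w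
  proof -
    have "uea_gen (in_g sl2_h) * w \<in> PJ" "uea_gen (bar sl2_h) * w \<in> PJ"
      "uea_gen (in_g sl2_e) * w \<in> PJ" "uea_gen (bar sl2_e) * w \<in> PJ"
      by (rule PJ_mult[OF _ that], simp only: borel_PB_PJ)+
    moreover have "uea_gen (in_g sl2_f) * w \<in> PJ" "uea_gen (bar sl2_f) * w \<in> PJ"
      using U_f_PJ[OF that] U_fb_PJ[OF that] by (simp_all add: U_f_def U_fb_def)
    ultimately show ?thesis
      by (subst uea_gen_expand) (simp only: distrib_right mult_cscale_left PJ_closed)
  qed
  have "\<forall>w\<in>PJ. u * w \<in> PJ"
    by (induction u rule: uea_induct)
      (auto simp: gens mult_cscale_left distrib_right mult.assoc PJ_closed)
  then have "u * (U_f ^ 0 * U_fb ^ 0) \<in> PJ" using PB_PJ by blast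
  then show ?thesis by simp
qed

section \<open>The tensor product with \<open>S_f\<close>: its map to the Laurent model and its
  normal forms\<close>

sublocale St: tensor Sf_left Sf_right "verma l1 l2"
proof
  fix u r s s'
  show "Sf_left u (s + s') = Sf_left u s + Sf_left u s'"
    by (rule Sf_cases[of s], rule Sf_cases[of s'])
      (simp only: Sf_add Sf_actions_abs distrib_left)
  show "Sf_left u (Sf_right s r) = Sf_right (Sf_left u s) r"
    by (rule Sf_cases[of s]) (simp only: Sf_actions_abs mult.assoc)
qed (simp_all only: verma_eq Vt.T_closed)

text \<open>\<open>MtoP\<close> kills the image of the generator and intertwines the actions, so it
  kills the image of the whole Verma module. This lets \<open>val2\<close> factor through the
  quotient \<open>S_f\<close> of the localization by U.\<close>

lemma val_MtoP: "d \<in> carrier (verma l1 l2) \<Longrightarrow> MtoP (actM u (val d)) = 0"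
proof -
  assume "d \<in> carrier (verma l1 l2)"
  then obtain w where "d = top_cls w" by (rule verma_cases)
  then show ?thesis by (simp only: top_cls_simps MtoP_actM MtoP_top U_act_linear)
qed

definition val2 :: "takiff_Sf \<times> (takiff_U \<times> complex \<Rightarrow>\<^sub>0 int) set \<Rightarrow> lpoly" where
  "val2 = (\<lambda>(s, d). MtoP (frac_act l1 l2 (rep_takiff_Sf s) (val d)))"

lemma val2_abs: "d \<in> carrier (verma l1 l2) \<Longrightarrow> val2 (abs_takiff_Sf x, d) = MtoP (frac_act l1 l2 x (val d))"
proof -
  assume d: "d \<in> carrier (verma l1 l2)"
  have "abs_takiff_Sf (rep_takiff_Sf (abs_takiff_Sf x)) = abs_takiff_Sf x"
    by (rule Quotient3_abs_rep[OF Quotient3_takiff_Sf])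
  then obtain u where "rep_takiff_Sf (abs_takiff_Sf x) - x = of_U u"
    by (auto simp: takiff_Sf.abs_eq_iff Sf_rel_def)
  then have "rep_takiff_Sf (abs_takiff_Sf x) = of_U u + x" by (simp add: algebra_simps)
  then show ?thesis
    by (simp only: val2_def prod.case frac_act_add frac_act_of_U clinear.add[OF clinear_MtoP] val_MtoP[OF d] add_0_left)
qed

lemma val2_simps:
  "d \<in> carrier (verma l1 l2) \<Longrightarrow> val2 (s + s', d) = val2 (s, d) + val2 (s', d)"
  "d \<in> carrier (verma l1 l2) \<Longrightarrow> d' \<in> carrier (verma l1 l2) \<Longrightarrow>
     val2 (s, d \<oplus>\<^bsub>verma l1 l2\<^esub> d') = val2 (s, d) + val2 (s, d')"
  "d \<in> carrier (verma l1 l2) \<Longrightarrow> val2 (Sf_right s r, d) = val2 (s, r \<odot>\<^bsub>verma l1 l2\<^esub> d)"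
  "d \<in> carrier (verma l1 l2) \<Longrightarrow> val2 (Sf_left u s, d) = actP u (val2 (s, d))"
proof -
  obtain x where s: "s = abs_takiff_Sf x" by (rule Sf_cases)
  obtain x' where s': "s' = abs_takiff_Sf x'" by (rule Sf_cases)
  note clin = clinear.add[OF clinear_MtoP] clinear.add[OF clinear_frac_act]
  show "val2 (s + s', d) = val2 (s, d) + val2 (s', d)" if "d \<in> carrier (verma l1 l2)"
    unfolding s s' Sf_add val2_abs[OF that] by (simp only: frac_act_add clin)
  show "val2 (s, d \<oplus>\<^bsub>verma l1 l2\<^esub> d') = val2 (s, d) + val2 (s, d')"
    if "d \<in> carrier (verma l1 l2)" "d' \<in> carrier (verma l1 l2)"
    unfolding val2_def prod.case by (simp only: val_add that clin)
  show "val2 (Sf_right s r, d) = val2 (s, r \<odot>\<^bsub>verma l1 l2\<^esub> d)" if "d \<in> carrier (verma l1 l2)"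
    unfolding s Sf_actions_abs val2_abs[OF that] val2_abs[OF St.B_smult[OF that]]
    by (simp only: val_smult[OF that] frac_act_mult frac_act_of_U)
  show "val2 (Sf_left u s, d) = actP u (val2 (s, d))" if "d \<in> carrier (verma l1 l2)"
    unfolding s Sf_actions_abs val2_abs[OF that] by (simp only: frac_act_mult frac_act_of_U MtoP_actM)
qed

definition nf_left :: "nat \<Rightarrow> complex \<Rightarrow> takiff_Sf" where "nf_left k c = abs_takiff_Sf (Frac (Suc k) (c *\<^sub>c 1))"

text \<open>Sums of tensors f^(-1-k) \<otimes> fb^j v with complex coefficients; a coefficient is
  put into the left factor because the ambient free group has only integer multiples.\<close>

definition nf :: "(nat \<times> nat) set \<Rightarrow> (nat \<times> nat \<Rightarrow> complex) \<Rightarrow> (takiff_Sf \<times> (takiff_U \<times> complex \<Rightarrow>\<^sub>0 int) set \<Rightarrow>\<^sub>0 int)" where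
  "nf A c = (\<Sum>p\<in>A. frag_of (nf_left (fst p) (c p), top_cls (U_fb ^ snd p)))"

lemma nf_left_simps: "nf_left k 0 = 0" "nf_left k (c + d) = nf_left k c + nf_left k d"
proof -
  show "nf_left k 0 = 0"
    using Sf_zero[of 0] by (simp add: nf_left_def Frac_zero of_U_zero)
  show "nf_left k (c + d) = nf_left k c + nf_left k d"
    by (simp only: nf_left_def Sf_add Frac_add cscale_add_left)
qed

lemma St_frag: "d \<in> carrier (verma l1 l2) \<Longrightarrow> frag_of (s, d) \<in> carrier St.G"
  by (rule St.G_closed)

lemma nf_extend:
  assumes "finite A'" "A \<subseteq> A'" "\<And>p. p \<in> A' - A \<Longrightarrow> c p = 0" shows "nf A' c - nf A c \<in> St.H"
proof -
  have "nf A' c - nf A c = (\<Sum>p\<in>A' - A. frag_of (nf_left (fst p) (c p), top_cls (U_fb ^ snd p)))"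
    unfolding nf_def by (rule sum_diff[OF assms(1,2), symmetric])
  also have "\<dots> \<in> St.H"
    by (rule St.H_sum) (simp only: assms(3) nf_left_simps(1) St.H_frag_zero[OF top_cls_simps(1)])
  finally show ?thesis .
qed

lemma nf_diff: "nf A (\<lambda>p. c p - c' p) - (nf A c - nf A c') \<in> St.H"
proof -
  have "nf A (\<lambda>p. c p - c' p) - (nf A c - nf A c') =
      (\<Sum>p\<in>A. - (frag_of (nf_left (fst p) (c p - c' p) + nf_left (fst p) (c' p), top_cls (U_fb ^ snd p)) -
         frag_of (nf_left (fst p) (c p - c' p), top_cls (U_fb ^ snd p)) - frag_of (nf_left (fst p) (c' p), top_cls (U_fb ^ snd p))))"
    by (simp add: nf_def sum_subtractf sum.distrib sum_negf flip: nf_left_simps(2))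
  also have "\<dots> \<in> St.H"
    by (intro St.H_sum St.H_closed(3) St.H_relators(1) top_cls_simps)
  finally show ?thesis .
qed

definition NF :: "(takiff_Sf \<times> (takiff_U \<times> complex \<Rightarrow>\<^sub>0 int) set \<Rightarrow>\<^sub>0 int) set" where
  "NF = {x. \<exists>A c. finite A \<and> (\<forall>p. p \<notin> A \<longrightarrow> c p = 0) \<and> x - nf A c \<in> St.H}"

lemma NF_diff: assumes "x \<in> NF" "y \<in> NF" shows "x - y \<in> NF"
proof -
  obtain A c where A: "finite A" "\<forall>p. p \<notin> A \<longrightarrow> c p = 0" "x - nf A c \<in> St.H" using assms(1) by (auto simp: NF_def)
  obtain B d where B: "finite B" "\<forall>p. p \<notin> B \<longrightarrow> d p = 0" "y - nf B d \<in> St.H" using assms(2) by (auto simp: NF_def)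
  have 1: "nf (A \<union> B) c - nf A c \<in> St.H" "nf (A \<union> B) d - nf B d \<in> St.H"
    using A B by (auto intro!: nf_extend)
  have "x - y - nf (A \<union> B) (\<lambda>p. c p - d p) =
      (x - nf A c) - (y - nf B d) - (nf (A \<union> B) c - nf A c) + (nf (A \<union> B) d - nf B d)
      - (nf (A \<union> B) (\<lambda>p. c p - d p) - (nf (A \<union> B) c - nf (A \<union> B) d))" by simp
  also have "\<dots> \<in> St.H"
    by (rule St.H_diff[OF St.H_closed(2)[OF St.H_diff[OF St.H_diff[OF A(3) B(3)] 1(1)] 1(2)] nf_diff])
  finally show ?thesis
    using A(1,2) B(1,2) unfolding NF_def by (intro CollectI exI[of _ "A \<union> B"] exI[of _ "\<lambda>p. c p - d p"]) auto
qed

lemma NF_H: "x \<in> St.H \<Longrightarrow> x \<in> NF"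
  unfolding NF_def by (intro CollectI exI[of _ "{}"] exI[of _ "\<lambda>_. 0"]) (simp add: nf_def)

lemma NF_add: assumes "x \<in> NF" "y \<in> NF" shows "x + y \<in> NF"
proof -
  have "0 - y \<in> NF" using NF_diff[OF NF_H[OF St.H_closed(1)] assms(2)] .
  then have "x - (0 - y) \<in> NF" by (rule NF_diff[OF assms(1)])
  then show ?thesis by simp
qed

lemma NF_mod: "x \<in> NF \<Longrightarrow> y - x \<in> St.H \<Longrightarrow> y \<in> NF"
  using NF_add[of x "y - x"] NF_H[of "y - x"] by simp

text \<open>The power f^i moves through the tensor sign to the fraction. For k \<le> i the result
  lies in U and is 0 in \<open>S_f\<close>; otherwise it is f^(-1-m) with m = k - i - 1.\<close>

lemma NF_monomial: "frag_of (abs_takiff_Sf (Frac k 1), top_cls (c *\<^sub>c (U_f ^ i * U_fb ^ j))) \<in> NF"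
proof -
  let ?d = "top_cls (U_fb ^ j)"
  have eq: "(c *\<^sub>c U_f ^ i) \<odot>\<^bsub>verma l1 l2\<^esub> ?d = top_cls (c *\<^sub>c (U_f ^ i * U_fb ^ j))"
    by (simp only: top_cls_simps mult_cscale_left)
  have right: "Sf_right (abs_takiff_Sf (Frac k 1)) (c *\<^sub>c U_f ^ i) = abs_takiff_Sf (Frac k (c *\<^sub>c U_f ^ i))"
    by (simp only: Sf_actions_abs ore_localization(3)[symmetric])
  have rel: "frag_of (abs_takiff_Sf (Frac k (c *\<^sub>c U_f ^ i)), ?d) -
      frag_of (abs_takiff_Sf (Frac k 1), top_cls (c *\<^sub>c (U_f ^ i * U_fb ^ j))) \<in> St.H"
    using St.H_relators(3)[OF top_cls_simps(1), of "abs_takiff_Sf (Frac k 1)" "c *\<^sub>c U_f ^ i" "U_fb ^ j"]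
    unfolding eq right .
  have "frag_of (abs_takiff_Sf (Frac k (c *\<^sub>c U_f ^ i)), ?d) \<in> NF"
  proof (cases "k \<le> i")
    case True
    have "Frac k (c *\<^sub>c U_f ^ i) = of_U (c *\<^sub>c U_f ^ (i - k))"
      using Frac_expand[of 0 "c *\<^sub>c U_f ^ (i - k)" k] True
      by (simp add: of_U_def mult_cscale_right flip: power_add)
    then show ?thesis using NF_H[OF St.H_frag_zero[OF top_cls_simps(1)]] by (simp add: Sf_zero)
  next
    case False
    then have k: "k = i + Suc (k - Suc i)" by simp
    have "Frac (i + Suc (k - Suc i)) (U_f ^ i * (c *\<^sub>c 1)) = Frac (Suc (k - Suc i)) (c *\<^sub>c 1)"
      by (rule Frac_expand[symmetric])
    then have "abs_takiff_Sf (Frac k (c *\<^sub>c U_f ^ i)) = nf_left (k - Suc i) c"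
      using k by (simp add: nf_left_def mult_cscale_right)
    then show ?thesis
      using St.H_closed(1) unfolding NF_def
      by (intro CollectI exI[of _ "{(k - Suc i, j)}"] exI[of _ "\<lambda>p. if p = (k - Suc i, j) then c else 0"]) (simp add: nf_def)
  qed
  moreover have "frag_of (abs_takiff_Sf (Frac k 1), top_cls (c *\<^sub>c (U_f ^ i * U_fb ^ j))) -
      frag_of (abs_takiff_Sf (Frac k (c *\<^sub>c U_f ^ i)), ?d) \<in> St.H"
    using St.H_closed(3)[OF rel] by simp
  ultimately show ?thesis by (rule NF_mod)
qed

text \<open>A pure tensor f^(-k) u \<otimes> w v equals f^(-k) \<otimes> u w v, and u w is a
  combination of monomials modulo \<open>J\<close>, so the monomial case applies.\<close>

lemma NF_all: "x \<in> carrier St.G \<Longrightarrow> x \<in> NF"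
proof -
  have pure: "frag_of (s, d) \<in> NF" if d: "d \<in> carrier (verma l1 l2)" for s d
  proof -
    obtain x where s: "s = abs_takiff_Sf x" by (rule Sf_cases)
    obtain k u where x: "x = Frac k u" by (rule Frac_cases)
    obtain w where w: "d = top_cls w" using d by (rule verma_cases)
    obtain w' where w': "w' \<in> cvec.span PB" "u * w - w' \<in> J" using PJ_UNIV[of "u * w"] by (auto simp: PJ_def)
    have "Sf_right (abs_takiff_Sf (Frac k 1)) u = s"
      by (simp only: Sf_actions_abs s x ore_localization(3)[of k u, symmetric])
    then have rel: "frag_of (s, d) - frag_of (abs_takiff_Sf (Frac k 1), top_cls w') \<in> St.H"
      using St.H_relators(3)[OF top_cls_simps(1), of "abs_takiff_Sf (Frac k 1)" u w] top_cls_J[OF w'(2)]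
      by (simp add: top_cls_simps w)
    have "frag_of (abs_takiff_Sf (Frac k 1), top_cls w') \<in> NF"
      using w'(1)
    proof (induction rule: cvec.span_induct_alt)
      case base
      show ?case using NF_monomial[of k 0 0 0] by simp
    next
      case (step c b y)
      obtain i j where b: "b = U_f ^ i * U_fb ^ j" using step by (auto simp: PB_def)
      have "frag_of (abs_takiff_Sf (Frac k 1), top_cls (c *\<^sub>c b + y)) -
          frag_of (abs_takiff_Sf (Frac k 1), top_cls (c *\<^sub>c b)) - frag_of (abs_takiff_Sf (Frac k 1), top_cls y) \<in> St.H"
        using St.H_relators(2)[OF top_cls_simps(1) top_cls_simps(1), of "abs_takiff_Sf (Frac k 1)" "c *\<^sub>c b" y]
        by (simp add: top_cls_simps)
      then show ?case
        using NF_mod[OF NF_add[OF NF_monomial[of k c i j] step(2)]] by (simp add: b diff_diff_eq)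
    qed
    then show ?thesis using rel by (rule NF_mod)
  qed
  assume "x \<in> carrier St.G"
  then have "Poly_Mapping.keys x \<subseteq> UNIV \<times> carrier (verma l1 l2)" by (simp only: St.G_carrier)
  then show ?thesis
    by (rule free_Abelian_group_induct[where P = "\<lambda>x. x \<in> NF"])
      (use NF_H[OF St.H_closed(1)] NF_diff pure in auto)
qed

definition tmonom :: "int \<Rightarrow> nat \<Rightarrow> lpoly" where "tmonom i j = (\<lambda>i'. if i' = i then monom 1 j else 0)"

lemma U_fb_M: "actM U_fb g = M_fb g"
  by (simp only: U_fb_def U_act_M(5)) (simp only: M_rep_def gens_rep_basis)

lemma val2_nf: "val2 (nf_left k c, top_cls (U_fb ^ j)) = (c * kappa (int k)) *\<^sub>c tmonom (int k - int j) j"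
proof -
  have fb: "actM (U_fb ^ j) M_top = (\<lambda>a. if a = int j then monom 1 j else 0)"
  proof (induction j)
    case 0
    show ?case by (simp only: power_0 U_act_M M_top_def monom_0 one_pCons of_nat_0)
  next
    case (Suc j)
    have "actM (U_fb ^ Suc j) M_top = M_fb (actM (U_fb ^ j) M_top)"
      by (simp only: power_Suc U_act_M(2) U_fb_M)
    then show ?case unfolding Suc by (auto simp: M_fb_def monom_Suc fun_eq_iff)
  qed
  have "val2 (nf_left k c, top_cls (U_fb ^ j)) = MtoP (shift (int (Suc k)) (actM (c *\<^sub>c 1) (actM (U_fb ^ j) M_top)))"
    by (simp only: nf_left_def val2_abs[OF top_cls_simps(1)] frac_act_Frac top_cls_simps)
  also have "\<dots> = c *\<^sub>c MtoP (shift (int (Suc k)) (actM (U_fb ^ j) M_top))"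
    by (simp only: U_act_M shift_simps clinear.cscale[OF clinear_MtoP])
  also have "MtoP (shift (int (Suc k)) (actM (U_fb ^ j) M_top)) = kappa (int k) *\<^sub>c tmonom (int k - int j) j"
    unfolding fb by (rule lpoly_eqI) (auto simp: coeff_MtoP shift_def tmonom_def)
  finally show ?thesis by (simp only: cscale_cscale)
qed

lemma frag_eval_nf: "frag_eval val2 (nf A c) = (\<Sum>p\<in>A. (c p * kappa (int (fst p))) *\<^sub>c tmonom (int (fst p) - int (snd p)) (snd p))"
  by (simp only: nf_def frag_eval_sum frag_eval_of val2_nf)

lemma kappa_nonzero: "kappa (int k) \<noteq> 0"
  by (simp add: kappa_def)

lemma coeff_frag_eval_nf:
  assumes "finite A"
  shows "coeff (frag_eval val2 (nf A c) (int k - int j)) j = (if (k, j) \<in> A then c (k, j) * kappa (int k) else 0)"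
proof -
  have "coeff (frag_eval val2 (nf A c) (int k - int j)) j =
      (\<Sum>p\<in>A. if p = (k, j) then c p * kappa (int (fst p)) else 0)"
    unfolding frag_eval_nf sum_fun_apply coeff_sum
    by (rule sum.cong) (auto simp: tmonom_def)
  then show ?thesis using assms by simp
qed

text \<open>Different pairs (k, j) give different monomials t^(k-j) s^j, and kappa k is nonzero for
  k \<ge> 0. So a normal form that evaluates to 0 has zero coefficients, and every element is a
  normal form modulo \<open>St.H\<close>.\<close>

lemma val2_kernel: assumes "x \<in> carrier St.G" "frag_eval val2 x = 0" shows "x \<in> St.H"
proof -
  obtain A c where A: "finite A" "x - nf A c \<in> St.H" using NF_all[OF assms(1)] by (auto simp: NF_def)
  have "frag_eval val2 (x - nf A c) = 0" by (rule St.frag_eval_H[OF _ _ _ A(2)]) (rule val2_simps | assumption)+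
  then have 0: "frag_eval val2 (nf A c) = 0" using assms(2) by (simp add: frag_eval_diff)
  have "c p = 0" if "p \<in> A" for p
  proof -
    have "coeff (frag_eval val2 (nf A c) (int (fst p) - int (snd p))) (snd p) = 0" by (simp add: 0)
    then show ?thesis
      unfolding coeff_frag_eval_nf[OF A(1)] using that kappa_nonzero[of "fst p"] by simp
  qed
  then have nf: "nf A c \<in> St.H"
    unfolding nf_def by (intro St.H_sum) (simp only: nf_left_simps(1) St.H_frag_zero[OF top_cls_simps(1)])
  show ?thesis using St.H_closed(2)[OF A(2) nf] by simp
qed

definition phi where "phi = St.hat val2"

definition X where "X = as_lie_module (tensor_module Sf_left Sf_right (verma l1 l2))"

lemma X_simps: "carrier X = carrier St.T" "\<zero>\<^bsub>X\<^esub> = \<zero>\<^bsub>St.T\<^esub>" "v \<oplus>\<^bsub>X\<^esub> w = v \<oplus>\<^bsub>St.T\<^esub> w"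
  "c \<odot>\<^bsub>X\<^esub> v = (c *\<^sub>c 1) \<odot>\<^bsub>St.T\<^esub> v" "lact X x v = uea_gen x \<odot>\<^bsub>St.T\<^esub> v"
  by (simp_all add: X_def as_lie_module_def)

lemma phi_cls: "x \<in> carrier St.G \<Longrightarrow> phi (St.cls x) = frag_eval val2 x"
  unfolding phi_def by (rule St.hat_cls) (rule val2_simps | assumption)+

lemma phi_smult: "v \<in> carrier St.T \<Longrightarrow> phi (u \<odot>\<^bsub>St.T\<^esub> v) = actP u (phi v)"
  unfolding phi_def by (rule St.hat_smult) (rule val2_simps clinear_U_act | assumption)+

lemma chart_X: "takiff_chart X phi (P_rep (l1 + 2) l2)"
proof (rule takiff_chart.intro[OF takiff_rep_P], rule chart.intro)
  show "inj_on phi (carrier X)"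
    unfolding X_simps phi_def by (rule St.inj_on_hat) (rule val2_simps val2_kernel | assumption)+
  show "\<zero>\<^bsub>X\<^esub> \<in> carrier X" "phi \<zero>\<^bsub>X\<^esub> = 0"
    by (simp_all add: X_simps St.T_simps St.G_closed phi_cls)
  fix v w assume v: "v \<in> carrier X" and w: "w \<in> carrier X"
  show "v \<oplus>\<^bsub>X\<^esub> w \<in> carrier X" "lact X x v \<in> carrier X" "c \<odot>\<^bsub>X\<^esub> v \<in> carrier X" for x c
    using v w by (simp_all only: X_simps St.T_closed)
  show "phi (v \<oplus>\<^bsub>X\<^esub> w) = phi v + phi w"
    using v w unfolding X_simps phi_def by (intro St.hat_add) (rule val2_simps | assumption)+
  show "phi (c \<odot>\<^bsub>X\<^esub> v) = c *\<^sub>c phi v" for c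
    using v by (simp only: X_simps phi_smult U_act_P)
  show "phi (lact X x v) = P_rep (l1 + 2) l2 x (phi v)" for x
    using v by (simp only: X_simps phi_smult U_act_P)
qed

text \<open>Elements of the image are finite combinations of t^(k-j) s^j with k, j \<ge> 0; in the
  layer of t^i with i < 0 this means j \<ge> -i, so s^(-i) divides.\<close>

lemma phi_image:
  assumes "g \<in> phi ` carrier X"
  shows "finite {i. g i \<noteq> 0}" "[:0, 1:] ^ nat (- i) dvd g i"
proof -
  obtain v where v: "g = phi v" "v \<in> carrier X" using assms by (rule imageE)
  have "v \<in> carrier St.T" using v(2) by (simp only: X_simps(1))
  then obtain x where x: "x \<in> carrier St.G" "v = St.cls x" by (rule St.T_cases)
  have gx: "g = frag_eval val2 x" by (simp only: v(1) x(2) phi_cls[OF x(1)])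
  obtain A c where A: "finite A" "x - nf A c \<in> St.H" using NF_all[OF x(1)] by (auto simp: NF_def)
  have "frag_eval val2 (x - nf A c) = 0" by (rule St.frag_eval_H[OF _ _ _ A(2)]) (rule val2_simps | assumption)+
  then have g: "g = frag_eval val2 (nf A c)" unfolding frag_eval_diff gx by (rule eq_iff_diff_eq_0[THEN iffD2])
  have gi: "g i = (\<Sum>p\<in>A. Polynomial.smult (c p * kappa (int (fst p))) (tmonom (int (fst p) - int (snd p)) (snd p) i))" for i
    unfolding g frag_eval_nf sum_fun_apply by simp
  have "g i = 0" if "i \<notin> (\<lambda>p. int (fst p) - int (snd p)) ` A" for i
    unfolding gi using that by (intro sum.neutral) (auto simp: tmonom_def)
  then have "{i. g i \<noteq> 0} \<subseteq> (\<lambda>p. int (fst p) - int (snd p)) ` A" by blast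
  then show "finite {i. g i \<noteq> 0}" using A(1) finite_subset by blast
  show "[:0, 1:] ^ nat (- i) dvd g i"
    unfolding gi
  proof (intro dvd_sum dvd_smult)
    fix p
    have "[:0, 1:] ^ nat (- i) dvd (monom 1 (snd p) :: complex poly)" if "i = int (fst p) - int (snd p)"
    proof -
      have "[:0, 1:] ^ nat (- i) dvd ([:0, 1:] :: complex poly) ^ snd p"
        by (rule le_imp_power_dvd) (use that in simp)
      then show ?thesis by (simp only: monom_altdef smult_1_left)
    qed
    then show "[:0, 1:] ^ nat (- i) dvd tmonom (int (fst p) - int (snd p)) (snd p) i" by (auto simp: tmonom_def)
  qed
qed

lemma tmonom_in_image: "tmonom (int k) 0 \<in> phi ` carrier X"
proof -
  let ?x = "frag_of (nf_left k (1 / kappa (int k)), top_cls (U_fb ^ 0))"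
  have x: "?x \<in> carrier St.G" by (intro St_frag top_cls_simps)
  have "phi (St.cls ?x) = tmonom (int k) 0"
    using kappa_nonzero[of k] by (simp only: phi_cls[OF x] frag_eval_of val2_nf) (simp add: cscale_one)
  then show ?thesis using x by (simp only: X_simps St.T_simps) (metis imageI)
qed

end


section \<open>The completion of a Verma module\<close>

text \<open>The span of an \<open>e\<close>-orbit need not be stable under the whole action, as
  \<open>restrict_carrier\<close> demands. Finite dimension does not involve the action, so the
  action is exchanged for the identity map, under which every subspace is stable.\<close>

lemma (in chart) finite_dim_restrict:
  assumes "W \<subseteq> carrier V" "cvec.subspace (\<phi> ` W)"
  shows "finite_dim (V\<lparr>carrier := W\<rparr>) \<longleftrightarrow> fd (\<phi> ` W)"
proof -
  have "chart (V\<lparr>lact := \<lambda>_ v. v\<rparr>) \<phi> (\<lambda>_ v. v)"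
    by unfold_locales (simp_all add: inj zero add smult)
  then have "chart (V\<lparr>lact := \<lambda>_ v. v\<rparr>\<lparr>carrier := W\<rparr>) \<phi> (\<lambda>_ v. v)"
    by (rule chart.restrict_carrier) (use assms in \<open>simp_all add: invariant_subspace_def\<close>)
  then have "finite_dim (V\<lparr>lact := \<lambda>_ v. v\<rparr>\<lparr>carrier := W\<rparr>) \<longleftrightarrow> fd (\<phi> ` W)"
    by (subst chart.finite_dim_iff) simp_all
  moreover have "finite_dim (V\<lparr>lact := \<lambda>_ v. v\<rparr>\<lparr>carrier := W\<rparr>) \<longleftrightarrow> finite_dim (V\<lparr>carrier := W\<rparr>)"
    unfolding finite_dim_def lin_span_def submodule_def submodule_axioms_def subgroup_def by simp
  ultimately show ?thesis by blast
qed

definition single :: "int \<Rightarrow> complex poly \<Rightarrow> lpoly" where "single i A = (\<lambda>i'. if i' = i then A else 0)"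

lemma coeff_single: "coeff (single i A i') j = (if i' = i then coeff A j else 0)"
  by (simp add: single_def)

lemma single_simps: "single i A + single i B = single i (A + B)" "c *\<^sub>c single i A = single i (Polynomial.smult c A)"
  "single i 0 = 0" "single i A i = A" "single i A = 0 \<longleftrightarrow> A = 0"
proof -
  show "single i A + single i B = single i (A + B)" "c *\<^sub>c single i A = single i (Polynomial.smult c A)"
    by (rule lpoly_eqI; simp only: coeff_lpoly_simps coeff_single; simp)+
  show "single i 0 = 0" "single i A i = A" "single i A = 0 \<longleftrightarrow> A = 0" by (auto simp: single_def fun_eq_iff)
qed

lemma sum_single: "finite {i. g i \<noteq> 0} \<Longrightarrow> g = (\<Sum>i\<in>{i. g i \<noteq> 0}. single i (g i))"
  by (rule ext) (simp add: sum_fun_apply single_def sum.delta' )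

text \<open>The differential operator \<open>b + q d/ds\<close>, where \<open>q = c - s\<close>, multiplies the coefficients of the
  expansion in powers of \<open>q\<close> by \<open>b - r\<close>, hence preserves the order of vanishing below \<open>b\<close>.\<close>

lemma power_dvd_of_derivation:
  fixes A q :: "complex poly"
  assumes q: "pderiv q = - 1" "q \<noteq> 0" and dvd: "q ^ Suc b dvd Polynomial.smult (of_nat b) A + q * pderiv A"
  shows "q ^ b dvd A"
proof -
  have "r \<le> b \<Longrightarrow> q ^ r dvd A" for r
  proof (induction r)
    case (Suc r)
    then obtain B where B: "A = q ^ r * B" by (auto elim: dvdE)
    have dq: "q * pderiv (q ^ r) = - Polynomial.smult (of_nat r) (q ^ r)"
      by (cases r) (simp_all add: pderiv_power_Suc q del: of_nat_Suc power_Suc, simp only: power_Suc)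
    have "q * pderiv A = q ^ r * (q * pderiv B) + B * (q * pderiv (q ^ r))"
      unfolding B pderiv_mult by (simp add: algebra_simps)
    then have "Polynomial.smult (of_nat b) A + q * pderiv A =
        q ^ r * (Polynomial.smult (of_nat b - of_nat r) B + q * pderiv B)"
      unfolding dq by (simp add: B smult_diff_left algebra_simps)
    moreover have "q ^ Suc r dvd q ^ Suc b" using Suc.prems by (intro le_imp_power_dvd) simp
    ultimately have "q ^ r * q dvd q ^ r * (Polynomial.smult (of_nat b - of_nat r) B + q * pderiv B)"
      using dvd dvd_trans by (metis power_Suc2)
    then have "q dvd Polynomial.smult (of_nat b - of_nat r) B + q * pderiv B"
      using q(2) by (subst (asm) dvd_mult_cancel_left) simp
    then have "q dvd Polynomial.smult (of_nat b - of_nat r) B"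
      using dvd_add_left_iff[of q "q * pderiv B"] by simp
    moreover have "(of_nat b - of_nat r :: complex) \<noteq> 0" using Suc.prems by simp
    ultimately have "q dvd B" by (simp add: dvd_smult_iff)
    then show ?case unfolding B power_Suc2 by (rule mult_dvd_mono[OF dvd_refl])
  qed simp
  then show ?thesis by blast
qed

text \<open>The sum of q and s is a nonzero constant c, so c C = q C + s C shows that q divides C
  whenever it divides s C. Iterating this, powers of q and s behave as coprime.\<close>

lemma powers_dvd_of_unit_sum:
  fixes A q s :: "complex poly"
  assumes q: "q + s = [:c:]" "c \<noteq> 0" "q \<noteq> 0" and dvd: "q ^ b dvd A" "s ^ a dvd A"
  shows "s ^ a * q ^ b dvd A"
proof -
  have one: "q dvd C" if "q dvd s * C" for C
  proof -
    have "q dvd q * C + s * C" using that by (intro dvd_add) simp_all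
    also have "q * C + s * C = Polynomial.smult c C" by (simp add: q(1) flip: distrib_right)
    finally show ?thesis using q(2) by (simp add: dvd_smult_iff)
  qed
  have step: "q ^ b dvd B" if "q ^ b dvd s * B" for b B
    using that
  proof (induction b)
    case (Suc b)
    have "q ^ b dvd s * B" by (rule power_le_dvd[OF Suc.prems]) simp
    then obtain C where C: "B = q ^ b * C" using Suc.IH by (auto elim: dvdE)
    have "q ^ b * q dvd q ^ b * (s * C)"
      using Suc.prems by (simp only: C power_Suc2 mult.left_commute[of s "q ^ b" C])
    then have "q dvd s * C" using q(3) by (subst (asm) dvd_mult_cancel_left) simp
    then show ?case unfolding C power_Suc2 by (rule mult_dvd_mono[OF dvd_refl one])
  qed simp
  obtain B where B: "A = s ^ a * B" using dvd(2) by (rule dvdE)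
  have "q ^ b dvd s ^ a * B \<Longrightarrow> q ^ b dvd B"
    by (induction a) (simp_all only: power_0 mult_1_left power_Suc mult.assoc, blast dest: step)
  then have "q ^ b dvd B" using dvd(1) by (simp only: B)
  then show ?thesis unfolding B by (rule mult_dvd_mono[OF dvd_refl])
qed

lemma P_single:
  "P_f (single i A) = single (i - 1) (- (Polynomial.smult (of_int i) A + pCons 0 (pderiv A)))"
  "P_fb (single i A) = single (i - 1) (pCons 0 A)"
  "P_h n (single i A) = single i (Polynomial.smult (n + 2 * of_int i) A)"
  "P_hb l2 (single i A) = single i ([:l2, -2:] * A)"
  "P_e n l2 (single i A) = single (i + 1) (Polynomial.smult (n + of_int i) A + [:l2, -1:] * pderiv A)"
  "P_eb l2 (single i A) = single (i + 1) ([:l2, -1:] * A)"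
  by (auto simp: P_f_def P_fb_def P_h_def P_hb_def P_e_def P_eb_def single_def fun_eq_iff simp del: mult_pCons_left)

section \<open>The generator and the submodule it generates in the Laurent model\<close>

locale completed_verma =
  fixes n :: int and l2 :: complex
  assumes l2: "l2 \<noteq> 0"
begin

sublocale P: takiff_rep "P_rep (of_int n) l2" by (rule takiff_rep_P)

lemma P_rep_basis: "P.e = P_e (of_int n) l2" "P.f = P_f" "P.h = P_h (of_int n)" "P.eb = P_eb l2" "P.fb = P_fb" "P.hb = P_hb l2"
  by (simp_all only: P_rep_def gens_rep_basis)

lemma Cbar_P: "P.Cbar g = (l2 * l2) *\<^sub>c g"
  unfolding P.Cbar_def P_rep_basis
  by (rule lpoly_eqI, rule_tac j = j in nat_cases3; simp only: coeff_P coeff_lpoly_simps; simp add: algebra_simps)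

lemma Cmix_P: "P.Cmix g = (of_int n * l2) *\<^sub>c g"
  unfolding P.Cmix_def P_rep_basis
  by (rule lpoly_eqI, rule_tac j = j in nat_cases3; simp only: coeff_P coeff_lpoly_simps; simp add: algebra_simps)

lemma eb_injective: "P.eb g = 0 \<Longrightarrow> g = 0"
proof (rule ext)
  fix i assume "P.eb g = 0"
  then have "P_eb l2 g (i + 1) = 0" by (simp only: P_rep_basis zero_fun_def)
  then show "g i = 0 i" using l2 by (simp add: P_eb_def del: mult_pCons_left)
qed

definition q where "q = [:l2, -1:]"
definition s where "s = ([:0, 1:] :: complex poly)"

text \<open>\<open>e\<close> sends t^i q^b to (n + i - b) t^(i+1) q^b, so among these vectors the
  ones with b = n + i are killed. This is the one of least i with i, b \<ge> 0, and its weight n + 2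
  i is |n|.\<close>

definition v0 where "v0 = single (int (nat (- n))) (q ^ nat n)"

lemma q_s: "pderiv q = - 1" "pderiv s = 1" "q + s = [:l2:]" "q \<noteq> 0"
  using l2 by (simp_all add: q_def s_def pderiv_pCons one_pCons)

lemma pderiv_q_power: "pderiv (q ^ b) = - Polynomial.smult (of_nat b) (q ^ (b - 1))"
  by (cases b) (simp_all add: pderiv_power_Suc q_s del: of_nat_Suc power_Suc)

lemma hw_v0: "P.hw (of_nat (nat \<bar>n\<bar>)) v0"
proof -
  have n: "of_int n + of_nat (nat (- n)) = (of_nat (nat n) :: complex)"
    by (cases "n \<ge> 0") simp_all
  have m: "of_int n + 2 * of_nat (nat (- n)) = (of_nat (nat \<bar>n\<bar>) :: complex)"
    by (cases "n \<ge> 0") simp_all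
  have "q * pderiv (q ^ nat n) = - Polynomial.smult (of_nat (nat n)) (q ^ nat n)"
    unfolding pderiv_q_power by (cases "nat n") simp_all
  then have "P.e v0 = 0"
    unfolding P_rep_basis v0_def P_single of_int_of_nat_eq n q_def[symmetric] by (simp add: single_simps)
  moreover have "P.h v0 = of_nat (nat \<bar>n\<bar>) *\<^sub>c v0"
    unfolding P_rep_basis v0_def P_single of_int_of_nat_eq m by (simp only: single_simps)
  ultimately show ?thesis by (simp add: P.hw_def)
qed

lemma v0_nonzero: "v0 \<noteq> 0"
  using q_s by (simp add: v0_def single_simps)

lemma f_pow_coeff: "coeff ((P.f ^^ m) g i) j = (\<Prod>r<m. - (of_int i + of_nat j + of_nat m - of_nat r)) * coeff (g (i + int m)) j"
proof (induction m arbitrary: i)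
  case (Suc m)
  have "coeff ((P.f ^^ Suc m) g i) j = - (of_int i + 1 + of_nat j) * coeff ((P.f ^^ m) g (i + 1)) j"
    unfolding funpow.simps comp_apply P_rep_basis by (rule coeff_P)
  also have "\<dots> = (- (of_int i + 1 + of_nat j) * (\<Prod>r<m. - (of_int i + of_nat j + of_nat (Suc m) - of_nat r))) * coeff (g (i + int (Suc m))) j"
    unfolding Suc by (simp add: algebra_simps)
  also have "- (of_int i + 1 + of_nat j) * (\<Prod>r<m. - (of_int i + of_nat j + of_nat (Suc m) - of_nat r)) =
      (\<Prod>r<Suc m. - (of_int i + of_nat j + of_nat (Suc m) - of_nat r :: complex))"
    by (simp add: algebra_simps)
  finally show ?case .
qed simp

text \<open>With fb = s / t held fixed, t^i s^j has degree i + j in t. In \<open>v0\<close> this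
  degree is at most max(0,-n) + max(0,n) = |n|, so |n| + 1 derivatives kill it.\<close>

lemma f_pow_v0: "(P.f ^^ Suc (nat \<bar>n\<bar>)) v0 = 0"
proof (rule lpoly_eqI)
  fix i j
  let ?N = "nat \<bar>n\<bar>"
  have "coeff (v0 (i + int (Suc ?N))) j = 0"
    if "(\<Prod>r<Suc ?N. - (of_int i + of_nat j + of_nat (Suc ?N) - of_nat r :: complex)) \<noteq> 0"
  proof (rule ccontr)
    assume nz: "coeff (v0 (i + int (Suc ?N))) j \<noteq> 0"
    then have i: "i + int (Suc ?N) = int (nat (- n))" and "coeff (q ^ nat n) j \<noteq> 0"
      by (auto simp: v0_def single_def split: if_splits)
    moreover have "degree (q ^ nat n) \<le> nat n" using degree_power_le[of q "nat n"] by (simp add: q_def)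
    ultimately have "j \<le> nat n" using le_degree order_trans by blast
    \<comment> \<open>The factor of the product that vanishes is the one whose index r is the degree
      of the monomial in t.\<close>
    then have r: "nat (- n) + j < Suc ?N" by (cases "n \<ge> 0") auto
    have "of_int (i + int (Suc ?N)) = (of_int (int (nat (- n))) :: complex)" by (simp only: i)
    then have "- (of_int i + of_nat j + of_nat (Suc ?N) - of_nat (nat (- n) + j) :: complex) = 0"
      by (simp add: algebra_simps)
    then show False using that r by (meson finite_lessThan lessThan_iff prod_zero)
  qed
  then show "coeff ((P.f ^^ Suc ?N) v0 i) j = coeff (0 i) j"
    unfolding f_pow_coeff by (simp only: zero_fun_apply coeff_0 mult_eq_0_iff) blast
qed

text \<open>\<open>eb\<close> is injective and 4 eb Dn v0 = (n^2 l2^2 - (n l2)^2) v0 = 0, so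
  \<open>Dn\<close> kills \<open>v0\<close>.\<close>

lemma generator_v0: "P.generator (nat \<bar>n\<bar>) (l2 * l2) (of_int n * l2) v0"
proof -
  have "of_nat (nat \<bar>n\<bar>) * of_nat (nat \<bar>n\<bar>) = (of_int n * of_int n :: complex)"
    by (cases "n \<ge> 0") simp_all
  then have "4 *\<^sub>c P.eb (P.Dn (of_nat (nat \<bar>n\<bar>)) v0) = 0"
    unfolding P.eb_Dn[OF hw_v0] Cbar_P Cmix_P by (simp only: cscale_cscale) (simp add: algebra_simps)
  then have "P.Dn (of_nat (nat \<bar>n\<bar>)) v0 = 0" using eb_injective by simp
  then show ?thesis
    unfolding P.generator_def using hw_v0 f_pow_v0 Cbar_P Cmix_P by blast
qed

text \<open>On a layer t^i A the element \<open>hb\<close> multiplies A by l2 - 2 s, so an invariant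
  subspace is closed under multiplication by s = (l2 - hb) / 2, hence by every polynomial.\<close>

lemma single_poly_mult:
  assumes W: "invariant_subspace (P_rep (of_int n) l2) W" and "single i A \<in> W"
  shows "single i (p * A) \<in> W"
proof -
  have sub: "cvec.subspace W" and inv: "w \<in> W \<Longrightarrow> P_rep (of_int n) l2 x w \<in> W" for x w
    using W by (auto simp: invariant_subspace_def)
  have s: "single i (s * B) \<in> W" if "single i B \<in> W" for B
  proof -
    have "(l2 / 2) *\<^sub>c single i B + (- 1 / 2) *\<^sub>c P.hb (single i B) \<in> W"
      using that by (intro cvec.subspace_add[OF sub] cvec.subspace_scale[OF sub] inv)
    also have "(l2 / 2) *\<^sub>c single i B + (- 1 / 2) *\<^sub>c P.hb (single i B) = single i (s * B)"
      unfolding P_rep_basis P_single single_simps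
      by (rule arg_cong[where f = "single i"], rule poly_eqI) (simp add: s_def coeff_pCons field_simps split: nat.split)
    finally show ?thesis .
  qed
  show ?thesis
    using assms(2)
  proof (induction p arbitrary: A)
    case 0
    show ?case unfolding mult_zero_left single_simps by (rule cvec.subspace_0[OF sub])
  next
    case (pCons a p)
    have "a *\<^sub>c single i A + single i (s * (p * A)) \<in> W"
      using pCons by (intro cvec.subspace_add[OF sub] cvec.subspace_scale[OF sub] s)
    also have "a *\<^sub>c single i A + single i (s * (p * A)) = single i (pCons a p * A)"
      unfolding single_simps by (simp add: s_def)
    finally show ?case .
  qed
qed

text \<open>The layer of t^i in the submodule will be the ideal generated by this product. Starting
  from \<open>v0\<close>, multiplication by t q through \<open>eb\<close> reaches the layers above,
  and \<open>f\<close> and \<open>fb\<close> reach those below.\<close>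

lemma base_in_generated: "single i (s ^ nat (- i) * q ^ nat (n + i)) \<in> P.gspan v0"
proof -
  let ?N = "P.gspan v0" and ?g = "\<lambda>i. single i (s ^ nat (- i) * q ^ nat (n + i))"
  have W: "invariant_subspace (P_rep (of_int n) l2) ?N" by (rule P.generated_invariant[OF generator_v0])
  have sub: "cvec.subspace ?N" and inv: "w \<in> ?N \<Longrightarrow> P_rep (of_int n) l2 x w \<in> ?N" for x w
    using W by (auto simp: invariant_subspace_def)
  have "v0 = ?g (int (nat (- n)))" by (cases "n \<ge> 0") (simp_all add: v0_def)
  then have base: "?g (int (nat (- n))) \<in> ?N" using P.generator_in_generated[OF generator_v0] by simp
  show ?thesis
  proof (cases "i \<ge> int (nat (- n))")
    case True
    then show ?thesis
    proof (induction rule: int_ge_induct)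
      case (step i)
      have "nat (n + (i + 1)) = Suc (nat (n + i))" "nat (- i) = 0" "nat (- (i + 1)) = 0" using step(1) by linarith+
      then have "P.eb (?g i) = ?g (i + 1)"
        unfolding P_rep_basis P_single by (simp add: q_def del: mult_pCons_left)
      then show ?case using inv[OF step(2)] by metis
    qed (rule base)
  next
    case False
    then have "i \<le> int (nat (- n))" by simp
    then show ?thesis
    proof (induction rule: int_le_induct)
      case (step i)
      \<comment> \<open>For i > 0 the layer generator is 1 and \<open>f\<close> acts by -i; for i
        \<le> 0 < n + i it trades a factor q for a factor s, with scalar n + i; below that
        \<open>fb\<close> adds a factor s.\<close>
      consider "i > 0" | "i \<le> 0" "n + i > 0" | "i \<le> 0" "n + i \<le> 0" by linarith
      then show ?case
      proof cases
        case 1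
        then have *: "nat (- i) = 0" "nat (- (i - 1)) = 0" "nat (n + i) = 0" "nat (n + (i - 1)) = 0"
          using step(1) by linarith+
        have "P.f (?g i) \<in> ?N" by (rule inv[OF step(2)])
        also have "P.f (?g i) = (- of_int i) *\<^sub>c ?g (i - 1)"
          unfolding P_rep_basis P_single single_simps * by simp
        finally have "(- of_int i) *\<^sub>c ?g (i - 1) \<in> ?N" .
        from cvec.subspace_scale[OF sub this, of "- 1 / of_int i"] show ?thesis
          using 1 by (simp add: cscale_one)
      next
        case 2
        obtain a b where ab: "nat (- i) = a" "nat (n + i) = Suc b" "nat (- (i - 1)) = Suc a" "nat (n + (i - 1)) = b"
          "of_int i = (- of_nat a :: complex)"
        proof (rule that[of "nat (- i)" "nat (n + i) - 1"])
          show "of_int i = (- of_nat (nat (- i)) :: complex)" using 2 by simp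
        qed (use 2 in linarith)+
        have sa: "s * pderiv (s ^ a) = Polynomial.smult (of_nat a) (s ^ a)"
          by (cases a) (simp_all add: pderiv_power_Suc q_s del: of_nat_Suc power_Suc, simp only: power_Suc)
        have qb: "pderiv (q ^ Suc b) = - Polynomial.smult (of_nat (Suc b)) (q ^ b)"
          unfolding pderiv_q_power by simp
        have "pCons 0 (pderiv (s ^ a * q ^ Suc b)) = s * pderiv (s ^ a * q ^ Suc b)" by (simp add: s_def)
        also have "\<dots> = q ^ Suc b * (s * pderiv (s ^ a)) + s * s ^ a * pderiv (q ^ Suc b)"
          by (simp only: pderiv_mult) (simp only: distrib_left ac_simps)
        also have "\<dots> = Polynomial.smult (of_nat a) (s ^ a * q ^ Suc b) - Polynomial.smult (of_nat (Suc b)) (s ^ Suc a * q ^ b)"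
          unfolding sa qb by (simp add: algebra_simps del: of_nat_Suc)
        finally have d: "- (Polynomial.smult (- of_nat a) (s ^ a * q ^ Suc b) + pCons 0 (pderiv (s ^ a * q ^ Suc b))) =
            Polynomial.smult (of_nat (Suc b)) (s ^ Suc a * q ^ b)"
          by simp
        have "P.f (?g i) \<in> ?N" by (rule inv[OF step(2)])
        also have "P.f (?g i) = of_nat (Suc b) *\<^sub>c ?g (i - 1)"
          unfolding P_rep_basis P_single single_simps ab d ..
        finally have "of_nat (Suc b) *\<^sub>c ?g (i - 1) \<in> ?N" .
        from cvec.subspace_scale[OF sub this, of "1 / of_nat (Suc b)"] show ?thesis
          by (simp add: cscale_one del: of_nat_Suc)
      next
        case 3
        then have *: "nat (- (i - 1)) = Suc (nat (- i))" "nat (n + i) = 0" "nat (n + (i - 1)) = 0" by linarith+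
        have "P.fb (?g i) = ?g (i - 1)"
          unfolding P_rep_basis P_single * by (simp add: s_def)
        then show ?thesis using inv[OF step(2)] by metis
      qed
    qed (rule base)
  qed
qed

text \<open>As q and s are coprime, each layer of g is a multiple of the layer generator, and
  finitely many layers add up to g.\<close>

lemma generated_if_divisible:
  assumes "finite {i. g i \<noteq> 0}" "\<And>i. s ^ nat (- i) dvd g i" "\<And>i. q ^ nat (n + i) dvd g i"
  shows "g \<in> P.gspan v0"
proof -
  have W: "invariant_subspace (P_rep (of_int n) l2) (P.gspan v0)" by (rule P.generated_invariant[OF generator_v0])
  have "single i (g i) \<in> P.gspan v0" for i
  proof -
    have "s ^ nat (- i) * q ^ nat (n + i) dvd g i"
      by (rule powers_dvd_of_unit_sum[OF q_s(3) l2 q_s(4) assms(3,2)])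
    then obtain p where "g i = s ^ nat (- i) * q ^ nat (n + i) * p" by (rule dvdE)
    then show ?thesis using single_poly_mult[OF W base_in_generated, of i p] by (simp only: mult.commute)
  qed
  then have "(\<Sum>i\<in>{i. g i \<noteq> 0}. single i (g i)) \<in> P.gspan v0"
    using W by (intro cvec.subspace_sum) (simp_all add: invariant_subspace_def)
  then show ?thesis by (subst sum_single[OF assms(1)])
qed

text \<open>In the layer of t^(i+1), \<open>e g\<close> is (n + i) g_i + q g_i', and
  \<open>power_dvd_of_derivation\<close> turns its divisibility by q^(n+i+1) into divisibility of
  g_i by q^(n+i). The descent starts in the layer where e^k g vanishes.\<close>

lemma e_nilpotent_imp_dvd: "(P.e ^^ k) g (i + int k) = 0 \<Longrightarrow> q ^ nat (n + i) dvd g i"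
proof (induction k arbitrary: g i)
  case (Suc k)
  have "(P.e ^^ k) (P.e g) ((i + 1) + int k) = 0"
    using Suc.prems by (simp add: funpow_swap1 add.assoc)
  then have dvd: "q ^ nat (n + (i + 1)) dvd P.e g (i + 1)" by (rule Suc.IH)
  show ?case
  proof (cases "n + i > 0")
    case True
    then have *: "nat (n + (i + 1)) = Suc (nat (n + i))" "of_int n + of_int (i + 1) - 1 = (of_nat (nat (n + i)) :: complex)"
      by simp_all
    show ?thesis
      using dvd unfolding P_rep_basis P_e_def * q_def[symmetric] add_diff_cancel_right'
      by (rule power_dvd_of_derivation[OF q_s(1,4)])
  qed simp
qed simp

text \<open>\<open>e\<close> moves the support up by one layer, while finitely many orbit vectors of
  finite support span the orbit and bound it from above. So the support of e^k g is squeezed out for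
  large k.\<close>

lemma e_nilpotent_of_fd:
  assumes "finite {i. g i \<noteq> 0}" "fd (cvec.span (range (\<lambda>k. (P.e ^^ k) g)))"
  obtains k where "(P.e ^^ k) g = 0"
proof -
  obtain B where B: "finite B" "B \<subseteq> range (\<lambda>k. (P.e ^^ k) g)" "cvec.span B = cvec.span (range (\<lambda>k. (P.e ^^ k) g))"
    using assms(2) by (rule fd_imp_span_finite_subset)
  have e_zero: "P.e g i = 0" if "g (i - 1) = 0" for g i
    unfolding P_rep_basis P_e_def by (simp add: that)
  have supp: "finite {i. (P.e ^^ k) g i \<noteq> 0}" for k
  proof (induction k)
    case (Suc k)
    have "{i. (P.e ^^ Suc k) g i \<noteq> 0} \<subseteq> (\<lambda>i. i + 1) ` {i. (P.e ^^ k) g i \<noteq> 0}"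
    proof
      fix i assume "i \<in> {i. (P.e ^^ Suc k) g i \<noteq> 0}"
      then have "i - 1 \<in> {i. (P.e ^^ k) g i \<noteq> 0}" using e_zero by auto
      then show "i \<in> (\<lambda>i. i + 1) ` {i. (P.e ^^ k) g i \<noteq> 0}" by force
    qed
    then show ?case using Suc finite_subset by blast
  qed (simp add: assms(1))
  have "finite (\<Union>b\<in>B. {i. b i \<noteq> 0})" using B(1,2) supp by auto
  then obtain M where M: "\<And>b i. b \<in> B \<Longrightarrow> b i \<noteq> 0 \<Longrightarrow> i \<le> M"
    using bdd_above_finite[of "\<Union>b\<in>B. {i. b i \<noteq> 0}"] unfolding bdd_above_def by blast
  have sub: "cvec.subspace {g :: lpoly. \<forall>i>M. g i = 0}"
    by (rule cvec.subspaceI) (auto simp: cscale_fun_def)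
  have "cvec.span B \<subseteq> {g. \<forall>i>M. g i = 0}"
    using M by (intro cvec.span_minimal[OF _ sub]) force
  then have le: "(P.e ^^ k) g i = 0" if "i > M" for k i
    using that cvec.span_base[of "(P.e ^^ k) g" "range (\<lambda>k. (P.e ^^ k) g)"] unfolding B(3) by blast
  obtain m where m: "\<And>i. g i \<noteq> 0 \<Longrightarrow> m \<le> i"
    using bdd_below_finite[OF assms(1)] unfolding bdd_below_def by blast
  have ge: "(P.e ^^ k) g i = 0" if "i < m + int k" for k i
    using that
  proof (induction k arbitrary: i)
    case 0
    then show ?case using m[of i] by force
  next
    case (Suc k)
    have "(P.e ^^ k) g (i - 1) = 0" using Suc by simp
    then show ?case by (simp add: e_zero)
  qed
  let ?k = "nat (M + 1 - m)"
  have "(P.e ^^ ?k) g i = 0" for i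
    using le[of i ?k] ge[of i ?k] by linarith
  then have "(P.e ^^ ?k) g = 0" by (intro ext) simp
  then show thesis by (rule that)
qed

section \<open>Identification of the locally e-finite part of the tensor product\<close>

sublocale verma_model "of_int n - 2" l2 .

sublocale X: takiff_chart X phi "P_rep (of_int n) l2"
  using chart_X by simp

lemma orbit_image:
  assumes "m \<in> carrier X"
  shows "phi ` lin_span X (range (\<lambda>k. (lact X (in_g sl2_e) ^^ k) m)) = cvec.span (range (\<lambda>k. (P.e ^^ k) (phi m)))"
    "lin_span X (range (\<lambda>k. (lact X (in_g sl2_e) ^^ k) m)) \<subseteq> carrier X"
proof -
  have k: "(lact X (in_g sl2_e) ^^ k) m \<in> carrier X \<and> phi ((lact X (in_g sl2_e) ^^ k) m) = (P.e ^^ k) (phi m)" for k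
    by (induction k) (simp_all add: assms X.lact)
  then have B: "range (\<lambda>k. (lact X (in_g sl2_e) ^^ k) m) \<subseteq> carrier X" by blast
  have im: "phi ` range (\<lambda>k. (lact X (in_g sl2_e) ^^ k) m) = range (\<lambda>k. (P.e ^^ k) (phi m))"
    using k by (auto simp: image_image)
  have "cvec.span (range (\<lambda>k. (P.e ^^ k) (phi m))) \<subseteq> phi ` carrier X"
    unfolding im[symmetric] using B by (intro cvec.span_minimal X.subspace_image) auto
  then show "phi ` lin_span X (range (\<lambda>k. (lact X (in_g sl2_e) ^^ k) m)) = cvec.span (range (\<lambda>k. (P.e ^^ k) (phi m)))"
    unfolding X.lin_span_eq[OF B] im by (rule X.image_pull)
  show "lin_span X (range (\<lambda>k. (lact X (in_g sl2_e) ^^ k) m)) \<subseteq> carrier X"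
    unfolding X.lin_span_eq[OF B] X.pull_def by blast
qed

lemma V_mod_eq: "V_mod n l2 = X\<lparr>carrier := {m \<in> carrier X. fd (cvec.span (range (\<lambda>k. (P.e ^^ k) (phi m))))}\<rparr>"
proof -
  have "finite_dim (X\<lparr>carrier := lin_span X (range (\<lambda>k. (lact X (in_g sl2_e) ^^ k) m))\<rparr>) \<longleftrightarrow>
      fd (cvec.span (range (\<lambda>k. (P.e ^^ k) (phi m))))" if "m \<in> carrier X" for m
    using X.finite_dim_restrict[OF orbit_image(2)[OF that]] unfolding orbit_image(1)[OF that] by simp
  then show ?thesis
    unfolding V_mod_def EA_def Let_def X_def[symmetric] by (simp cong: conj_cong)
qed

text \<open>Finiteness under \<open>e\<close> gives nilpotency and with it divisibility of every
  layer by the power of q; the power of s divides on the whole tensor product. Conversely, the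
  submodule generated by \<open>v0\<close> is locally finite under sl2.\<close>

lemma V_mod_image: "phi ` carrier (V_mod n l2) = P.gspan v0"
proof
  show "phi ` carrier (V_mod n l2) \<subseteq> P.gspan v0"
  proof
    fix g assume "g \<in> phi ` carrier (V_mod n l2)"
    then have g: "g \<in> phi ` carrier X" "fd (cvec.span (range (\<lambda>k. (P.e ^^ k) g)))"
      by (auto simp: V_mod_eq)
    obtain k where k: "(P.e ^^ k) g = 0" by (rule e_nilpotent_of_fd[OF phi_image(1)[OF g(1)] g(2)])
    have "q ^ nat (n + i) dvd g i" for i
      by (rule e_nilpotent_imp_dvd[of k]) (simp only: k zero_fun_apply)
    then show "g \<in> P.gspan v0"
      using phi_image[OF g(1)] unfolding s_def[symmetric] by (intro generated_if_divisible)
  qed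
  have "single (int (nat (- n))) 1 \<in> phi ` carrier X"
    using tmonom_in_image[of "nat (- n)"] by (simp only: tmonom_def single_def monom_0 one_pCons)
  then have "v0 \<in> phi ` carrier X"
    unfolding v0_def using single_poly_mult[OF X.invariant_image, of _ 1 "q ^ nat n"] by simp
  then have sub: "P.gspan v0 \<subseteq> phi ` carrier X"
    by (intro P.generated_minimal[OF generator_v0] X.invariant_image)
  show "P.gspan v0 \<subseteq> phi ` carrier (V_mod n l2)"
  proof
    fix g assume g: "g \<in> P.gspan v0"
    then obtain Y where Y: "fd Y" "invariant_subspace (\<lambda>a. P_rep (of_int n) l2 (in_g a)) Y" "g \<in> Y"
      by (rule P.generated_locally_finite[OF generator_v0])
    have "(P.e ^^ k) g \<in> Y" for k
      by (induction k) (use Y in \<open>auto simp: invariant_subspace_def\<close>)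
    then have "cvec.span (range (\<lambda>k. (P.e ^^ k) g)) \<subseteq> Y"
      using Y(2) by (intro cvec.span_minimal) (auto simp: invariant_subspace_def)
    then have "fd (cvec.span (range (\<lambda>k. (P.e ^^ k) g)))" by (rule fd_subset[OF Y(1)])
    then show "g \<in> phi ` carrier (V_mod n l2)" using sub g by (auto simp: V_mod_eq)
  qed
qed

lemma chart_V_mod: "takiff_chart (V_mod n l2) phi (P_rep (of_int n) l2)"
proof (rule takiff_chart.intro[OF takiff_rep_P])
  have sub: "carrier (V_mod n l2) \<subseteq> carrier X" by (auto simp: V_mod_eq)
  have eq: "V_mod n l2 = X\<lparr>carrier := carrier (V_mod n l2)\<rparr>" by (simp add: V_mod_eq)
  show "chart (V_mod n l2) phi (P_rep (of_int n) l2)"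
    by (subst eq, rule X.restrict_carrier[OF sub])
      (simp only: V_mod_image P.generated_invariant[OF generator_v0])
qed

end


section \<open>The classification\<close>

lemma (in takiff_rep) generated_central_character:
  assumes gen: "generator n z c v" and "u \<in> gspan v"
  shows "Cbar u = z *\<^sub>c u" "Cmix u = c *\<^sub>c u"
proof -
  have base: "Cbar ((f ^^ i) ((eb ^^ k) v)) = z *\<^sub>c (f ^^ i) ((eb ^^ k) v)"
    "Cmix ((f ^^ i) ((eb ^^ k) v)) = c *\<^sub>c (f ^^ i) ((eb ^^ k) v)" for i k
    by (induction i) (simp_all add: Cbar_eb_pow[OF gen] Cmix_eb_pow[OF gen] Cbar_commute Cmix_commute rep_simps)
  have "gspan v \<subseteq> {u. Cbar u = z *\<^sub>c u}" "gspan v \<subseteq> {u. Cmix u = c *\<^sub>c u}"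
    unfolding gspan_def
    by (rule cvec.span_minimal[OF _ eigenspace_subspace[OF linear_Cbar]], use base in blast)
      (rule cvec.span_minimal[OF _ eigenspace_subspace[OF linear_Cmix]], use base in blast)
  then show "Cbar u = z *\<^sub>c u" "Cmix u = c *\<^sub>c u" using assms(2) by blast+
qed

lemma minimal_g_type_unique: "minimal_g_type V n \<Longrightarrow> minimal_g_type V m \<Longrightarrow> n = m"
  unfolding minimal_g_type_def by (meson le_antisym)

text \<open>n is the minimal type of V, and z and c are scalars of expressions that can be written
  inside V, namely \<open>C\<close> and \<open>D\<close> below; none of them refers to a
  chart.\<close>

lemma generator_invariants:
  assumes "takiff_chart V \<phi> \<rho>" "takiff_chart V \<psi> \<sigma>"
    and "takiff_rep.generator \<rho> n z c v" "v \<noteq> 0" "\<phi> ` carrier V = takiff_rep.gspan \<rho> v"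
    and "takiff_rep.generator \<sigma> n' z' c' w" "w \<noteq> 0" "\<psi> ` carrier V = takiff_rep.gspan \<sigma> w"
  shows "n' = n" "z' = z" "c' = c"
proof -
  interpret A: takiff_chart V \<phi> \<rho> by fact
  interpret B: takiff_chart V \<psi> \<sigma> by fact
  show "n' = n"
    using A.minimal_g_type_generator[OF assms(3-5)] B.minimal_g_type_generator[OF assms(6-8)]
    by (rule minimal_g_type_unique[symmetric])
  obtain x where x: "x \<in> carrier V" "\<phi> x = v"
    using A.generator_in_generated[OF assms(3)] unfolding assms(5)[symmetric] by (metis imageE)
  have \<psi>x: "\<psi> x \<in> B.gspan w" using x(1) assms(8) by blast
  define C where "C = lact V (bar sl2_h) (lact V (bar sl2_h) x) \<oplus>\<^bsub>V\<^esub>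
     4 \<odot>\<^bsub>V\<^esub> lact V (bar sl2_f) (lact V (bar sl2_e) x)"
  define D where "D = lact V (in_g sl2_h) (lact V (bar sl2_h) x) \<oplus>\<^bsub>V\<^esub>
     2 \<odot>\<^bsub>V\<^esub> lact V (bar sl2_f) (lact V (in_g sl2_e) x) \<oplus>\<^bsub>V\<^esub>
     2 \<odot>\<^bsub>V\<^esub> lact V (in_g sl2_f) (lact V (bar sl2_e) x) \<oplus>\<^bsub>V\<^esub> 2 \<odot>\<^bsub>V\<^esub> lact V (bar sl2_h) x"
  have C: "C \<in> carrier V" "\<phi> C = A.Cbar (\<phi> x)" "\<psi> C = B.Cbar (\<psi> x)"
    by (simp_all add: C_def x(1) A.add A.smult A.lact B.add B.smult B.lact A.Cbar_def B.Cbar_def)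
  have D: "D \<in> carrier V" "\<phi> D = A.Cmix (\<phi> x)" "\<psi> D = B.Cmix (\<psi> x)"
    by (simp_all add: D_def x(1) A.add A.smult A.lact B.add B.smult B.lact A.Cmix_def B.Cmix_def)
  have A_eq: "y = a \<odot>\<^bsub>V\<^esub> x" if "y \<in> carrier V" "\<phi> y = a *\<^sub>c \<phi> x" for y a
    using A.eq_iff[OF that(1) A.smult(1)[OF x(1), of a]] that(2) A.smult(2)[OF x(1), of a] by simp
  have B_eq: "y = a \<odot>\<^bsub>V\<^esub> x" if "y \<in> carrier V" "\<psi> y = a *\<^sub>c \<psi> x" for y a
    using B.eq_iff[OF that(1) B.smult(1)[OF x(1), of a]] that(2) B.smult(2)[OF x(1), of a] by simp
  note char_A = A.generated_central_character[OF assms(3) A.generator_in_generated[OF assms(3)]]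
    and char_B = B.generated_central_character[OF assms(6) \<psi>x]
  have "C = z \<odot>\<^bsub>V\<^esub> x" "D = c \<odot>\<^bsub>V\<^esub> x"
    using A_eq[OF C(1)] A_eq[OF D(1)] unfolding C(2) D(2) x(2) char_A by blast+
  moreover have "C = z' \<odot>\<^bsub>V\<^esub> x" "D = c' \<odot>\<^bsub>V\<^esub> x"
    using B_eq[OF C(1)] B_eq[OF D(1)] unfolding C(3) D(3) char_B by blast+
  ultimately have "z' \<odot>\<^bsub>V\<^esub> x = z \<odot>\<^bsub>V\<^esub> x" "c' \<odot>\<^bsub>V\<^esub> x = c \<odot>\<^bsub>V\<^esub> x" by simp_all
  then have "z' *\<^sub>c v = z *\<^sub>c v" "c' *\<^sub>c v = c *\<^sub>c v" using A.smult(2)[OF x(1)] x(2) by metis+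
  then show "z' = z" "c' = c" using assms(4) by (simp_all add: cvec.scale_right_imp_eq)
qed

text \<open>The chart \<open>\<phi>\<close> is an argument because its target type cannot be hidden
  under the existential quantifier.\<close>

definition takiff_generated_via :: "('v \<Rightarrow> 'a::complex_vector) \<Rightarrow> (takiff, 'v) lie_module \<Rightarrow> nat \<Rightarrow> complex \<Rightarrow> complex \<Rightarrow> bool" where
  "takiff_generated_via \<phi> V n z c \<longleftrightarrow> (\<exists>\<rho> v. takiff_chart V \<phi> \<rho> \<and> takiff_rep.generator \<rho> n z c v \<and> v \<noteq> 0 \<and>
     \<phi> ` carrier V = takiff_rep.gspan \<rho> v)"

lemma lie_iso_imp_invariants:
  assumes "takiff_generated_via \<phi> V n z c" "takiff_generated_via \<psi> W n' z' c'" "lie_iso V W"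
  shows "n' = n \<and> z' = z \<and> c' = c"
proof -
  obtain \<rho> v where A: "takiff_chart V \<phi> \<rho>" "takiff_rep.generator \<rho> n z c v" "v \<noteq> 0"
    "\<phi> ` carrier V = takiff_rep.gspan \<rho> v"
    using assms(1) unfolding takiff_generated_via_def by blast
  obtain \<sigma> w where B: "takiff_chart W \<psi> \<sigma>" "takiff_rep.generator \<sigma> n' z' c' w" "w \<noteq> 0"
    "\<psi> ` carrier W = takiff_rep.gspan \<sigma> w"
    using assms(2) unfolding takiff_generated_via_def by blast
  interpret A: takiff_chart V \<phi> \<rho> by fact
  interpret B: takiff_chart W \<psi> \<sigma> by fact
  obtain \<theta> where \<theta>: "chart V \<theta> \<sigma>" "\<theta> ` carrier V = \<psi> ` carrier W"
    using lie_iso_chart[OF B.chart_V assms(3) lie_module_chart_closure[OF A.lie_module[OF A.lie_rep_\<rho>]]] by blast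
  have "takiff_chart V \<theta> \<sigma>" by (rule takiff_chart.intro[OF B.takiff_rep_axioms \<theta>(1)])
  from generator_invariants[OF A(1) this A(2-4) B(2,3)] show ?thesis using \<theta>(2) B(4) by simp
qed

lemma lie_iso_of_invariants:
  assumes "takiff_generated_via \<phi> V n z c" "takiff_generated_via \<psi> W n z c"
    and "simple_lie_module V" "simple_lie_module W"
  shows "lie_iso V W"
proof -
  obtain \<rho> v where A: "takiff_chart V \<phi> \<rho>" "takiff_rep.generator \<rho> n z c v" "v \<noteq> 0"
    "\<phi> ` carrier V = takiff_rep.gspan \<rho> v"
    using assms(1) unfolding takiff_generated_via_def by blast
  obtain \<sigma> w where B: "takiff_chart W \<psi> \<sigma>" "takiff_rep.generator \<sigma> n z c w" "w \<noteq> 0"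
    "\<psi> ` carrier W = takiff_rep.gspan \<sigma> w"
    using assms(2) unfolding takiff_generated_via_def by blast
  show ?thesis by (rule lie_iso_of_generators[OF A(1) B(1) A(2) B(2) A(4) B(4) A(3) B(3) assms(3,4)])
qed

lemma V_mod_generated:
  assumes "l2 \<noteq> 0"
  shows "takiff_generated_via (verma_model.phi (of_int n - 2) l2) (V_mod n l2) (nat \<bar>n\<bar>) (l2 * l2) (of_int n * l2)"
    and "simple_harish_chandra (V_mod n l2)"
proof -
  interpret completed_verma n l2 by unfold_locales fact
  show "takiff_generated_via phi (V_mod n l2) (nat \<bar>n\<bar>) (l2 * l2) (of_int n * l2)"
    unfolding takiff_generated_via_def using chart_V_mod generator_v0 v0_nonzero V_mod_image by blast
  show "simple_harish_chandra (V_mod n l2)"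
    by (rule takiff_chart.simple_harish_chandra_generator[OF chart_V_mod generator_v0 V_mod_image])
      (use assms v0_nonzero in simp_all)
qed

lemma L_mod_generated: "takiff_generated_via id (L_mod n) n 0 0"
  unfolding takiff_generated_via_def using takiff_chart_L_mod L_mod_generator by blast

lemma simple_harish_chandra_cases:
  fixes V :: "(takiff, 'v) lie_module"
  assumes "simple_harish_chandra V"
  obtains n z where "minimal_g_type V n" "\<forall>chi. C_bar_acts_as V chi \<longrightarrow> chi = z"
    "z \<noteq> 0 \<longrightarrow> (\<exists>l2. l2\<^sup>2 = z \<and> lie_iso V (V_mod (int n) l2))" "z = 0 \<longrightarrow> lie_iso V (L_mod n)"
proof -
  have simple: "simple_lie_module V" using assms by (simp add: simple_harish_chandra_def)
  then have "lie_module V" by (simp add: simple_lie_module_def)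
  then obtain \<phi> :: "'v \<Rightarrow> 'v \<Rightarrow> complex" and \<rho> where \<phi>: "lie_rep \<rho>" "chart V \<phi> \<rho>"
    by (rule lie_module_has_chart)
  have ch: "takiff_chart V \<phi> \<rho>" by (rule takiff_chart.intro[OF takiff_rep.intro[OF \<phi>(1)] \<phi>(2)])
  interpret takiff_chart V \<phi> \<rho> by (rule ch)
  obtain n z c v where gen: "generator n z c v" "v \<noteq> 0" "\<phi> ` carrier V = gspan v"
    and Cbar: "\<And>u. u \<in> \<phi> ` carrier V \<Longrightarrow> Cbar u = z *\<^sub>c u"
    by (rule simple_harish_chandra_has_generator[OF assms]) (rule that, assumption+)
  have cc: "c * c = of_nat n * of_nat n * z" by (rule generator_scalars[OF gen(1,2)])
  have via: "takiff_generated_via \<phi> V n z c" unfolding takiff_generated_via_def using ch gen by blast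
  have simple': "simple_lie_module (V_mod m l2)" if "l2 \<noteq> 0" for m l2
    using V_mod_generated(2)[OF that] by (simp add: simple_harish_chandra_def)
  have simple'': "simple_lie_module (L_mod m)" for m
    using simple_harish_chandra_L_mod by (simp add: simple_harish_chandra_def)
  show thesis
  proof (rule that)
    show "minimal_g_type V n" by (rule minimal_g_type_generator[OF gen])
    show "\<forall>chi. C_bar_acts_as V chi \<longrightarrow> chi = z"
    proof (intro allI impI)
      fix chi assume chi: "C_bar_acts_as V chi"
      have "v \<in> \<phi> ` carrier V" using generator_in_generated[OF gen(1)] gen(3) by blast
      then have "chi *\<^sub>c v = z *\<^sub>c v" using chi Cbar unfolding C_bar_acts_as_iff by metis
      then show "chi = z" using gen(2) by (simp add: cvec.scale_right_imp_eq)
    qed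
    show "z \<noteq> 0 \<longrightarrow> (\<exists>l2. l2\<^sup>2 = z \<and> lie_iso V (V_mod (int n) l2))"
    proof
      assume z: "z \<noteq> 0"
      \<comment> \<open>\<open>Cmix\<close> acts on V(n, l2) as n l2, which determines l2 = c / n
        for n > 0. For n = 0 also c = 0, and any square root of z will do.\<close>
      define l2 where "l2 = (if n = 0 then csqrt z else c / of_nat n)"
      have l2: "l2 * l2 = z \<and> of_int (int n) * l2 = c"
      proof (cases "n = 0")
        case True
        then show ?thesis using cc by (simp add: l2_def flip: power2_eq_square)
      next
        case False
        then show ?thesis using cc by (simp add: l2_def field_simps)
      qed
      then have nz: "l2 \<noteq> 0" using z by auto
      have "takiff_generated_via (verma_model.phi (of_int (int n) - 2) l2) (V_mod (int n) l2) n z c"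
        using V_mod_generated(1)[OF nz, of "int n"] l2 by (simp only: abs_of_nat nat_int)
      then have "lie_iso V (V_mod (int n) l2)"
        by (rule lie_iso_of_invariants[OF via _ simple simple'[OF nz]])
      then show "\<exists>l2. l2\<^sup>2 = z \<and> lie_iso V (V_mod (int n) l2)" using l2 by (metis power2_eq_square)
    qed
    show "z = 0 \<longrightarrow> lie_iso V (L_mod n)"
    proof
      assume z: "z = 0"
      then have "c = 0" using cc by simp
      then have "takiff_generated_via \<phi> V n 0 0" using via z by simp
      then show "lie_iso V (L_mod n)" by (rule lie_iso_of_invariants[OF _ L_mod_generated simple simple''])
    qed
  qed
qed

text \<open>Of the invariants |n|, l2^2 and n l2, the first two fix n and l2 up to signs and the
  third ties the signs together. For n = 0 the third imposes nothing, in accordance with V(0, l2)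
  \<cong> V(0, -l2).\<close>

lemma lie_iso_V_mod_iff:
  assumes "l2 \<noteq> 0" "m2 \<noteq> 0"
  shows "lie_iso (V_mod n l2) (V_mod m m2) \<longleftrightarrow> (m = n \<and> m2 = l2) \<or> (m = - n \<and> m2 = - l2)"
proof
  assume "lie_iso (V_mod n l2) (V_mod m m2)"
  then have inv: "nat \<bar>m\<bar> = nat \<bar>n\<bar>" "m2 * m2 = l2 * l2" "of_int m * m2 = of_int n * l2"
    using lie_iso_imp_invariants[OF V_mod_generated(1)[OF assms(1)] V_mod_generated(1)[OF assms(2)]] by blast+
  have "m2 = l2 \<or> m2 = - l2" using inv(2) by (simp add: square_eq_iff)
  moreover have "m = n \<or> m = - n" using inv(1) by linarith
  ultimately show "(m = n \<and> m2 = l2) \<or> (m = - n \<and> m2 = - l2)"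
    using inv(3) assms by auto
next
  assume "(m = n \<and> m2 = l2) \<or> (m = - n \<and> m2 = - l2)"
  then have "nat \<bar>m\<bar> = nat \<bar>n\<bar>" "m2 * m2 = l2 * l2" "of_int m * m2 = of_int n * l2" by auto
  then show "lie_iso (V_mod n l2) (V_mod m m2)"
    using V_mod_generated[OF assms(1), of n] V_mod_generated[OF assms(2), of m]
    by (metis lie_iso_of_invariants simple_harish_chandra_def)
qed

theorem theorem30:
  fixes V :: "(takiff, 'v) lie_module"
  shows
    "(\<forall>chi n. simple_harish_chandra V \<and> C_bar_acts_as V chi \<and> minimal_g_type V n \<longrightarrow>
        (chi \<noteq> 0 \<longrightarrow> (\<exists>l2. l2\<^sup>2 = chi \<and> lie_iso V (V_mod (int n) l2))) \<and>
        (chi = 0 \<longrightarrow> lie_iso V (L_mod n)))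
     \<and> (\<forall>n l2. l2 \<noteq> 0 \<longrightarrow> simple_harish_chandra (V_mod n l2))
     \<and> (\<forall>n. simple_harish_chandra (L_mod n))
     \<and> (simple_harish_chandra V \<longrightarrow>
          (\<exists>n l2. l2 \<noteq> 0 \<and> lie_iso V (V_mod n l2)) \<or> (\<exists>n. lie_iso V (L_mod n)))
     \<and> (\<forall>n l2 m m2. l2 \<noteq> 0 \<and> m2 \<noteq> 0 \<longrightarrow>
          lie_iso (V_mod n l2) (V_mod m m2) \<longleftrightarrow>
            (m = n \<and> m2 = l2) \<or> (m = - n \<and> m2 = - l2))
     \<and> (\<forall>n m. lie_iso (L_mod n) (L_mod m) \<longleftrightarrow> n = m)
     \<and> (\<forall>n l2 m. l2 \<noteq> 0 \<longrightarrow> \<not> lie_iso (V_mod n l2) (L_mod m))"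
  proof (intro conjI allI impI)
  fix chi n assume V: "simple_harish_chandra V \<and> C_bar_acts_as V chi \<and> minimal_g_type V n"
  then have "simple_harish_chandra V" by blast
  then obtain m z where *: "minimal_g_type V m" "\<forall>chi. C_bar_acts_as V chi \<longrightarrow> chi = z"
    "z \<noteq> 0 \<longrightarrow> (\<exists>l2. l2\<^sup>2 = z \<and> lie_iso V (V_mod (int m) l2))" "z = 0 \<longrightarrow> lie_iso V (L_mod m)"
    by (rule simple_harish_chandra_cases)
  have "m = n" using *(1) V minimal_g_type_unique by blast
  moreover have "z = chi" using *(2) V by blast
  ultimately show "chi \<noteq> 0 \<Longrightarrow> \<exists>l2. l2\<^sup>2 = chi \<and> lie_iso V (V_mod (int n) l2)" "chi = 0 \<Longrightarrow> lie_iso V (L_mod n)"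
    using *(3,4) by simp_all
next
  assume "simple_harish_chandra V"
  then obtain m z where *: "minimal_g_type V m" "\<forall>chi. C_bar_acts_as V chi \<longrightarrow> chi = z"
    "z \<noteq> 0 \<longrightarrow> (\<exists>l2. l2\<^sup>2 = z \<and> lie_iso V (V_mod (int m) l2))" "z = 0 \<longrightarrow> lie_iso V (L_mod m)"
    by (rule simple_harish_chandra_cases)
  show "(\<exists>n l2. l2 \<noteq> 0 \<and> lie_iso V (V_mod n l2)) \<or> (\<exists>n. lie_iso V (L_mod n))"
  proof (cases "z = 0")
    case False
    then obtain l2 where "l2\<^sup>2 = z" "lie_iso V (V_mod (int m) l2)" using *(3) by blast
    then show ?thesis using False by force
  qed (use *(4) in blast)
next
  fix n m
  show "lie_iso (L_mod n) (L_mod m) \<longleftrightarrow> n = m"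
  proof
    show "lie_iso (L_mod n) (L_mod m) \<Longrightarrow> n = m"
      using lie_iso_imp_invariants[OF L_mod_generated L_mod_generated] by metis
    show "n = m \<Longrightarrow> lie_iso (L_mod n) (L_mod m)"
      using simple_harish_chandra_L_mod lie_iso_of_invariants[OF L_mod_generated L_mod_generated]
      by (simp add: simple_harish_chandra_def)
  qed
next
  fix n l2 m assume l2: "l2 \<noteq> (0 :: complex)"
  show "\<not> lie_iso (V_mod n l2) (L_mod m)"
  proof
    assume "lie_iso (V_mod n l2) (L_mod m)"
    from lie_iso_imp_invariants[OF V_mod_generated(1)[OF l2] L_mod_generated this] show False using l2 by simp
  qed
qed (simp_all add: lie_iso_V_mod_iff V_mod_generated(2) simple_harish_chandra_L_mod)

end
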